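(* Let $k\neq 0$ be a commutative ring, and let $H^0$ and, for $\lambda=(\lambda_{ij})\in k^\Xi$, $H^\lambda$ be the Hopf algebras over $k$ constructed in the context from a diagonal braided module $V=\{x_i,g_i,\chi_i\}_{i\in I}$ over an abelian group $\Gamma$, a partition of $I$, and a set of relations $\mathcal R$. Then $H^\lambda$ and $H^0$ are cocycle deformations of each other.
   Context: Cocycle deformations. A (right) $2$-cocycle for a Hopf algebra $H$ is a convolution-invertible $k$-linear map $\sigma:H\otimes H\to k$ with $\sum\sigma(a_1,b_1)\sigma(a_2b_2,c)=\sum\sigma(b_1,c_1)\sigma(a,b_2c_2)$ and $\sigma(a,1)=\varepsilon(a)=\sigma(1,a)$. $H^\sigma$ is the coalgebra $H$ with product $a\cdot b=\sum\sigma(a_1,b_1)a_2b_2\sigma^{-1}(a_3,b_3)$, a Hopf algebra. Hopf algebras $L,H$ are cocycle deformations of each other if $L\simeq H^\sigma$ for some $2$-cocycle $\sigma$ for $H$ (a symmetric relation). Setting. $\Gamma$ is an abelian group, $\hat\Gamma$ the group of homomorphisms $\Gamma\to k^\times$, $I$ a non-empty finite set; $g_i\in\Gamma$, $\chi_i\in\hat\Gamma$ ($i\in I$), $q_{ij}:=\chi_j(g_i)\in k^\times$. $V=\bigoplus_{i\in I}kx_i$ is the free $k$-module, a Yetter–Drinfeld module over $k\Gamma$ with $x_i$ of degree $|x_i|=g_i$ and $gx_i=\chi_i(g)x_i$. Its braiding is $c(x_i\otimes x_j)=q_{ij}x_j\otimes x_i$, which makes $T^lV$ a module over the group algebra $kB_l$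 of the braid group. The tensor algebra $TV$ is a graded braided Hopf algebra in the category of Yetter–Drinfeld modules over $k\Gamma$ with elements of $V$ primitive. $F=TV\rtimes\Gamma$ is its bosonization: $TV\otimes k\Gamma$ with $gx_i=\chi_i(g)x_ig$, $\Delta(g)=g\otimes g$, $\Delta(x_i)=x_i\otimes1+g_i\otimes x_i$. Put $(\mathrm{ad}_c\,x_i)(x_j)=x_i\otimes x_j-q_{ij}x_j\otimes x_i$. Fix a partition $I=I_1\sqcup\cdots\sqcup I_N$ into non-empty subsets; write $|i|=r$ if $i\in I_r$, and assume $q_{ij}q_{ji}=1$ whenever $|i|\ne|j|$. Put $\Theta=\{(i,j)\in I\times I\mid|i|>|j|\}$ and $\Xi=\{(i,j)\in\Theta\mid\chi_i\chi_j=1\}$. $\mathcal R\subset TV$ is a set of elements of the form $\xi(x_{i_1}\otimes\cdots\otimes x_{i_l})$ with $l\ge2$, $\xi\in kB_l$, $|i_1|=\cdots=|i_l|$, with a finite chain $\emptyset=\mathcal R_{(0)}\subset\mathcal R_{(1)}\subset\cdots\subset\mathcal R_{(L)}=\mathcal R$ ($L\ge0$) such that for $0<h\le L$ every element of $\mathcal R_{(h)}$ is primitive in $TV$ modulo the ideal $(\mathcal R_{(h-1)})$. $H^0=F/(\mathcal R^0)$ with $\mathcal R^0=\mathcal R\cup\{(\mathrm{ad}_c\,x_i)(x_j)\mid(i,j)\in\Theta\}$. For $\lambda\in k^\Xi$ set $\lambda_{ij}=0$ for $(i,j)\in\Theta\setminus\Xi$; $H^\lambda=F/(\mathcal R^\lambda)$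 with $\mathcal R^\lambda=\mathcal R\cup\{(\mathrm{ad}_c\,x_i)(x_j)-\lambda_{ij}(g_ig_j-1)\mid(i,j)\in\Theta\}$. Both are quotient Hopf algebras of $F$; $(\cdot)$ denotes the generated two-sided ideal. *)

theory Defs
  imports HOL.Modules "HOL-Algebra.QuotRing" "HOL-Algebra.Module" "HOL-Library.Poly_Mapping"
begin

text \<open>
  The base ring is a type \<open>'k\<close> of class \<^class>\<open>comm_ring_1\<close> (so \<open>0 \<noteq> 1\<close>), the abelian
  group \<open>\<Gamma>\<close> is a type of class \<^class>\<open>ab_group_add\<close> (hence written additively), and
  the index set \<open>I\<close> is a finite type. Algebras, coalgebras and their quotients are
  HOL-Algebra records with explicit carriers.
\<close>

section \<open>Free modules\<close>

definition base_ring :: "('k::comm_ring_1, 'k) module" where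
  "base_ring = \<lparr>carrier = UNIV, mult = (*), one = 1, zero = 0, add = (+), smult = (*)\<rparr>"

definition fscale :: "'k::comm_ring_1 \<Rightarrow> ('x \<Rightarrow>\<^sub>0 'k) \<Rightarrow> ('x \<Rightarrow>\<^sub>0 'k)" where
  "fscale c p = Poly_Mapping.map ((*) c) p"

abbreviation basis :: "'x \<Rightarrow> ('x \<Rightarrow>\<^sub>0 'k::comm_ring_1)" where
  "basis x \<equiv> Poly_Mapping.single x 1"

lemma lookup_fscale [simp]:
  "Poly_Mapping.lookup (fscale c p) x = c * Poly_Mapping.lookup p x"
  by (simp add: fscale_def Poly_Mapping.map.rep_eq when_def)

interpretation fmod: Modules.module "fscale :: 'k::comm_ring_1 \<Rightarrow> ('x \<Rightarrow>\<^sub>0 'k) \<Rightarrow> _"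
  by standard (auto intro!: poly_mapping_eqI simp: lookup_add algebra_simps)

definition flin :: "('x \<Rightarrow> ('y \<Rightarrow>\<^sub>0 'k::comm_ring_1)) \<Rightarrow> ('x \<Rightarrow>\<^sub>0 'k) \<Rightarrow> ('y \<Rightarrow>\<^sub>0 'k)" where
  "flin f p = (\<Sum>x\<in>Poly_Mapping.keys p. fscale (Poly_Mapping.lookup p x) (f x))"

section \<open>Tensor products over the base ring\<close>

text \<open>
  \<open>M \<otimes> N\<close> is the free module on \<open>carrier M \<times> carrier N\<close> modulo the span of the
  bilinearity relations; its elements are cosets. The modules need not be free.
\<close>

definition tensor_rels ::
  "('k::comm_ring_1, 'a, 'm) module_scheme \<Rightarrow> ('k, 'b, 'n) module_scheme \<Rightarrow> ('a \<times> 'b \<Rightarrow>\<^sub>0 'k) set" where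
  "tensor_rels M N =
     {basis (a \<oplus>\<^bsub>M\<^esub> a', b) - basis (a, b) - basis (a', b) | a a' b.
        a \<in> carrier M \<and> a' \<in> carrier M \<and> b \<in> carrier N} \<union>
     {basis (a, b \<oplus>\<^bsub>N\<^esub> b') - basis (a, b) - basis (a, b') | a b b'.
        a \<in> carrier M \<and> b \<in> carrier N \<and> b' \<in> carrier N} \<union>
     {basis (c \<odot>\<^bsub>M\<^esub> a, b) - fscale c (basis (a, b)) | c a b.
        a \<in> carrier M \<and> b \<in> carrier N} \<union>
     {basis (a, c \<odot>\<^bsub>N\<^esub> b) - fscale c (basis (a, b)) | c a b.
        a \<in> carrier M \<and> b \<in> carrier N}"

definition tclass ::
  "('k::comm_ring_1, 'a, 'm) module_scheme \<Rightarrow> ('k, 'b, 'n) module_scheme \<Rightarrow>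
   ('a \<times> 'b \<Rightarrow>\<^sub>0 'k) \<Rightarrow> ('a \<times> 'b \<Rightarrow>\<^sub>0 'k) set" where
  "tclass M N t = (\<lambda>z. t + z) ` fmod.span (tensor_rels M N)"

definition rep :: "'a set \<Rightarrow> 'a" where
  "rep T = (SOME t. t \<in> T)"

definition pure ::
  "('k::comm_ring_1, 'a, 'm) module_scheme \<Rightarrow> ('k, 'b, 'n) module_scheme \<Rightarrow>
   'a \<Rightarrow> 'b \<Rightarrow> ('a \<times> 'b \<Rightarrow>\<^sub>0 'k) set" where
  "pure M N a b = tclass M N (basis (a, b))"

text \<open>
  The multiplicative part of the record is the product \<open>(a \<otimes> b)(c \<otimes> d) = ac \<otimes> bd\<close>;
  it is meaningful only if \<open>M\<close> and \<open>N\<close> are algebras.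
\<close>

definition tensor ::
  "('k::comm_ring_1, 'a, 'm) module_scheme \<Rightarrow> ('k, 'b, 'n) module_scheme \<Rightarrow>
   ('k, ('a \<times> 'b \<Rightarrow>\<^sub>0 'k) set) module" where
  "tensor M N =
     \<lparr>carrier = tclass M N ` {t. Poly_Mapping.keys t \<subseteq> carrier M \<times> carrier N},
      mult = (\<lambda>S T. tclass M N
        (flin (\<lambda>(a, b). flin (\<lambda>(c, d). basis (a \<otimes>\<^bsub>M\<^esub> c, b \<otimes>\<^bsub>N\<^esub> d)) (rep T)) (rep S))),
      one = pure M N \<one>\<^bsub>M\<^esub> \<one>\<^bsub>N\<^esub>,
      zero = tclass M N 0,
      add = (\<lambda>S T. tclass M N (rep S + rep T)),
      smult = (\<lambda>c T. tclass M N (fscale c (rep T)))\<rparr>"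

text \<open>
  The linear map \<open>M \<otimes> N \<rightarrow> P\<close> induced by a bilinear map \<open>f\<close>: it sends
  \<open>\<Sum> a \<otimes> b\<close> to \<open>\<Sum> f a b\<close>.
\<close>

definition tlift ::
  "('k::comm_ring_1, 'c, 'p) module_scheme \<Rightarrow> ('a \<Rightarrow> 'b \<Rightarrow> 'c) \<Rightarrow> ('a \<times> 'b \<Rightarrow>\<^sub>0 'k) set \<Rightarrow> 'c" where
  "tlift P f T =
     (\<Oplus>\<^bsub>P\<^esub>p\<in>Poly_Mapping.keys (rep T). Poly_Mapping.lookup (rep T) p \<odot>\<^bsub>P\<^esub> f (fst p) (snd p))"

section \<open>Hopf algebras\<close>

record (overloaded) ('k, 'a) bialg = "('k::comm_ring_1, 'a) module" +
  comult :: "'a \<Rightarrow> ('a \<times> 'a \<Rightarrow>\<^sub>0 'k) set"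
  counit :: "'a \<Rightarrow> 'k"

definition k_algebra :: "('k::comm_ring_1, 'a, 'm) module_scheme \<Rightarrow> bool" where
  "k_algebra A \<longleftrightarrow> ring A \<and> Module.module base_ring A \<and>
     (\<forall>c. \<forall>x\<in>carrier A. \<forall>y\<in>carrier A.
        (c \<odot>\<^bsub>A\<^esub> x) \<otimes>\<^bsub>A\<^esub> y = c \<odot>\<^bsub>A\<^esub> (x \<otimes>\<^bsub>A\<^esub> y) \<and> x \<otimes>\<^bsub>A\<^esub> (c \<odot>\<^bsub>A\<^esub> y) = c \<odot>\<^bsub>A\<^esub> (x \<otimes>\<^bsub>A\<^esub> y))"

definition k_linear ::
  "('k::comm_ring_1, 'a, 'm) module_scheme \<Rightarrow> ('k, 'b, 'n) module_scheme \<Rightarrow> ('a \<Rightarrow> 'b) \<Rightarrow> bool" where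
  "k_linear M N f \<longleftrightarrow> f \<in> carrier M \<rightarrow> carrier N \<and>
     (\<forall>x\<in>carrier M. \<forall>y\<in>carrier M. f (x \<oplus>\<^bsub>M\<^esub> y) = f x \<oplus>\<^bsub>N\<^esub> f y) \<and>
     (\<forall>c. \<forall>x\<in>carrier M. f (c \<odot>\<^bsub>M\<^esub> x) = c \<odot>\<^bsub>N\<^esub> f x)"

text \<open>Sweedler sums: \<open>sweedler H P f a\<close> is \<open>\<Sum> f a\<^sub>1 a\<^sub>2\<close>, computed in \<open>P\<close>.\<close>

definition sweedler ::
  "('k::comm_ring_1, 'a, 'm) bialg_scheme \<Rightarrow> ('k, 'c, 'p) module_scheme \<Rightarrow> ('a \<Rightarrow> 'a \<Rightarrow> 'c) \<Rightarrow> 'a \<Rightarrow> 'c" where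
  "sweedler H P f a = tlift P f (comult H a)"

definition coalgebra :: "('k::comm_ring_1, 'a, 'm) bialg_scheme \<Rightarrow> bool" where
  "coalgebra H \<longleftrightarrow> Module.module base_ring H \<and>
     k_linear H (tensor H H) (comult H) \<and> k_linear H base_ring (counit H) \<and>
     (let HHH = tensor H (tensor H H) in \<forall>a\<in>carrier H.
        sweedler H HHH (\<lambda>x a3. sweedler H HHH
          (\<lambda>a1 a2. pure H (tensor H H) a1 (pure H H a2 a3)) x) a
        = sweedler H HHH (\<lambda>a1 y. pure H (tensor H H) a1 (comult H y)) a) \<and>
     (\<forall>a\<in>carrier H. sweedler H H (\<lambda>a1 a2. counit H a1 \<odot>\<^bsub>H\<^esub> a2) a = a \<and>
                    sweedler H H (\<lambda>a1 a2. counit H a2 \<odot>\<^bsub>H\<^esub> a1) a = a)"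

definition bialgebra :: "('k::comm_ring_1, 'a, 'm) bialg_scheme \<Rightarrow> bool" where
  "bialgebra H \<longleftrightarrow> k_algebra H \<and> coalgebra H \<and>
     comult H \<in> ring_hom H (tensor H H) \<and> counit H \<in> ring_hom H base_ring"

definition hopf_algebra :: "('k::comm_ring_1, 'a, 'm) bialg_scheme \<Rightarrow> bool" where
  "hopf_algebra H \<longleftrightarrow> bialgebra H \<and>
     (\<exists>S. k_linear H H S \<and>
       (\<forall>a\<in>carrier H. sweedler H H (\<lambda>a1 a2. S a1 \<otimes>\<^bsub>H\<^esub> a2) a = counit H a \<odot>\<^bsub>H\<^esub> \<one>\<^bsub>H\<^esub> \<and>
                      sweedler H H (\<lambda>a1 a2. a1 \<otimes>\<^bsub>H\<^esub> S a2) a = counit H a \<odot>\<^bsub>H\<^esub> \<one>\<^bsub>H\<^esub>))"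

text \<open>Morphisms of bialgebras between Hopf algebras commute with the antipodes automatically.\<close>

definition hopf_iso ::
  "('k::comm_ring_1, 'a, 'm) bialg_scheme \<Rightarrow> ('k, 'b, 'n) bialg_scheme \<Rightarrow> ('a \<Rightarrow> 'b) \<Rightarrow> bool" where
  "hopf_iso L H f \<longleftrightarrow> f \<in> ring_iso L H \<and> k_linear L H f \<and>
     (\<forall>a\<in>carrier L.
        comult H (f a) = sweedler L (tensor H H) (\<lambda>a1 a2. pure H H (f a1) (f a2)) a \<and>
        counit H (f a) = counit L a)"

section \<open>Cocycle deformations\<close>

text \<open>A linear map \<open>H \<otimes> H \<rightarrow> k\<close> is given by the corresponding bilinear form.\<close>

definition bilinear_form :: "('k::comm_ring_1, 'a, 'm) module_scheme \<Rightarrow> ('a \<Rightarrow> 'a \<Rightarrow> 'k) \<Rightarrow> bool" where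
  "bilinear_form H \<sigma> \<longleftrightarrow>
     (\<forall>a\<in>carrier H. k_linear H base_ring (\<lambda>b. \<sigma> a b)) \<and>
     (\<forall>b\<in>carrier H. k_linear H base_ring (\<lambda>a. \<sigma> a b))"

definition convolution ::
  "('k::comm_ring_1, 'a, 'm) bialg_scheme \<Rightarrow> ('a \<Rightarrow> 'a \<Rightarrow> 'k) \<Rightarrow> ('a \<Rightarrow> 'a \<Rightarrow> 'k) \<Rightarrow> 'a \<Rightarrow> 'a \<Rightarrow> 'k" where
  "convolution H \<sigma> \<tau> a b =
     sweedler H base_ring (\<lambda>a1 a2. sweedler H base_ring (\<lambda>b1 b2. \<sigma> a1 b1 * \<tau> a2 b2) b) a"

definition convolution_inverse ::
  "('k::comm_ring_1, 'a, 'm) bialg_scheme \<Rightarrow> ('a \<Rightarrow> 'a \<Rightarrow> 'k) \<Rightarrow> ('a \<Rightarrow> 'a \<Rightarrow> 'k) \<Rightarrow> bool" where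
  "convolution_inverse H \<sigma> \<tau> \<longleftrightarrow> bilinear_form H \<tau> \<and>
     (\<forall>a\<in>carrier H. \<forall>b\<in>carrier H.
        convolution H \<sigma> \<tau> a b = counit H a * counit H b \<and>
        convolution H \<tau> \<sigma> a b = counit H a * counit H b)"

definition two_cocycle :: "('k::comm_ring_1, 'a, 'm) bialg_scheme \<Rightarrow> ('a \<Rightarrow> 'a \<Rightarrow> 'k) \<Rightarrow> bool" where
  "two_cocycle H \<sigma> \<longleftrightarrow> bilinear_form H \<sigma> \<and> (\<exists>\<tau>. convolution_inverse H \<sigma> \<tau>) \<and>
     (\<forall>a\<in>carrier H. \<forall>b\<in>carrier H. \<forall>c\<in>carrier H.
        sweedler H base_ring (\<lambda>a1 a2. sweedler H base_ring
          (\<lambda>b1 b2. \<sigma> a1 b1 * \<sigma> (a2 \<otimes>\<^bsub>H\<^esub> b2) c) b) a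
        = sweedler H base_ring (\<lambda>b1 b2. sweedler H base_ring
          (\<lambda>c1 c2. \<sigma> b1 c1 * \<sigma> a (b2 \<otimes>\<^bsub>H\<^esub> c2)) c) b) \<and>
     (\<forall>a\<in>carrier H. \<sigma> a \<one>\<^bsub>H\<^esub> = counit H a \<and> \<sigma> \<one>\<^bsub>H\<^esub> a = counit H a)"

text \<open>
  \<open>H\<^sup>\<sigma>\<close>, where \<open>\<tau>\<close> is the convolution inverse of \<open>\<sigma>\<close> (which is unique on the carrier):
  \<open>a \<cdot> b = \<Sum> \<sigma> a\<^sub>1 b\<^sub>1 a\<^sub>2 b\<^sub>2 \<tau> a\<^sub>3 b\<^sub>3\<close>.
\<close>

definition deform ::
  "('k::comm_ring_1, 'a) bialg \<Rightarrow> ('a \<Rightarrow> 'a \<Rightarrow> 'k) \<Rightarrow> ('a \<Rightarrow> 'a \<Rightarrow> 'k) \<Rightarrow> ('k, 'a) bialg" where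
  "deform H \<sigma> \<tau> = H\<lparr>mult := (\<lambda>a b.
     sweedler H H (\<lambda>x a3. sweedler H H (\<lambda>a1 a2.
       sweedler H H (\<lambda>y b3. sweedler H H (\<lambda>b1 b2.
         (\<sigma> a1 b1 * \<tau> a3 b3) \<odot>\<^bsub>H\<^esub> (a2 \<otimes>\<^bsub>H\<^esub> b2)) y) b) x) a)\<rparr>"

definition cocycle_deformations ::
  "('k::comm_ring_1, 'a) bialg \<Rightarrow> ('k, 'b) bialg \<Rightarrow> bool" where
  "cocycle_deformations L H \<longleftrightarrow> hopf_algebra L \<and> hopf_algebra H \<and>
     (\<exists>\<sigma> \<tau> f. two_cocycle H \<sigma> \<and> convolution_inverse H \<sigma> \<tau> \<and> hopf_iso L (deform H \<sigma> \<tau>) f)"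

section \<open>Quotients\<close>

definition quot_module ::
  "('k::comm_ring_1, 'a, 'm) module_scheme \<Rightarrow> 'a set \<Rightarrow> ('k, 'a set) module" where
  "quot_module A J =
     ring.extend (A Quot J) (module.fields (\<lambda>c X. J +>\<^bsub>A\<^esub> (c \<odot>\<^bsub>A\<^esub> rep X)))"

text \<open>The map \<open>A \<otimes> A \<rightarrow> A/J \<otimes> A/J\<close> induced by the projection.\<close>

definition tensor_proj ::
  "('k::comm_ring_1, 'a, 'm) module_scheme \<Rightarrow> 'a set \<Rightarrow> ('a \<times> 'a \<Rightarrow>\<^sub>0 'k) set \<Rightarrow>
   ('a set \<times> 'a set \<Rightarrow>\<^sub>0 'k) set" where
  "tensor_proj A J =
     tlift (tensor (quot_module A J) (quot_module A J))
       (\<lambda>a b. pure (quot_module A J) (quot_module A J) (J +>\<^bsub>A\<^esub> a) (J +>\<^bsub>A\<^esub> b))"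

definition quot_bialg :: "('k::comm_ring_1, 'a) bialg \<Rightarrow> 'a set \<Rightarrow> ('k, 'a set) bialg" where
  "quot_bialg H J =
     module.extend (quot_module H J)
       (bialg.fields (\<lambda>X. tensor_proj H J (comult H (rep X))) (\<lambda>X. counit H (rep X)))"

definition primitive_mod ::
  "('k::comm_ring_1, 'a, 'm) module_scheme \<Rightarrow> ('a \<Rightarrow> ('a \<times> 'a \<Rightarrow>\<^sub>0 'k) set) \<Rightarrow> 'a set \<Rightarrow> 'a \<Rightarrow> bool" where
  "primitive_mod A \<Delta> J r \<longleftrightarrow>
     (let Q = quot_module A J in
        tensor_proj A J (\<Delta> r) = pure Q Q (J +>\<^bsub>A\<^esub> r) \<one>\<^bsub>Q\<^esub> \<oplus>\<^bsub>tensor Q Q\<^esub> pure Q Q \<one>\<^bsub>Q\<^esub> (J +>\<^bsub>A\<^esub> r))"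

section \<open>The tensor algebra of a diagonal braided module\<close>

definition character :: "('g::ab_group_add \<Rightarrow> 'k::comm_ring_1) \<Rightarrow> bool" where
  "character \<chi> \<longleftrightarrow> (\<forall>x. \<chi> x dvd 1) \<and> (\<forall>x y. \<chi> (x + y) = \<chi> x * \<chi> y)"

text \<open>
  The word \<open>[i\<^sub>1, \<dots>, i\<^sub>l]\<close> stands for the basis element \<open>x\<^bsub>i\<^sub>1\<^esub> \<otimes> \<dots> \<otimes> x\<^bsub>i\<^sub>l\<^esub>\<close> of \<open>TV\<close>.
\<close>

definition word_char :: "('i \<Rightarrow> 'g \<Rightarrow> 'k::comm_ring_1) \<Rightarrow> 'i list \<Rightarrow> 'g \<Rightarrow> 'k" where
  "word_char \<chi> w h = prod_list (map (\<lambda>i. \<chi> i h) w)"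

definition word_deg :: "('i \<Rightarrow> 'g::ab_group_add) \<Rightarrow> 'i list \<Rightarrow> 'g" where
  "word_deg g w = sum_list (map g w)"

definition TV :: "('k::comm_ring_1, 'i list \<Rightarrow>\<^sub>0 'k) module" where
  "TV = \<lparr>carrier = UNIV,
         mult = (\<lambda>p q. flin (\<lambda>u. flin (\<lambda>v. basis (u @ v)) q) p),
         one = basis [], zero = 0, add = (+), smult = fscale\<rparr>"

text \<open>The braiding of \<open>TV\<close>: \<open>c(u \<otimes> v) = (|u| v) \<otimes> u\<close> for words \<open>u\<close> and \<open>v\<close>.\<close>

definition TV_braiding ::
  "('i \<Rightarrow> 'g::ab_group_add) \<Rightarrow> ('i \<Rightarrow> 'g \<Rightarrow> 'k::comm_ring_1) \<Rightarrow>
   ('i list \<Rightarrow>\<^sub>0 'k) \<Rightarrow> ('i list \<Rightarrow>\<^sub>0 'k) \<Rightarrow> (('i list \<Rightarrow>\<^sub>0 'k) \<times> ('i list \<Rightarrow>\<^sub>0 'k) \<Rightarrow>\<^sub>0 'k) set" where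
  "TV_braiding g \<chi> p q =
     tclass TV TV (flin (\<lambda>u. flin (\<lambda>v.
       fscale (word_char \<chi> v (word_deg g u)) (basis (basis v, basis u))) q) p)"

text \<open>The product \<open>(a \<otimes> b)(c \<otimes> d) = a c(b \<otimes> c) d\<close> of the braided tensor product of algebras.\<close>

definition TV_braided_mult ::
  "('i \<Rightarrow> 'g::ab_group_add) \<Rightarrow> ('i \<Rightarrow> 'g \<Rightarrow> 'k::comm_ring_1) \<Rightarrow>
   (('i list \<Rightarrow>\<^sub>0 'k) \<times> ('i list \<Rightarrow>\<^sub>0 'k) \<Rightarrow>\<^sub>0 'k) set \<Rightarrow>
   (('i list \<Rightarrow>\<^sub>0 'k) \<times> ('i list \<Rightarrow>\<^sub>0 'k) \<Rightarrow>\<^sub>0 'k) set \<Rightarrow>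
   (('i list \<Rightarrow>\<^sub>0 'k) \<times> ('i list \<Rightarrow>\<^sub>0 'k) \<Rightarrow>\<^sub>0 'k) set" where
  "TV_braided_mult g \<chi> S T =
     tlift (tensor TV TV) (\<lambda>a b. tlift (tensor TV TV) (\<lambda>c d.
       tlift (tensor TV TV) (\<lambda>c' b'. pure TV TV (a \<otimes>\<^bsub>TV\<^esub> c') (b' \<otimes>\<^bsub>TV\<^esub> d))
         (TV_braiding g \<chi> b c)) T) S"

primrec TV_comult_word ::
  "('i \<Rightarrow> 'g::ab_group_add) \<Rightarrow> ('i \<Rightarrow> 'g \<Rightarrow> 'k::comm_ring_1) \<Rightarrow> 'i list \<Rightarrow>
   (('i list \<Rightarrow>\<^sub>0 'k) \<times> ('i list \<Rightarrow>\<^sub>0 'k) \<Rightarrow>\<^sub>0 'k) set" where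
  "TV_comult_word g \<chi> [] = pure TV TV \<one>\<^bsub>TV\<^esub> \<one>\<^bsub>TV\<^esub>"
| "TV_comult_word g \<chi> (i # w) =
     TV_braided_mult g \<chi>
       (pure TV TV (basis [i]) \<one>\<^bsub>TV\<^esub> \<oplus>\<^bsub>tensor TV TV\<^esub> pure TV TV \<one>\<^bsub>TV\<^esub> (basis [i]))
       (TV_comult_word g \<chi> w)"

definition TV_comult ::
  "('i \<Rightarrow> 'g::ab_group_add) \<Rightarrow> ('i \<Rightarrow> 'g \<Rightarrow> 'k::comm_ring_1) \<Rightarrow> ('i list \<Rightarrow>\<^sub>0 'k) \<Rightarrow>
   (('i list \<Rightarrow>\<^sub>0 'k) \<times> ('i list \<Rightarrow>\<^sub>0 'k) \<Rightarrow>\<^sub>0 'k) set" where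
  "TV_comult g \<chi> p =
     (\<Oplus>\<^bsub>tensor TV TV\<^esub>w\<in>Poly_Mapping.keys p.
        Poly_Mapping.lookup p w \<odot>\<^bsub>tensor TV TV\<^esub> TV_comult_word g \<chi> w)"

section \<open>The braid group and its action\<close>

text \<open>
  \<open>B\<^sub>l\<close> is given by its Artin presentation. The letter \<open>(s, True)\<close>, \<open>s + 1 < l\<close>, stands for
  the generator that acts on the tensor factors at (zero-based) positions \<open>s\<close> and \<open>s + 1\<close>,
  and \<open>(s, False)\<close> for its inverse.
\<close>

type_synonym braid_word = "(nat \<times> bool) list"

definition braid_words :: "nat \<Rightarrow> braid_word set" where
  "braid_words l = {w. \<forall>(s, b)\<in>set w. s + 1 < l}"

inductive braid_eq :: "nat \<Rightarrow> braid_word \<Rightarrow> braid_word \<Rightarrow> bool" for l where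
  refl: "w \<in> braid_words l \<Longrightarrow> braid_eq l w w"
| sym: "braid_eq l u v \<Longrightarrow> braid_eq l v u"
| trans: "braid_eq l u v \<Longrightarrow> braid_eq l v w \<Longrightarrow> braid_eq l u w"
| cong: "braid_eq l u v \<Longrightarrow> p \<in> braid_words l \<Longrightarrow> q \<in> braid_words l \<Longrightarrow> braid_eq l (p @ u @ q) (p @ v @ q)"
| cancel: "s + 1 < l \<Longrightarrow> braid_eq l [(s, b), (s, \<not> b)] []"
| far: "s + 1 < t \<Longrightarrow> t + 1 < l \<Longrightarrow> braid_eq l [(s, True), (t, True)] [(t, True), (s, True)]"
| braid: "s + 2 < l \<Longrightarrow>
    braid_eq l [(s, True), (s + 1, True), (s, True)] [(s + 1, True), (s, True), (s + 1, True)]"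

definition braid_group :: "nat \<Rightarrow> braid_word set set" where
  "braid_group l = braid_words l // {(u, v). braid_eq l u v}"

text \<open>
  With \<open>q i j = \<chi> j (g i)\<close>: the braiding maps \<open>x\<^sub>i \<otimes> x\<^sub>j\<close> to \<open>q i j\<close> times \<open>x\<^sub>j \<otimes> x\<^sub>i\<close>, and its
  inverse maps it to the inverse of \<open>q j i\<close> times \<open>x\<^sub>j \<otimes> x\<^sub>i\<close>; here \<open>\<chi> i (- g j)\<close> is that inverse.
\<close>

definition braid_letter_act ::
  "('i \<Rightarrow> 'g::ab_group_add) \<Rightarrow> ('i \<Rightarrow> 'g \<Rightarrow> 'k::comm_ring_1) \<Rightarrow> nat \<times> bool \<Rightarrow> 'i list \<Rightarrow> ('i list \<Rightarrow>\<^sub>0 'k)" where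
  "braid_letter_act g \<chi> z w =
     (let s = fst z; i = w ! s; j = w ! (s + 1)
      in Poly_Mapping.single (w[s := j, s + 1 := i]) (if snd z then \<chi> j (g i) else \<chi> i (- g j)))"

primrec braid_word_act ::
  "('i \<Rightarrow> 'g::ab_group_add) \<Rightarrow> ('i \<Rightarrow> 'g \<Rightarrow> 'k::comm_ring_1) \<Rightarrow> braid_word \<Rightarrow> ('i list \<Rightarrow>\<^sub>0 'k) \<Rightarrow> ('i list \<Rightarrow>\<^sub>0 'k)" where
  "braid_word_act g \<chi> [] p = p"
| "braid_word_act g \<chi> (z # u) p = flin (braid_letter_act g \<chi> z) (braid_word_act g \<chi> u p)"

definition braid_group_algebra :: "nat \<Rightarrow> (braid_word set \<Rightarrow>\<^sub>0 'k::comm_ring_1) set" where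
  "braid_group_algebra l = {\<xi>. Poly_Mapping.keys \<xi> \<subseteq> braid_group l}"

text \<open>
  An element of \<open>B\<^sub>l\<close> acts through a representing word; on tensors of length \<open>l\<close> the choice is
  immaterial, because the braiding satisfies the braid relations.
\<close>

definition braid_act ::
  "('i \<Rightarrow> 'g::ab_group_add) \<Rightarrow> ('i \<Rightarrow> 'g \<Rightarrow> 'k::comm_ring_1) \<Rightarrow> (braid_word set \<Rightarrow>\<^sub>0 'k) \<Rightarrow>
   ('i list \<Rightarrow>\<^sub>0 'k) \<Rightarrow> ('i list \<Rightarrow>\<^sub>0 'k)" where
  "braid_act g \<chi> \<xi> p = flin (\<lambda>b. braid_word_act g \<chi> (rep b) p) \<xi>"

section \<open>The bosonization and its quotients\<close>

text \<open>The basis element \<open>(w, h)\<close> of \<open>F\<close> stands for \<open>w h\<close> with \<open>w\<close> a word and \<open>h \<in> \<Gamma>\<close>.\<close>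

definition F_alg :: "('i \<Rightarrow> 'g \<Rightarrow> 'k) \<Rightarrow> ('k::comm_ring_1, 'i list \<times> 'g::ab_group_add \<Rightarrow>\<^sub>0 'k) module" where
  "F_alg \<chi> =
     \<lparr>carrier = UNIV,
      mult = (\<lambda>p q. flin (\<lambda>(u, a). flin (\<lambda>(v, b).
        fscale (word_char \<chi> v a) (basis (u @ v, a + b))) q) p),
      one = basis ([], 0), zero = 0, add = (+), smult = fscale\<rparr>"

primrec F_comult_word ::
  "('i \<Rightarrow> 'g::ab_group_add) \<Rightarrow> ('i \<Rightarrow> 'g \<Rightarrow> 'k::comm_ring_1) \<Rightarrow> 'g \<Rightarrow> 'i list \<Rightarrow>
   (('i list \<times> 'g \<Rightarrow>\<^sub>0 'k) \<times> ('i list \<times> 'g \<Rightarrow>\<^sub>0 'k) \<Rightarrow>\<^sub>0 'k) set" where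
  "F_comult_word g \<chi> h [] = pure (F_alg \<chi>) (F_alg \<chi>) (basis ([], h)) (basis ([], h))"
| "F_comult_word g \<chi> h (i # w) =
     (pure (F_alg \<chi>) (F_alg \<chi>) (basis ([i], 0)) \<one>\<^bsub>F_alg \<chi>\<^esub>
        \<oplus>\<^bsub>tensor (F_alg \<chi>) (F_alg \<chi>)\<^esub> pure (F_alg \<chi>) (F_alg \<chi>) (basis ([], g i)) (basis ([i], 0)))
      \<otimes>\<^bsub>tensor (F_alg \<chi>) (F_alg \<chi>)\<^esub> F_comult_word g \<chi> h w"

definition F_hopf ::
  "('i \<Rightarrow> 'g::ab_group_add) \<Rightarrow> ('i \<Rightarrow> 'g \<Rightarrow> 'k::comm_ring_1) \<Rightarrow> ('k, 'i list \<times> 'g \<Rightarrow>\<^sub>0 'k) bialg" where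
  "F_hopf g \<chi> = module.extend (F_alg \<chi>) (bialg.fields
     (\<lambda>p. \<Oplus>\<^bsub>tensor (F_alg \<chi>) (F_alg \<chi>)\<^esub>x\<in>Poly_Mapping.keys p.
        Poly_Mapping.lookup p x \<odot>\<^bsub>tensor (F_alg \<chi>) (F_alg \<chi>)\<^esub> F_comult_word g \<chi> (snd x) (fst x))
     (\<lambda>p. \<Sum>x\<in>Poly_Mapping.keys p. if fst x = [] then Poly_Mapping.lookup p x else 0))"

definition TV_to_F :: "('i list \<Rightarrow>\<^sub>0 'k::comm_ring_1) \<Rightarrow> ('i list \<times> 'g::ab_group_add \<Rightarrow>\<^sub>0 'k)" where
  "TV_to_F p = flin (\<lambda>w. basis (w, 0)) p"

definition ad_c ::
  "('i \<Rightarrow> 'g::ab_group_add) \<Rightarrow> ('i \<Rightarrow> 'g \<Rightarrow> 'k::comm_ring_1) \<Rightarrow> 'i \<Rightarrow> 'i \<Rightarrow> ('i list \<Rightarrow>\<^sub>0 'k)" where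
  "ad_c g \<chi> i j = basis [i, j] - fscale (\<chi> j (g i)) (basis [j, i])"

text \<open>The partition of the index set is given by the function \<open>blk\<close> mapping \<open>i\<close> to \<open>|i|\<close>.\<close>

definition Theta :: "('i \<Rightarrow> nat) \<Rightarrow> ('i \<times> 'i) set" where
  "Theta blk = {(i, j). blk i > blk j}"

definition Xi :: "('i \<Rightarrow> 'g \<Rightarrow> 'k::comm_ring_1) \<Rightarrow> ('i \<Rightarrow> nat) \<Rightarrow> ('i \<times> 'i) set" where
  "Xi \<chi> blk = {(i, j) \<in> Theta blk. \<forall>h. \<chi> i h * \<chi> j h = 1}"

definition H0 ::
  "('i \<Rightarrow> 'g::ab_group_add) \<Rightarrow> ('i \<Rightarrow> 'g \<Rightarrow> 'k::comm_ring_1) \<Rightarrow> ('i \<Rightarrow> nat) \<Rightarrow> ('i list \<Rightarrow>\<^sub>0 'k) set \<Rightarrow>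
   ('k, ('i list \<times> 'g \<Rightarrow>\<^sub>0 'k) set) bialg" where
  "H0 g \<chi> blk R = quot_bialg (F_hopf g \<chi>) (Idl\<^bsub>F_hopf g \<chi>\<^esub>
     (TV_to_F ` R \<union> {TV_to_F (ad_c g \<chi> i j) | i j. (i, j) \<in> Theta blk}))"

text \<open>Only the values of \<open>\<lambda>\<close> on \<open>\<Xi>\<close> matter, so \<open>\<lambda>\<close> represents a family in \<open>k\<^sup>\<Xi>\<close>.\<close>

definition Hlam ::
  "('i \<Rightarrow> 'g::ab_group_add) \<Rightarrow> ('i \<Rightarrow> 'g \<Rightarrow> 'k::comm_ring_1) \<Rightarrow> ('i \<Rightarrow> nat) \<Rightarrow> ('i list \<Rightarrow>\<^sub>0 'k) set \<Rightarrow>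
   ('i \<times> 'i \<Rightarrow> 'k) \<Rightarrow> ('k, ('i list \<times> 'g \<Rightarrow>\<^sub>0 'k) set) bialg" where
  "Hlam g \<chi> blk R lam = quot_bialg (F_hopf g \<chi>) (Idl\<^bsub>F_hopf g \<chi>\<^esub>
     (TV_to_F ` R \<union>
      {TV_to_F (ad_c g \<chi> i j)
         - fscale (if (i, j) \<in> Xi \<chi> blk then lam (i, j) else 0) (basis ([], g i + g j) - basis ([], 0))
       | i j. (i, j) \<in> Theta blk}))"

end

theory Submission
  imports Defs "HOL-Library.Multiset"
begin

text \<open>
  Both Hopf algebras are quotients of \<open>F = TV \<rtimes> \<Gamma>\<close>, which is free over \<open>k\<close>, and the
  deformation already takes place on \<open>F\<close>. Let \<open>D\<^sub>i\<close> be the skew derivation of \<open>F\<close> that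
  contracts \<open>x\<^sub>i\<close> with \<open>x\<^sub>j\<close> (\<open>|j| < |i|\<close>) to \<open>- \<lambda>\<^sub>i\<^sub>j\<close>. The algebra \<open>F\<close> acts on itself through
  \<open>x\<^sub>i \<mapsto> x\<^sub>i + D\<^sub>i\<close>; evaluating this action at \<open>1\<close> is a colinear bijection \<open>\<theta> = f' * id\<close>, where
  \<open>f' = \<epsilon> \<circ> \<theta>\<close> has a convolution inverse \<open>f\<close>. The coboundary \<open>\<sigma>\<close> of \<open>f\<close> is a 2-cocycle with
  \<open>\<sigma>(x, y) = \<epsilon>(\<theta>\<inverse>(x) \<cdot> y)\<close>, and \<open>\<psi> = f' * id * f\<close> is an isomorphism from \<open>F\<close> to \<open>F\<^sup>\<sigma>\<close> that
  fixes \<open>\<R>\<close> and sends \<open>ad\<^sub>c(x\<^sub>i)(x\<^sub>j) - \<lambda>\<^sub>i\<^sub>j (g\<^sub>i g\<^sub>j - 1)\<close> to \<open>ad\<^sub>c(x\<^sub>i)(x\<^sub>j)\<close>.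

  The defining ideal of \<open>H\<^sup>0\<close> is stable under the action, and \<open>ad\<^sub>c(x\<^sub>i)(x\<^sub>j) + \<lambda>\<^sub>i\<^sub>j\<close> acts as left
  multiplication by \<open>ad\<^sub>c(x\<^sub>i)(x\<^sub>j)\<close>. A relation \<open>r \<in> \<R>\<close> acts as left multiplication by \<open>r\<close>, modulo
  relations that come earlier in the chain, because \<open>\<epsilon>(r \<cdot> y) = 0\<close>: this pairing is multiplicative in \<open>y\<close>
  and \<open>r\<close> is primitive of degree at least two. It follows that \<open>\<sigma>\<close> vanishes on the ideal, and so does
  \<open>\<sigma>\<inverse>\<close>, because it is a geometric series in \<open>\<epsilon> \<otimes> \<epsilon> - \<sigma>\<close>. Hence everything descends to the quotients.
\<close>

section \<open>Linear maps on free modules\<close>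

text \<open>Over a commutative ring the quotients need not be free, so neither they nor their tensor
  squares have bases to compute with. On \<open>F\<close> every map is fixed by its values on words,
  and a form on \<open>F \<otimes> F\<close> descends as soon as it kills
  \<open>J \<otimes> F + F \<otimes> J\<close>. This is why the whole deformation lives on
  \<open>F\<close>. The price is that \<open>f\<close> itself does not descend: it sends the
  commutator of x_i and x_j to the parameter of that pair, although the commutator vanishes in the
  undeformed quotient. So the cocycle is a coboundary on \<open>F\<close> only, and its vanishing on
  the ideal has to be proved one argument at a time. In the second argument this is stability of the
  ideal under the action. In the first it needs control of the inverse of \<theta>, which is not
  multiplicative: an element of the ideal must be carried to an element that annihilates the
  quotient module. The skew derivations are chosen so that in the commutator of
  \<open>x_i + D_i\<close> and \<open>x_j + D_j\<close> all mixed and quadratic terms cancel and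
  only the contraction of x_i with x_j is left. These cancellations consume exactly the two kinds of
  hypotheses on the characters: \<open>q_ij q_ji = 1\<close> across blocks, and inverse characters
  wherever a contraction is nonzero.\<close>

abbreviation lin :: "(('x \<Rightarrow>\<^sub>0 'k::comm_ring_1) \<Rightarrow> ('y \<Rightarrow>\<^sub>0 'k)) \<Rightarrow> bool" where
  "lin \<equiv> module_hom fscale fscale"

abbreviation linf :: "(('x \<Rightarrow>\<^sub>0 'k::comm_ring_1) \<Rightarrow> 'k) \<Rightarrow> bool" where
  "linf \<equiv> module_hom fscale (*)"

lemma module_fscale: "Modules.module (fscale :: 'k::comm_ring_1 \<Rightarrow> ('x \<Rightarrow>\<^sub>0 'k) \<Rightarrow> _)"
  by (rule fmod.module_axioms)

lemma module_times: "Modules.module ((*) :: 'k::comm_ring_1 \<Rightarrow> 'k \<Rightarrow> 'k)"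
  by standard (auto simp: algebra_simps)

lemma hom_compose:
  "module_hom s1 s2 f \<Longrightarrow> module_hom s2 s3 g \<Longrightarrow> module_hom s1 s3 (\<lambda>x. g (f x))"
  by (auto simp: module_hom_iff)

lemma hom_sub: "module_hom s1 s2 f \<Longrightarrow> f (x - y) = f x - f y"
  by (rule module_hom.diff)

lemma hom_add: "module_hom s1 s2 f \<Longrightarrow> f (x + y) = f x + f y"
  by (rule module_hom.add)

lemma hom_scale: "module_hom s1 s2 f \<Longrightarrow> f (s1 c x) = s2 c (f x)"
  by (rule module_hom.scale)

lemma hom_zero: "module_hom s1 s2 f \<Longrightarrow> f 0 = 0"
  by (rule module_hom.zero)

text \<open>The scalar multiplication of the target is a parameter, so that one operator covers maps
  into free modules and linear forms with values in the base ring.\<close>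

definition lev :: "('k::comm_ring_1 \<Rightarrow> 'm \<Rightarrow> 'm::ab_group_add) \<Rightarrow> ('x \<Rightarrow> 'm) \<Rightarrow> ('x \<Rightarrow>\<^sub>0 'k) \<Rightarrow> 'm" where
  "lev sc f p = (\<Sum>x\<in>Poly_Mapping.keys p. sc (Poly_Mapping.lookup p x) (f x))"

lemma flin_lev: "flin = lev fscale"
  by (intro ext) (simp only: flin_def lev_def)

lemma lev_superset:
  assumes "Modules.module sc" "finite A" "Poly_Mapping.keys p \<subseteq> A"
  shows "lev sc f p = (\<Sum>x\<in>A. sc (Poly_Mapping.lookup p x) (f x))"
proof -
  interpret Modules.module sc by fact
  show ?thesis unfolding lev_def
    using assms(2,3) by (intro sum.mono_neutral_left) (auto simp: in_keys_iff)
qed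

lemma lev_hom: "Modules.module sc \<Longrightarrow> module_hom fscale sc (lev sc f)"
proof -
  assume m: "Modules.module sc"
  then interpret Modules.module sc .
  have "lev sc f (p + q) = lev sc f p + lev sc f q" for p q
  proof -
    let ?A = "Poly_Mapping.keys p \<union> Poly_Mapping.keys q"
    have "lev sc f (p + q) = (\<Sum>x\<in>?A. sc (Poly_Mapping.lookup (p + q) x) (f x))"
      by (rule lev_superset[OF m]) (use keys_add[of p q] in auto)
    moreover have "lev sc f p = (\<Sum>x\<in>?A. sc (Poly_Mapping.lookup p x) (f x))"
      by (rule lev_superset[OF m]) auto
    moreover have "lev sc f q = (\<Sum>x\<in>?A. sc (Poly_Mapping.lookup q x) (f x))"
      by (rule lev_superset[OF m]) auto
    ultimately show ?thesis
      by (simp only: lookup_add scale_left_distrib sum.distrib)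
  qed
  moreover have "lev sc f (fscale c p) = sc c (lev sc f p)" for c p
  proof -
    have "Poly_Mapping.keys (fscale c p) \<subseteq> Poly_Mapping.keys p"
      by (auto simp: in_keys_iff)
    from lev_superset[OF m _ this] show ?thesis
      by (simp add: lev_def scale_sum_right)
  qed
  ultimately show ?thesis
    by (simp add: module_hom_iff module_axioms fmod.module_axioms)
qed

lemma lev_single: "Modules.module sc \<Longrightarrow> lev sc f (Poly_Mapping.single x c) = sc c (f x)"
proof -
  assume "Modules.module sc"
  then interpret Modules.module sc .
  show ?thesis by (simp add: lev_def)
qed

lemma lev_basis [simp]: "Modules.module sc \<Longrightarrow> lev sc f (basis x) = f x"
proof -
  assume m: "Modules.module sc"
  then interpret Modules.module sc .
  show ?thesis by (simp add: lev_single[OF m])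
qed

lemma lev_basis_expand: "lev fscale basis p = p"
proof (rule poly_mapping_eqI)
  fix x
  have "Poly_Mapping.lookup (lev fscale basis p) x
    = (\<Sum>y\<in>Poly_Mapping.keys p. Poly_Mapping.lookup p y * (if y = x then 1 else 0))"
    by (simp add: lev_def lookup_sum lookup_single when_def)
  also have "\<dots> = Poly_Mapping.lookup p x"
    by (simp add: if_distrib[of "(*) _"] in_keys_iff cong: if_cong)
  finally show "Poly_Mapping.lookup (lev fscale basis p) x = Poly_Mapping.lookup p x" .
qed

lemma hom_lev: "module_hom sc sc' h \<Longrightarrow> h (lev sc f p) = lev sc' (\<lambda>x. h (f x)) p"
proof -
  assume "module_hom sc sc' h"
  then interpret module_hom sc sc' h .
  show ?thesis by (simp add: lev_def sum scale)
qed

lemma hom_expand: "module_hom fscale sc h \<Longrightarrow> h p = lev sc (\<lambda>x. h (basis x)) p"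
  using hom_lev[of fscale sc h basis p] by (simp only: lev_basis_expand)

lemma hom_ext:
  assumes "module_hom fscale sc h" "module_hom fscale sc h'" "\<And>x. h (basis x) = h' (basis x)"
  shows "h p = h' p"
  unfolding hom_expand[OF assms(1), of p] hom_expand[OF assms(2), of p] by (simp only: assms(3))

lemma lev_cong: "(\<And>x. x \<in> Poly_Mapping.keys p \<Longrightarrow> f x = g x) \<Longrightarrow> lev sc f p = lev sc g p"
  by (simp add: lev_def)

lemma lev_lev: "Modules.module sc \<Longrightarrow> lev sc f (lev fscale g p) = lev sc (\<lambda>x. lev sc f (g x)) p"
  by (rule hom_lev[OF lev_hom])

lemma lev_in_subspace:
  assumes "fmod.subspace U" "\<And>x. x \<in> Poly_Mapping.keys p \<Longrightarrow> f x \<in> U"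
  shows "lev fscale f p \<in> U"
  unfolding lev_def by (intro fmod.subspace_sum fmod.subspace_scale assms)

lemma subspace_vimage: "lin h \<Longrightarrow> fmod.subspace U \<Longrightarrow> fmod.subspace {p. h p \<in> U}"
  using hom_zero[of fscale fscale h] by (auto simp: fmod.subspace_def module_hom_iff)

lemma subspace_kernel: "linf h \<Longrightarrow> fmod.subspace {p. h p = 0}"
  using hom_zero[of fscale "(*)" h] by (auto simp: fmod.subspace_def module_hom_iff)

subsection \<open>Bilinear maps and tensor products\<close>

definition bil :: "('k::comm_ring_1 \<Rightarrow> 'm \<Rightarrow> 'm::ab_group_add) \<Rightarrow>
    (('x \<Rightarrow>\<^sub>0 'k) \<Rightarrow> ('y \<Rightarrow>\<^sub>0 'k) \<Rightarrow> 'm) \<Rightarrow> bool" where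
  "bil sc \<Phi> \<longleftrightarrow> (\<forall>b. module_hom fscale sc (\<lambda>a. \<Phi> a b)) \<and> (\<forall>a. module_hom fscale sc (\<Phi> a))"

lemma bilI:
  "(\<And>b. module_hom fscale sc (\<lambda>a. \<Phi> a b)) \<Longrightarrow> (\<And>a. module_hom fscale sc (\<lambda>b. \<Phi> a b)) \<Longrightarrow> bil sc \<Phi>"
  by (simp add: bil_def)

lemma bil1: "bil sc \<Phi> \<Longrightarrow> module_hom fscale sc (\<lambda>a. \<Phi> a b)"
  and bil2: "bil sc \<Phi> \<Longrightarrow> module_hom fscale sc (\<Phi> a)"
  by (simp_all add: bil_def)

lemma bil_module: "bil sc \<Phi> \<Longrightarrow> Modules.module sc"
  by (auto simp: bil_def module_hom_iff)

definition tens :: "('x \<Rightarrow>\<^sub>0 'k::comm_ring_1) \<Rightarrow> ('y \<Rightarrow>\<^sub>0 'k) \<Rightarrow> ('x \<times> 'y \<Rightarrow>\<^sub>0 'k)" where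
  "tens a b = lev fscale (\<lambda>u. lev fscale (\<lambda>v. basis (u, v)) b) a"

lemma lev_add_fun: "Modules.module sc \<Longrightarrow> lev sc (\<lambda>x. f x + g x) p = lev sc f p + lev sc g p"
proof -
  assume "Modules.module sc"
  then interpret Modules.module sc .
  show ?thesis by (simp add: lev_def scale_right_distrib sum.distrib)
qed

lemma lev_scale_fun: "Modules.module sc \<Longrightarrow> lev sc (\<lambda>x. sc c (f x)) p = sc c (lev sc f p)"
proof -
  assume "Modules.module sc"
  then interpret Modules.module sc .
  show ?thesis by (simp add: lev_def scale_sum_right mult.commute)
qed

lemma lev_fun_hom:
  assumes "Modules.module sc" "Modules.module s1" "\<And>x. module_hom s1 sc (\<lambda>a. f a x)"
  shows "module_hom s1 sc (\<lambda>a. lev sc (f a) p)"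
proof -
  have "(\<lambda>x. f (a + b) x) = (\<lambda>x. f a x + f b x)" "(\<lambda>x. f (s1 c a) x) = (\<lambda>x. sc c (f a x))" for a b c
    using assms(3) by (auto simp: module_hom_iff)
  then show ?thesis
    using assms(1,2) by (simp add: module_hom_iff lev_add_fun lev_scale_fun)
qed

lemma bil_lev2:
  assumes "Modules.module sc"
  shows "bil sc (\<lambda>a b. lev sc (\<lambda>u. lev sc (\<lambda>v. f u v) b) a)"
  by (intro bilI lev_hom lev_fun_hom assms module_fscale)

lemma bil_tens: "bil fscale tens"
  unfolding tens_def by (rule bil_lev2[OF module_fscale])

lemma tens_basis [simp]: "tens (basis u) (basis v) = basis (u, v)"
  by (simp add: tens_def module_fscale)

lemma tens_hom1: "module_hom s fscale f \<Longrightarrow> module_hom s fscale (\<lambda>x. tens (f x) b)"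
  by (erule hom_compose, rule bil1, rule bil_tens)

lemma tens_hom2: "module_hom s fscale f \<Longrightarrow> module_hom s fscale (\<lambda>x. tens b (f x))"
  by (erule hom_compose, rule bil2, rule bil_tens)

lemmas tens_add1 = hom_add[OF bil1[OF bil_tens]]
lemmas tens_add2 = hom_add[OF bil2[OF bil_tens]]
lemmas tens_sub1 = hom_sub[OF bil1[OF bil_tens]]
lemmas tens_sub2 = hom_sub[OF bil2[OF bil_tens]]
lemmas tens_scale1 = hom_scale[OF bil1[OF bil_tens]]
lemmas tens_scale2 = hom_scale[OF bil2[OF bil_tens]]
lemmas tens_zero1 [simp] = hom_zero[OF bil1[OF bil_tens]]
lemmas tens_zero2 [simp] = hom_zero[OF bil2[OF bil_tens]]

text \<open>The linear map on the tensor product induced by a bilinear \<open>\<Phi>\<close>. Only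
  basis pairs are read, so \<open>pr\<close> is linear for every \<open>\<Phi>\<close>; bilinearity
  enters when it is evaluated on \<open>tens a b\<close>.\<close>

definition pr :: "('k::comm_ring_1 \<Rightarrow> 'm \<Rightarrow> 'm::ab_group_add) \<Rightarrow>
    (('x \<Rightarrow>\<^sub>0 'k) \<Rightarrow> ('y \<Rightarrow>\<^sub>0 'k) \<Rightarrow> 'm) \<Rightarrow> ('x \<times> 'y \<Rightarrow>\<^sub>0 'k) \<Rightarrow> 'm" where
  "pr sc \<Phi> = lev sc (\<lambda>(u, v). \<Phi> (basis u) (basis v))"

lemma pr_hom: "Modules.module sc \<Longrightarrow> module_hom fscale sc (pr sc \<Phi>)"
  unfolding pr_def by (rule lev_hom)

lemma pr_basis: "Modules.module sc \<Longrightarrow> pr sc \<Phi> (basis (u, v)) = \<Phi> (basis u) (basis v)"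
  by (simp add: pr_def)

lemma bil_ext:
  assumes "bil sc \<Phi>" "bil sc \<Psi>" "\<And>u v. \<Phi> (basis u) (basis v) = \<Psi> (basis u) (basis v)"
  shows "\<Phi> a b = \<Psi> a b"
proof -
  have "\<Phi> a (basis v) = \<Psi> a (basis v)" for v
    by (rule hom_ext[OF bil1[OF assms(1)] bil1[OF assms(2)]]) (rule assms(3))
  then show ?thesis
    by (rule hom_ext[OF bil2[OF assms(1)] bil2[OF assms(2)]])
qed

lemma pr_tens:
  assumes "bil sc \<Phi>" shows "pr sc \<Phi> (tens a b) = \<Phi> a b"
proof (rule bil_ext[OF _ assms])
  have m: "Modules.module sc" using assms by (rule bil_module)
  show "bil sc (\<lambda>a b. pr sc \<Phi> (tens a b))"
    by (intro bilI hom_compose[OF bil1[OF bil_tens] pr_hom[OF m]]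
        hom_compose[OF bil2[OF bil_tens] pr_hom[OF m]])
  show "pr sc \<Phi> (tens (basis u) (basis v)) = \<Phi> (basis u) (basis v)" for u v
    by (simp add: pr_basis m)
qed

lemma hom_ext2:
  assumes "module_hom fscale sc X" "module_hom fscale sc Y" "\<And>a b. X (tens a b) = Y (tens a b)"
  shows "X z = Y z"
proof (rule hom_ext[OF assms(1,2)])
  fix p :: "'b \<times> 'c"
  show "X (basis p) = Y (basis p)"
    using assms(3)[of "basis (fst p)" "basis (snd p)"] by simp
qed

lemma hom_pr: "module_hom sc sc' h \<Longrightarrow> h (pr sc \<Phi> z) = pr sc' (\<lambda>a b. h (\<Phi> a b)) z"
  unfolding pr_def by (subst hom_lev, assumption) (simp only: case_prod_unfold)

definition tm :: "(('x \<Rightarrow>\<^sub>0 'k::comm_ring_1) \<Rightarrow> ('u \<Rightarrow>\<^sub>0 'k)) \<Rightarrow> (('y \<Rightarrow>\<^sub>0 'k) \<Rightarrow> ('v \<Rightarrow>\<^sub>0 'k)) \<Rightarrow>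
    ('x \<times> 'y \<Rightarrow>\<^sub>0 'k) \<Rightarrow> ('u \<times> 'v \<Rightarrow>\<^sub>0 'k)" where
  "tm A B = pr fscale (\<lambda>a b. tens (A a) (B b))"

lemma tm_hom: "lin (tm A B)"
  unfolding tm_def by (rule pr_hom[OF module_fscale])

lemma tm_tens: "lin A \<Longrightarrow> lin B \<Longrightarrow> tm A B (tens a b) = tens (A a) (B b)"
  unfolding tm_def by (rule pr_tens) (intro bilI tens_hom1 tens_hom2; assumption)

lemma bil_compose:
  assumes "bil sc \<Phi>" "lin A" "lin B" shows "bil sc (\<lambda>a b. \<Phi> (A a) (B b))"
  by (intro bilI hom_compose[OF assms(2) bil1[OF assms(1)]] hom_compose[OF assms(3) bil2[OF assms(1)]])

lemma pr_tm:
  assumes "bil sc \<Phi>" "lin A" "lin B"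
  shows "pr sc \<Phi> (tm A B z) = pr sc (\<lambda>a b. \<Phi> (A a) (B b)) z"
proof (rule hom_ext2)
  have m: "Modules.module sc" using assms(1) by (rule bil_module)
  show "module_hom fscale sc (\<lambda>z. pr sc \<Phi> (tm A B z))"
    by (rule hom_compose[OF tm_hom pr_hom[OF m]])
  show "module_hom fscale sc (pr sc (\<lambda>a b. \<Phi> (A a) (B b)))" by (rule pr_hom[OF m])
  fix a b
  show "pr sc \<Phi> (tm A B (tens a b)) = pr sc (\<lambda>a b. \<Phi> (A a) (B b)) (tens a b)"
    by (simp only: tm_tens[OF assms(2,3)] pr_tens[OF assms(1)] pr_tens[OF bil_compose[OF assms]])
qed

lemma tm_tm:
  assumes "lin A" "lin B" "lin A'" "lin B'"
  shows "tm A' B' (tm A B z) = tm (\<lambda>a. A' (A a)) (\<lambda>b. B' (B b)) z"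
  unfolding tm_def[of A' B'] tm_def[of "\<lambda>a. A' (A a)"]
  by (rule pr_tm[OF bil_compose[OF bil_tens assms(3,4)] assms(1,2)])

lemma lin_ident: "lin (\<lambda>x. x)"
  by (rule fmod.module_hom_ident)

lemma tm_id: "tm (\<lambda>x. x) (\<lambda>x. x) z = z"
  unfolding tm_def pr_def by (simp add: case_prod_unfold lev_basis_expand)

text \<open>\<open>\<phi> \<otimes> B\<close>, \<open>A \<otimes> \<psi>\<close> and \<open>\<phi> \<otimes> \<psi>\<close>, with \<open>k \<otimes> M\<close> and \<open>M \<otimes> k\<close> identified with \<open>M\<close>.\<close>

abbreviation cl :: "(('x \<Rightarrow>\<^sub>0 'k::comm_ring_1) \<Rightarrow> 'k) \<Rightarrow> (('y \<Rightarrow>\<^sub>0 'k) \<Rightarrow> ('v \<Rightarrow>\<^sub>0 'k)) \<Rightarrow>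
    ('x \<times> 'y \<Rightarrow>\<^sub>0 'k) \<Rightarrow> ('v \<Rightarrow>\<^sub>0 'k)" where
  "cl \<phi> B \<equiv> pr fscale (\<lambda>a b. fscale (\<phi> a) (B b))"

abbreviation cr :: "(('x \<Rightarrow>\<^sub>0 'k::comm_ring_1) \<Rightarrow> ('v \<Rightarrow>\<^sub>0 'k)) \<Rightarrow> (('y \<Rightarrow>\<^sub>0 'k) \<Rightarrow> 'k) \<Rightarrow>
    ('x \<times> 'y \<Rightarrow>\<^sub>0 'k) \<Rightarrow> ('v \<Rightarrow>\<^sub>0 'k)" where
  "cr A \<psi> \<equiv> pr fscale (\<lambda>a b. fscale (\<psi> b) (A a))"

abbreviation cc :: "(('x \<Rightarrow>\<^sub>0 'k::comm_ring_1) \<Rightarrow> 'k) \<Rightarrow> (('y \<Rightarrow>\<^sub>0 'k) \<Rightarrow> 'k) \<Rightarrow>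
    ('x \<times> 'y \<Rightarrow>\<^sub>0 'k) \<Rightarrow> 'k" where
  "cc \<phi> \<psi> \<equiv> pr (*) (\<lambda>a b. \<phi> a * \<psi> b)"

lemma fscale_hom1: "module_hom s (*) f \<Longrightarrow> module_hom s fscale (\<lambda>x. fscale (f x) b)"
  by (erule hom_compose, rule fmod.module_hom_scale_left)

lemma fscale_hom2: "module_hom s fscale f \<Longrightarrow> module_hom s fscale (\<lambda>x. fscale c (f x))"
  by (erule hom_compose, rule fmod.module_hom_scale_self)

lemma times_hom1: "module_hom s (*) f \<Longrightarrow> module_hom s ((*) :: 'k::comm_ring_1 \<Rightarrow> _) (\<lambda>x. f x * b)"
  by (erule hom_compose, rule Modules.module.module_hom_scale_left[OF module_times])

lemma times_hom2: "module_hom s (*) f \<Longrightarrow> module_hom s ((*) :: 'k::comm_ring_1 \<Rightarrow> _) (\<lambda>x. c * f x)"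
  by (erule hom_compose, rule Modules.module.module_hom_scale_self[OF module_times])

lemma bil_cl: "linf \<phi> \<Longrightarrow> lin B \<Longrightarrow> bil fscale (\<lambda>a b. fscale (\<phi> a) (B b))"
  by (rule bilI, rule fscale_hom1, assumption, rule fscale_hom2, assumption)

lemma bil_cr: "lin A \<Longrightarrow> linf \<psi> \<Longrightarrow> bil fscale (\<lambda>a b. fscale (\<psi> b) (A a))"
  by (rule bilI, rule fscale_hom2, assumption, rule fscale_hom1, assumption)

lemma bil_cc: "linf \<phi> \<Longrightarrow> linf \<psi> \<Longrightarrow> bil (*) (\<lambda>a b. \<phi> a * \<psi> b)"
  by (rule bilI, rule times_hom1, assumption, rule times_hom2, assumption)

lemmas cl_tens = pr_tens[OF bil_cl]
lemmas cr_tens = pr_tens[OF bil_cr]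
lemmas cc_tens = pr_tens[OF bil_cc]

section \<open>Coalgebras with a chosen basis\<close>

definition reassoc :: "(('x \<times> 'y) \<times> 'z \<Rightarrow>\<^sub>0 'k::comm_ring_1) \<Rightarrow> ('x \<times> ('y \<times> 'z) \<Rightarrow>\<^sub>0 'k)" where
  "reassoc = lev fscale (\<lambda>((u, v), w). basis (u, (v, w)))"

lemma reassoc_hom: "lin reassoc"
  unfolding reassoc_def by (rule lev_hom[OF module_fscale])

text \<open>True on basis vectors by definition; these are then replaced by arbitrary vectors, one
  argument at a time.\<close>

lemma reassoc_tens [simp]: "reassoc (tens (tens a b) c) = tens a (tens b c)"
proof -
  have 1: "reassoc (tens (tens a (basis v)) (basis w)) = tens a (tens (basis v) (basis w))" for v w a
    by (rule hom_ext[of fscale "\<lambda>a. reassoc (tens (tens a (basis v)) (basis w))"], intro hom_compose[OF _ reassoc_hom] tens_hom1 tens_hom2 lin_ident,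
        intro tens_hom1 tens_hom2 lin_ident, simp add: reassoc_def module_fscale)
  have 2: "reassoc (tens (tens a b) (basis w)) = tens a (tens b (basis w))" for w a b
    by (rule hom_ext[of fscale "\<lambda>b. reassoc (tens (tens a b) (basis w))"], intro hom_compose[OF _ reassoc_hom] tens_hom1 tens_hom2 lin_ident,
        intro tens_hom1 tens_hom2 lin_ident, simp del: tens_basis add: 1)
  show ?thesis
    by (rule hom_ext[of fscale "\<lambda>c. reassoc (tens (tens a b) c)"], intro hom_compose[OF _ reassoc_hom] tens_hom1 tens_hom2 lin_ident,
        intro tens_hom1 tens_hom2 lin_ident, simp del: tens_basis add: 2)
qed

definition swap23 :: "(('x \<times> 'y) \<times> ('u \<times> 'v) \<Rightarrow>\<^sub>0 'k::comm_ring_1) \<Rightarrow> (('x \<times> 'u) \<times> ('y \<times> 'v) \<Rightarrow>\<^sub>0 'k)" where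
  "swap23 = lev fscale (\<lambda>((a, b), (c, d)). basis ((a, c), (b, d)))"

lemma swap23_hom: "lin swap23"
  unfolding swap23_def by (rule lev_hom[OF module_fscale])

lemma swap23_tens [simp]: "swap23 (tens (tens a b) (tens c d)) = tens (tens a c) (tens b d)"
proof -
  have 1: "swap23 (tens (tens a (basis v)) (tens (basis w) (basis x))) = tens (tens a (basis w)) (tens (basis v) (basis x))" for v w x a
    by (rule hom_ext[of fscale "\<lambda>a. swap23 (tens (tens a (basis v)) (tens (basis w) (basis x)))"], intro hom_compose[OF _ swap23_hom] tens_hom1 tens_hom2 lin_ident,
        intro tens_hom1 tens_hom2 lin_ident, simp add: swap23_def module_fscale)
  have 2: "swap23 (tens (tens a b) (tens (basis w) (basis x))) = tens (tens a (basis w)) (tens b (basis x))" for w x a b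
    by (rule hom_ext[of fscale "\<lambda>b. swap23 (tens (tens a b) (tens (basis w) (basis x)))"], intro hom_compose[OF _ swap23_hom] tens_hom1 tens_hom2 lin_ident,
        intro tens_hom1 tens_hom2 lin_ident, simp del: tens_basis add: 1)
  have 3: "swap23 (tens (tens a b) (tens c (basis x))) = tens (tens a c) (tens b (basis x))" for x a b c
    by (rule hom_ext[of fscale "\<lambda>c. swap23 (tens (tens a b) (tens c (basis x)))"], intro hom_compose[OF _ swap23_hom] tens_hom1 tens_hom2 lin_ident,
        intro tens_hom1 tens_hom2 lin_ident, simp del: tens_basis add: 2)
  show ?thesis
    by (rule hom_ext[of fscale "\<lambda>d. swap23 (tens (tens a b) (tens c d))"], intro hom_compose[OF _ swap23_hom] tens_hom1 tens_hom2 lin_ident,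
        intro tens_hom1 tens_hom2 lin_ident, simp del: tens_basis add: 3)
qed

lemma hom_ext3:
  assumes "module_hom fscale sc X" "module_hom fscale sc Y"
    "\<And>a b c. X (tens (tens a b) c) = Y (tens (tens a b) c)"
  shows "X z = Y z"
proof (rule hom_ext2[OF assms(1,2)])
  fix p c
  show "X (tens p c) = Y (tens p c)"
    by (rule hom_ext2[of sc "\<lambda>p. X (tens p c)" "\<lambda>p. Y (tens p c)"])
      (intro hom_compose[OF tens_hom1[OF lin_ident]] assms)+
qed

lemma hom_ext3':
  assumes "module_hom fscale sc X" "module_hom fscale sc Y"
    "\<And>a b c. X (tens a (tens b c)) = Y (tens a (tens b c))"
  shows "X z = Y z"
proof (rule hom_ext2[OF assms(1,2)])
  fix a p
  show "X (tens a p) = Y (tens a p)"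
    by (rule hom_ext2[of sc "\<lambda>p. X (tens a p)" "\<lambda>p. Y (tens a p)"])
      (intro hom_compose[OF tens_hom2[OF lin_ident]] assms)+
qed

lemma hom_ext4:
  assumes "module_hom fscale sc X" "module_hom fscale sc Y"
    "\<And>a b c d. X (tens (tens a b) (tens c d)) = Y (tens (tens a b) (tens c d))"
  shows "X z = Y z"
proof (rule hom_ext2[OF assms(1,2)])
  fix p q
  show "X (tens p q) = Y (tens p q)"
    by (rule hom_ext3'[of sc "X" "Y" "tens p q"], (intro assms)+)
      (rule hom_ext2[of sc "\<lambda>p. X (tens p (tens _ _))" "\<lambda>p. Y (tens p (tens _ _))"],
        (intro hom_compose[OF tens_hom1[OF lin_ident]] assms)+)
qed

lemma tm_id_fun: "tm (\<lambda>x. x) (\<lambda>x. x) = (\<lambda>x. x)"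
  by (rule ext) (rule tm_id)

locale coalg =
  fixes dl :: "('c \<Rightarrow>\<^sub>0 'k::comm_ring_1) \<Rightarrow> ('c \<times> 'c \<Rightarrow>\<^sub>0 'k)" and cu :: "('c \<Rightarrow>\<^sub>0 'k) \<Rightarrow> 'k"
  assumes dl_hom: "lin dl" and cu_hom: "linf cu"
    and coassoc: "reassoc (tm dl (\<lambda>x. x) (dl a)) = tm (\<lambda>x. x) dl (dl a)"
    and counit_l: "cl cu (\<lambda>x. x) (dl a) = a"
    and counit_r: "cr (\<lambda>x. x) cu (dl a) = a"
begin

text \<open>In Sweedler notation, \<open>lc \<phi> a = \<Sum> \<phi>(a\<^sub>1) a\<^sub>2\<close> and \<open>rc \<phi> a = \<Sum> a\<^sub>1 \<phi>(a\<^sub>2)\<close>.\<close>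

definition lc :: "(('c \<Rightarrow>\<^sub>0 'k) \<Rightarrow> 'k) \<Rightarrow> ('c \<Rightarrow>\<^sub>0 'k) \<Rightarrow> ('c \<Rightarrow>\<^sub>0 'k)" where
  "lc \<phi> a = cl \<phi> (\<lambda>x. x) (dl a)"

definition rc :: "(('c \<Rightarrow>\<^sub>0 'k) \<Rightarrow> 'k) \<Rightarrow> ('c \<Rightarrow>\<^sub>0 'k) \<Rightarrow> ('c \<Rightarrow>\<^sub>0 'k)" where
  "rc \<phi> a = cr (\<lambda>x. x) \<phi> (dl a)"

definition conv :: "(('c \<Rightarrow>\<^sub>0 'k) \<Rightarrow> 'k) \<Rightarrow> (('c \<Rightarrow>\<^sub>0 'k) \<Rightarrow> 'k) \<Rightarrow> ('c \<Rightarrow>\<^sub>0 'k) \<Rightarrow> 'k" where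
  "conv \<phi> \<psi> a = cc \<phi> \<psi> (dl a)"

lemma lc_hom: "lin (lc \<phi>)"
  unfolding lc_def by (rule hom_compose[OF dl_hom pr_hom[OF module_fscale]])

lemma rc_hom: "lin (rc \<phi>)"
  unfolding rc_def by (rule hom_compose[OF dl_hom pr_hom[OF module_fscale]])

lemma lc_cu [simp]: "lc cu a = a" and rc_cu [simp]: "rc cu a = a"
  by (simp_all add: lc_def rc_def counit_l counit_r)

lemma hom_lc: "lin X \<Longrightarrow> X (lc \<phi> a) = cl \<phi> X (dl a)"
  by (simp add: lc_def hom_pr[of fscale fscale X] module_hom.scale[of fscale fscale X])

lemma hom_rc: "lin X \<Longrightarrow> X (rc \<phi> a) = cr X \<phi> (dl a)"
  by (simp add: rc_def hom_pr[of fscale fscale X] module_hom.scale[of fscale fscale X])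

lemma form_lc: "linf \<psi> \<Longrightarrow> \<psi> (lc \<phi> a) = conv \<phi> \<psi> a"
  by (simp add: lc_def conv_def hom_pr[of fscale "(*)" \<psi>] module_hom.scale[of fscale "(*)" \<psi>])

lemma form_rc: "linf \<phi> \<Longrightarrow> \<phi> (rc \<psi> a) = conv \<phi> \<psi> a"
  by (simp add: rc_def conv_def hom_pr[of fscale "(*)" \<phi>] module_hom.scale[of fscale "(*)" \<phi>] mult.commute)

lemma cl_id_tens: "linf \<phi> \<Longrightarrow> cl \<phi> (\<lambda>x. x) (tens a b) = fscale (\<phi> a) b"
  by (rule cl_tens[OF _ lin_ident])

lemma cr_id_tens: "linf \<phi> \<Longrightarrow> cr (\<lambda>x. x) \<phi> (tens a b) = fscale (\<phi> b) a"
  by (rule cr_tens[OF lin_ident])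

text \<open>Coassociativity: \<open>lc \<phi>\<close> consumes the leftmost Sweedler factor only, so
  it commutes with the right coaction given by \<open>dl\<close>.\<close>

lemma dl_lc:
  assumes "linf \<phi>" shows "dl (lc \<phi> a) = tm (lc \<phi>) (\<lambda>x. x) (dl a)"
proof -
  have "dl (lc \<phi> a) = cl \<phi> dl (dl a)" by (rule hom_lc[OF dl_hom])
  also have "\<dots> = cl \<phi> (\<lambda>x. x) (tm (\<lambda>x. x) dl (dl a))"
    by (rule pr_tm[OF bil_cl[OF assms lin_ident] lin_ident dl_hom, symmetric])
  also have "\<dots> = cl \<phi> (\<lambda>x. x) (reassoc (tm dl (\<lambda>x. x) (dl a)))" by (simp only: coassoc)
  also have "\<dots> = tm (cl \<phi> (\<lambda>x. x)) (\<lambda>x. x) (tm dl (\<lambda>x. x) (dl a))"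
    by (rule hom_ext3[of fscale "\<lambda>z. cl \<phi> (\<lambda>x. x) (reassoc z)"])
      (auto intro!: hom_compose[OF reassoc_hom] pr_hom module_fscale tm_hom
        simp: tm_tens lin_ident cl_id_tens assms tens_scale1 pr_hom module_fscale)
  also have "\<dots> = tm (lc \<phi>) (\<lambda>x. x) (dl a)"
    unfolding lc_def by (rule tm_tm[OF dl_hom lin_ident pr_hom[OF module_fscale] lin_ident])
  finally show ?thesis .
qed

lemma dl_rc:
  assumes "linf \<phi>" shows "dl (rc \<phi> a) = tm (\<lambda>x. x) (rc \<phi>) (dl a)"
proof -
  have "dl (rc \<phi> a) = cr dl \<phi> (dl a)" by (rule hom_rc[OF dl_hom])
  also have "\<dots> = cr (\<lambda>x. x) \<phi> (tm dl (\<lambda>x. x) (dl a))"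
    by (rule pr_tm[OF bil_cr[OF lin_ident assms] dl_hom lin_ident, symmetric])
  also have "\<dots> = tm (\<lambda>x. x) (cr (\<lambda>x. x) \<phi>) (reassoc (tm dl (\<lambda>x. x) (dl a)))"
    by (rule hom_ext3[of fscale _ "\<lambda>z. tm (\<lambda>x. x) (cr (\<lambda>x. x) \<phi>) (reassoc z)"])
      (auto intro!: hom_compose[OF reassoc_hom] pr_hom module_fscale tm_hom
        simp: tm_tens lin_ident cr_id_tens assms tens_scale2 pr_hom module_fscale)
  also have "\<dots> = tm (\<lambda>x. x) (cr (\<lambda>x. x) \<phi>) (tm (\<lambda>x. x) dl (dl a))" by (simp only: coassoc)
  also have "\<dots> = tm (\<lambda>x. x) (rc \<phi>) (dl a)"
    unfolding rc_def by (rule tm_tm[OF lin_ident dl_hom lin_ident pr_hom[OF module_fscale]])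
  finally show ?thesis .
qed

text \<open>Both sides are the sum of \<open>a1 \<phi>(a2) \<otimes> a3\<close>. A form can thus be
  moved from the right end of the first leg to the left end of the second; this produces the
  cancellations of \<open>f\<close> against \<open>f'\<close> below.\<close>

lemma tm_rc_lc:
  assumes "linf \<phi>" shows "tm (rc \<phi>) (\<lambda>x. x) (dl a) = tm (\<lambda>x. x) (lc \<phi>) (dl a)"
proof -
  have "tm (rc \<phi>) (\<lambda>x. x) (dl a) = tm (cr (\<lambda>x. x) \<phi>) (\<lambda>x. x) (tm dl (\<lambda>x. x) (dl a))"
    unfolding rc_def by (rule tm_tm[OF dl_hom lin_ident pr_hom[OF module_fscale] lin_ident, symmetric])
  also have "\<dots> = tm (\<lambda>x. x) (cl \<phi> (\<lambda>x. x)) (reassoc (tm dl (\<lambda>x. x) (dl a)))"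
    by (rule hom_ext3[of fscale _ "\<lambda>z. tm (\<lambda>x. x) (cl \<phi> (\<lambda>x. x)) (reassoc z)"])
      (auto intro!: hom_compose[OF reassoc_hom] pr_hom module_fscale tm_hom
        simp: tm_tens lin_ident cl_id_tens cr_id_tens assms tens_scale1 tens_scale2 pr_hom module_fscale)
  also have "\<dots> = tm (\<lambda>x. x) (cl \<phi> (\<lambda>x. x)) (tm (\<lambda>x. x) dl (dl a))" by (simp only: coassoc)
  also have "\<dots> = tm (\<lambda>x. x) (lc \<phi>) (dl a)"
    unfolding lc_def by (rule tm_tm[OF lin_ident dl_hom lin_ident pr_hom[OF module_fscale]])
  finally show ?thesis .
qed

text \<open>The form applied first takes the outermost Sweedler factor. Hence \<open>lc\<close>
  reverses the convolution product, while \<open>rc\<close> preserves it.\<close>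

lemma lc_lc:
  assumes "linf \<phi>" "linf \<psi>" shows "lc \<psi> (lc \<phi> a) = lc (conv \<phi> \<psi>) a"
proof -
  have "lc \<psi> (lc \<phi> a) = cl \<psi> (\<lambda>x. x) (tm (lc \<phi>) (\<lambda>x. x) (dl a))"
    by (simp only: lc_def[of \<psi>] dl_lc[OF assms(1)])
  also have "\<dots> = pr fscale (\<lambda>a b. fscale (\<psi> (lc \<phi> a)) b) (dl a)"
    by (rule pr_tm[OF bil_cl[OF assms(2) lin_ident] lc_hom lin_ident])
  also have "\<dots> = lc (conv \<phi> \<psi>) a" by (simp only: form_lc[OF assms(2)] lc_def[of "conv \<phi> \<psi>"])
  finally show ?thesis .
qed

lemma rc_rc:
  assumes "linf \<phi>" "linf \<psi>" shows "rc \<phi> (rc \<psi> a) = rc (conv \<phi> \<psi>) a"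
proof -
  have "rc \<phi> (rc \<psi> a) = cr (\<lambda>x. x) \<phi> (tm (\<lambda>x. x) (rc \<psi>) (dl a))"
    by (simp only: rc_def[of \<phi>] dl_rc[OF assms(2)])
  also have "\<dots> = pr fscale (\<lambda>a b. fscale (\<phi> (rc \<psi> b)) a) (dl a)"
    by (rule pr_tm[OF bil_cr[OF lin_ident assms(1)] lin_ident rc_hom])
  also have "\<dots> = rc (conv \<phi> \<psi>) a" by (simp only: form_rc[OF assms(1)] rc_def[of "conv \<phi> \<psi>"])
  finally show ?thesis .
qed

lemma lc_rc:
  assumes "linf \<phi>" "linf \<psi>" shows "lc \<phi> (rc \<psi> a) = rc \<psi> (lc \<phi> a)"
proof -
  have "lc \<phi> (rc \<psi> a) = cl \<phi> (\<lambda>x. x) (tm (\<lambda>x. x) (rc \<psi>) (dl a))"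
    by (simp only: lc_def[of \<phi>] dl_rc[OF assms(2)])
  also have "\<dots> = cl \<phi> (rc \<psi>) (dl a)"
    by (rule pr_tm[OF bil_cl[OF assms(1) lin_ident] lin_ident rc_hom])
  also have "\<dots> = rc \<psi> (lc \<phi> a)" by (rule hom_lc[OF rc_hom, symmetric])
  finally show ?thesis .
qed

text \<open>Apply the counit to the left leg of \<open>dl (X a)\<close>. In this way colinear
  operators, such as the skew derivations and the bijection \<open>theta\<close> below, are
  recovered from linear forms.\<close>

lemma colinear_lc:
  assumes "lin X" "\<And>a. dl (X a) = tm X (\<lambda>x. x) (dl a)" shows "X a = lc (\<lambda>a. cu (X a)) a"
proof -
  have "X a = cl cu (\<lambda>x. x) (tm X (\<lambda>x. x) (dl a))" by (simp only: assms(2)[symmetric] counit_l)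
  also have "\<dots> = lc (\<lambda>a. cu (X a)) a"
    unfolding lc_def by (rule pr_tm[OF bil_cl[OF cu_hom lin_ident] assms(1) lin_ident])
  finally show ?thesis .
qed

end

section \<open>Coideals and the tensors with a factor in them\<close>

lemma subspace_keys: "fmod.subspace {p :: 'x \<Rightarrow>\<^sub>0 'k::comm_ring_1. Poly_Mapping.keys p \<subseteq> S}"
proof -
  have "Poly_Mapping.keys (fscale c p) \<subseteq> Poly_Mapping.keys p" for c and p :: "'x \<Rightarrow>\<^sub>0 'k"
    by (auto simp: in_keys_iff)
  moreover have "Poly_Mapping.keys (p + q) \<subseteq> Poly_Mapping.keys p \<union> Poly_Mapping.keys q" for p q :: "'x \<Rightarrow>\<^sub>0 'k"
    by (rule keys_add)
  ultimately show ?thesis unfolding fmod.subspace_def by (auto; blast)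
qed

text \<open>The subspace \<open>K \<otimes> C + C \<otimes> K\<close>. For an ideal K of an algebra
  it is the kernel of the projection to the tensor square of the quotient, see
  \<open>T2_eq_iff\<close>.\<close>

definition tens_span :: "('c \<Rightarrow>\<^sub>0 'k::comm_ring_1) set \<Rightarrow> ('c \<times> 'c \<Rightarrow>\<^sub>0 'k) set" where
  "tens_span K = fmod.span {tens a b | a b. a \<in> K \<or> b \<in> K}"

lemma tens_spanI1: "a \<in> K \<Longrightarrow> tens a b \<in> tens_span K"
  and tens_spanI2: "b \<in> K \<Longrightarrow> tens a b \<in> tens_span K"
  unfolding tens_span_def by (rule fmod.span_base, blast)+

lemma tens_span_subspace: "fmod.subspace (tens_span K)"
  unfolding tens_span_def by (rule fmod.subspace_span)

lemma tens_span_map: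
  assumes "lin X" "fmod.subspace U" "\<And>a b. a \<in> K \<Longrightarrow> X (tens a b) \<in> U"
    "\<And>a b. b \<in> K \<Longrightarrow> X (tens a b) \<in> U" "z \<in> tens_span K"
  shows "X z \<in> U"
proof -
  have "tens_span K \<subseteq> {z. X z \<in> U}"
    unfolding tens_span_def
    by (rule fmod.span_minimal) (use assms in \<open>auto intro: subspace_vimage\<close>)
  then show ?thesis using assms(5) by auto
qed

lemma tens_span_form:
  assumes "linf X" "\<And>a b. a \<in> K \<Longrightarrow> X (tens a b) = 0" "\<And>a b. b \<in> K \<Longrightarrow> X (tens a b) = 0"
    "z \<in> tens_span K"
  shows "X z = 0"
proof -
  have "tens_span K \<subseteq> {z. X z = 0}"
    unfolding tens_span_def
    by (rule fmod.span_minimal) (use assms in \<open>auto intro: subspace_kernel\<close>)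
  then show ?thesis using assms(4) by auto
qed

lemma tens_span_mono: "K \<subseteq> K' \<Longrightarrow> tens_span K \<subseteq> tens_span K'"
  unfolding tens_span_def by (rule fmod.span_mono) blast

context coalg
begin

text \<open>The part of \<open>dl a\<close> with left factor in K is killed by
  \<open>\<phi>\<close>, and the part with right factor in K leaves multiples of elements of
  K.\<close>

lemma lc_stable:
  assumes "fmod.subspace K" "\<And>a. a \<in> K \<Longrightarrow> dl a \<in> tens_span K" "linf \<phi>"
    "\<And>a. a \<in> K \<Longrightarrow> \<phi> a = 0" "a \<in> K"
  shows "lc \<phi> a \<in> K"
  unfolding lc_def
  by (rule tens_span_map[OF pr_hom[OF module_fscale] assms(1) _ _ assms(2)[OF assms(5)]])
    (simp_all add: cl_id_tens assms fmod.subspace_0 fmod.subspace_scale)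

lemma rc_stable:
  assumes "fmod.subspace K" "\<And>a. a \<in> K \<Longrightarrow> dl a \<in> tens_span K" "linf \<phi>"
    "\<And>a. a \<in> K \<Longrightarrow> \<phi> a = 0" "a \<in> K"
  shows "rc \<phi> a \<in> K"
  unfolding rc_def
  by (rule tens_span_map[OF pr_hom[OF module_fscale] assms(1) _ _ assms(2)[OF assms(5)]])
    (simp_all add: cr_id_tens assms fmod.subspace_0 fmod.subspace_scale)

text \<open>
  If \<open>\<sigma>\<close> is trivial in degree zero, \<open>\<epsilon> - \<sigma>\<close> is locally nilpotent, so that the inverse
  of \<open>\<sigma>\<close> is a geometric series in it.
\<close>

lemma conv_inverse_vanish:
  fixes deg :: "'c \<Rightarrow> nat"
  assumes grad: "\<And>c u v. (u, v) \<in> Poly_Mapping.keys (dl (basis c)) \<Longrightarrow> deg u + deg v = deg c"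
    and K: "fmod.subspace K" "\<And>a. a \<in> K \<Longrightarrow> dl a \<in> tens_span K" "\<And>a. a \<in> K \<Longrightarrow> cu a = 0"
    and \<sigma>: "linf \<sigma>" "\<And>a. a \<in> K \<Longrightarrow> \<sigma> a = 0" "\<And>c. deg c = 0 \<Longrightarrow> \<sigma> (basis c) = cu (basis c)"
    and \<tau>: "linf \<tau>" "\<And>a. conv \<tau> \<sigma> a = cu a"
    and "a \<in> K"
  shows "\<tau> a = 0"
proof -
  define \<eta> where "\<eta> a = cu a - \<sigma> a" for a
  have \<eta>: "linf \<eta>" unfolding \<eta>_def using cu_hom \<sigma>(1) by (auto simp: module_hom_iff algebra_simps)
  have \<eta>K: "\<eta> a = 0" if "a \<in> K" for a using that by (simp add: \<eta>_def K \<sigma>)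
  have rc_diff: "rc \<eta> a = a - rc \<sigma> a" for a
  proof -
    have "rc \<eta> a = pr fscale (\<lambda>a b. fscale (cu b) a - fscale (\<sigma> b) a) (dl a)"
      by (simp add: rc_def \<eta>_def fmod.scale_left_diff_distrib)
    also have "\<dots> = rc cu a - rc \<sigma> a"
      by (simp add: rc_def pr_def lev_def fmod.scale_right_diff_distrib sum_subtractf case_prod_unfold)
    finally show ?thesis by simp
  qed
  \<comment> \<open>Substituting \<open>\<epsilon> - \<eta>\<close> for \<open>\<sigma>\<close> in
    the equation \<open>\<tau> * \<sigma> = \<epsilon>\<close>, whose right side is 0 on K, gives
    \<open>\<tau> = \<tau> * \<eta>\<close> on K. Iterating it is the geometric series.\<close>
  have step: "\<tau> a = \<tau> (rc \<eta> a)" if "a \<in> K" for a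
  proof -
    have "\<tau> (rc \<eta> a) = \<tau> a - conv \<tau> \<sigma> a"
      unfolding rc_diff hom_sub[OF \<tau>(1)] form_rc[OF \<tau>(1)] ..
    then show ?thesis by (simp only: \<tau>(2) K(3)[OF that] diff_zero)
  qed
  \<comment> \<open>\<open>\<eta>\<close> sees only right factors of positive degree, so the left
    factor that remains has strictly smaller degree.\<close>
  have low: "Poly_Mapping.keys (rc \<eta> (basis c)) \<subseteq> {u. deg u < deg c}" for c
  proof -
    have *: "fmod.subspace {p :: 'c \<Rightarrow>\<^sub>0 'k. Poly_Mapping.keys p \<subseteq> {u. deg u < deg c}}"
      by (rule subspace_keys)
    have "rc \<eta> (basis c) \<in> {p. Poly_Mapping.keys p \<subseteq> {u. deg u < deg c}}"
      unfolding rc_def pr_def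
    proof (rule lev_in_subspace[OF *], clarify)
      fix u v x assume uv: "(u, v) \<in> Poly_Mapping.keys (dl (basis c))"
        and x: "x \<in> Poly_Mapping.keys (fscale (\<eta> (basis v)) (basis u))"
      have "\<eta> (basis v) \<noteq> 0" "x = u" using x by (auto simp: in_keys_iff lookup_single when_def split: if_splits)
      then have "deg v \<noteq> 0" using \<sigma>(3)[of v] by (auto simp: \<eta>_def)
      then show "deg x < deg c" using grad[OF uv] \<open>x = u\<close> by simp
    qed
    then show ?thesis by simp
  qed
  have "\<tau> a = 0" if "a \<in> K" "Poly_Mapping.keys a \<subseteq> {u. deg u < n}" for a n
    using that
  proof (induction n arbitrary: a)
    case 0
    then show ?case by (simp add: hom_zero[OF \<tau>(1)])
  next
    case (Suc n)
    have *: "fmod.subspace {p :: 'c \<Rightarrow>\<^sub>0 'k. Poly_Mapping.keys p \<subseteq> {u. deg u < n}}"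
      by (rule subspace_keys)
    have "rc \<eta> a = lev fscale (\<lambda>c. rc \<eta> (basis c)) a" by (rule hom_expand[OF rc_hom])
    also have "\<dots> \<in> {p. Poly_Mapping.keys p \<subseteq> {u. deg u < n}}"
    proof (rule lev_in_subspace[OF *])
      fix x assume "x \<in> Poly_Mapping.keys a"
      then have "deg x < Suc n" using Suc.prems(2) by auto
      then show "rc \<eta> (basis x) \<in> {p. Poly_Mapping.keys p \<subseteq> {u. deg u < n}}"
        using low[of x] by force
    qed
    finally have "\<tau> (rc \<eta> a) = 0"
      using Suc.IH rc_stable[OF K(1,2) \<eta> \<eta>K Suc.prems(1)] by simp
    then show ?case using step[OF Suc.prems(1)] by simp
  qed
  moreover have "Poly_Mapping.keys a \<subseteq> {u. deg u < Suc (Max (deg ` Poly_Mapping.keys a))}"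
    by (auto simp: less_Suc_eq_le)
  ultimately show ?thesis using \<open>a \<in> K\<close> by blast
qed

subsection \<open>The tensor square of a coalgebra\<close>

definition dl2 :: "('c \<times> 'c \<Rightarrow>\<^sub>0 'k) \<Rightarrow> (('c \<times> 'c) \<times> ('c \<times> 'c) \<Rightarrow>\<^sub>0 'k)" where
  "dl2 z = swap23 (tm dl dl z)"

definition cu2 :: "('c \<times> 'c \<Rightarrow>\<^sub>0 'k) \<Rightarrow> 'k" where
  "cu2 = cc cu cu"

lemma dl2_hom: "lin dl2"
  unfolding dl2_def by (rule hom_compose[OF tm_hom swap23_hom])

lemma cu2_hom: "linf cu2"
  unfolding cu2_def by (rule pr_hom[OF module_times])

lemma dl2_tens: "dl2 (tens a b) = swap23 (tens (dl a) (dl b))"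
  by (simp add: dl2_def tm_tens dl_hom)

lemma cu2_tens: "cu2 (tens a b) = cu a * cu b"
  unfolding cu2_def by (rule cc_tens[OF cu_hom cu_hom])

lemma swap23_tm:
  assumes "lin A" "lin B" "lin C" "lin D"
  shows "swap23 (tm (tm A B) (tm C D) z) = tm (tm A C) (tm B D) (swap23 z)"
  by (rule hom_ext4[of fscale "\<lambda>z. swap23 (tm (tm A B) (tm C D) z)"])
    (auto intro!: hom_compose[OF swap23_hom] hom_compose[OF _ swap23_hom] tm_hom simp: tm_tens assms tm_hom)

lemma dl2_tm:
  assumes "\<And>a. dl (X a) = tm A B (dl a)" "\<And>a. dl (Y a) = tm C D (dl a)" "lin X" "lin Y" "lin A" "lin B" "lin C" "lin D"
  shows "dl2 (tm X Y z) = tm (tm A C) (tm B D) (dl2 z)"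
  unfolding dl2_def by (simp add: tm_tm dl_hom assms tm_hom swap23_tm[symmetric])

lemma tm_coalg_swap:
  assumes "lin A" "lin B" "lin A'" "lin B'"
    "\<And>a. tm A (\<lambda>x. x) (dl a) = tm (\<lambda>x. x) B (dl a)" "\<And>a. tm A' (\<lambda>x. x) (dl a) = tm (\<lambda>x. x) B' (dl a)"
  shows "tm (tm A A') (\<lambda>x. x) (dl2 z) = tm (\<lambda>x. x) (tm B B') (dl2 z)"
proof -
  have "tm (tm A A') (tm (\<lambda>x. x) (\<lambda>x. x)) (dl2 z) = swap23 (tm (tm A (\<lambda>x. x)) (tm A' (\<lambda>x. x)) (tm dl dl z))"
    unfolding dl2_def by (rule swap23_tm[OF assms(1) lin_ident assms(3) lin_ident, symmetric])
  also have "\<dots> = swap23 (tm (tm (\<lambda>x. x) B) (tm (\<lambda>x. x) B') (tm dl dl z))"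
    by (simp add: tm_tm dl_hom tm_hom assms(5,6))
  also have "\<dots> = tm (tm (\<lambda>x. x) (\<lambda>x. x)) (tm B B') (dl2 z)"
    unfolding dl2_def by (rule swap23_tm[OF lin_ident assms(2) lin_ident assms(4)])
  finally show ?thesis by (simp only: tm_id_fun)
qed

lemma coalg2: "coalg dl2 cu2"
proof (rule coalg.intro)
  show "lin dl2" by (rule dl2_hom)
  show "linf cu2" by (rule cu2_hom)
  fix z
  \<comment> \<open>These shuffles of six factors turn the product of the iterated coproducts of
    both components into the iterated coproduct of the square. \<open>A\<close> is then an identity
    of permutations, and \<open>B\<close>, \<open>C\<close> pull \<open>dl\<close> through.\<close>
  let ?sh = "\<lambda>z. tm swap23 (\<lambda>x. x) (swap23 z)"
  let ?sh' = "\<lambda>z. tm (\<lambda>x. x) swap23 (swap23 z)"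
  have sh: "lin ?sh" "lin ?sh'"
    by (intro hom_compose[OF swap23_hom] tm_hom)+
  have A: "reassoc (?sh w) = ?sh' (tm reassoc reassoc w)" for w :: "((('c \<times> 'c) \<times> 'c) \<times> (('c \<times> 'c) \<times> 'c)) \<Rightarrow>\<^sub>0 'k"
  proof (rule hom_ext2[of fscale "\<lambda>w. reassoc (?sh w)" "\<lambda>w. ?sh' (tm reassoc reassoc w)"])
    show "lin (\<lambda>w. reassoc (?sh w))" by (rule hom_compose[OF sh(1) reassoc_hom])
    show "lin (\<lambda>w. ?sh' (tm reassoc reassoc w))" by (rule hom_compose[OF tm_hom sh(2)])
    fix p q :: "('c \<times> 'c) \<times> 'c \<Rightarrow>\<^sub>0 'k"
    show "reassoc (?sh (tens p q)) = ?sh' (tm reassoc reassoc (tens p q))"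
    proof (rule hom_ext3[of fscale "\<lambda>p. reassoc (?sh (tens p q))" "\<lambda>p. ?sh' (tm reassoc reassoc (tens p q))"])
      show "lin (\<lambda>p. reassoc (?sh (tens p q)))"
        by (intro hom_compose[OF tens_hom1[OF lin_ident]] hom_compose[OF sh(1) reassoc_hom])
      show "lin (\<lambda>p. ?sh' (tm reassoc reassoc (tens p q)))"
        by (intro hom_compose[OF tens_hom1[OF lin_ident]] hom_compose[OF tm_hom sh(2)])
      fix a b c :: "'c \<Rightarrow>\<^sub>0 'k"
      let ?t = "tens (tens a b) c"
      show "reassoc (?sh (tens ?t q)) = ?sh' (tm reassoc reassoc (tens ?t q))"
      proof (rule hom_ext3[of fscale "\<lambda>q. reassoc (?sh (tens ?t q))" "\<lambda>q. ?sh' (tm reassoc reassoc (tens ?t q))"])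
        show "lin (\<lambda>q. reassoc (?sh (tens ?t q)))"
          by (intro hom_compose[OF tens_hom2[OF lin_ident]] hom_compose[OF sh(1) reassoc_hom])
        show "lin (\<lambda>q. ?sh' (tm reassoc reassoc (tens ?t q)))"
          by (intro hom_compose[OF tens_hom2[OF lin_ident]] hom_compose[OF tm_hom sh(2)])
      qed (simp add: tm_tens lin_ident swap23_hom reassoc_hom)
    qed
  qed
  have B: "tm dl2 (\<lambda>x. x) (swap23 w) = ?sh (tm (tm dl (\<lambda>x. x)) (tm dl (\<lambda>x. x)) w)" for w
    by (rule hom_ext4[of fscale "\<lambda>w. tm dl2 (\<lambda>x. x) (swap23 w)"])
      (auto intro!: hom_compose[OF swap23_hom] hom_compose[OF _ sh(1)] tm_hom
        simp: tm_tens lin_ident dl_hom tm_hom dl2_hom swap23_hom dl2_tens)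
  have C: "tm (\<lambda>x. x) dl2 (swap23 w) = ?sh' (tm (tm (\<lambda>x. x) dl) (tm (\<lambda>x. x) dl) w)" for w
    by (rule hom_ext4[of fscale "\<lambda>w. tm (\<lambda>x. x) dl2 (swap23 w)"])
      (auto intro!: hom_compose[OF swap23_hom] hom_compose[OF _ sh(2)] tm_hom
        simp: tm_tens lin_ident dl_hom tm_hom dl2_hom swap23_hom dl2_tens)
  show "reassoc (tm dl2 (\<lambda>x. x) (dl2 z)) = tm (\<lambda>x. x) dl2 (dl2 z)"
  proof -
    have L: "lin (\<lambda>a. tm dl (\<lambda>x. x) (dl a))" by (rule hom_compose[OF dl_hom tm_hom])
    have "reassoc (tm dl2 (\<lambda>x. x) (dl2 z)) = ?sh' (tm reassoc reassoc (tm (\<lambda>a. tm dl (\<lambda>x. x) (dl a)) (\<lambda>a. tm dl (\<lambda>x. x) (dl a)) z))"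
      by (simp only: dl2_def[of z] A B tm_tm[OF dl_hom dl_hom tm_hom tm_hom])
    also have "\<dots> = ?sh' (tm (\<lambda>a. tm (\<lambda>x. x) dl (dl a)) (\<lambda>a. tm (\<lambda>x. x) dl (dl a)) z)"
      by (simp only: tm_tm[OF L L reassoc_hom reassoc_hom] coassoc)
    also have "\<dots> = tm (\<lambda>x. x) dl2 (dl2 z)"
      by (simp only: dl2_def[of z] C tm_tm[OF dl_hom dl_hom tm_hom tm_hom])
    finally show ?thesis .
  qed
  have D: "cl cu2 (\<lambda>x. x) (swap23 w) = tm (cl cu (\<lambda>x. x)) (cl cu (\<lambda>x. x)) w" for w
    by (rule hom_ext4[of fscale "\<lambda>w. cl cu2 (\<lambda>x. x) (swap23 w)"])
      (auto intro!: hom_compose[OF swap23_hom] tm_hom pr_hom module_fscale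
        simp: tm_tens cl_tens lin_ident cu_hom cu2_hom pr_hom module_fscale cu2_tens tens_scale1 tens_scale2 mult.commute)
  show "cl cu2 (\<lambda>x. x) (dl2 z) = z"
    by (simp add: dl2_def D tm_tm dl_hom pr_hom module_fscale counit_l tm_id)
  have E: "cr (\<lambda>x. x) cu2 (swap23 w) = tm (cr (\<lambda>x. x) cu) (cr (\<lambda>x. x) cu) w" for w
    by (rule hom_ext4[of fscale "\<lambda>w. cr (\<lambda>x. x) cu2 (swap23 w)"])
      (auto intro!: hom_compose[OF swap23_hom] tm_hom pr_hom module_fscale
        simp: tm_tens cr_tens lin_ident cu_hom cu2_hom pr_hom module_fscale cu2_tens tens_scale1 tens_scale2 mult.commute)
  show "cr (\<lambda>x. x) cu2 (dl2 z) = z"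
    by (simp add: dl2_def E tm_tm dl_hom pr_hom module_fscale counit_r tm_id)
qed

end

section \<open>Bialgebras on free modules and coboundary twists\<close>

locale free_alg =
  fixes M :: "('s \<times> 's \<Rightarrow>\<^sub>0 'k::comm_ring_1) \<Rightarrow> ('s \<Rightarrow>\<^sub>0 'k)" and un :: "'s \<Rightarrow>\<^sub>0 'k"
  assumes M_hom: "lin M"
    and M_assoc: "M (tens (M (tens a b)) c) = M (tens a (M (tens b c)))"
    and M_unit_l: "M (tens un a) = a" and M_unit_r: "M (tens a un) = a"

locale free_bialg = coalg dl cu + free_alg M un
  for dl :: "('s \<Rightarrow>\<^sub>0 'k::comm_ring_1) \<Rightarrow> ('s \<times> 's \<Rightarrow>\<^sub>0 'k)" and cu
    and M :: "('s \<times> 's \<Rightarrow>\<^sub>0 'k) \<Rightarrow> ('s \<Rightarrow>\<^sub>0 'k)" and un +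
  assumes dl_M: "dl (M z) = tm M M (dl2 z)" and cu_M: "cu (M z) = cu2 z"
    and dl_un: "dl un = tens un un" and cu_un: "cu un = 1"
begin

text \<open>A 2-cocycle is a form on the tensor square, so the stability results for coideals are
  applied there, with \<open>tens_span J\<close> in the role of K.\<close>

lemma tens_span_coideal:
  assumes "\<And>a. a \<in> J \<Longrightarrow> dl a \<in> tens_span J" "z \<in> tens_span J"
  shows "dl2 z \<in> tens_span (tens_span J)"
proof (rule tens_span_map[OF dl2_hom tens_span_subspace _ _ assms(2)])
  fix a b
  show "dl2 (tens a b) \<in> tens_span (tens_span J)" if a: "a \<in> J"
    unfolding dl2_tens
  proof (rule tens_span_map[OF _ tens_span_subspace _ _ assms(1)[OF a], of "\<lambda>z. swap23 (tens z (dl b))"])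
    show *: "lin (\<lambda>z. swap23 (tens z (dl b)))"
      by (rule hom_compose[OF tens_hom1[OF lin_ident] swap23_hom])
    have "swap23 (tens (tens x y) w) \<in> tens_span (tens_span J)" if "x \<in> J \<or> y \<in> J" for x y w
    proof -
      have "swap23 (tens (tens x y) w) = lev fscale (\<lambda>p. swap23 (tens (tens x y) (basis p))) w"
        by (rule hom_expand[OF hom_compose[OF tens_hom2[OF lin_ident] swap23_hom]])
      also have "\<dots> \<in> tens_span (tens_span J)"
      proof (rule lev_in_subspace[OF tens_span_subspace])
        fix p :: "'s \<times> 's"
        have "swap23 (tens (tens x y) (tens (basis (fst p)) (basis (snd p)))) \<in> tens_span (tens_span J)"
          using that by (auto simp del: tens_basis intro: tens_spanI1 tens_spanI2)
        then show "swap23 (tens (tens x y) (basis p)) \<in> tens_span (tens_span J)" by simp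
      qed
      finally show ?thesis .
    qed
    note ** = this
    show "swap23 (tens (tens x y) (dl b)) \<in> tens_span (tens_span J)" if "x \<in> J" for x y
      by (rule **) (simp add: that)
    show "swap23 (tens (tens x y) (dl b)) \<in> tens_span (tens_span J)" if "y \<in> J" for x y
      by (rule **) (simp add: that)
  qed
  show "dl2 (tens a b) \<in> tens_span (tens_span J)" if b: "b \<in> J"
    unfolding dl2_tens
  proof (rule tens_span_map[OF _ tens_span_subspace _ _ assms(1)[OF b], of "\<lambda>z. swap23 (tens (dl a) z)"])
    show *: "lin (\<lambda>z. swap23 (tens (dl a) z))"
      by (rule hom_compose[OF tens_hom2[OF lin_ident] swap23_hom])
    have "swap23 (tens w (tens x y)) \<in> tens_span (tens_span J)" if "x \<in> J \<or> y \<in> J" for x y w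
    proof -
      have "swap23 (tens w (tens x y)) = lev fscale (\<lambda>p. swap23 (tens (basis p) (tens x y))) w"
        by (rule hom_expand[OF hom_compose[OF tens_hom1[OF lin_ident] swap23_hom]])
      also have "\<dots> \<in> tens_span (tens_span J)"
      proof (rule lev_in_subspace[OF tens_span_subspace])
        fix p :: "'s \<times> 's"
        have "swap23 (tens (tens (basis (fst p)) (basis (snd p))) (tens x y)) \<in> tens_span (tens_span J)"
          using that by (auto simp del: tens_basis intro: tens_spanI1 tens_spanI2)
        then show "swap23 (tens (basis p) (tens x y)) \<in> tens_span (tens_span J)" by simp
      qed
      finally show ?thesis .
    qed
    note ** = this
    show "swap23 (tens (dl a) (tens x y)) \<in> tens_span (tens_span J)" if "x \<in> J" for x y
      by (rule **) (simp add: that)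
    show "swap23 (tens (dl a) (tens x y)) \<in> tens_span (tens_span J)" if "y \<in> J" for x y
      by (rule **) (simp add: that)
  qed
qed

lemma cu2_tens_span: "(\<And>a. a \<in> J \<Longrightarrow> cu a = 0) \<Longrightarrow> z \<in> tens_span J \<Longrightarrow> cu2 z = 0"
  by (rule tens_span_form[OF cu2_hom]) (simp_all add: cu2_tens)

end

text \<open>
  The cocycle \<open>\<sigma> = (f \<otimes> f) * (f' \<circ> M)\<close> is the coboundary of \<open>f\<close>. Its cocycle identity is the
  associativity of the product \<open>star\<close> obtained by transporting \<open>M\<close> along the colinear bijection
  \<open>th\<close>, and transport along the coalgebra automorphism \<open>psi\<close> yields the deformed product \<open>dm\<close>.
\<close>

locale coboundary = free_bialg dl cu M un
  for dl :: "('s \<Rightarrow>\<^sub>0 'k::comm_ring_1) \<Rightarrow> ('s \<times> 's \<Rightarrow>\<^sub>0 'k)" and cu M un +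
  fixes f f' :: "('s \<Rightarrow>\<^sub>0 'k) \<Rightarrow> 'k"
  assumes f_hom: "linf f" and f'_hom: "linf f'" and f_un: "f un = 1"
    and conv1: "conv f f' = cu" and conv2: "conv f' f = cu"
begin

interpretation c2: coalg dl2 cu2 by (rule coalg2)

definition "th = lc f'"
definition "th' = lc f"
definition "thr = rc f"
definition "thr' = rc f'"
definition "psi a = th (thr a)"
definition "psi' a = th' (thr' a)"
definition "star z = th (M (tm th' th' z))"
definition "sg z = cu (star z)"
text \<open>In convolution notation \<open>sg\<close> is \<open>(f \<otimes> f) * (f' o M)\<close>
  and \<open>ta\<close> is \<open>(f o M) * (f' \<otimes> f')\<close>; the closed form makes
  \<open>ta\<close> a two-sided inverse of \<open>sg\<close>.\<close>

definition "ta z = f (M (tm thr' thr' z))"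
definition "dm z = psi (M (tm psi' psi' z))"

lemma th_hom: "lin th" and th'_hom: "lin th'" and thr_hom: "lin thr" and thr'_hom: "lin thr'"
  unfolding th_def th'_def thr_def thr'_def by (rule lc_hom rc_hom)+

lemma psi_hom: "lin psi" and psi'_hom: "lin psi'"
  unfolding psi_def psi'_def by (intro hom_compose[OF thr_hom th_hom] hom_compose[OF thr'_hom th'_hom])+

lemma th_th' [simp]: "th (th' a) = a" and th'_th [simp]: "th' (th a) = a"
  and thr_thr' [simp]: "thr (thr' a) = a" and thr'_thr [simp]: "thr' (thr a) = a"
  by (simp_all add: th_def th'_def thr_def thr'_def lc_lc rc_rc f_hom f'_hom conv1 conv2)

lemma th_thr: "th (thr a) = thr (th a)" and th'_thr': "th' (thr' a) = thr' (th' a)"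
  by (simp_all add: th_def th'_def thr_def thr'_def lc_rc f_hom f'_hom)

lemma psi_psi' [simp]: "psi (psi' a) = a" and psi'_psi [simp]: "psi' (psi a) = a"
  by (simp_all add: psi_def psi'_def th'_thr' th_thr)

lemma dl_th: "dl (th a) = tm th (\<lambda>x. x) (dl a)" and dl_th': "dl (th' a) = tm th' (\<lambda>x. x) (dl a)"
  and dl_thr: "dl (thr a) = tm (\<lambda>x. x) thr (dl a)" and dl_thr': "dl (thr' a) = tm (\<lambda>x. x) thr' (dl a)"
  by (simp_all add: th_def th'_def thr_def thr'_def dl_lc dl_rc f_hom f'_hom)

lemma cu_th: "cu (th a) = f' a"
  using form_lc[OF cu_hom, of f' a] form_rc[OF f'_hom, of cu a] by (simp add: th_def)

lemma cu_psi: "cu (psi a) = cu a"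
  using form_rc[OF f'_hom, of f a] by (simp add: psi_def cu_th thr_def conv2)

lemma star_hom: "lin star"
  unfolding star_def by (rule hom_compose[OF hom_compose[OF tm_hom M_hom] th_hom])

lemma sg_hom: "linf sg"
  unfolding sg_def by (rule hom_compose[OF star_hom cu_hom])

lemma ta_hom: "linf ta"
  unfolding ta_def by (rule hom_compose[OF hom_compose[OF tm_hom M_hom] f_hom])

text \<open>\<open>th\<close> and \<open>th'\<close> act on the leftmost Sweedler factors only, so
  the right leg still carries the original product. Colinearity then recovers \<open>star\<close>
  from its counit \<open>sg\<close>, which is \<open>star_eq\<close>.\<close>

lemma dl_star: "dl (star z) = tm star M (dl2 z)"
proof -
  have "dl (star z) = tm th (\<lambda>x. x) (tm M M (dl2 (tm th' th' z)))"
    by (simp only: star_def dl_th dl_M)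
  also have "dl2 (tm th' th' z) = tm (tm th' th') (tm (\<lambda>x. x) (\<lambda>x. x)) (dl2 z)"
    by (rule dl2_tm[OF dl_th' dl_th' th'_hom th'_hom th'_hom lin_ident th'_hom lin_ident])
  also have "tm th (\<lambda>x. x) (tm M M (tm (tm th' th') (tm (\<lambda>x. x) (\<lambda>x. x)) (dl2 z))) = tm star M (dl2 z)"
    unfolding tm_id_fun star_def
    by (simp add: tm_tm M_hom tm_hom lin_ident th_hom hom_compose[OF tm_hom M_hom])
  finally show ?thesis .
qed

lemma star_eq: "star z = M (c2.lc sg z)"
proof -
  have "star z = cl cu (\<lambda>x. x) (tm star M (dl2 z))" by (simp only: dl_star[symmetric] counit_l)
  also have "\<dots> = cl sg M (dl2 z)"
    unfolding sg_def by (rule pr_tm[OF bil_cl[OF cu_hom lin_ident] star_hom M_hom])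
  also have "\<dots> = M (c2.lc sg z)" by (rule c2.hom_lc[OF M_hom, symmetric])
  finally show ?thesis .
qed

text \<open>\<open>psi'\<close> distributes over the coproduct as \<open>th'\<close> on the left leg
  and \<open>thr'\<close> on the right leg. The left legs assemble to \<open>star\<close>, the right
  legs to \<open>ta\<close>, so the transported product has the shape of the deformed
  product.\<close>

lemma dm_eq: "dm z = star (c2.rc ta z)"
proof -
  define w where "w = tm psi' psi' z"
  have dlpsi': "dl (psi' a) = tm th' thr' (dl a)" for a
    by (simp add: psi'_def dl_th' dl_thr' tm_tm lin_ident th'_hom thr'_hom)
  have w: "dl2 w = tm (tm th' th') (tm thr' thr') (dl2 z)"
    unfolding w_def by (rule dl2_tm[OF dlpsi' dlpsi' psi'_hom psi'_hom th'_hom thr'_hom th'_hom thr'_hom])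
  have "thr (M w) = cr (\<lambda>x. x) f (tm M M (dl2 w))" by (simp only: thr_def rc_def dl_M)
  also have "\<dots> = cr M (\<lambda>x. f (M x)) (dl2 w)"
    by (rule pr_tm[OF bil_cr[OF lin_ident f_hom] M_hom M_hom])
  also have "\<dots> = pr fscale (\<lambda>a b. fscale (ta b) (M (tm th' th' a))) (dl2 z)"
    unfolding w ta_def
    by (rule pr_tm[OF bil_cr[OF M_hom hom_compose[OF M_hom f_hom]] tm_hom tm_hom])
  finally have "dm z = pr fscale (\<lambda>a b. th (fscale (ta b) (M (tm th' th' a)))) (dl2 z)"
    by (simp only: dm_def w_def[symmetric] psi_def hom_pr[OF th_hom])
  also have "\<dots> = cr star ta (dl2 z)"
    by (simp only: hom_scale[OF th_hom] star_def)
  also have "\<dots> = star (c2.rc ta z)" by (rule c2.hom_rc[OF star_hom, symmetric])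
  finally show ?thesis .
qed

lemma cu2_tm: "lin X \<Longrightarrow> (\<And>a. cu (X a) = cu a) \<Longrightarrow> cu2 (tm X X z) = cu2 z"
  unfolding cu2_def by (subst pr_tm[OF bil_cc[OF cu_hom cu_hom]]) simp_all

lemma cu_psi': "cu (psi' a) = cu a"
  using cu_psi[of "psi' a"] by simp

text \<open>The counit of \<open>dm\<close> is computed twice: through \<open>dm_eq\<close> it is
  this convolution, and through the definition it is the counit of \<open>M\<close>, since
  \<open>psi\<close> and \<open>psi'\<close> preserve counits.\<close>

lemma conv_sg_ta: "c2.conv sg ta = cu2"
proof
  fix z
  have "c2.conv sg ta z = cu (dm z)"
    by (simp only: c2.form_rc[OF sg_hom, symmetric] dm_eq) (simp add: sg_def)
  also have "\<dots> = cu2 z"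
    by (simp add: dm_def cu_psi cu_M cu2_tm psi'_hom cu_psi')
  finally show "c2.conv sg ta z = cu2 z" .
qed

lemma conv_ta_sg: "c2.conv ta sg = cu2"
proof
  fix z
  let ?T = "tm (tm thr' thr') (tm th' th') (dl2 z)"
  \<comment> \<open>The inner factors cancel: \<open>thr'\<close> on the left leg can be rewritten
    as \<open>th\<close> on the right leg, where it meets \<open>th'\<close>.\<close>
  have "?T = tm (\<lambda>x. x) (tm th' th') (tm (tm thr' thr') (\<lambda>x. x) (dl2 z))"
    by (simp add: tm_tm tm_hom lin_ident)
  also have "tm (tm thr' thr') (\<lambda>x. x) (dl2 z) = tm (\<lambda>x. x) (tm th th) (dl2 z)"
    by (rule tm_coalg_swap) (simp_all add: thr'_hom th_hom, simp_all add: thr'_def th_def tm_rc_lc f'_hom)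
  also have "tm (\<lambda>x. x) (tm th' th') (tm (\<lambda>x. x) (tm th th) (dl2 z)) = dl2 z"
    by (simp add: tm_tm tm_hom lin_ident th_hom th'_hom tm_id_fun tm_id)
  finally have T: "?T = dl2 z" .
  have "c2.conv ta sg z = pr (*) (\<lambda>a b. f (M (tm thr' thr' a)) * f' (M (tm th' th' b))) (dl2 z)"
    by (simp only: c2.conv_def ta_def sg_def star_def cu_th)
  also have "\<dots> = cc (\<lambda>x. f (M x)) (\<lambda>x. f' (M x)) ?T"
    by (rule pr_tm[symmetric]) (intro bil_cc hom_compose[OF M_hom] f_hom f'_hom tm_hom)+
  also have "\<dots> = cc f f' (tm M M (dl2 z))"
    unfolding T by (rule pr_tm[OF bil_cc[OF f_hom f'_hom] M_hom M_hom, symmetric])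
  also have "\<dots> = conv f f' (M z)" by (simp only: conv_def dl_M)
  also have "\<dots> = cu2 z" by (simp only: conv1 cu_M)
  finally show "c2.conv ta sg z = cu2 z" .
qed

lemma star_assoc: "star (tens (star (tens a b)) c) = star (tens a (star (tens b c)))"
  by (simp add: star_def tm_tens th'_hom M_assoc)

text \<open>These are the counits of the two bracketings of the associative product
  \<open>star\<close>.\<close>

lemma sg_cocycle:
  "sg (tens (M (c2.lc sg (tens a b))) c) = sg (tens a (M (c2.lc sg (tens b c))))"
  using star_assoc[of a b c] by (simp add: star_eq[symmetric]) (simp add: sg_def)

lemma f'_un: "f' un = 1"
proof -
  have "conv f f' un = f un * f' un" by (simp add: conv_def dl_un cc_tens f_hom f'_hom)
  then show ?thesis by (simp add: conv1 cu_un f_un)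
qed

lemma th'_un: "th' un = un"
  by (simp add: th'_def lc_def dl_un cl_id_tens f_hom f_un)

lemma psi_un: "psi un = un"
  by (simp add: psi_def thr_def rc_def th_def lc_def dl_un cr_id_tens cl_id_tens f_hom f'_hom f_un f'_un)

lemma sg_unit_r: "sg (tens a un) = cu a" and sg_unit_l: "sg (tens un a) = cu a"
  by (simp_all add: sg_def star_def tm_tens th'_hom th'_un M_unit_r M_unit_l)

lemma psi_M: "psi (M (tens a b)) = dm (tens (psi a) (psi b))"
  by (simp add: dm_def tm_tens psi'_hom)

text \<open>In \<open>f'(a1) a2 f(a3) \<otimes> f'(a4) a5 f(a6)\<close> the two inner forms
  cancel.\<close>

lemma dl_psi: "dl (psi a) = tm psi psi (dl a)"
proof -
  have "tm psi psi (dl a) = tm th psi (tm thr (\<lambda>x. x) (dl a))"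
    unfolding psi_def by (simp add: tm_tm thr_hom th_hom lin_ident hom_compose[OF thr_hom th_hom])
  also have "tm thr (\<lambda>x. x) (dl a) = tm (\<lambda>x. x) th' (dl a)"
    unfolding thr_def th'_def by (rule tm_rc_lc[OF f_hom])
  also have "tm th psi (tm (\<lambda>x. x) th' (dl a)) = tm th thr (dl a)"
    unfolding psi_def by (simp add: tm_tm thr_hom th'_hom th_hom lin_ident hom_compose[OF th_hom thr_hom] th_thr)
  also have "\<dots> = dl (psi a)"
    by (simp add: psi_def dl_th dl_thr tm_tm lin_ident th_hom thr_hom)
  finally show ?thesis by simp
qed

lemma M_eq: "M z = star (c2.lc ta z)"
  by (simp add: star_eq c2.lc_lc ta_hom sg_hom conv_ta_sg)

lemma star_dm: "star z = dm (c2.rc sg z)"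
  by (simp add: dm_eq c2.rc_rc ta_hom sg_hom conv_ta_sg)

section \<open>Coideals on which the cocycle and its inverse vanish\<close>

context
  fixes J
  assumes J: "fmod.subspace J" "\<And>a. a \<in> J \<Longrightarrow> dl a \<in> tens_span J"
    and sgJ: "\<And>z. z \<in> tens_span J \<Longrightarrow> sg z = 0" and taJ: "\<And>z. z \<in> tens_span J \<Longrightarrow> ta z = 0"
begin

lemma lc_sg_stable: "z \<in> tens_span J \<Longrightarrow> c2.lc sg z \<in> tens_span J"
  by (rule c2.lc_stable[OF tens_span_subspace _ sg_hom]) (auto intro: tens_span_coideal J(2) sgJ)

lemma rc_sg_stable: "z \<in> tens_span J \<Longrightarrow> c2.rc sg z \<in> tens_span J"
  by (rule c2.rc_stable[OF tens_span_subspace _ sg_hom]) (auto intro: tens_span_coideal J(2) sgJ)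

lemma lc_ta_stable: "z \<in> tens_span J \<Longrightarrow> c2.lc ta z \<in> tens_span J"
  by (rule c2.lc_stable[OF tens_span_subspace _ ta_hom]) (auto intro: tens_span_coideal J(2) taJ)

lemma rc_ta_stable: "z \<in> tens_span J \<Longrightarrow> c2.rc ta z \<in> tens_span J"
  by (rule c2.rc_stable[OF tens_span_subspace _ ta_hom]) (auto intro: tens_span_coideal J(2) taJ)

lemma dm_stable:
  assumes "\<And>z. z \<in> tens_span J \<Longrightarrow> M z \<in> J" "z \<in> tens_span J" shows "dm z \<in> J"
  unfolding dm_eq star_eq
  by (rule assms(1), rule lc_sg_stable, rule rc_ta_stable, rule assms(2))

text \<open>The twist can be undone: \<open>M\<close> arises from \<open>dm\<close> by twisting back
  with \<open>ta\<close> on the left and \<open>sg\<close> on the right, and these twists preserve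
  \<open>tens_span J\<close> as well.\<close>

lemma M_stable:
  assumes "\<And>z. z \<in> tens_span J \<Longrightarrow> dm z \<in> J" "z \<in> tens_span J" shows "M z \<in> J"
proof -
  have "M z = dm (c2.rc sg (c2.lc ta z))" by (simp only: M_eq[of z] star_dm)
  then show ?thesis by (simp only:) (rule assms(1), rule rc_sg_stable, rule lc_ta_stable, rule assms(2))
qed

end

lemma ta_vanish:
  fixes deg :: "'s \<Rightarrow> nat"
  assumes grad: "\<And>c u v. (u, v) \<in> Poly_Mapping.keys (dl (basis c)) \<Longrightarrow> deg u + deg v = deg c"
    and J: "\<And>a. a \<in> J \<Longrightarrow> dl a \<in> tens_span J" "\<And>a. a \<in> J \<Longrightarrow> cu a = 0"
    and sgJ: "\<And>z. z \<in> tens_span J \<Longrightarrow> sg z = 0"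
    and sg0: "\<And>u v. deg u = 0 \<Longrightarrow> deg v = 0 \<Longrightarrow> sg (basis (u, v)) = cu2 (basis (u, v))"
    and "z \<in> tens_span J"
  shows "ta z = 0"
proof (rule c2.conv_inverse_vanish[where deg = "\<lambda>(u, v). deg u + deg v" and K = "tens_span J" and \<sigma> = sg])
  show "fmod.subspace (tens_span J)" by (rule tens_span_subspace)
  show "dl2 a \<in> tens_span (tens_span J)" if "a \<in> tens_span J" for a
    by (rule tens_span_coideal[OF J(1) that])
  show "cu2 a = 0" if "a \<in> tens_span J" for a by (rule cu2_tens_span[OF J(2) that])
  show "linf sg" "linf ta" by (rule sg_hom ta_hom)+
  show "c2.conv ta sg a = cu2 a" for a by (simp add: conv_ta_sg)
  show "sg (basis c) = cu2 (basis c)" if "(case c of (u, v) \<Rightarrow> deg u + deg v) = 0" for c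
    using that sg0[of "fst c" "snd c"] by (cases c) simp
  fix c u v
  assume uv: "(u, v) \<in> Poly_Mapping.keys (dl2 (basis c))"
  obtain c1 c2 where c: "c = (c1, c2)" by (cases c)
  let ?S = "{((u1, u2), (v1, v2)) | u1 u2 v1 v2. deg u1 + deg v1 = deg c1 \<and> deg u2 + deg v2 = deg c2}"
  have "dl2 (basis c) = swap23 (tens (dl (basis c1)) (dl (basis c2)))"
    unfolding c tens_basis[symmetric] dl2_tens ..
  also have "\<dots> = lev fscale (\<lambda>p. lev fscale (\<lambda>q. swap23 (basis (p, q))) (dl (basis c2))) (dl (basis c1))"
    unfolding tens_def by (simp only: hom_lev[OF swap23_hom])
  also have "\<dots> \<in> {p. Poly_Mapping.keys p \<subseteq> ?S}"
  proof (intro lev_in_subspace subspace_keys)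
    fix p q assume p: "p \<in> Poly_Mapping.keys (dl (basis c1))" and q: "q \<in> Poly_Mapping.keys (dl (basis c2))"
    obtain p1 p2 q1 q2 where [simp]: "p = (p1, p2)" "q = (q1, q2)" by (cases p, cases q)
    have "swap23 (basis (p, q) :: _ \<Rightarrow>\<^sub>0 'k) = basis ((p1, q1), (p2, q2))"
      by (simp add: swap23_def module_fscale)
    then show "swap23 (basis (p, q) :: _ \<Rightarrow>\<^sub>0 'k) \<in> {p. Poly_Mapping.keys p \<subseteq> ?S}"
      using grad[of p1 p2 c1] grad[of q1 q2 c2] p q by auto
  qed
  finally have "(u, v) \<in> ?S" using uv by blast
  then show "(case u of (u, v) \<Rightarrow> deg u + deg v) + (case v of (u, v) \<Rightarrow> deg u + deg v)
      = (case c of (u, v) \<Rightarrow> deg u + deg v)"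
    by (auto simp: c)
qed (use assms in auto)

end

section \<open>Modules presented as linear images of free modules\<close>

text \<open>A surjection from a free module through which the operations of \<open>P\<close> are
  computed. All records in the statement are handled by such presentations, so that tensors and
  Sweedler sums in them are evaluated on free modules.\<close>

definition pres :: "('k::comm_ring_1, 'a, 'm) module_scheme \<Rightarrow> (('x \<Rightarrow>\<^sub>0 'k) \<Rightarrow> 'a) \<Rightarrow> bool" where
  "pres P \<rho> \<longleftrightarrow> carrier P = range \<rho> \<and> \<zero>\<^bsub>P\<^esub> = \<rho> 0 \<and> (\<forall>a b. \<rho> a \<oplus>\<^bsub>P\<^esub> \<rho> b = \<rho> (a + b)) \<and>
     (\<forall>c a. c \<odot>\<^bsub>P\<^esub> \<rho> a = \<rho> (fscale c a))"

lemma pres_carrier: "pres P \<rho> \<Longrightarrow> carrier P = range \<rho>"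
  and pres_zero: "pres P \<rho> \<Longrightarrow> \<zero>\<^bsub>P\<^esub> = \<rho> 0"
  and pres_add: "pres P \<rho> \<Longrightarrow> \<rho> a \<oplus>\<^bsub>P\<^esub> \<rho> b = \<rho> (a + b)"
  and pres_smult: "pres P \<rho> \<Longrightarrow> c \<odot>\<^bsub>P\<^esub> \<rho> a = \<rho> (fscale c a)"
  by (simp_all add: pres_def)

lemma pres_in: "pres P \<rho> \<Longrightarrow> \<rho> a \<in> carrier P"
  by (simp add: pres_def)

lemma cring_base_ring: "cring (base_ring :: ('k::comm_ring_1, 'k) module)"
proof (rule cringI)
  show "abelian_group (base_ring :: ('k, 'k) module)"
  proof (rule abelian_groupI)
    fix x :: 'k
    show "\<exists>y\<in>carrier base_ring. y \<oplus>\<^bsub>base_ring\<^esub> x = \<zero>\<^bsub>base_ring\<^esub>"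
      by (rule bexI[of _ "- x"]) (simp_all add: base_ring_def)
  qed (simp_all add: base_ring_def ac_simps)
  show "comm_monoid (base_ring :: ('k, 'k) module)"
    by (rule comm_monoidI) (simp_all add: base_ring_def ac_simps)
qed (simp_all add: base_ring_def algebra_simps)

lemma pres_module:
  assumes "pres P \<rho>" shows "Module.module base_ring P"
proof (rule moduleI[OF cring_base_ring])
  show "abelian_group P"
  proof (rule abelian_groupI)
    fix x assume "x \<in> carrier P"
    then obtain a where "x = \<rho> a" using pres_carrier[OF assms] by auto
    then show "\<exists>y\<in>carrier P. y \<oplus>\<^bsub>P\<^esub> x = \<zero>\<^bsub>P\<^esub>"
      using assms by (intro bexI[of _ "\<rho> (- a)"]) (auto simp: pres_def)
  qed (use assms in \<open>auto simp: pres_def ac_simps\<close>)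
qed (use assms in \<open>auto simp: pres_def base_ring_def fmod.scale_left_distrib fmod.scale_right_distrib\<close>)

lemma pres_finsum:
  assumes "pres P \<rho>" "finite A"
  shows "(\<Oplus>\<^bsub>P\<^esub>x\<in>A. \<rho> (g x)) = \<rho> (\<Sum>x\<in>A. g x)"
proof -
  interpret P: Module.module base_ring P by (rule pres_module[OF assms(1)])
  show ?thesis using assms(2)
    by (induction A) (simp_all add: pres_zero[OF assms(1)] pres_in[OF assms(1)] pres_add[OF assms(1)] P.M.finsum_insert)
qed

lemma pres_eq_iff:
  assumes "pres P \<rho>" shows "\<rho> a = \<rho> b \<longleftrightarrow> \<rho> (a - b) = \<rho> 0"
proof
  assume "\<rho> a = \<rho> b"
  then have "\<rho> a \<oplus>\<^bsub>P\<^esub> \<rho> (- b) = \<rho> b \<oplus>\<^bsub>P\<^esub> \<rho> (- b)" by simp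
  then show "\<rho> (a - b) = \<rho> 0" by (simp add: pres_add[OF assms])
next
  assume "\<rho> (a - b) = \<rho> 0"
  then have "\<rho> (a - b) \<oplus>\<^bsub>P\<^esub> \<rho> b = \<rho> 0 \<oplus>\<^bsub>P\<^esub> \<rho> b" by simp
  then show "\<rho> a = \<rho> b" by (simp add: pres_add[OF assms])
qed

lemma pres_kernel:
  assumes "pres P \<rho>" shows "fmod.subspace {a. \<rho> a = \<rho> 0}"
proof -
  have "\<rho> (a + b) = \<rho> 0" if "\<rho> a = \<rho> 0" "\<rho> b = \<rho> 0" for a b
    using pres_add[OF assms, of a b] pres_add[OF assms, of 0 0] that by simp
  moreover have "\<rho> (fscale c a) = \<rho> 0" if "\<rho> a = \<rho> 0" for a c
    using pres_smult[OF assms, of c a] pres_smult[OF assms, of c 0] that by simp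
  ultimately show ?thesis by (auto simp: fmod.subspace_def)
qed

lemma lev_diff_fun: "lev fscale (\<lambda>x. f x - g x) p = lev fscale f p - lev fscale g p"
  by (simp add: lev_def fmod.scale_right_diff_distrib sum_subtractf)

lemma pres_lev_cong:
  assumes "pres P \<rho>" "\<And>x. x \<in> Poly_Mapping.keys p \<Longrightarrow> \<rho> (f x) = \<rho> (g x)"
  shows "\<rho> (lev fscale f p) = \<rho> (lev fscale g p)"
proof -
  have "lev fscale (\<lambda>x. f x - g x) p \<in> {a. \<rho> a = \<rho> 0}"
    using assms(2) pres_eq_iff[OF assms(1)] by (intro lev_in_subspace[OF pres_kernel[OF assms(1)]]) auto
  then show ?thesis using pres_eq_iff[OF assms(1)] by (simp add: lev_diff_fun)
qed

subsection \<open>Tensor products\<close>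

lemma tclass_eq_iff: "tclass M N s = tclass M N t \<longleftrightarrow> s - t \<in> fmod.span (tensor_rels M N)"
proof
  assume "tclass M N s = tclass M N t"
  moreover have "s \<in> tclass M N s"
    unfolding tclass_def by (rule image_eqI[of _ _ 0]) (simp_all add: fmod.span_zero)
  ultimately obtain z where "z \<in> fmod.span (tensor_rels M N)" "s = t + z"
    by (auto simp: tclass_def)
  then show "s - t \<in> fmod.span (tensor_rels M N)" by simp
next
  assume st: "s - t \<in> fmod.span (tensor_rels M N)"
  have *: "tclass M N s \<subseteq> tclass M N t" if "s - t \<in> fmod.span (tensor_rels M N)" for s t
  proof
    fix x assume "x \<in> tclass M N s"
    then obtain z where z: "z \<in> fmod.span (tensor_rels M N)" "x = s + z" by (auto simp: tclass_def)
    then have "x = t + ((s - t) + z)" by simp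
    then show "x \<in> tclass M N t"
      unfolding tclass_def using fmod.span_add[OF that z(1)] by blast
  qed
  have "t - s \<in> fmod.span (tensor_rels M N)" using fmod.span_neg[OF st] by simp
  then show "tclass M N s = tclass M N t" using *[OF st] * by blast
qed

lemma rep_tclass: "rep (tclass M N s) - s \<in> fmod.span (tensor_rels M N)"
proof -
  have "s \<in> tclass M N s"
    unfolding tclass_def by (rule image_eqI[of _ _ 0]) (simp_all add: fmod.span_zero)
  then have "rep (tclass M N s) \<in> tclass M N s" unfolding rep_def by (rule someI)
  then show ?thesis by (auto simp: tclass_def)
qed

lemma tclass_add: "tclass M N s \<oplus>\<^bsub>tensor M N\<^esub> tclass M N t = tclass M N (s + t)"
  using fmod.span_add[OF rep_tclass[of M N s] rep_tclass[of M N t]]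
  by (simp add: tensor_def tclass_eq_iff algebra_simps)

lemma tclass_smult: "c \<odot>\<^bsub>tensor M N\<^esub> tclass M N s = tclass M N (fscale c s)"
  using fmod.span_scale[OF rep_tclass[of M N s], of c]
  by (simp add: tensor_def tclass_eq_iff fmod.scale_right_diff_distrib)

lemma tensor_rels_keys:
  fixes z :: "'a \<times> 'b \<Rightarrow>\<^sub>0 'k::comm_ring_1"
  assumes M: "pres M \<rho>M" and N: "pres N \<rho>N" and "z \<in> fmod.span (tensor_rels M N)"
  shows "Poly_Mapping.keys z \<subseteq> carrier M \<times> carrier N"
proof -
  have c: "a \<oplus>\<^bsub>M\<^esub> a' \<in> carrier M" "c \<odot>\<^bsub>M\<^esub> a \<in> carrier M" if "a \<in> carrier M" "a' \<in> carrier M" for a a' c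
    using that M by (auto simp: pres_def)
  have d: "a \<oplus>\<^bsub>N\<^esub> a' \<in> carrier N" "c \<odot>\<^bsub>N\<^esub> a \<in> carrier N" if "a \<in> carrier N" "a' \<in> carrier N" for a a' c
    using that N by (auto simp: pres_def)
  define U where "U = {z :: 'a \<times> 'b \<Rightarrow>\<^sub>0 'k. Poly_Mapping.keys z \<subseteq> carrier M \<times> carrier N}"
  have U: "fmod.subspace U" unfolding U_def by (rule subspace_keys)
  have b: "basis (a, b) \<in> U" if "a \<in> carrier M" "b \<in> carrier N" for a b
    using that by (simp add: U_def)
  have "tensor_rels M N \<subseteq> U"
    unfolding tensor_rels_def
    by (auto intro!: fmod.subspace_diff[OF U] fmod.subspace_scale[OF U] b c d)
  then have "z \<in> U" using fmod.span_minimal[OF _ U] assms(3) by blast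
  then show ?thesis by (simp add: U_def)
qed

definition temb :: "(('x \<Rightarrow>\<^sub>0 'k::comm_ring_1) \<Rightarrow> 'a) \<Rightarrow> (('y \<Rightarrow>\<^sub>0 'k) \<Rightarrow> 'b) \<Rightarrow>
    ('x \<times> 'y \<Rightarrow>\<^sub>0 'k) \<Rightarrow> ('a \<times> 'b \<Rightarrow>\<^sub>0 'k)" where
  "temb \<rho>M \<rho>N = lev fscale (\<lambda>(u, v). basis (\<rho>M (basis u), \<rho>N (basis v)))"

definition tp :: "('k::comm_ring_1, 'a, 'm) module_scheme \<Rightarrow> ('k, 'b, 'n) module_scheme \<Rightarrow>
    (('x \<Rightarrow>\<^sub>0 'k) \<Rightarrow> 'a) \<Rightarrow> (('y \<Rightarrow>\<^sub>0 'k) \<Rightarrow> 'b) \<Rightarrow> ('x \<times> 'y \<Rightarrow>\<^sub>0 'k) \<Rightarrow> ('a \<times> 'b \<Rightarrow>\<^sub>0 'k) set" where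
  "tp M N \<rho>M \<rho>N z = tclass M N (temb \<rho>M \<rho>N z)"

lemma temb_hom: "lin (temb \<rho>M \<rho>N)"
  unfolding temb_def by (rule lev_hom[OF module_fscale])

text \<open>Modulo the relations, \<open>basis (\<rho>M a, \<rho>N b)\<close> is bilinear in a and
  b, as is the left term, and both agree on basis vectors.\<close>

lemma temb_tens:
  assumes M: "pres M \<rho>M" and N: "pres N \<rho>N"
  shows "temb \<rho>M \<rho>N (tens a b) - basis (\<rho>M a, \<rho>N b) \<in> fmod.span (tensor_rels M N)" (is "?\<delta> a b \<in> ?R")
proof -
  have R: "fmod.subspace ?R" by (rule fmod.subspace_span)
  have r1: "basis (\<rho>M (a + a'), \<rho>N b) - basis (\<rho>M a, \<rho>N b) - basis (\<rho>M a', \<rho>N b) \<in> ?R" for a a' b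
    unfolding pres_add[OF M, symmetric]
    by (rule fmod.span_base) (unfold tensor_rels_def, use pres_in[OF M] pres_in[OF N] in blast)
  have r2: "basis (\<rho>M a, \<rho>N (b + b')) - basis (\<rho>M a, \<rho>N b) - basis (\<rho>M a, \<rho>N b') \<in> ?R" for a b b'
    unfolding pres_add[OF N, symmetric]
    by (rule fmod.span_base) (unfold tensor_rels_def, use pres_in[OF M] pres_in[OF N] in blast)
  have r3: "basis (\<rho>M (fscale c a), \<rho>N b) - fscale c (basis (\<rho>M a, \<rho>N b)) \<in> ?R" for c a b
    unfolding pres_smult[OF M, symmetric]
    by (rule fmod.span_base) (unfold tensor_rels_def, use pres_in[OF M] pres_in[OF N] in blast)
  have r4: "basis (\<rho>M a, \<rho>N (fscale c b)) - fscale c (basis (\<rho>M a, \<rho>N b)) \<in> ?R" for c a b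
    unfolding pres_smult[OF N, symmetric]
    by (rule fmod.span_base) (unfold tensor_rels_def, use pres_in[OF M] pres_in[OF N] in blast)
  \<comment> \<open>A pair with a zero entry is itself a relation: homogeneity with the scalar
    0.\<close>
  have z1: "basis (\<rho>M 0, \<rho>N b) \<in> ?R" for b using r3[of 0 0 b] by simp
  have z2: "basis (\<rho>M a, \<rho>N 0) \<in> ?R" for a using r4[of a 0 0] by simp
  note e = hom_add[OF temb_hom] hom_scale[OF temb_hom] hom_zero[OF temb_hom]
  have s1: "fmod.subspace {a. ?\<delta> a b \<in> ?R}" for b
    unfolding fmod.subspace_def
  proof (intro conjI ballI allI; simp only: mem_Collect_eq)
    show "?\<delta> 0 b \<in> ?R" using fmod.span_neg[OF z1[of b]] by (simp add: e)
    show "?\<delta> (x + y) b \<in> ?R" if "?\<delta> x b \<in> ?R" "?\<delta> y b \<in> ?R" for x y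
      using fmod.span_diff[OF fmod.span_add[OF that] r1[of x y b]] by (simp add: e tens_add1 algebra_simps)
    show "?\<delta> (fscale c x) b \<in> ?R" if "?\<delta> x b \<in> ?R" for c x
      using fmod.span_diff[OF fmod.span_scale[OF that, of c] r3[of c x b]]
      by (simp add: e tens_scale1 fmod.scale_right_diff_distrib)
  qed
  have s2: "fmod.subspace {b. ?\<delta> a b \<in> ?R}" for a
    unfolding fmod.subspace_def
  proof (intro conjI ballI allI; simp only: mem_Collect_eq)
    show "?\<delta> a 0 \<in> ?R" using fmod.span_neg[OF z2[of a]] by (simp add: e)
    show "?\<delta> a (x + y) \<in> ?R" if "?\<delta> a x \<in> ?R" "?\<delta> a y \<in> ?R" for x y
      using fmod.span_diff[OF fmod.span_add[OF that] r2[of a x y]] by (simp add: e tens_add2 algebra_simps)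
    show "?\<delta> a (fscale c x) \<in> ?R" if "?\<delta> a x \<in> ?R" for c x
      using fmod.span_diff[OF fmod.span_scale[OF that, of c] r4[of a c x]]
      by (simp add: e tens_scale2 fmod.scale_right_diff_distrib)
  qed
  have "?\<delta> (basis u) (basis v) \<in> ?R" for u v
    by (simp add: temb_def module_fscale fmod.span_zero)
  then have "lev fscale basis a \<in> {a. ?\<delta> a (basis v) \<in> ?R}" for v
    by (intro lev_in_subspace[OF s1]) simp
  then have "?\<delta> a (basis v) \<in> ?R" for v by (simp add: lev_basis_expand)
  then have "lev fscale basis b \<in> {b. ?\<delta> a b \<in> ?R}"
    by (intro lev_in_subspace[OF s2]) simp
  then show ?thesis by (simp add: lev_basis_expand)
qed

lemma tp_tens:
  assumes "pres M \<rho>M" "pres N \<rho>N"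
  shows "pure M N (\<rho>M a) (\<rho>N b) = tp M N \<rho>M \<rho>N (tens a b)"
  using fmod.span_neg[OF temb_tens[OF assms, of a b]] by (simp add: pure_def tp_def tclass_eq_iff)

lemma temb_keys:
  assumes "pres M \<rho>M" "pres N \<rho>N"
  shows "Poly_Mapping.keys (temb \<rho>M \<rho>N z) \<subseteq> carrier M \<times> carrier N"
proof -
  have "temb \<rho>M \<rho>N z \<in> {z. Poly_Mapping.keys z \<subseteq> carrier M \<times> carrier N}"
    unfolding temb_def by (rule lev_in_subspace[OF subspace_keys]) (auto simp: pres_in[OF assms(1)] pres_in[OF assms(2)])
  then show ?thesis by simp
qed

definition sect :: "('x \<Rightarrow> 'a) \<Rightarrow> 'a \<Rightarrow> 'x" where
  "sect \<rho> x = (SOME a. \<rho> a = x)"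

lemma sect: "x \<in> range \<rho> \<Longrightarrow> \<rho> (sect \<rho> x) = x"
  unfolding sect_def by (rule someI_ex) auto

lemma tclass_carrier:
  assumes M: "pres M \<rho>M" and N: "pres N \<rho>N" and t: "Poly_Mapping.keys t \<subseteq> carrier M \<times> carrier N"
  shows "tclass M N t = tp M N \<rho>M \<rho>N (lev fscale (\<lambda>(a, b). tens (sect \<rho>M a) (sect \<rho>N b)) t)"
proof -
  let ?g = "\<lambda>(a, b). tens (sect \<rho>M a) (sect \<rho>N b)"
  have "lev fscale (\<lambda>p. temb \<rho>M \<rho>N (?g p) - basis p) t \<in> fmod.span (tensor_rels M N)"
  proof (rule lev_in_subspace[OF fmod.subspace_span])
    fix p assume "p \<in> Poly_Mapping.keys t"
    then obtain a b where p: "p = (a, b)" "a \<in> carrier M" "b \<in> carrier N" using t by auto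
    then have "\<rho>M (sect \<rho>M a) = a" "\<rho>N (sect \<rho>N b) = b"
      using pres_carrier[OF M] pres_carrier[OF N] by (auto intro!: sect)
    then show "temb \<rho>M \<rho>N (?g p) - basis p \<in> fmod.span (tensor_rels M N)"
      using temb_tens[OF M N, of "sect \<rho>M a" "sect \<rho>N b"] by (simp add: p)
  qed
  then have "temb \<rho>M \<rho>N (lev fscale ?g t) - t \<in> fmod.span (tensor_rels M N)"
    by (simp only: lev_diff_fun lev_basis_expand hom_lev[OF temb_hom])
  from fmod.span_neg[OF this] show ?thesis
    unfolding tp_def tclass_eq_iff by (simp only: minus_diff_eq)
qed

lemma pres_tensor:
  assumes M: "pres M \<rho>M" and N: "pres N \<rho>N"
  shows "pres (tensor M N) (tp M N \<rho>M \<rho>N)"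
  unfolding pres_def
proof (intro conjI allI)
  show "carrier (tensor M N) = range (tp M N \<rho>M \<rho>N)"
  proof (intro equalityI subsetI)
    fix T assume "T \<in> carrier (tensor M N)"
    then obtain t where "T = tclass M N t" "Poly_Mapping.keys t \<subseteq> carrier M \<times> carrier N"
      by (auto simp: tensor_def)
    then show "T \<in> range (tp M N \<rho>M \<rho>N)" using tclass_carrier[OF M N] by (metis rangeI)
  next
    fix T assume "T \<in> range (tp M N \<rho>M \<rho>N)"
    then show "T \<in> carrier (tensor M N)" using temb_keys[OF M N] by (auto simp: tensor_def tp_def)
  qed
  show "\<zero>\<^bsub>tensor M N\<^esub> = tp M N \<rho>M \<rho>N 0"
    by (simp add: tensor_def tp_def hom_zero[OF temb_hom])
  show "tp M N \<rho>M \<rho>N a \<oplus>\<^bsub>tensor M N\<^esub> tp M N \<rho>M \<rho>N b = tp M N \<rho>M \<rho>N (a + b)" for a b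
    by (simp only: tp_def tclass_add hom_add[OF temb_hom])
  show "c \<odot>\<^bsub>tensor M N\<^esub> tp M N \<rho>M \<rho>N a = tp M N \<rho>M \<rho>N (fscale c a)" for c a
    by (simp only: tp_def tclass_smult hom_scale[OF temb_hom])
qed

lemma rep_keys:
  assumes M: "pres M \<rho>M" and N: "pres N \<rho>N"
  shows "Poly_Mapping.keys (rep (tp M N \<rho>M \<rho>N z)) \<subseteq> carrier M \<times> carrier N"
proof -
  let ?t = "rep (tp M N \<rho>M \<rho>N z)"
  have "Poly_Mapping.keys (?t - temb \<rho>M \<rho>N z) \<subseteq> carrier M \<times> carrier N"
    unfolding tp_def by (rule tensor_rels_keys[OF M N rep_tclass])
  then have "(?t - temb \<rho>M \<rho>N z) + temb \<rho>M \<rho>N z \<in> {z. Poly_Mapping.keys z \<subseteq> carrier M \<times> carrier N}"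
    using temb_keys[OF M N, of z] by (intro fmod.subspace_add[OF subspace_keys]) simp_all
  then show ?thesis by simp
qed

text \<open>The evaluation rule for \<open>tlift\<close>, which is defined through an arbitrarily
  chosen representative of the class. If \<open>f\<close> lifts to a bilinear map between the
  presenting free modules, the value can be computed there.\<close>

lemma tlift_pres:
  assumes M: "pres M \<rho>M" and N: "pres N \<rho>N" and P: "pres P \<rho>" and \<Phi>: "bil fscale \<Phi>"
    and f: "\<And>a b. f (\<rho>M a) (\<rho>N b) = \<rho> (\<Phi> a b)"
  shows "tlift P f (tp M N \<rho>M \<rho>N z) = \<rho> (pr fscale \<Phi> z)"
proof -
  let ?t = "rep (tp M N \<rho>M \<rho>N z)"
  let ?R = "tensor_rels M N"
  let ?g = "\<lambda>p. \<Phi> (sect \<rho>M (fst p)) (sect \<rho>N (snd p))"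
  interpret P: Module.module base_ring P by (rule pres_module[OF P])
  have s: "\<rho>M (sect \<rho>M a) = a" "\<rho>N (sect \<rho>N b) = b" if "a \<in> carrier M" "b \<in> carrier N" for a b
    using that pres_carrier[OF M] pres_carrier[OF N] by (auto intro!: sect)
  have g: "\<rho> (?g (a, b)) = f a b" if "a \<in> carrier M" "b \<in> carrier N" for a b
    using f[of "sect \<rho>M a" "sect \<rho>N b"] s[OF that] by simp
  have "tlift P f (tp M N \<rho>M \<rho>N z)
      = (\<Oplus>\<^bsub>P\<^esub>p\<in>Poly_Mapping.keys ?t. \<rho> (fscale (Poly_Mapping.lookup ?t p) (?g p)))"
    unfolding tlift_def
  proof (rule P.M.finsum_cong'[OF HOL.refl])
    show "(\<lambda>p. \<rho> (fscale (Poly_Mapping.lookup ?t p) (?g p))) \<in> Poly_Mapping.keys ?t \<rightarrow> carrier P"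
      by (simp add: pres_in[OF P])
    fix p assume "p \<in> Poly_Mapping.keys ?t"
    then have "fst p \<in> carrier M" "snd p \<in> carrier N" using rep_keys[OF M N, of z] by auto
    then have "f (fst p) (snd p) = \<rho> (?g p)" using g[of "fst p" "snd p"] by simp
    then show "Poly_Mapping.lookup ?t p \<odot>\<^bsub>P\<^esub> f (fst p) (snd p)
        = \<rho> (fscale (Poly_Mapping.lookup ?t p) (?g p))"
      by (simp add: pres_smult[OF P])
  qed
  also have "\<dots> = \<rho> (lev fscale ?g ?t)"
    unfolding lev_def by (rule pres_finsum[OF P]) simp
  \<comment> \<open>Independence of the representative: the lift sends each of the four kinds of
    bilinearity relations into the kernel of \<open>\<rho>\<close>.\<close>
  also have "\<dots> = \<rho> (lev fscale ?g (temb \<rho>M \<rho>N z))"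
  proof -
    let ?K = "{a. \<rho> a = \<rho> 0}"
    have K: "fmod.subspace {z. lev fscale ?g z \<in> ?K}"
      by (rule subspace_vimage[OF lev_hom[OF module_fscale] pres_kernel[OF P]])
    have base: "lev fscale ?g (basis (a, b)) = ?g (a, b)" for a b
      by (simp add: module_fscale)
    note l = hom_sub[OF lev_hom[OF module_fscale]] hom_scale[OF lev_hom[OF module_fscale]] base
    have c: "a \<oplus>\<^bsub>M\<^esub> a' \<in> carrier M" "c \<odot>\<^bsub>M\<^esub> a \<in> carrier M" if "a \<in> carrier M" "a' \<in> carrier M" for a a' c
      using that M by (auto simp: pres_def)
    have d: "a \<oplus>\<^bsub>N\<^esub> a' \<in> carrier N" "c \<odot>\<^bsub>N\<^esub> a \<in> carrier N" if "a \<in> carrier N" "a' \<in> carrier N" for a a' c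
      using that N by (auto simp: pres_def)
    have diff0: "\<rho> (x - y) = \<rho> 0" if "\<rho> x = \<rho> y" for x y using that pres_eq_iff[OF P] by simp
    have "?R \<subseteq> {z. lev fscale ?g z \<in> ?K}"
      unfolding tensor_rels_def
    proof (intro Un_least subsetI; clarify)
      fix a a' b assume h: "a \<in> carrier M" "a' \<in> carrier M" "b \<in> carrier N"
      have "\<rho> (?g (a \<oplus>\<^bsub>M\<^esub> a', b)) = f (a \<oplus>\<^bsub>M\<^esub> a') b" using h c g by blast
      also have "\<dots> = f (\<rho>M (sect \<rho>M a + sect \<rho>M a')) (\<rho>N (sect \<rho>N b))"
        using h by (simp add: s pres_add[OF M, symmetric])
      also have "\<dots> = \<rho> (?g (a, b) + ?g (a', b))"
        by (simp add: f hom_add[OF bil1[OF \<Phi>]])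
      finally show "\<rho> (lev fscale ?g (basis (a \<oplus>\<^bsub>M\<^esub> a', b) - basis (a, b) - basis (a', b))) = \<rho> 0"
        unfolding l by (simp only: diff_diff_eq) (rule diff0)
    next
      fix a b b' assume h: "a \<in> carrier M" "b \<in> carrier N" "b' \<in> carrier N"
      have "\<rho> (?g (a, b \<oplus>\<^bsub>N\<^esub> b')) = f a (b \<oplus>\<^bsub>N\<^esub> b')" using h d g by blast
      also have "\<dots> = f (\<rho>M (sect \<rho>M a)) (\<rho>N (sect \<rho>N b + sect \<rho>N b'))"
        using h by (simp add: s pres_add[OF N, symmetric])
      also have "\<dots> = \<rho> (?g (a, b) + ?g (a, b'))"
        by (simp add: f hom_add[OF bil2[OF \<Phi>]])
      finally show "\<rho> (lev fscale ?g (basis (a, b \<oplus>\<^bsub>N\<^esub> b') - basis (a, b) - basis (a, b'))) = \<rho> 0"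
        unfolding l by (simp only: diff_diff_eq) (rule diff0)
    next
      fix a b x assume h: "a \<in> carrier M" "b \<in> carrier N"
      have "\<rho> (?g (x \<odot>\<^bsub>M\<^esub> a, b)) = f (x \<odot>\<^bsub>M\<^esub> a) b" using h c g by blast
      also have "\<dots> = f (\<rho>M (fscale x (sect \<rho>M a))) (\<rho>N (sect \<rho>N b))"
        using h by (simp add: s pres_smult[OF M, symmetric])
      also have "\<dots> = \<rho> (fscale x (?g (a, b)))"
        by (simp add: f hom_scale[OF bil1[OF \<Phi>]])
      finally show "\<rho> (lev fscale ?g (basis (x \<odot>\<^bsub>M\<^esub> a, b) - fscale x (basis (a, b)))) = \<rho> 0"
        unfolding l by (rule diff0)
    next
      fix a b x assume h: "a \<in> carrier M" "b \<in> carrier N"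
      have "\<rho> (?g (a, x \<odot>\<^bsub>N\<^esub> b)) = f a (x \<odot>\<^bsub>N\<^esub> b)" using h d g by blast
      also have "\<dots> = f (\<rho>M (sect \<rho>M a)) (\<rho>N (fscale x (sect \<rho>N b)))"
        using h by (simp add: s pres_smult[OF N, symmetric])
      also have "\<dots> = \<rho> (fscale x (?g (a, b)))"
        by (simp add: f hom_scale[OF bil2[OF \<Phi>]])
      finally show "\<rho> (lev fscale ?g (basis (a, x \<odot>\<^bsub>N\<^esub> b) - fscale x (basis (a, b)))) = \<rho> 0"
        unfolding l by (rule diff0)
    qed
    from fmod.span_minimal[OF this K] rep_tclass[of M N "temb \<rho>M \<rho>N z"]
    have "lev fscale ?g (?t - temb \<rho>M \<rho>N z) \<in> ?K" unfolding tp_def by blast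
    then show ?thesis
      unfolding hom_sub[OF lev_hom[OF module_fscale]] using pres_eq_iff[OF P] by simp
  qed
  also have "lev fscale ?g (temb \<rho>M \<rho>N z)
      = lev fscale (\<lambda>p. ?g (\<rho>M (basis (fst p)), \<rho>N (basis (snd p)))) z"
    unfolding temb_def lev_lev[OF module_fscale] by (simp add: case_prod_unfold module_fscale)
  also have "\<rho> \<dots> = \<rho> (pr fscale \<Phi> z)"
    unfolding pr_def
    by (rule pres_lev_cong[OF P], subst g) (auto simp: pres_in[OF M] pres_in[OF N] f case_prod_unfold)
  finally show ?thesis .
qed

text \<open>The base ring as the free module on one generator, so that the evaluation rule also
  covers linear forms.\<close>

lemma pres_base_ring: "pres (base_ring :: ('k::comm_ring_1, 'k) module) (\<lambda>p. Poly_Mapping.lookup p ())"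
  by (auto simp: pres_def base_ring_def lookup_add intro!: image_eqI[of _ _ "Poly_Mapping.single () _"])

lemma tlift_base:
  fixes \<Phi> :: "('x \<Rightarrow>\<^sub>0 'k::comm_ring_1) \<Rightarrow> ('y \<Rightarrow>\<^sub>0 'k) \<Rightarrow> 'k"
  assumes M: "pres M \<rho>M" and N: "pres N \<rho>N" and \<Phi>: "bil (*) \<Phi>"
    and f: "\<And>a b. f (\<rho>M a) (\<rho>N b) = \<Phi> a b"
  shows "tlift base_ring f (tp M N \<rho>M \<rho>N z) = pr (*) \<Phi> z"
proof -
  have s: "module_hom (*) fscale (\<lambda>c :: 'k. Poly_Mapping.single () c)"
    by (auto simp: module_hom_iff module_times module_fscale single_add intro!: poly_mapping_eqI)
  have l: "linf (\<lambda>p :: unit \<Rightarrow>\<^sub>0 'k. Poly_Mapping.lookup p ())"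
    by (auto simp: module_hom_iff module_times module_fscale lookup_add)
  have "bil fscale (\<lambda>a b. Poly_Mapping.single () (\<Phi> a b))"
    by (intro bilI hom_compose[OF bil1[OF \<Phi>] s] hom_compose[OF bil2[OF \<Phi>] s])
  from tlift_pres[OF M N pres_base_ring this, of f z]
  have "tlift base_ring f (tp M N \<rho>M \<rho>N z)
      = Poly_Mapping.lookup (pr fscale (\<lambda>a b. Poly_Mapping.single () (\<Phi> a b)) z) ()"
    by (simp add: f)
  also have "\<dots> = pr (*) (\<lambda>a b. Poly_Mapping.lookup (Poly_Mapping.single () (\<Phi> a b)) ()) z"
    by (rule hom_pr[OF l])
  finally show ?thesis by simp
qed

lemma pr_expand:
  assumes "module_hom fscale sc X" "Modules.module sc"
  shows "pr sc (\<lambda>a b. X (tens a b)) z = X z"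
proof -
  have "pr sc (\<lambda>a b. X (tens a b)) z = lev sc (\<lambda>p. X (basis p)) z"
    by (simp add: pr_def case_prod_unfold)
  then show ?thesis by (simp only: hom_expand[OF assms(1), symmetric])
qed

lemma bil_hom_tens: "module_hom fscale sc X \<Longrightarrow> bil sc (\<lambda>a b. X (tens a b))"
  by (intro bilI) (erule hom_compose[rotated], intro tens_hom1 tens_hom2 lin_ident)+

lemma tlift_pres':
  assumes "pres M \<rho>M" "pres N \<rho>N" "pres P \<rho>" "lin X"
    "\<And>a b. f (\<rho>M a) (\<rho>N b) = \<rho> (X (tens a b))"
  shows "tlift P f (tp M N \<rho>M \<rho>N z) = \<rho> (X z)"
  using tlift_pres[OF assms(1-3) bil_hom_tens[OF assms(4)] assms(5)]
  by (simp add: pr_expand[OF assms(4) module_fscale])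

lemma tlift_base':
  assumes "pres M \<rho>M" "pres N \<rho>N" "linf X"
    "\<And>a b. f (\<rho>M a) (\<rho>N b) = X (tens a b)"
  shows "tlift base_ring f (tp M N \<rho>M \<rho>N z) = X z"
  using tlift_base[OF assms(1,2) bil_hom_tens[OF assms(3)] assms(4)]
  by (simp add: pr_expand[OF assms(3) module_times])

text \<open>A set-theoretic section s of \<open>\<pi>\<close> is linear modulo J, so
  \<open>s \<otimes> s\<close> maps the bilinearity relations into \<open>tens_span J\<close>. As s
  after \<open>\<pi>\<close> is the identity modulo J, whatever dies in the tensor square of the
  quotient already lies there.\<close>

lemma tp_kernel:
  fixes H :: "('k::comm_ring_1, 'a, 'm) module_scheme" and \<pi> :: "('x \<Rightarrow>\<^sub>0 'k) \<Rightarrow> 'a"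
  assumes H: "pres H \<pi>" and J: "\<And>a. \<pi> a = \<pi> 0 \<longleftrightarrow> a \<in> J"
    and z: "tp H H \<pi> \<pi> z = tp H H \<pi> \<pi> 0"
  shows "z \<in> tens_span J"
proof -
  let ?R = "tensor_rels H H"
  define s where "s = sect \<pi>"
  let ?g = "\<lambda>p. tens (s (fst p)) (s (snd p))"
  have \<pi>: "\<pi> a = \<pi> b \<longleftrightarrow> a - b \<in> J" for a b using J pres_eq_iff[OF H] by simp
  have s: "\<pi> (s a) = a" if "a \<in> carrier H" for a
    using that pres_carrier[OF H] unfolding s_def by (auto intro!: sect)
  have c: "a \<oplus>\<^bsub>H\<^esub> a' \<in> carrier H" "c \<odot>\<^bsub>H\<^esub> a \<in> carrier H" if "a \<in> carrier H" "a' \<in> carrier H" for a a' c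
    using that H by (auto simp: pres_def)
  have sadd: "s (a \<oplus>\<^bsub>H\<^esub> a') - (s a + s a') \<in> J" if "a \<in> carrier H" "a' \<in> carrier H" for a a'
    using that by (simp add: \<pi>[symmetric] s c pres_add[OF H, symmetric])
  have sscale: "s (x \<odot>\<^bsub>H\<^esub> a) - fscale x (s a) \<in> J" if "a \<in> carrier H" for a x
    using that c(2)[OF that that] by (simp add: \<pi>[symmetric] s pres_smult[OF H, symmetric])
  have base: "lev fscale ?g (basis (a, b)) = tens (s a) (s b)" for a b by (simp add: module_fscale)
  note l = hom_sub[OF lev_hom[OF module_fscale]] hom_scale[OF lev_hom[OF module_fscale]] base
  have "?R \<subseteq> {z. lev fscale ?g z \<in> tens_span J}"
    unfolding tensor_rels_def
  proof (intro Un_least subsetI; clarify)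
    fix a a' b assume h: "a \<in> carrier H" "a' \<in> carrier H" "b \<in> carrier H"
    show "lev fscale ?g (basis (a \<oplus>\<^bsub>H\<^esub> a', b) - basis (a, b) - basis (a', b)) \<in> tens_span J"
      unfolding l using tens_spanI1[OF sadd[OF h(1,2)], of "s b"] by (simp only: tens_sub1 tens_add1 diff_diff_eq)
  next
    fix a b b' assume h: "a \<in> carrier H" "b \<in> carrier H" "b' \<in> carrier H"
    show "lev fscale ?g (basis (a, b \<oplus>\<^bsub>H\<^esub> b') - basis (a, b) - basis (a, b')) \<in> tens_span J"
      unfolding l using tens_spanI2[OF sadd[OF h(2,3)], of "s a"] by (simp only: tens_sub2 tens_add2 diff_diff_eq)
  next
    fix a b x assume h: "a \<in> carrier H" "b \<in> carrier H"
    show "lev fscale ?g (basis (x \<odot>\<^bsub>H\<^esub> a, b) - fscale x (basis (a, b))) \<in> tens_span J"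
      unfolding l using tens_spanI1[OF sscale[OF h(1), of x], of "s b"] by (simp only: tens_sub1 tens_scale1)
  next
    fix a b x assume h: "a \<in> carrier H" "b \<in> carrier H"
    show "lev fscale ?g (basis (a, x \<odot>\<^bsub>H\<^esub> b) - fscale x (basis (a, b))) \<in> tens_span J"
      unfolding l using tens_spanI2[OF sscale[OF h(2), of x], of "s a"] by (simp only: tens_sub2 tens_scale2)
  qed
  moreover have "temb \<pi> \<pi> z \<in> fmod.span ?R"
    using z by (simp add: tp_def tclass_eq_iff hom_zero[OF temb_hom])
  ultimately have 1: "lev fscale ?g (temb \<pi> \<pi> z) \<in> tens_span J"
    using fmod.span_minimal[OF _ subspace_vimage[OF lev_hom[OF module_fscale] tens_span_subspace]] by blast
  have "lev fscale (\<lambda>p. ?g (\<pi> (basis (fst p)), \<pi> (basis (snd p))) - basis p) z \<in> tens_span J"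
  proof (rule lev_in_subspace[OF tens_span_subspace])
    fix p :: "'x \<times> 'x"
    have s': "s (\<pi> a) - a \<in> J" for a by (simp add: \<pi>[symmetric] s pres_in[OF H])
    let ?u = "basis (fst p) :: 'x \<Rightarrow>\<^sub>0 'k" and ?v = "basis (snd p) :: 'x \<Rightarrow>\<^sub>0 'k"
    have "tens (s (\<pi> ?u)) (s (\<pi> ?v)) - basis p = tens (s (\<pi> ?u) - ?u) (s (\<pi> ?v)) + tens ?u (s (\<pi> ?v) - ?v)"
      by (simp add: tens_sub1 tens_sub2)
    also have "\<dots> \<in> tens_span J"
      by (intro fmod.subspace_add[OF tens_span_subspace] tens_spanI1 tens_spanI2 s')
    finally show "?g (\<pi> (basis (fst p)), \<pi> (basis (snd p))) - basis p \<in> tens_span J" by simp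
  qed
  then have "lev fscale ?g (temb \<pi> \<pi> z) - z \<in> tens_span J"
    unfolding lev_diff_fun lev_basis_expand temb_def lev_lev[OF module_fscale]
    by (simp add: case_prod_unfold module_fscale)
  from fmod.subspace_diff[OF tens_span_subspace 1 this] show ?thesis by simp
qed

lemma tp_vanish:
  assumes H: "pres H \<pi>" and J: "\<And>a. a \<in> J \<Longrightarrow> \<pi> a = \<pi> 0" and z: "z \<in> tens_span J"
  shows "tp H H \<pi> \<pi> z = tp H H \<pi> \<pi> 0"
proof -
  have "tp H H \<pi> \<pi> (tens a b) = tp H H \<pi> \<pi> 0" if "a \<in> J \<or> b \<in> J" for a b
  proof -
    have "pure H H (\<pi> a) (\<pi> b) = tp H H \<pi> \<pi> 0"
    proof (cases "a \<in> J")
      case True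
      then show ?thesis using tp_tens[OF H H, of 0 b] by (simp only: J[OF True] tens_zero1)
    next
      case False
      then have "b \<in> J" using that by simp
      then show ?thesis using tp_tens[OF H H, of a 0] by (simp only: J[OF \<open>b \<in> J\<close>] tens_zero2)
    qed
    then show ?thesis by (simp only: tp_tens[OF H H])
  qed
  then have "tens_span J \<subseteq> {z. tp H H \<pi> \<pi> z = tp H H \<pi> \<pi> 0}"
    unfolding tens_span_def by (intro fmod.span_minimal pres_kernel[OF pres_tensor[OF H H]]) auto
  then show ?thesis using z by auto
qed

subsection \<open>Algebras\<close>

context free_alg
begin

definition alg_pres :: "('k, 'a, 'm) module_scheme \<Rightarrow> (('s \<Rightarrow>\<^sub>0 'k) \<Rightarrow> 'a) \<Rightarrow> bool" where
  "alg_pres H \<pi> \<longleftrightarrow> pres H \<pi> \<and> (\<forall>a b. \<pi> a \<otimes>\<^bsub>H\<^esub> \<pi> b = \<pi> (M (tens a b))) \<and> \<one>\<^bsub>H\<^esub> = \<pi> un"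

lemma M_bil: "bil fscale (\<lambda>a b. M (tens a b))"
  by (rule bil_hom_tens[OF M_hom])

lemmas M_add1 = hom_add[OF bil1[OF M_bil]] and M_add2 = hom_add[OF bil2[OF M_bil]]

lemma alg_pres_k_algebra:
  assumes "alg_pres H \<pi>" shows "k_algebra H"
proof -
  have P: "pres H \<pi>" and m: "\<And>a b. \<pi> a \<otimes>\<^bsub>H\<^esub> \<pi> b = \<pi> (M (tens a b))" and o: "\<one>\<^bsub>H\<^esub> = \<pi> un"
    using assms by (simp_all add: alg_pres_def)
  interpret H: Module.module base_ring H by (rule pres_module[OF P])
  note c = pres_carrier[OF P] and a = pres_add[OF P] and s = pres_smult[OF P]
  have "ring H"
  proof (rule ringI)
    show "abelian_group H" by (rule H.M.abelian_group_axioms)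
    show "Group.monoid H"
      by (rule monoidI) (auto simp: c m o M_assoc M_unit_l M_unit_r)
  qed (auto simp: c m a M_add1 M_add2 tens_add1 tens_add2 hom_add[OF M_hom])
  then show ?thesis
    unfolding k_algebra_def
    by (auto simp: H.module_axioms c m s tens_scale1 tens_scale2 hom_scale[OF M_hom])
qed

end

section \<open>Products in tensor squares\<close>

lemma tensor_finsum:
  assumes H: "pres H \<pi>" and "finite A"
    "\<And>x. x \<in> A \<Longrightarrow> Poly_Mapping.keys (h x) \<subseteq> carrier H \<times> carrier H"
  shows "(\<Oplus>\<^bsub>tensor H H\<^esub>x\<in>A. tclass H H (h x)) = tclass H H (\<Sum>x\<in>A. h x)"
proof -
  note P = pres_tensor[OF H H]
  interpret T: Module.module base_ring "tensor H H" by (rule pres_module[OF P])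
  let ?s = "lev fscale (\<lambda>(a, b). tens (sect \<pi> a) (sect \<pi> b))"
  have l: "lin ?s" by (rule lev_hom[OF module_fscale])
  have "(\<Oplus>\<^bsub>tensor H H\<^esub>x\<in>A. tclass H H (h x)) = (\<Oplus>\<^bsub>tensor H H\<^esub>x\<in>A. tp H H \<pi> \<pi> (?s (h x)))"
  proof (rule T.M.finsum_cong'[OF HOL.refl])
    show "(\<lambda>x. tp H H \<pi> \<pi> (?s (h x))) \<in> A \<rightarrow> carrier (tensor H H)"
      by (auto intro: pres_in[OF P])
    show "tclass H H (h x) = tp H H \<pi> \<pi> (?s (h x))" if "x \<in> A" for x
      by (rule tclass_carrier[OF H H assms(3)[OF that]])
  qed
  also have "\<dots> = tp H H \<pi> \<pi> (\<Sum>x\<in>A. ?s (h x))" by (rule pres_finsum[OF P assms(2)])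
  also have "(\<Sum>x\<in>A. ?s (h x)) = ?s (\<Sum>x\<in>A. h x)" by (rule module_hom.sum[OF l, symmetric])
  also have "tp H H \<pi> \<pi> (?s (\<Sum>x\<in>A. h x)) = tclass H H (\<Sum>x\<in>A. h x)"
  proof (rule tclass_carrier[OF H H, symmetric])
    have "(\<Sum>x\<in>A. h x) \<in> {z. Poly_Mapping.keys z \<subseteq> carrier H \<times> carrier H}"
      by (rule fmod.subspace_sum[OF subspace_keys]) (use assms(3) in auto)
    then show "Poly_Mapping.keys (\<Sum>x\<in>A. h x) \<subseteq> carrier H \<times> carrier H" by simp
  qed
  finally show ?thesis .
qed

lemma keys_fscale: "Poly_Mapping.keys (fscale c p) \<subseteq> Poly_Mapping.keys p"
  by (auto simp: in_keys_iff)

text \<open>The product of \<open>tensor\<close> is given by \<open>flin\<close> on representatives;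
  this identifies such expressions with \<open>tlift\<close>, to which the evaluation rule
  applies.\<close>

lemma tlift_tclass:
  assumes H: "pres H \<pi>"
    and f: "\<And>a b. a \<in> carrier H \<Longrightarrow> b \<in> carrier H \<Longrightarrow> f a b = tclass H H (h (a, b))"
    and h: "\<And>a b. a \<in> carrier H \<Longrightarrow> b \<in> carrier H \<Longrightarrow> Poly_Mapping.keys (h (a, b)) \<subseteq> carrier H \<times> carrier H"
    and T: "T = tp H H \<pi> \<pi> z"
  shows "tlift (tensor H H) f T = tclass H H (lev fscale h (rep T))"
proof -
  note P = pres_tensor[OF H H]
  interpret T: Module.module base_ring "tensor H H" by (rule pres_module[OF P])
  let ?t = "rep T"
  have k: "Poly_Mapping.keys ?t \<subseteq> carrier H \<times> carrier H" unfolding T by (rule rep_keys[OF H H])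
  have kk: "Poly_Mapping.keys (fscale c (h p)) \<subseteq> carrier H \<times> carrier H" if "p \<in> Poly_Mapping.keys ?t" for p c
    using h[of "fst p" "snd p"] k that keys_fscale[of c "h p"] by fastforce
  have "tlift (tensor H H) f T
      = (\<Oplus>\<^bsub>tensor H H\<^esub>p\<in>Poly_Mapping.keys ?t. tclass H H (fscale (Poly_Mapping.lookup ?t p) (h p)))"
    unfolding tlift_def
  proof (rule T.M.finsum_cong'[OF HOL.refl])
    show "(\<lambda>p. tclass H H (fscale (Poly_Mapping.lookup ?t p) (h p))) \<in> Poly_Mapping.keys ?t \<rightarrow> carrier (tensor H H)"
      using kk by (auto simp: tensor_def)
    fix p assume "p \<in> Poly_Mapping.keys ?t"
    then have "f (fst p) (snd p) = tclass H H (h p)" using k f[of "fst p" "snd p"] by auto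
    then show "Poly_Mapping.lookup ?t p \<odot>\<^bsub>tensor H H\<^esub> f (fst p) (snd p)
        = tclass H H (fscale (Poly_Mapping.lookup ?t p) (h p))"
      by (simp only: tclass_smult)
  qed
  also have "\<dots> = tclass H H (lev fscale h ?t)"
    unfolding lev_def by (rule tensor_finsum[OF H]) (use kk in auto)
  finally show ?thesis .
qed

context free_alg
begin

lemma tensor_mult:
  assumes "alg_pres H \<pi>"
  shows "tp H H \<pi> \<pi> z \<otimes>\<^bsub>tensor H H\<^esub> tp H H \<pi> \<pi> z' = tp H H \<pi> \<pi> (tm M M (swap23 (tens z z')))"
proof -
  have H: "pres H \<pi>" and m: "\<And>a b. \<pi> a \<otimes>\<^bsub>H\<^esub> \<pi> b = \<pi> (M (tens a b))"
    using assms by (simp_all add: alg_pres_def)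
  note P = pres_tensor[OF H H]
  define S where "S = tp H H \<pi> \<pi> z"
  define T where "T = tp H H \<pi> \<pi> z'"
  have c: "a \<otimes>\<^bsub>H\<^esub> b \<in> carrier H" if "a \<in> carrier H" "b \<in> carrier H" for a b
    using that pres_carrier[OF H] m by auto
  let ?h = "\<lambda>(a, b). lev fscale (\<lambda>(c, d). basis (a \<otimes>\<^bsub>H\<^esub> c, b \<otimes>\<^bsub>H\<^esub> d)) (rep T)"
  let ?f = "\<lambda>a b. tlift (tensor H H) (\<lambda>c d. pure H H (a \<otimes>\<^bsub>H\<^esub> c) (b \<otimes>\<^bsub>H\<^esub> d)) T"
  have in1: "?f a b = tclass H H (?h (a, b))" if "a \<in> carrier H" "b \<in> carrier H" for a b
    unfolding prod.case by (rule tlift_tclass[OF H _ _ T_def]) (use that c in \<open>auto simp: pure_def\<close>)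
  have kT: "Poly_Mapping.keys (rep T) \<subseteq> carrier H \<times> carrier H" unfolding T_def by (rule rep_keys[OF H H])
  have in2: "Poly_Mapping.keys (?h (a, b)) \<subseteq> carrier H \<times> carrier H" if "a \<in> carrier H" "b \<in> carrier H" for a b
  proof -
    have "?h (a, b) \<in> {z. Poly_Mapping.keys z \<subseteq> carrier H \<times> carrier H}"
      unfolding prod.case by (rule lev_in_subspace[OF subspace_keys]) (use that c kT in auto)
    then show ?thesis by simp
  qed
  have "S \<otimes>\<^bsub>tensor H H\<^esub> T = tclass H H (lev fscale ?h (rep S))"
    by (simp add: tensor_def flin_lev)
  also have "\<dots> = tlift (tensor H H) ?f S"
    by (rule tlift_tclass[of H \<pi> ?f ?h S z, OF H _ _ S_def, symmetric]) (fact in1 in2)+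
  also have "\<dots> = tp H H \<pi> \<pi> (tm M M (swap23 (tens z z')))"
    unfolding S_def
  proof (rule tlift_pres'[OF H H P])
    show "lin (\<lambda>z. tm M M (swap23 (tens z z')))"
      by (rule hom_compose[OF hom_compose[OF tens_hom1[OF lin_ident] swap23_hom] tm_hom])
    fix a b
    show "?f (\<pi> a) (\<pi> b) = tp H H \<pi> \<pi> (tm M M (swap23 (tens (tens a b) z')))"
      unfolding T_def
    proof (rule tlift_pres'[OF H H P])
      show "lin (\<lambda>z'. tm M M (swap23 (tens (tens a b) z')))"
        by (rule hom_compose[OF hom_compose[OF tens_hom2[OF lin_ident] swap23_hom] tm_hom])
      fix c d
      show "pure H H (\<pi> a \<otimes>\<^bsub>H\<^esub> \<pi> c) (\<pi> b \<otimes>\<^bsub>H\<^esub> \<pi> d) = tp H H \<pi> \<pi> (tm M M (swap23 (tens (tens a b) (tens c d))))"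
        by (simp only: m tp_tens[OF H H] swap23_tens tm_tens[OF M_hom M_hom])
    qed
  qed
  finally show ?thesis unfolding S_def T_def .
qed

end

section \<open>Ideals and quotient algebras\<close>

locale free_alg_rec = free_alg M un
  for M :: "('s \<times> 's \<Rightarrow>\<^sub>0 'k::comm_ring_1) \<Rightarrow> ('s \<Rightarrow>\<^sub>0 'k)" and un +
  fixes A :: "('k, 's \<Rightarrow>\<^sub>0 'k, 'm) module_scheme"
  assumes rec_A: "carrier A = UNIV" "a \<otimes>\<^bsub>A\<^esub> b = M (tens a b)" "\<one>\<^bsub>A\<^esub> = un" "\<zero>\<^bsub>A\<^esub> = 0"
    "a \<oplus>\<^bsub>A\<^esub> b = a + b" "c \<odot>\<^bsub>A\<^esub> a = fscale c a"
begin

lemma alg_pres_A: "alg_pres A (\<lambda>x. x)"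
  by (auto simp: alg_pres_def pres_def rec_A)

lemma pres_A: "pres A (\<lambda>x. x)"
  using alg_pres_A by (simp add: alg_pres_def)

lemma ring_A: "ring A"
  using alg_pres_k_algebra[OF alg_pres_A] by (simp add: k_algebra_def)

lemma ideal_iff:
  "ideal J A \<longleftrightarrow> fmod.subspace J \<and> (\<forall>a. \<forall>x\<in>J. M (tens a x) \<in> J \<and> M (tens x a) \<in> J)"
proof
  assume "ideal J A"
  then interpret ideal J A .
  have m: "M (tens a x) \<in> J" "M (tens x a) \<in> J" if "x \<in> J" for a x
    using I_l_closed[OF that, of a] I_r_closed[OF that, of a] by (simp_all add: rec_A)
  \<comment> \<open>Scalars act through multiples of the unit, so a ring ideal is a
    submodule.\<close>
  have "fscale c x \<in> J" if "x \<in> J" for c x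
    using m(1)[OF that, of "fscale c un"] by (simp add: tens_scale1 hom_scale[OF M_hom] M_unit_l)
  then have "fmod.subspace J"
    using additive_subgroup.zero_closed[OF additive_subgroup_axioms]
      additive_subgroup.a_closed[OF additive_subgroup_axioms]
    by (auto simp: fmod.subspace_def rec_A)
  then show "fmod.subspace J \<and> (\<forall>a. \<forall>x\<in>J. M (tens a x) \<in> J \<and> M (tens x a) \<in> J)" using m by blast
next
  assume J: "fmod.subspace J \<and> (\<forall>a. \<forall>x\<in>J. M (tens a x) \<in> J \<and> M (tens x a) \<in> J)"
  have inv: "inv\<^bsub>add_monoid A\<^esub> x = - x" for x
  proof -
    interpret A: ring A by (rule ring_A)
    have "\<ominus>\<^bsub>A\<^esub> x = - x"
      by (rule A.minus_equality) (simp_all add: rec_A)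
    then show ?thesis by (simp add: a_inv_def)
  qed
  show "ideal J A"
  proof (rule idealI[OF ring_A])
    interpret A: ring A by (rule ring_A)
    show "subgroup J (add_monoid A)"
    proof (rule group.subgroupI[OF A.a_group])
      show "inv\<^bsub>add_monoid A\<^esub> a \<in> J" if "a \<in> J" for a
        unfolding inv using J that by (simp add: fmod.subspace_neg)
    qed (use J in \<open>auto simp: rec_A fmod.subspace_def\<close>)
  qed (use J in \<open>auto simp: rec_A\<close>)
qed

lemma ideal_gen: "ideal (Idl\<^bsub>A\<^esub> S) A" and gen_subset: "S \<subseteq> Idl\<^bsub>A\<^esub> S"
  by (rule ring.genideal_ideal[OF ring_A], simp add: rec_A,
      rule ring.genideal_self[OF ring_A], simp add: rec_A)

lemma gen_minimal: "ideal I A \<Longrightarrow> S \<subseteq> I \<Longrightarrow> Idl\<^bsub>A\<^esub> S \<subseteq> I"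
  by (rule ring.genideal_minimal[OF ring_A])

lemma gen_span: "Idl\<^bsub>A\<^esub> S = fmod.span {M (tens a (M (tens r b))) | a r b. r \<in> S}" (is "_ = fmod.span ?G")
proof
  have M1: "lin (\<lambda>x. M (tens c x))" and M2: "lin (\<lambda>x. M (tens x c))" for c
    by (intro hom_compose[OF tens_hom2[OF lin_ident] M_hom] hom_compose[OF tens_hom1[OF lin_ident] M_hom])+
  have "ideal (fmod.span ?G) A"
    unfolding ideal_iff
  proof (intro conjI allI ballI)
    fix c x assume x: "x \<in> fmod.span ?G"
    have "?G \<subseteq> {x. M (tens c x) \<in> fmod.span ?G}"
      by (force simp: M_assoc[symmetric] intro: fmod.span_base)
    then show "M (tens c x) \<in> fmod.span ?G"
      using fmod.span_minimal[OF _ subspace_vimage[OF M1 fmod.subspace_span]] x by blast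
    have "?G \<subseteq> {x. M (tens x c) \<in> fmod.span ?G}"
      by (force simp: M_assoc intro: fmod.span_base)
    then show "M (tens x c) \<in> fmod.span ?G"
      using fmod.span_minimal[OF _ subspace_vimage[OF M2 fmod.subspace_span]] x by blast
  qed (rule fmod.subspace_span)
  moreover have "S \<subseteq> fmod.span ?G"
  proof
    fix r assume "r \<in> S"
    then have "M (tens un (M (tens r un))) \<in> fmod.span ?G" by (intro fmod.span_base) blast
    then show "r \<in> fmod.span ?G" by (simp add: M_unit_l M_unit_r)
  qed
  ultimately show "Idl\<^bsub>A\<^esub> S \<subseteq> fmod.span ?G" by (rule gen_minimal)
  show "fmod.span ?G \<subseteq> Idl\<^bsub>A\<^esub> S"
    by (rule fmod.span_minimal) (use ideal_gen[of S] gen_subset[of S] in \<open>auto simp: ideal_iff\<close>)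
qed

end

locale free_alg_quot = free_alg_rec M un A
  for M :: "('s \<times> 's \<Rightarrow>\<^sub>0 'k::comm_ring_1) \<Rightarrow> ('s \<Rightarrow>\<^sub>0 'k)" and un
    and A :: "('k, 's \<Rightarrow>\<^sub>0 'k, 'm) module_scheme" +
  fixes J assumes J_ideal: "ideal J A"
begin

definition pj :: "('s \<Rightarrow>\<^sub>0 'k) \<Rightarrow> ('s \<Rightarrow>\<^sub>0 'k) set" where
  "pj a = J +>\<^bsub>A\<^esub> a"

lemma J_subspace: "fmod.subspace J"
  using J_ideal by (simp add: ideal_iff)

lemma M_J: "x \<in> J \<Longrightarrow> M (tens a x) \<in> J" "x \<in> J \<Longrightarrow> M (tens x a) \<in> J"
  using J_ideal by (simp_all add: ideal_iff)

lemma pj_def': "pj a = (\<lambda>j. j + a) ` J"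
  by (auto simp: pj_def a_r_coset_def' rec_A)

lemma pj_eq: "pj a = pj b \<longleftrightarrow> a - b \<in> J"
proof
  assume "pj a = pj b"
  moreover have "a \<in> pj a" using fmod.subspace_0[OF J_subspace] by (force simp: pj_def')
  ultimately show "a - b \<in> J" by (auto simp: pj_def')
next
  have *: "pj a \<subseteq> pj b" if "a - b \<in> J" for a b
  proof
    fix x assume "x \<in> pj a"
    then obtain j where j: "j \<in> J" "x = j + a" by (auto simp: pj_def')
    then have "x = (j + (a - b)) + b" by simp
    then show "x \<in> pj b" unfolding pj_def' using fmod.subspace_add[OF J_subspace j(1) that] by blast
  qed
  assume "a - b \<in> J"
  moreover from fmod.subspace_neg[OF J_subspace this] have "b - a \<in> J" by simp
  ultimately show "pj a = pj b" using * by blast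
qed

lemma pj_eq_0: "pj a = pj 0 \<longleftrightarrow> a \<in> J"
  by (simp add: pj_eq)

lemma rep_pj: "rep (pj a) - a \<in> J"
proof -
  have "a \<in> pj a" using fmod.subspace_0[OF J_subspace] by (force simp: pj_def')
  then have "rep (pj a) \<in> pj a" unfolding rep_def by (rule someI)
  then show ?thesis by (auto simp: pj_def')
qed

lemma pj_rep [simp]: "pj (rep (pj a)) = pj a"
  by (simp add: pj_eq rep_pj)

lemma quot_module_simps:
  "carrier (quot_module A J) = range pj"
  "\<zero>\<^bsub>quot_module A J\<^esub> = pj 0"
  "\<one>\<^bsub>quot_module A J\<^esub> = pj un"
  "pj a \<oplus>\<^bsub>quot_module A J\<^esub> pj b = pj (a + b)"
  "pj a \<otimes>\<^bsub>quot_module A J\<^esub> pj b = pj (M (tens a b))"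
  "c \<odot>\<^bsub>quot_module A J\<^esub> X = pj (fscale c (rep X))"
proof -
  interpret ideal J A by (rule J_ideal)
  show "carrier (quot_module A J) = range pj"
    by (auto simp: quot_module_def ring.defs module.defs FactRing_def A_RCOSETS_def' pj_def rec_A)
  show "\<zero>\<^bsub>quot_module A J\<^esub> = pj 0"
    by (simp add: quot_module_def ring.defs module.defs FactRing_def pj_def')
  show "\<one>\<^bsub>quot_module A J\<^esub> = pj un"
    by (simp add: quot_module_def ring.defs module.defs FactRing_def pj_def rec_A)
  show "pj a \<oplus>\<^bsub>quot_module A J\<^esub> pj b = pj (a + b)"
    using a_rcos_sum[of a b] by (simp add: quot_module_def ring.defs module.defs FactRing_def pj_def rec_A)
  show "pj a \<otimes>\<^bsub>quot_module A J\<^esub> pj b = pj (M (tens a b))"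
    using rcoset_mult_add[of a b] by (simp add: quot_module_def ring.defs module.defs FactRing_def pj_def rec_A)
  show "c \<odot>\<^bsub>quot_module A J\<^esub> X = pj (fscale c (rep X))"
    by (simp add: quot_module_def ring.defs module.defs FactRing_def pj_def rec_A)
qed

lemma alg_pres_quot: "alg_pres (quot_module A J) pj"
proof -
  have "pj (fscale c (rep (pj a))) = pj (fscale c a)" for c a
    using fmod.subspace_scale[OF J_subspace rep_pj, of c a] by (simp add: pj_eq fmod.scale_right_diff_distrib)
  then show ?thesis by (simp add: alg_pres_def pres_def quot_module_simps)
qed

lemma pres_quot: "pres (quot_module A J) pj"
  using alg_pres_quot by (simp add: alg_pres_def)

abbreviation "T2 \<equiv> tp (quot_module A J) (quot_module A J) pj pj"

lemma T2_eq_iff: "T2 z = T2 z' \<longleftrightarrow> z - z' \<in> tens_span J"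
  unfolding pres_eq_iff[OF pres_tensor[OF pres_quot pres_quot], of z z']
proof
  show "T2 (z - z') = T2 0 \<Longrightarrow> z - z' \<in> tens_span J"
    by (rule tp_kernel[OF pres_quot pj_eq_0])
  show "z - z' \<in> tens_span J \<Longrightarrow> T2 (z - z') = T2 0"
    by (rule tp_vanish[OF pres_quot iffD2[OF pj_eq_0]])
qed

lemma tensor_proj_eq:
  "tensor_proj A J (tp A A (\<lambda>x. x) (\<lambda>x. x) z) = T2 z"
  unfolding tensor_proj_def pj_def[symmetric]
  by (rule tlift_pres'[OF pres_A pres_A pres_tensor[OF pres_quot pres_quot] lin_ident])
    (rule tp_tens[OF pres_quot pres_quot])

end

section \<open>Quotients by Hopf ideals\<close>

locale hopf_quot = free_bialg dl cu M un + free_alg_quot M un A J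
  for dl :: "('s \<Rightarrow>\<^sub>0 'k::comm_ring_1) \<Rightarrow> ('s \<times> 's \<Rightarrow>\<^sub>0 'k)" and cu M un
    and A :: "('k, 's \<Rightarrow>\<^sub>0 'k) bialg" and J +
  fixes ap :: "('s \<Rightarrow>\<^sub>0 'k) \<Rightarrow> ('s \<Rightarrow>\<^sub>0 'k)"
  assumes comult_A: "comult A p = tp A A (\<lambda>x. x) (\<lambda>x. x) (dl p)" and counit_A: "counit A p = cu p"
    and ap_hom: "lin ap"
    and antipode_l: "M (tm ap (\<lambda>x. x) (dl a)) = fscale (cu a) un"
    and antipode_r: "M (tm (\<lambda>x. x) ap (dl a)) = fscale (cu a) un"
    and J_coideal: "a \<in> J \<Longrightarrow> dl a \<in> tens_span J" and J_cu: "a \<in> J \<Longrightarrow> cu a = 0"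
    and J_ap: "a \<in> J \<Longrightarrow> ap a \<in> J"
begin

abbreviation "H \<equiv> quot_bialg A J"

lemma H_fields:
  "carrier H = carrier (quot_module A J)" "add H = add (quot_module A J)"
  "smult H = smult (quot_module A J)" "zero H = zero (quot_module A J)"
  "monoid.mult H = monoid.mult (quot_module A J)" "one H = one (quot_module A J)"
  "comult H = (\<lambda>X. tensor_proj A J (comult A (rep X)))" "counit H = (\<lambda>X. counit A (rep X))"
  by (simp_all add: quot_bialg_def module.defs bialg.defs)

lemma alg_pres_H: "alg_pres H pj"
  using alg_pres_quot by (simp add: alg_pres_def pres_def H_fields)

lemma pres_H: "pres H pj"
  using alg_pres_H by (simp add: alg_pres_def)

lemma mult_H: "pj a \<otimes>\<^bsub>H\<^esub> pj b = pj (M (tens a b))" and one_H: "\<one>\<^bsub>H\<^esub> = pj un"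
  using alg_pres_H by (simp_all add: alg_pres_def)

text \<open>\<open>tp\<close> looks only at the carrier, the addition and the scalar multiplication
  of a record, and these agree.\<close>

lemma T2_H: "tp H H pj pj = T2"
  by (simp add: fun_eq_iff tp_def tclass_def tensor_rels_def H_fields)

lemma comult_H: "comult H (pj a) = tp H H pj pj (dl a)"
proof -
  have "rep (pj a) - a \<in> J" by (rule rep_pj)
  then have "dl (rep (pj a)) - dl a \<in> tens_span J" using J_coideal by (simp add: hom_sub[OF dl_hom, symmetric])
  then have "T2 (dl (rep (pj a))) = T2 (dl a)" by (simp add: T2_eq_iff)
  then show ?thesis by (simp add: H_fields comult_A tensor_proj_eq T2_H)
qed

lemma counit_H: "counit H (pj a) = cu a"
  using J_cu[OF rep_pj, of a] by (simp add: H_fields counit_A hom_sub[OF cu_hom])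

lemma sweedler_pres:
  assumes "pres P \<rho>" "lin X" "\<And>a b. f (pj a) (pj b) = \<rho> (X (tens a b))"
  shows "sweedler H P f (pj a) = \<rho> (X (dl a))"
  unfolding sweedler_def comult_H by (rule tlift_pres'[OF pres_H pres_H assms])

lemma sweedler_base:
  assumes "linf X" "\<And>a b. f (pj a) (pj b) = X (tens a b)"
  shows "sweedler H base_ring f (pj a) = X (dl a)"
  unfolding sweedler_def comult_H by (rule tlift_base'[OF pres_H pres_H assms])

lemma carrier_H: "x \<in> carrier H \<longleftrightarrow> (\<exists>a. x = pj a)"
  using pres_carrier[OF pres_H] by auto

lemma k_linearI:
  assumes "pres P \<rho>" "lin X" "\<And>a. f (pj a) = \<rho> (X a)"
  shows "k_linear H P f"
  unfolding k_linear_def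
  by (auto simp: carrier_H assms pres_in[OF assms(1)] pres_add[OF pres_H] pres_add[OF assms(1)]
      pres_smult[OF pres_H] pres_smult[OF assms(1)] hom_add[OF assms(2)] hom_scale[OF assms(2)])

lemma k_linear_baseI:
  assumes "linf X" "\<And>a. f (pj a) = X a"
  shows "k_linear H base_ring f"
  unfolding k_linear_def
  by (auto simp: carrier_H assms pres_add[OF pres_H] pres_smult[OF pres_H] hom_add[OF assms(1)]
      hom_scale[OF assms(1)] base_ring_def)

lemma coalgebra_H: "coalgebra H"
proof -
  let ?HH = "tensor H H"
  let ?HHH = "tensor H ?HH"
  let ?T3 = "tp H ?HH pj (tp H H pj pj)"
  note P2 = pres_tensor[OF pres_H pres_H]
  note P3 = pres_tensor[OF pres_H P2]
  have c1: "sweedler H ?HHH (\<lambda>x a3. sweedler H ?HHH (\<lambda>a1 a2. pure H ?HH a1 (pure H H a2 a3)) x) (pj a)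
      = ?T3 (reassoc (tm dl (\<lambda>x. x) (dl a)))" for a
  proof (rule sweedler_pres[OF P3])
    show "lin (\<lambda>z. reassoc (tm dl (\<lambda>x. x) z))" by (rule hom_compose[OF tm_hom reassoc_hom])
    fix x a3
    have "sweedler H ?HHH (\<lambda>a1 a2. pure H ?HH a1 (pure H H a2 (pj a3))) (pj x) = ?T3 (reassoc (tens (dl x) a3))"
    proof (rule sweedler_pres[OF P3])
      show "lin (\<lambda>z. reassoc (tens z a3))" by (rule hom_compose[OF tens_hom1[OF lin_ident] reassoc_hom])
      show "pure H ?HH (pj a1) (pure H H (pj a2) (pj a3)) = ?T3 (reassoc (tens (tens a1 a2) a3))" for a1 a2
        by (simp only: tp_tens[OF pres_H pres_H] tp_tens[OF pres_H P2] reassoc_tens)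
    qed
    then show "sweedler H ?HHH (\<lambda>a1 a2. pure H ?HH a1 (pure H H a2 (pj a3))) (pj x)
        = ?T3 (reassoc (tm dl (\<lambda>x. x) (tens x a3)))"
      by (simp only: tm_tens[OF dl_hom lin_ident])
  qed
  have c2: "sweedler H ?HHH (\<lambda>a1 y. pure H ?HH a1 (comult H y)) (pj a) = ?T3 (tm (\<lambda>x. x) dl (dl a))" for a
    by (rule sweedler_pres[OF P3 tm_hom])
      (simp only: comult_H tp_tens[OF pres_H P2] tm_tens[OF lin_ident dl_hom])
  have u1: "sweedler H H (\<lambda>a1 a2. counit H a1 \<odot>\<^bsub>H\<^esub> a2) (pj a) = pj (cl cu (\<lambda>x. x) (dl a))" for a
    by (rule sweedler_pres[OF pres_H pr_hom[OF module_fscale]])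
      (simp only: counit_H pres_smult[OF pres_H] cl_id_tens[OF cu_hom])
  have u2: "sweedler H H (\<lambda>a1 a2. counit H a2 \<odot>\<^bsub>H\<^esub> a1) (pj a) = pj (cr (\<lambda>x. x) cu (dl a))" for a
    by (rule sweedler_pres[OF pres_H pr_hom[OF module_fscale]])
      (simp only: counit_H pres_smult[OF pres_H] cr_id_tens[OF cu_hom])
  show ?thesis
    unfolding coalgebra_def Let_def
    using pres_module[OF pres_H] k_linearI[OF P2 dl_hom comult_H] k_linear_baseI[OF cu_hom counit_H]
    by (auto simp: carrier_H c1 c2 u1 u2 coassoc counit_l counit_r)
qed

lemma bialgebra_H: "bialgebra H"
proof -
  note P2 = pres_tensor[OF pres_H pres_H]
  have "comult H \<in> ring_hom H (tensor H H)"
  proof (rule ring_hom_memI)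
    fix x y assume "x \<in> carrier H" "y \<in> carrier H"
    then obtain a b where [simp]: "x = pj a" "y = pj b" by (auto simp: carrier_H)
    show "comult H x \<in> carrier (tensor H H)" by (simp add: comult_H pres_in[OF P2])
    show "comult H (x \<otimes>\<^bsub>H\<^esub> y) = comult H x \<otimes>\<^bsub>tensor H H\<^esub> comult H y"
      by (simp add: mult_H comult_H dl_M dl2_tens tensor_mult[OF alg_pres_H])
    show "comult H (x \<oplus>\<^bsub>H\<^esub> y) = comult H x \<oplus>\<^bsub>tensor H H\<^esub> comult H y"
      by (simp add: pres_add[OF pres_H] pres_add[OF P2] comult_H hom_add[OF dl_hom])
  next
    have "\<one>\<^bsub>tensor H H\<^esub> = pure H H \<one>\<^bsub>H\<^esub> \<one>\<^bsub>H\<^esub>" by (simp add: tensor_def)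
    then show "comult H \<one>\<^bsub>H\<^esub> = \<one>\<^bsub>tensor H H\<^esub>"
      by (simp only: one_H comult_H dl_un tp_tens[OF pres_H pres_H])
  qed
  moreover have "counit H \<in> ring_hom H base_ring"
    by (rule ring_hom_memI)
      (auto simp: carrier_H mult_H one_H pres_add[OF pres_H] counit_H cu_M cu2_tens cu_un hom_add[OF cu_hom] base_ring_def)
  ultimately show ?thesis
    unfolding bialgebra_def using alg_pres_k_algebra[OF alg_pres_H] coalgebra_H by blast
qed

lemma hopf_algebra_H: "hopf_algebra H"
proof -
  define S where "S X = pj (ap (rep X))" for X
  have S: "S (pj a) = pj (ap a)" for a
    using J_ap[OF rep_pj, of a] by (simp add: S_def pj_eq hom_sub[OF ap_hom])
  have "sweedler H H (\<lambda>a1 a2. S a1 \<otimes>\<^bsub>H\<^esub> a2) (pj a) = pj (M (tm ap (\<lambda>x. x) (dl a)))" for a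
    by (rule sweedler_pres[OF pres_H hom_compose[OF tm_hom M_hom]]) (simp only: S mult_H tm_tens[OF ap_hom lin_ident])
  moreover have "sweedler H H (\<lambda>a1 a2. a1 \<otimes>\<^bsub>H\<^esub> S a2) (pj a) = pj (M (tm (\<lambda>x. x) ap (dl a)))" for a
    by (rule sweedler_pres[OF pres_H hom_compose[OF tm_hom M_hom]]) (simp only: S mult_H tm_tens[OF lin_ident ap_hom])
  moreover have "k_linear H H S" by (rule k_linearI[OF pres_H ap_hom S])
  ultimately show ?thesis
    unfolding hopf_algebra_def using bialgebra_H
    by (intro conjI exI[of _ S]) (auto simp: carrier_H antipode_l antipode_r counit_H one_H pres_smult[OF pres_H])
qed

lemma sweedler2_base:
  assumes X: "linf X" "\<And>a1 a2 b1 b2. g (pj a1) (pj a2) (pj b1) (pj b2) = X (tens (tens a1 b1) (tens a2 b2))"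
  shows "sweedler H base_ring (\<lambda>a1 a2. sweedler H base_ring (\<lambda>b1 b2. g a1 a2 b1 b2) (pj b)) (pj a)
    = X (dl2 (tens a b))"
  unfolding dl2_tens
proof (rule sweedler_base)
  show "linf (\<lambda>z. X (swap23 (tens z (dl b))))"
    by (rule hom_compose[OF hom_compose[OF tens_hom1[OF lin_ident] swap23_hom] X(1)])
  fix a1 a2
  show "sweedler H base_ring (\<lambda>b1 b2. g (pj a1) (pj a2) b1 b2) (pj b) = X (swap23 (tens (tens a1 a2) (dl b)))"
  proof (rule sweedler_base)
    show "linf (\<lambda>z. X (swap23 (tens (tens a1 a2) z)))"
      by (rule hom_compose[OF hom_compose[OF tens_hom2[OF lin_ident] swap23_hom] X(1)])
  qed (simp only: X(2) swap23_tens)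
qed

lemma sweedler3:
  assumes X: "lin X" "\<And>a1 a2 a3. g (pj a1) (pj a2) (pj a3) = pj (X (tens (tens a1 a2) a3))"
  shows "sweedler H H (\<lambda>x a3. sweedler H H (\<lambda>a1 a2. g a1 a2 a3) x) (pj a) = pj (X (tm dl (\<lambda>x. x) (dl a)))"
proof (rule sweedler_pres[OF pres_H hom_compose[OF tm_hom X(1)]])
  fix x a3
  show "sweedler H H (\<lambda>a1 a2. g a1 a2 (pj a3)) (pj x) = pj (X (tm dl (\<lambda>x. x) (tens x a3)))"
    unfolding tm_tens[OF dl_hom lin_ident]
    by (rule sweedler_pres[OF pres_H hom_compose[OF tens_hom1[OF lin_ident] X(1)] X(2)])
qed

end

section \<open>Descent of the cocycle to the quotient\<close>

locale coboundary_quot = hopf_quot dl cu M un A J ap + coboundary dl cu M un f f'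
  for dl :: "('s \<Rightarrow>\<^sub>0 'k::comm_ring_1) \<Rightarrow> ('s \<times> 's \<Rightarrow>\<^sub>0 'k)" and cu M un
    and A :: "('k, 's \<Rightarrow>\<^sub>0 'k) bialg" and J ap f f' +
  assumes sg_vanish: "z \<in> tens_span J \<Longrightarrow> sg z = 0" and ta_vanish': "z \<in> tens_span J \<Longrightarrow> ta z = 0"
begin

interpretation c2: coalg dl2 cu2 by (rule coalg2)

definition "\<sigma>H X Y = sg (tens (rep X) (rep Y))"
definition "\<tau>H X Y = ta (tens (rep X) (rep Y))"

text \<open>Changing both representatives changes the tensor by an element of
  \<open>tens_span J\<close>.\<close>

lemma form_rep:
  assumes "linf X" "\<And>z. z \<in> tens_span J \<Longrightarrow> X z = 0"
  shows "X (tens (rep (pj a)) (rep (pj b))) = X (tens a b)"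
proof -
  have "tens (rep (pj a)) (rep (pj b)) - tens a b
      = tens (rep (pj a) - a) (rep (pj b)) + tens a (rep (pj b) - b)"
    by (simp add: tens_sub1 tens_sub2)
  also have "\<dots> \<in> tens_span J"
    by (intro fmod.subspace_add[OF tens_span_subspace] tens_spanI1 tens_spanI2 rep_pj)
  finally have "X (tens (rep (pj a)) (rep (pj b)) - tens a b) = 0" by (rule assms(2))
  then show ?thesis by (simp add: hom_sub[OF assms(1)])
qed

lemma \<sigma>H: "\<sigma>H (pj a) (pj b) = sg (tens a b)" and \<tau>H: "\<tau>H (pj a) (pj b) = ta (tens a b)"
  unfolding \<sigma>H_def \<tau>H_def by (rule form_rep sg_hom ta_hom sg_vanish ta_vanish'; assumption?)+

lemma bilinear_formI:
  assumes "linf X" "\<And>a b. g (pj a) (pj b) = X (tens a b)" shows "bilinear_form H g"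
  unfolding bilinear_form_def
proof (intro conjI ballI)
  fix x assume "x \<in> carrier H"
  then obtain a where [simp]: "x = pj a" by (auto simp: carrier_H)
  show "k_linear H base_ring (g x)"
    by (rule k_linear_baseI[OF hom_compose[OF tens_hom2[OF lin_ident] assms(1)]]) (simp add: assms(2))
  show "k_linear H base_ring (\<lambda>a. g a x)"
    by (rule k_linear_baseI[OF hom_compose[OF tens_hom1[OF lin_ident] assms(1)]]) (simp add: assms(2))
qed

lemma convolution_inverse_H: "convolution_inverse H \<sigma>H \<tau>H"
proof -
  have "convolution H \<sigma>H \<tau>H (pj a) (pj b) = c2.conv sg ta (tens a b)" for a b
    unfolding convolution_def c2.conv_def
    by (rule sweedler2_base[OF pr_hom[OF module_times]]) (simp only: \<sigma>H \<tau>H cc_tens[OF sg_hom ta_hom])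
  moreover have "convolution H \<tau>H \<sigma>H (pj a) (pj b) = c2.conv ta sg (tens a b)" for a b
    unfolding convolution_def c2.conv_def
    by (rule sweedler2_base[OF pr_hom[OF module_times]]) (simp only: \<sigma>H \<tau>H cc_tens[OF ta_hom sg_hom])
  ultimately show ?thesis
    unfolding convolution_inverse_def using bilinear_formI[OF ta_hom \<tau>H]
    by (auto simp: carrier_H conv_sg_ta conv_ta_sg cu2_tens counit_H)
qed

lemma two_cocycle_H: "two_cocycle H \<sigma>H"
proof -
  have X1: "linf (\<lambda>z. sg (tens (M z) c))" and X2: "linf (\<lambda>z. sg (tens c (M z)))" for c
    by (intro hom_compose[OF tens_hom1[OF M_hom] sg_hom] hom_compose[OF tens_hom2[OF M_hom] sg_hom])+
  have "sweedler H base_ring (\<lambda>a1 a2. sweedler H base_ring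
      (\<lambda>b1 b2. \<sigma>H a1 b1 * \<sigma>H (a2 \<otimes>\<^bsub>H\<^esub> b2) (pj c)) (pj b)) (pj a)
    = cc sg (\<lambda>z. sg (tens (M z) c)) (dl2 (tens a b))" for a b c
    by (rule sweedler2_base[OF pr_hom[OF module_times]]) (simp only: \<sigma>H mult_H cc_tens[OF sg_hom X1])
  also have "cc sg (\<lambda>z. sg (tens (M z) c)) (dl2 (tens a b)) = sg (tens (M (c2.lc sg (tens a b))) c)" for a b c
    using c2.form_lc[OF X1[of c], of sg "tens a b"] by (simp only: c2.conv_def)
  finally have l: "sweedler H base_ring (\<lambda>a1 a2. sweedler H base_ring
      (\<lambda>b1 b2. \<sigma>H a1 b1 * \<sigma>H (a2 \<otimes>\<^bsub>H\<^esub> b2) (pj c)) (pj b)) (pj a)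
    = sg (tens (M (c2.lc sg (tens a b))) c)" for a b c .
  have "sweedler H base_ring (\<lambda>b1 b2. sweedler H base_ring
      (\<lambda>c1 c2. \<sigma>H b1 c1 * \<sigma>H (pj a) (b2 \<otimes>\<^bsub>H\<^esub> c2)) (pj c)) (pj b)
    = cc sg (\<lambda>z. sg (tens a (M z))) (dl2 (tens b c))" for a b c
    by (rule sweedler2_base[OF pr_hom[OF module_times]]) (simp only: \<sigma>H mult_H cc_tens[OF sg_hom X2])
  also have "cc sg (\<lambda>z. sg (tens a (M z))) (dl2 (tens b c)) = sg (tens a (M (c2.lc sg (tens b c))))" for a b c
    using c2.form_lc[OF X2[of a], of sg "tens b c"] by (simp only: c2.conv_def)
  finally have r: "sweedler H base_ring (\<lambda>b1 b2. sweedler H base_ring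
      (\<lambda>c1 c2. \<sigma>H b1 c1 * \<sigma>H (pj a) (b2 \<otimes>\<^bsub>H\<^esub> c2)) (pj c)) (pj b)
    = sg (tens a (M (c2.lc sg (tens b c))))" for a b c .
  show ?thesis
    unfolding two_cocycle_def
    using bilinear_formI[OF sg_hom \<sigma>H] convolution_inverse_H
    by (auto simp: carrier_H l r sg_cocycle one_H \<sigma>H sg_unit_l sg_unit_r counit_H)
qed

abbreviation "D \<equiv> deform H \<sigma>H \<tau>H"

lemma mult_D: "pj a \<otimes>\<^bsub>D\<^esub> pj b = pj (dm (tens a b))"
proof -
  \<comment> \<open>The summand of the deformed product as one linear map on six factors. The outer
    swap pairs a3 with b3 for \<open>ta\<close>, the inner one pairs a1 with b1 for
    \<open>sg\<close> and a2 with b2 for \<open>M\<close>.\<close>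
  define Z where "Z p = cr (\<lambda>w. cl sg M (swap23 w)) ta (swap23 p)" for p
  have Zi: "lin (\<lambda>w. cl sg M (swap23 w))" by (rule hom_compose[OF swap23_hom pr_hom[OF module_fscale]])
  have Z: "lin Z" unfolding Z_def by (rule hom_compose[OF swap23_hom pr_hom[OF module_fscale]])
  have Zt: "Z (tens (tens (tens a1 a2) a3) (tens (tens b1 b2) b3))
      = fscale (sg (tens a1 b1) * ta (tens a3 b3)) (M (tens a2 b2))" for a1 a2 a3 b1 b2 b3
    by (simp add: Z_def cr_tens[OF Zi ta_hom] cl_tens[OF sg_hom M_hom] mult.commute)
  have "pj a \<otimes>\<^bsub>D\<^esub> pj b = sweedler H H (\<lambda>x a3. sweedler H H (\<lambda>a1 a2.
      sweedler H H (\<lambda>y b3. sweedler H H (\<lambda>b1 b2.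
        (\<sigma>H a1 b1 * \<tau>H a3 b3) \<odot>\<^bsub>H\<^esub> (a2 \<otimes>\<^bsub>H\<^esub> b2)) y) (pj b)) x) (pj a)"
    by (simp add: deform_def)
  also have "\<dots> = pj (Z (tens (tm dl (\<lambda>x. x) (dl a)) (tm dl (\<lambda>x. x) (dl b))))"
  proof (rule sweedler3[of "\<lambda>z. Z (tens z (tm dl (\<lambda>x. x) (dl b)))"])
    show "lin (\<lambda>z. Z (tens z (tm dl (\<lambda>x. x) (dl b))))" by (rule hom_compose[OF tens_hom1[OF lin_ident] Z])
    fix a1 a2 a3
    show "sweedler H H (\<lambda>y b3. sweedler H H (\<lambda>b1 b2.
        (\<sigma>H (pj a1) b1 * \<tau>H (pj a3) b3) \<odot>\<^bsub>H\<^esub> (pj a2 \<otimes>\<^bsub>H\<^esub> b2)) y) (pj b)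
      = pj (Z (tens (tens (tens a1 a2) a3) (tm dl (\<lambda>x. x) (dl b))))"
      by (rule sweedler3[of "\<lambda>z. Z (tens (tens (tens a1 a2) a3) z)", OF hom_compose[OF tens_hom2[OF lin_ident] Z]])
        (simp only: \<sigma>H \<tau>H mult_H pres_smult[OF pres_H] Zt)
  qed
  also have "tens (tm dl (\<lambda>x. x) (dl a)) (tm dl (\<lambda>x. x) (dl b))
      = tm (tm dl (\<lambda>x. x)) (tm dl (\<lambda>x. x)) (tens (dl a) (dl b))"
    by (simp only: tm_tens[OF tm_hom tm_hom])
  also have "Z \<dots> = cr (\<lambda>w. cl sg M (swap23 w)) ta (tm (tm dl dl) (tm (\<lambda>x. x) (\<lambda>x. x)) (dl2 (tens a b)))"
    unfolding Z_def dl2_tens by (simp only: swap23_tm[OF dl_hom lin_ident dl_hom lin_ident])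
  also have "\<dots> = pr fscale (\<lambda>w v. fscale (ta (tm (\<lambda>x. x) (\<lambda>x. x) v)) (cl sg M (swap23 (tm dl dl w)))) (dl2 (tens a b))"
    by (rule pr_tm[OF bil_cr[OF Zi ta_hom] tm_hom tm_hom])
  also have "\<dots> = cr star ta (dl2 (tens a b))"
    by (simp only: tm_id dl2_def[symmetric] c2.hom_lc[OF M_hom, symmetric] star_eq)
  also have "\<dots> = dm (tens a b)"
    by (simp only: c2.hom_rc[OF star_hom, symmetric] dm_eq)
  finally show ?thesis .
qed

lemma D_fields: "carrier D = carrier H" "add D = add H" "smult D = smult H" "zero D = zero H"
  "one D = one H" "comult D = comult H" "counit D = counit H"
  by (simp_all add: deform_def)

lemma pres_D: "pres D pj"
  using pres_H by (simp add: pres_def D_fields)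

lemma T2_D: "tp H H pj pj = tp D D pj pj"
  by (simp add: fun_eq_iff tp_def tclass_def tensor_rels_def D_fields)

text \<open>One direction of the assumed equivalence makes the map induced by \<open>psi\<close>
  well defined, the other makes it injective; \<open>psi'\<close> gives surjectivity.\<close>

theorem cocycle_deformation:
  assumes L: "hopf_quot dl cu M un A I ap" and psi: "\<And>a. psi a \<in> J \<longleftrightarrow> a \<in> I"
  shows "cocycle_deformations (quot_bialg A I) H"
proof -
  interpret L: hopf_quot dl cu M un A I ap by (rule L)
  define \<phi> where "\<phi> X = pj (psi (rep X))" for X
  have \<phi>: "\<phi> (L.pj a) = pj (psi a)" for a
    using L.rep_pj[of a] by (simp add: \<phi>_def pj_eq hom_sub[OF psi_hom, symmetric] psi)
  have cL: "x \<in> carrier L.H \<Longrightarrow> \<exists>a. x = L.pj a" for x by (simp add: L.carrier_H)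
  have "\<phi> \<in> ring_hom L.H D"
  proof (rule ring_hom_memI)
    fix x y assume "x \<in> carrier L.H" "y \<in> carrier L.H"
    then obtain a b where [simp]: "x = L.pj a" "y = L.pj b" using cL by blast
    show "\<phi> x \<in> carrier D" by (simp add: \<phi> pres_in[OF pres_D])
    show "\<phi> (x \<otimes>\<^bsub>L.H\<^esub> y) = \<phi> x \<otimes>\<^bsub>D\<^esub> \<phi> y" by (simp add: L.mult_H \<phi> mult_D psi_M)
    show "\<phi> (x \<oplus>\<^bsub>L.H\<^esub> y) = \<phi> x \<oplus>\<^bsub>D\<^esub> \<phi> y"
      by (simp add: pres_add[OF L.pres_H] pres_add[OF pres_D] \<phi> hom_add[OF psi_hom])
  next
    show "\<phi> \<one>\<^bsub>L.H\<^esub> = \<one>\<^bsub>D\<^esub>" by (simp add: L.one_H \<phi> psi_un D_fields one_H)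
  qed
  moreover have "bij_betw \<phi> (carrier L.H) (carrier D)"
    unfolding bij_betw_def
  proof
    show "inj_on \<phi> (carrier L.H)"
    proof (rule inj_onI)
      fix x y assume "x \<in> carrier L.H" "y \<in> carrier L.H" and e: "\<phi> x = \<phi> y"
      then obtain a b where [simp]: "x = L.pj a" "y = L.pj b" using cL by blast
      show "x = y" using e by (simp add: \<phi> pj_eq L.pj_eq hom_sub[OF psi_hom, symmetric] psi)
    qed
    show "\<phi> ` carrier L.H = carrier D"
    proof -
      have "pj a \<in> \<phi> ` carrier L.H" for a
        by (rule image_eqI[of _ _ "L.pj (psi' a)"]) (simp_all add: \<phi> pres_in[OF L.pres_H])
      then show ?thesis using cL by (auto simp: D_fields carrier_H \<phi> dest!: cL)
    qed
  qed
  moreover have "k_linear L.H D \<phi>" by (rule L.k_linearI[OF pres_D psi_hom \<phi>])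
  moreover have "comult D (\<phi> x) = sweedler L.H (tensor D D) (\<lambda>a1 a2. pure D D (\<phi> a1) (\<phi> a2)) x \<and>
      counit D (\<phi> x) = counit L.H x" if x: "x \<in> carrier L.H" for x
  proof -
    obtain a where [simp]: "x = L.pj a" using x cL by blast
    have "sweedler L.H (tensor D D) (\<lambda>a1 a2. pure D D (\<phi> a1) (\<phi> a2)) (L.pj a) = tp D D pj pj (tm psi psi (dl a))"
      by (rule L.sweedler_pres[OF pres_tensor[OF pres_D pres_D] tm_hom])
        (simp only: \<phi> tp_tens[OF pres_D pres_D] tm_tens[OF psi_hom psi_hom])
    then show ?thesis by (simp add: \<phi> D_fields comult_H counit_H L.counit_H cu_psi dl_psi T2_D)
  qed
  ultimately have "hopf_iso L.H D \<phi>" by (auto simp: hopf_iso_def ring_iso_def)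
  then show ?thesis
    unfolding cocycle_deformations_def
    using L.hopf_algebra_H hopf_algebra_H two_cocycle_H convolution_inverse_H by blast
qed

end

section \<open>The bosonization as a free bialgebra\<close>

lemma tm_add1: "tm (\<lambda>x. A x + B x) C z = tm A C z + tm B C z"
  by (simp add: tm_def pr_def tens_add1 case_prod_unfold lev_add_fun[OF module_fscale])

lemma tm_add2: "tm C (\<lambda>x. A x + B x) z = tm C A z + tm C B z"
  by (simp add: tm_def pr_def tens_add2 case_prod_unfold lev_add_fun[OF module_fscale])

lemma tm_scale1: "tm (\<lambda>x. fscale c (A x)) B z = fscale c (tm A B z)"
  by (simp add: tm_def pr_def tens_scale1 case_prod_unfold lev_scale_fun[OF module_fscale])

lemma tm_scale2: "tm A (\<lambda>x. fscale c (B x)) z = fscale c (tm A B z)"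
  by (simp add: tm_def pr_def tens_scale2 case_prod_unfold lev_scale_fun[OF module_fscale])

lemma reassoc_tm:
  assumes "lin A" "lin B" "lin C"
  shows "reassoc (tm (tm A B) C z) = tm A (tm B C) (reassoc z)"
  by (rule hom_ext3[OF hom_compose[OF tm_hom reassoc_hom] hom_compose[OF reassoc_hom tm_hom]])
    (simp add: tm_tens assms tm_hom)

text \<open>Operators that can be pulled out of the first argument of \<open>P\<close> and
  \<open>Q\<close> can be pulled out of the product on the tensor square. This drives the inductions
  over the first factor of a product.\<close>

lemma tm_swap_left:
  assumes "lin A" "lin B" "lin P" "lin Q" "lin A'" "lin B'"
    "\<And>p q. P (tens (A p) q) = A' (P (tens p q))" "\<And>p q. Q (tens (B p) q) = B' (Q (tens p q))"
  shows "tm P Q (swap23 (tens (tm A B z) w)) = tm A' B' (tm P Q (swap23 (tens z w)))"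
proof -
  have *: "tm P Q (swap23 (tens (tm A B (tens p q)) (tens r s))) = tm A' B' (tm P Q (swap23 (tens (tens p q) (tens r s))))" for p q r s
    by (simp add: tm_tens assms)
  have "tm P Q (swap23 (tm (tm A B) (\<lambda>x. x) y)) = tm A' B' (tm P Q (swap23 y))" for y
    by (rule hom_ext4[of fscale "\<lambda>y. tm P Q (swap23 (tm (tm A B) (\<lambda>x. x) y))" "\<lambda>y. tm A' B' (tm P Q (swap23 y))"],
        rule hom_compose[OF hom_compose[OF tm_hom swap23_hom] tm_hom],
        rule hom_compose[OF hom_compose[OF swap23_hom tm_hom] tm_hom])
      (simp only: tm_tens[OF tm_hom lin_ident] *)
  from this[of "tens z w"] show ?thesis by (simp add: tm_tens tm_hom lin_ident)
qed

lemma lin_add: "lin A \<Longrightarrow> lin B \<Longrightarrow> lin (\<lambda>x. A x + B x)"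
  by (auto simp: module_hom_iff fmod.scale_right_distrib)

lemma lin_minus: "lin A \<Longrightarrow> lin B \<Longrightarrow> lin (\<lambda>x. A x - B x)"
  by (auto simp: module_hom_iff fmod.scale_right_diff_distrib)

lemma hom_neg: "module_hom s1 s2 f \<Longrightarrow> f (- x) = - f x"
  by (rule module_hom.neg)

lemma linf_zero: "linf (\<lambda>x. 0)"
  by (simp add: module_hom_iff module_fscale module_times)

lemma tm_in_subspace:
  assumes "fmod.subspace U" "\<And>s t. (s, t) \<in> Poly_Mapping.keys z \<Longrightarrow> tens (A (basis s)) (B (basis t)) \<in> U"
  shows "tm A B z \<in> U"
  unfolding tm_def pr_def using assms(2) by (intro lev_in_subspace[OF assms(1)]) auto

locale diag =
  fixes g :: "'i \<Rightarrow> 'g::ab_group_add" and \<chi> :: "'i \<Rightarrow> 'g \<Rightarrow> 'k::comm_ring_1"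
  assumes char: "character (\<chi> i)"
begin

lemma \<chi>_add: "\<chi> i (x + y) = \<chi> i x * \<chi> i y"
  using char[of i] by (simp add: character_def)

lemma \<chi>_0 [simp]: "\<chi> i 0 = 1"
proof -
  obtain u where u: "1 = \<chi> i 0 * u" using char[of i] unfolding character_def dvd_def by blast
  have "\<chi> i 0 = \<chi> i 0 * (\<chi> i 0 * u)" using u by simp
  also have "\<dots> = \<chi> i (0 + 0) * u" by (simp only: \<chi>_add mult.assoc)
  also have "\<dots> = 1" using u by simp
  finally show ?thesis .
qed

lemma \<chi>_inv [simp]: "\<chi> i x * \<chi> i (- x) = 1" "\<chi> i (- x) * \<chi> i x = 1"
  using \<chi>_add[of i x "- x"] \<chi>_add[of i "- x" x] by simp_all

abbreviation "wc \<equiv> word_char \<chi>"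

lemma wc_Nil [simp]: "wc [] h = 1" and wc_Cons [simp]: "wc (i # w) h = \<chi> i h * wc w h"
  and wc_append: "wc (u @ v) h = wc u h * wc v h"
  by (simp_all add: word_char_def)

lemma wc_0 [simp]: "wc w 0 = 1" and wc_add: "wc w (a + b) = wc w a * wc w b"
  by (induction w) (simp_all add: \<chi>_add ac_simps)

text \<open>\<open>L i\<close> and \<open>G x\<close> are the left multiplications by \<open>x\<^sub>i\<close> and by \<open>x \<in> \<Gamma>\<close>.\<close>

definition L :: "'i \<Rightarrow> ('i list \<times> 'g \<Rightarrow>\<^sub>0 'k) \<Rightarrow> ('i list \<times> 'g \<Rightarrow>\<^sub>0 'k)" where
  "L i = lev fscale (\<lambda>(w, h). basis (i # w, h))"

definition G :: "'g \<Rightarrow> ('i list \<times> 'g \<Rightarrow>\<^sub>0 'k) \<Rightarrow> ('i list \<times> 'g \<Rightarrow>\<^sub>0 'k)" where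
  "G x = lev fscale (\<lambda>(w, h). fscale (wc w x) (basis (w, x + h)))"

definition M :: "(('i list \<times> 'g) \<times> ('i list \<times> 'g) \<Rightarrow>\<^sub>0 'k) \<Rightarrow> ('i list \<times> 'g \<Rightarrow>\<^sub>0 'k)" where
  "M = lev fscale (\<lambda>((u, a), (v, b)). fscale (wc v a) (basis (u @ v, a + b)))"

definition un :: "'i list \<times> 'g \<Rightarrow>\<^sub>0 'k" where
  "un = basis ([], 0)"

definition cu :: "('i list \<times> 'g \<Rightarrow>\<^sub>0 'k) \<Rightarrow> 'k" where
  "cu = lev (*) (\<lambda>(w, h). if w = [] then 1 else 0)"

lemma L_hom: "lin (L i)" and G_hom: "lin (G x)" and M_lin: "lin M" and cu_lin: "linf cu"
  unfolding L_def G_def M_def cu_def by (rule lev_hom[OF module_fscale] lev_hom[OF module_times])+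

lemma L_basis [simp]: "L i (basis (w, h)) = basis (i # w, h)"
  and G_basis: "G x (basis (w, h)) = fscale (wc w x) (basis (w, x + h))"
  and cu_basis: "cu (basis (w, h)) = (if w = [] then 1 else 0)"
  by (simp_all add: L_def G_def cu_def module_fscale module_times)

lemma M_basis: "M (basis ((u, a), (v, b))) = fscale (wc v a) (basis (u @ v, a + b))"
  by (simp add: M_def module_fscale)

lemma M_bil': "bil fscale (\<lambda>a b. M (tens a b))"
  by (rule bil_hom_tens[OF M_lin])

lemma M_un_l: "M (tens un a) = a"
  by (rule hom_ext[OF bil2[OF M_bil'] lin_ident], unfold un_def, case_tac x, simp add: M_basis)

lemma M_un_r: "M (tens a un) = a"
  by (rule hom_ext[OF bil1[OF M_bil'] lin_ident], unfold un_def, case_tac x, simp add: M_basis)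

lemma M_ass: "M (tens (M (tens a b)) c) = M (tens a (M (tens b c)))"
proof -
  have "M (tm M (\<lambda>x. x) z) = M (tm (\<lambda>x. x) M (reassoc z))" for z
  proof (rule hom_ext[OF hom_compose[OF tm_hom M_lin] hom_compose[OF hom_compose[OF reassoc_hom tm_hom] M_lin]])
    fix p :: "(('i list \<times> 'g) \<times> ('i list \<times> 'g)) \<times> ('i list \<times> 'g)"
    obtain u a v b w c where p: "p = (((u, a), (v, b)), (w, c))" by (metis surj_pair)
    have "M (tm M (\<lambda>x. x) (tens (tens (basis (u, a)) (basis (v, b))) (basis (w, c))))
      = M (tm (\<lambda>x. x) M (reassoc (tens (tens (basis (u, a)) (basis (v, b))) (basis (w, c)))))"
      unfolding reassoc_tens tm_tens[OF M_lin lin_ident] tm_tens[OF lin_ident M_lin]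
      by (simp add: M_basis tens_scale1 tens_scale2 hom_scale[OF M_lin] wc_append wc_add ac_simps)
    then show "M (tm M (\<lambda>x. x) (basis p)) = M (tm (\<lambda>x. x) M (reassoc (basis p)))" by (simp add: p)
  qed
  from this[of "tens (tens a b) c"] show ?thesis by (simp add: tm_tens M_lin lin_ident)
qed

lemma L_M: "L i p = M (tens (basis ([i], 0)) p)"
  by (rule hom_ext[OF L_hom bil2[OF M_bil']], case_tac x, simp add: M_basis)

lemma G_M: "G x p = M (tens (basis ([], x)) p)"
  by (rule hom_ext[OF G_hom bil2[OF M_bil']], case_tac xa, simp add: M_basis G_basis)

lemma M_L: "M (tens (L i p) q) = L i (M (tens p q))" and M_G: "M (tens (G x p) q) = G x (M (tens p q))"
  by (simp_all add: L_M G_M M_ass)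

lemma G_L: "G x (L i p) = fscale (\<chi> i x) (L i (G x p))"
  by (rule hom_ext[OF hom_compose[OF L_hom G_hom] fscale_hom2[OF hom_compose[OF G_hom L_hom]]], case_tac xa)
    (simp add: G_basis hom_scale[OF L_hom])

lemma G_G: "G x (G y p) = G (x + y) p"
  by (rule hom_ext[OF hom_compose[OF G_hom G_hom] G_hom], case_tac xa)
    (simp add: G_basis hom_scale[OF G_hom] wc_add ac_simps)

lemma G_0: "G 0 p = p"
  by (rule hom_ext[OF G_hom lin_ident], case_tac x) (simp add: G_basis)

lemma cu_L [simp]: "cu (L i p) = 0"
  by (rule hom_ext[OF hom_compose[OF L_hom cu_lin] linf_zero], case_tac x)
    (simp add: cu_basis)

lemma cu_G [simp]: "cu (G x p) = cu p"
  by (rule hom_ext[OF hom_compose[OF G_hom cu_lin] cu_lin], case_tac xa)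
    (simp add: G_basis cu_basis hom_scale[OF cu_lin])

text \<open>Every basis element arises from a group element by operators \<open>L i\<close>. This is
  the induction principle behind most identities on \<open>F\<close>.\<close>

lemma hom_ext_F:
  assumes "module_hom fscale sc X" "module_hom fscale sc Y"
    and base: "\<And>h. X (basis ([], h)) = Y (basis ([], h))"
    and step: "\<And>i p. X p = Y p \<Longrightarrow> X (L i p) = Y (L i p)"
  shows "X p = Y p"
proof (rule hom_ext[OF assms(1,2)])
  fix x :: "'i list \<times> 'g"
  have "X (basis (w, h)) = Y (basis (w, h))" for w h
    by (induction w) (use base step in \<open>auto simp flip: L_basis\<close>)
  then show "X (basis x) = Y (basis x)" by (cases x) simp
qed

text \<open>The second clause is left multiplication by the coproduct
  \<open>x_i \<otimes> 1 + g_i \<otimes> x_i\<close> of the first letter, written with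
  operators.\<close>

primrec dlw :: "'g \<Rightarrow> 'i list \<Rightarrow> (('i list \<times> 'g) \<times> ('i list \<times> 'g) \<Rightarrow>\<^sub>0 'k)" where
  "dlw h [] = basis (([], h), ([], h))"
| "dlw h (i # w) = tm (L i) (\<lambda>x. x) (dlw h w) + tm (G (g i)) (L i) (dlw h w)"

definition dl :: "('i list \<times> 'g \<Rightarrow>\<^sub>0 'k) \<Rightarrow> (('i list \<times> 'g) \<times> ('i list \<times> 'g) \<Rightarrow>\<^sub>0 'k)" where
  "dl = lev fscale (\<lambda>(w, h). dlw h w)"

lemma dl_lin: "lin dl"
  unfolding dl_def by (rule lev_hom[OF module_fscale])

lemma dl_group: "dl (basis ([], h)) = tens (basis ([], h)) (basis ([], h))"
  by (simp add: dl_def module_fscale)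

lemma dl_L: "dl (L i p) = tm (L i) (\<lambda>x. x) (dl p) + tm (G (g i)) (L i) (dl p)"
  by (rule hom_ext[OF hom_compose[OF L_hom dl_lin] lin_add[OF hom_compose[OF dl_lin tm_hom] hom_compose[OF dl_lin tm_hom]]],
      case_tac x) (simp add: dl_def module_fscale)

lemma dl_G: "dl (G x p) = tm (G x) (G x) (dl p)"
proof (rule hom_ext_F[OF hom_compose[OF G_hom dl_lin] hom_compose[OF dl_lin tm_hom]])
  show "dl (G x (basis ([], h))) = tm (G x) (G x) (dl (basis ([], h)))" for h
    by (simp add: G_basis dl_group tm_tens G_hom del: tens_basis)
  fix i p
  assume IH: "dl (G x p) = tm (G x) (G x) (dl p)"
  have "dl (G x (L i p)) = fscale (\<chi> i x) (tm (\<lambda>p. L i (G x p)) (G x) (dl p) + tm (\<lambda>p. G (g i) (G x p)) (\<lambda>p. L i (G x p)) (dl p))"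
    by (simp add: G_L hom_scale[OF dl_lin] dl_L IH tm_tm G_hom L_hom lin_ident)
  also have "\<dots> = tm (\<lambda>p. G x (L i p)) (G x) (dl p) + tm (\<lambda>p. G x (G (g i) p)) (\<lambda>p. G x (L i p)) (dl p)"
    by (simp add: G_L tm_scale1 tm_scale2 fmod.scale_right_distrib G_G add.commute)
  also have "\<dots> = tm (G x) (G x) (dl (L i p))"
    by (simp add: dl_L hom_add[OF tm_hom] tm_tm G_hom L_hom lin_ident)
  finally show "dl (G x (L i p)) = tm (G x) (G x) (dl (L i p))" .
qed

lemma coalg_F: "coalg dl cu"
proof (rule coalg.intro[OF dl_lin cu_lin])
  fix a
  note lins = L_hom G_hom lin_ident dl_lin tm_hom
  show "reassoc (tm dl (\<lambda>x. x) (dl a)) = tm (\<lambda>x. x) dl (dl a)"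
  proof (rule hom_ext_F[OF hom_compose[OF hom_compose[OF dl_lin tm_hom] reassoc_hom] hom_compose[OF dl_lin tm_hom]])
    show "reassoc (tm dl (\<lambda>x. x) (dl (basis ([], h)))) = tm (\<lambda>x. x) dl (dl (basis ([], h)))" for h
      by (simp add: dl_group tm_tens lins del: tens_basis)
    fix i p
    assume IH: "reassoc (tm dl (\<lambda>x. x) (dl p)) = tm (\<lambda>x. x) dl (dl p)"
    let ?R = "tm dl (\<lambda>x. x) (dl p)"
    have "tm dl (\<lambda>x. x) (dl (L i p)) = tm (tm (L i) (\<lambda>x. x)) (\<lambda>x. x) ?R + tm (tm (G (g i)) (L i)) (\<lambda>x. x) ?R
        + tm (tm (G (g i)) (G (g i))) (L i) ?R"
      by (simp add: dl_L hom_add[OF tm_hom] tm_tm lins dl_G tm_add1)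
    then have "reassoc (tm dl (\<lambda>x. x) (dl (L i p))) = tm (L i) (tm (\<lambda>x. x) (\<lambda>x. x)) (reassoc ?R)
        + tm (G (g i)) (tm (L i) (\<lambda>x. x)) (reassoc ?R) + tm (G (g i)) (tm (G (g i)) (L i)) (reassoc ?R)"
      by (simp only: hom_add[OF reassoc_hom] reassoc_tm[OF L_hom lin_ident lin_ident]
          reassoc_tm[OF G_hom L_hom lin_ident] reassoc_tm[OF G_hom G_hom L_hom])
    also have "\<dots> = tm (\<lambda>x. x) dl (dl (L i p))"
      by (simp add: IH dl_L hom_add[OF tm_hom] tm_tm lins tm_add2 tm_id_fun)
    finally show "reassoc (tm dl (\<lambda>x. x) (dl (L i p))) = tm (\<lambda>x. x) dl (dl (L i p))" .
  qed
  note prl = pr_hom[OF module_fscale]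
  show "cl cu (\<lambda>x. x) (dl a) = a"
  proof (rule hom_ext_F[OF hom_compose[OF dl_lin prl] lin_ident])
    show "cl cu (\<lambda>x. x) (dl (basis ([], h))) = basis ([], h)" for h
      by (simp add: dl_group cl_tens cu_lin lin_ident cu_basis del: tens_basis)
    fix i p
    assume IH: "cl cu (\<lambda>x. x) (dl p) = p"
    have "cl cu (\<lambda>x. x) (dl (L i p)) = pr fscale (\<lambda>a b. fscale (cu (L i a)) b) (dl p)
        + pr fscale (\<lambda>a b. fscale (cu (G (g i) a)) (L i b)) (dl p)"
      by (simp only: dl_L hom_add[OF prl] pr_tm[OF bil_cl[OF cu_lin lin_ident] L_hom lin_ident]
          pr_tm[OF bil_cl[OF cu_lin lin_ident] G_hom L_hom])
    also have "\<dots> = L i (cl cu (\<lambda>x. x) (dl p))"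
      by (simp add: hom_pr[OF L_hom] hom_scale[OF L_hom]) (simp add: pr_def lev_def case_prod_unfold)
    finally show "cl cu (\<lambda>x. x) (dl (L i p)) = L i p" by (simp only: IH)
  qed
  show "cr (\<lambda>x. x) cu (dl a) = a"
  proof (rule hom_ext_F[OF hom_compose[OF dl_lin prl] lin_ident])
    show "cr (\<lambda>x. x) cu (dl (basis ([], h))) = basis ([], h)" for h
      by (simp add: dl_group cr_tens cu_lin lin_ident cu_basis del: tens_basis)
    fix i p
    assume IH: "cr (\<lambda>x. x) cu (dl p) = p"
    have "cr (\<lambda>x. x) cu (dl (L i p)) = pr fscale (\<lambda>a b. fscale (cu b) (L i a)) (dl p)
        + pr fscale (\<lambda>a b. fscale (cu (L i b)) (G (g i) a)) (dl p)"
      by (simp only: dl_L hom_add[OF prl] pr_tm[OF bil_cr[OF lin_ident cu_lin] L_hom lin_ident]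
          pr_tm[OF bil_cr[OF lin_ident cu_lin] G_hom L_hom])
    also have "\<dots> = L i (cr (\<lambda>x. x) cu (dl p))"
      by (simp add: hom_pr[OF L_hom] hom_scale[OF L_hom]) (simp add: pr_def lev_def case_prod_unfold)
    finally show "cr (\<lambda>x. x) cu (dl (L i p)) = L i p" by (simp only: IH)
  qed
qed

sublocale free_bialg dl cu M un
proof (rule free_bialg.intro[OF coalg_F])
  show "free_alg M un" by (rule free_alg.intro[OF M_lin M_ass M_un_l M_un_r])
  interpret coalg dl cu by (rule coalg_F)
  show "free_bialg_axioms dl cu M un"
  proof
    fix z
    show "dl (M z) = tm M M (dl2 z)"
    proof (rule hom_ext2[OF hom_compose[OF M_lin dl_lin] hom_compose[OF dl2_hom tm_hom]])
      fix p q
      show "dl (M (tens p q)) = tm M M (dl2 (tens p q))"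
        unfolding dl2_tens
      proof (rule hom_ext_F[of fscale "\<lambda>p. dl (M (tens p q))" "\<lambda>p. tm M M (swap23 (tens (dl p) (dl q)))"])
        show "lin (\<lambda>p. dl (M (tens p q)))" by (rule hom_compose[OF bil1[OF M_bil'] dl_lin])
        show "lin (\<lambda>p. tm M M (swap23 (tens (dl p) (dl q))))"
          by (rule hom_compose[OF hom_compose[OF tens_hom1[OF dl_lin] swap23_hom] tm_hom])
        show "dl (M (tens (basis ([], h)) q)) = tm M M (swap23 (tens (dl (basis ([], h))) (dl q)))" for h
        proof -
          have "tm M M (swap23 (tens (tm (G h) (G h) (tens un un)) (dl q))) = tm (G h) (G h) (tm M M (swap23 (tens (tens un un) (dl q))))"
            by (rule tm_swap_left[OF G_hom G_hom M_lin M_lin G_hom G_hom M_G M_G])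
          also have "tm M M (swap23 (tens (tens un un) w)) = w" for w
            by (rule hom_ext2[OF hom_compose[OF hom_compose[OF tens_hom2[OF lin_ident] swap23_hom] tm_hom] lin_ident])
              (simp add: tm_tens M_lin M_un_l)
          also have "tm (G h) (G h) (tens un un) = dl (basis ([], h))"
            by (simp add: tm_tens G_hom dl_group) (simp add: un_def G_basis)
          finally show ?thesis by (simp add: G_M[symmetric] dl_G)
        qed
        fix i p
        assume IH: "dl (M (tens p q)) = tm M M (swap23 (tens (dl p) (dl q)))"
        show "dl (M (tens (L i p) q)) = tm M M (swap23 (tens (dl (L i p)) (dl q)))"
          by (simp add: M_L dl_L IH tens_add1 hom_add[OF swap23_hom] hom_add[OF tm_hom]
              tm_swap_left[OF L_hom lin_ident M_lin M_lin L_hom lin_ident M_L] tm_swap_left[OF G_hom L_hom M_lin M_lin G_hom L_hom M_G M_L])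
      qed
    qed
    show "cu (M z) = cu2 z"
    proof (rule hom_ext[OF hom_compose[OF M_lin cu_lin] cu2_hom])
      fix p :: "('i list \<times> 'g) \<times> ('i list \<times> 'g)"
      obtain u a v b where p: "p = ((u, a), (v, b))" by (metis surj_pair)
      have "cu2 (tens (basis (u, a)) (basis (v, b))) = cu (M (basis p))"
        unfolding cu2_tens p by (simp add: cu_basis M_basis hom_scale[OF cu_lin])
      then show "cu (M (basis p)) = cu2 (basis p)" by (simp add: p)
    qed
    show "dl un = tens un un" by (simp add: un_def dl_group)
    show "cu un = 1" by (simp add: un_def cu_basis)
  qed
qed

text \<open>The coproduct respects word length; this is the grading used for the geometric
  series.\<close>

lemma dl_keys:
  assumes "(u, v) \<in> Poly_Mapping.keys (dl (basis c))" shows "length (fst u) + length (fst v) = length (fst c)"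
proof -
  let ?S = "\<lambda>n. {(u, v). length (fst u) + length (fst v) = n} :: (('i list \<times> 'g) \<times> ('i list \<times> 'g)) set"
  have "Poly_Mapping.keys (dlw h w) \<subseteq> ?S (length w)" for h w
  proof (induction w)
    case (Cons i w)
    have "tm (L i) (\<lambda>x. x) (dlw h w) \<in> {z. Poly_Mapping.keys z \<subseteq> ?S (length (i # w))}"
      by (rule tm_in_subspace[OF subspace_keys]) (use Cons in \<open>auto\<close>)
    moreover have "tm (G (g i)) (L i) (dlw h w) \<in> {z. Poly_Mapping.keys z \<subseteq> ?S (length (i # w))}"
      by (rule tm_in_subspace[OF subspace_keys]) (use Cons keys_fscale in \<open>force simp: G_basis tens_scale1\<close>)
    ultimately have "dlw h (i # w) \<in> {z. Poly_Mapping.keys z \<subseteq> ?S (length (i # w))}"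
      unfolding dlw.simps by (rule fmod.subspace_add[OF subspace_keys])
    then show ?case by simp
  qed simp
  from this[of "snd c" "fst c"] show ?thesis
    using assms by (cases c) (auto simp: dl_def module_fscale)
qed

subsection \<open>The antipode\<close>

text \<open>The antipode of \<open>x_i\<close>, which is minus the inverse of \<open>g_i\<close>
  times \<open>x_i\<close>.\<close>

definition sx :: "'i \<Rightarrow> ('i list \<times> 'g \<Rightarrow>\<^sub>0 'k)" where
  "sx i = - G (- g i) (basis ([i], 0))"

primrec apw :: "'g \<Rightarrow> 'i list \<Rightarrow> ('i list \<times> 'g \<Rightarrow>\<^sub>0 'k)" where
  "apw h [] = basis ([], - h)"
| "apw h (i # w) = M (tens (apw h w) (sx i))"

definition ap :: "('i list \<times> 'g \<Rightarrow>\<^sub>0 'k) \<Rightarrow> ('i list \<times> 'g \<Rightarrow>\<^sub>0 'k)" where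
  "ap = lev fscale (\<lambda>(w, h). apw h w)"

lemma ap_hom: "lin ap"
  unfolding ap_def by (rule lev_hom[OF module_fscale])

lemma ap_group: "ap (basis ([], h)) = basis ([], - h)"
  by (simp add: ap_def module_fscale)

lemma M_hom1: "module_hom s fscale f \<Longrightarrow> module_hom s fscale (\<lambda>x. M (tens (f x) q))"
  by (rule hom_compose[OF tens_hom1 M_lin])

lemma M_hom2: "module_hom s fscale f \<Longrightarrow> module_hom s fscale (\<lambda>x. M (tens q (f x)))"
  by (rule hom_compose[OF tens_hom2 M_lin])

lemma ap_L: "ap (L i p) = M (tens (ap p) (sx i))"
  by (rule hom_ext[OF hom_compose[OF L_hom ap_hom] M_hom1[OF ap_hom]], case_tac x)
    (simp add: ap_def module_fscale)

lemma sx_group: "M (tens (basis ([], - x)) (sx i)) = fscale (\<chi> i (- x)) (M (tens (sx i) (basis ([], - x))))"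
  unfolding sx_def hom_neg[OF M_hom1[OF lin_ident]] hom_neg[OF M_hom2[OF lin_ident]] G_basis
    tens_scale1 tens_scale2 hom_scale[OF M_lin] M_basis
  by (simp add: M_basis ac_simps)

lemma ap_G: "ap (G x p) = M (tens (ap p) (basis ([], - x)))"
proof (rule hom_ext_F[OF hom_compose[OF G_hom ap_hom] M_hom1[OF ap_hom]])
  show "ap (G x (basis ([], h))) = M (tens (ap (basis ([], h))) (basis ([], - x)))" for h
    by (simp only: G_basis wc_Nil fmod.scale_one ap_group minus_add tens_basis M_basis append.simps)
  fix i p
  assume IH: "ap (G x p) = M (tens (ap p) (basis ([], - x)))"
  have "ap (G x (L i p)) = fscale (\<chi> i x) (M (tens (ap p) (M (tens (basis ([], - x)) (sx i)))))"
    by (simp add: G_L hom_scale[OF ap_hom] ap_L IH M_ass)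
  also have "\<dots> = M (tens (ap (L i p)) (basis ([], - x)))"
    by (simp add: sx_group tens_scale2 hom_scale[OF M_lin] ap_L M_ass)
  finally show "ap (G x (L i p)) = M (tens (ap (L i p)) (basis ([], - x)))" .
qed

lemma ap_M: "ap (M (tens p q)) = M (tens (ap q) (ap p))"
proof (rule hom_ext_F[OF hom_compose[OF M_hom1[OF lin_ident] ap_hom] M_hom2[OF ap_hom]])
  show "ap (M (tens (basis ([], h)) q)) = M (tens (ap q) (ap (basis ([], h))))" for h
    by (simp only: G_M[symmetric] ap_G ap_group)
  show "ap (M (tens (L i p) q)) = M (tens (ap q) (ap (L i p)))"
    if "ap (M (tens p q)) = M (tens (ap q) (ap p))" for i p
    by (simp add: M_L ap_L that M_ass)
qed

lemma antipode_left: "M (tm ap (\<lambda>x. x) (dl a)) = fscale (cu a) un"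
proof (rule hom_ext_F[OF hom_compose[OF hom_compose[OF dl_lin tm_hom] M_lin] fscale_hom1[OF cu_lin]])
  show "M (tm ap (\<lambda>x. x) (dl (basis ([], h)))) = fscale (cu (basis ([], h))) un" for h
    by (simp add: dl_group tm_tens ap_hom lin_ident ap_group M_basis cu_basis un_def
        del: tens_basis) (simp add: M_basis)
  fix i p
  have "M (tm (\<lambda>x. ap (L i x)) (\<lambda>x. x) z + tm (\<lambda>x. ap (G (g i) x)) (L i) z) = M (tens 0 0)" for z
  proof (rule hom_ext2[of fscale "\<lambda>z. M (tm (\<lambda>x. ap (L i x)) (\<lambda>x. x) z + tm (\<lambda>x. ap (G (g i) x)) (L i) z)"
        "\<lambda>z. M (tens 0 0)"])
    fix p q
    \<comment> \<open>The two summands of the coproduct of \<open>x_i\<close> cancel between the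
      antipode of the left leg and the right leg.\<close>
    have "M (tens (sx i) q) + M (tens (basis ([], - g i)) (L i q)) = 0"
      unfolding sx_def hom_neg[OF M_hom1[OF lin_ident]] M_G L_M[symmetric] G_M[symmetric] by simp
    then have "M (tens (ap p) (M (tens (sx i) q) + M (tens (basis ([], - g i)) (L i q)))) = M (tens 0 0)" by simp
    then show "M (tm (\<lambda>x. ap (L i x)) (\<lambda>x. x) (tens p q) + tm (\<lambda>x. ap (G (g i) x)) (L i) (tens p q)) = M (tens 0 0)"
      unfolding tm_tens[OF hom_compose[OF L_hom ap_hom] lin_ident] tm_tens[OF hom_compose[OF G_hom ap_hom] L_hom]
      by (simp only: ap_L ap_G hom_add[OF M_lin] hom_add[OF M_hom2[OF lin_ident]] M_ass)
    show "lin (\<lambda>z. M (tm (\<lambda>x. ap (L i x)) (\<lambda>x. x) z + tm (\<lambda>x. ap (G (g i) x)) (L i) z))"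
      by (rule hom_compose[OF lin_add[OF tm_hom tm_hom] M_lin])
    show "lin (\<lambda>z :: ('i list \<times> 'g) \<times> ('i list \<times> 'g) \<Rightarrow>\<^sub>0 'k. M (tens 0 0))"
      by (simp add: hom_zero[OF M_lin] module_hom_iff module_fscale)
  qed
  then show "M (tm ap (\<lambda>x. x) (dl (L i p))) = fscale (cu (L i p)) un"
    by (simp only: dl_L hom_add[OF tm_hom] tm_tm[OF L_hom lin_ident ap_hom lin_ident] tm_tm[OF G_hom L_hom ap_hom lin_ident]
        cu_L fmod.scale_zero_left tens_zero1 hom_zero[OF M_lin])
qed

lemma antipode_right: "M (tm (\<lambda>x. x) ap (dl a)) = fscale (cu a) un"
proof (rule hom_ext_F[OF hom_compose[OF hom_compose[OF dl_lin tm_hom] M_lin] fscale_hom1[OF cu_lin]])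
  show "M (tm (\<lambda>x. x) ap (dl (basis ([], h)))) = fscale (cu (basis ([], h))) un" for h
    by (simp add: dl_group tm_tens ap_hom lin_ident ap_group M_basis cu_basis un_def
        del: tens_basis) (simp add: M_basis)
  fix i p
  assume IH: "M (tm (\<lambda>x. x) ap (dl p)) = fscale (cu p) un"
  have 1: "M (tm (L i) ap z) = L i (M (tm (\<lambda>x. x) ap z))" for z
    by (rule hom_ext2[OF hom_compose[OF tm_hom M_lin] hom_compose[OF hom_compose[OF tm_hom M_lin] L_hom]])
      (simp only: tm_tens[OF L_hom ap_hom] tm_tens[OF lin_ident ap_hom] M_L)
  have 2: "M (tm (G (g i)) (\<lambda>x. ap (L i x)) z) = G (g i) (M (tens (M (tm (\<lambda>x. x) ap z)) (sx i)))" for z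
    by (rule hom_ext2[OF hom_compose[OF tm_hom M_lin]
          hom_compose[OF M_hom1[OF hom_compose[OF tm_hom M_lin]] G_hom]])
      (simp only: tm_tens[OF G_hom hom_compose[OF L_hom ap_hom]], simp only: tm_tens[OF lin_ident ap_hom] M_G ap_L M_ass)
  have "M (tm (\<lambda>x. x) ap (dl (L i p))) = L i (fscale (cu p) un) + G (g i) (M (tens (fscale (cu p) un) (sx i)))"
    by (simp only: dl_L hom_add[OF tm_hom] hom_add[OF M_lin] tm_tm[OF L_hom lin_ident lin_ident ap_hom]
        tm_tm[OF G_hom L_hom lin_ident ap_hom] 1 2 IH)
  also have "\<dots> = fscale (cu p) (L i un + G (g i) (sx i))"
    by (simp add: tens_scale1 hom_scale[OF M_lin] hom_scale[OF L_hom] hom_scale[OF G_hom] M_un_l fmod.scale_right_distrib)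
  also have "L i un + G (g i) (sx i) = 0"
    by (simp add: sx_def hom_neg[OF G_hom] G_G G_0 un_def)
  finally show "M (tm (\<lambda>x. x) ap (dl (L i p))) = fscale (cu (L i p)) un" by simp
qed

end

context diag
begin

abbreviation "FA \<equiv> F_alg \<chi>"
abbreviation "FH \<equiv> F_hopf g \<chi>"

lemma M_flin: "flin (\<lambda>(u, a). flin (\<lambda>(v, b). fscale (wc v a) (basis (u @ v, a + b))) q) p = M (tens p q)"
  unfolding tens_def hom_lev[OF M_lin] flin_lev
  by (intro lev_cong) (auto simp: M_basis case_prod_unfold intro!: lev_cong)

text \<open>The coproduct in the statement is formed in the tensor square of \<open>F_alg\<close>,
  while the quotients are taken of \<open>F_hopf\<close>. Both records therefore have to be
  recognised as the algebra with product \<open>M\<close>.\<close>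

lemma FA_rec: "free_alg_rec M un FA"
  by (intro free_alg_rec.intro free_alg_axioms free_alg_rec_axioms.intro)
    (auto simp: F_alg_def un_def M_flin)

lemma FH_fields:
  "carrier FH = carrier FA" "add FH = add FA" "smult FH = smult FA" "zero FH = zero FA"
  "monoid.mult FH = monoid.mult FA" "one FH = one FA"
  by (simp_all add: F_hopf_def module.defs bialg.defs)

lemma FH_rec: "free_alg_rec M un FH"
  using FA_rec unfolding free_alg_rec_def free_alg_rec_axioms_def FH_fields .

sublocale free_alg_rec M un FH
  by (rule FH_rec)

lemma F_comult_word_tp: "F_comult_word g \<chi> h w = tp FA FA (\<lambda>x. x) (\<lambda>x. x) (dlw h w)"
proof (induction w)
  interpret FA: free_alg_rec M un FA by (rule FA_rec)
  note P = FA.pres_A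
  note P2 = pres_tensor[OF P P]
  have o: "\<one>\<^bsub>FA\<^esub> = un" by (simp add: FA.rec_A)
  {
    case Nil
    show ?case by (simp add: tp_tens[OF P P])
  next
    case (Cons i w)
    have un_L: "basis ([i], 0) = L i un" and un_G: "basis ([], g i) = G (g i) un"
      by (simp_all add: un_def G_basis)
    have u: "tm M M (swap23 (tens (tens un un) z)) = z" for z
      by (rule hom_ext2[OF hom_compose[OF hom_compose[OF tens_hom2[OF lin_ident] swap23_hom] tm_hom] lin_ident])
        (simp add: tm_tens M_lin M_un_l)
    have t: "tens (L i un) un + tens (G (g i) un) (L i un)
        = tm (L i) (\<lambda>x. x) (tens un un) + tm (G (g i)) (L i) (tens un un)"
      by (simp add: tm_tens L_hom G_hom lin_ident)
    have "F_comult_word g \<chi> h (i # w) = tp FA FA (\<lambda>x. x) (\<lambda>x. x)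
        (tm M M (swap23 (tens (tens (L i un) un + tens (G (g i) un) (L i un)) (dlw h w))))"
      by (simp only: F_comult_word.simps Cons.IH un_L un_G o tp_tens[OF P P] pres_add[OF P2] tensor_mult[OF FA.alg_pres_A])
    also have "tm M M (swap23 (tens (tens (L i un) un + tens (G (g i) un) (L i un)) (dlw h w))) = dlw h (i # w)"
      unfolding t tens_add1 hom_add[OF swap23_hom] hom_add[OF tm_hom]
        tm_swap_left[OF L_hom lin_ident M_lin M_lin L_hom lin_ident M_L HOL.refl]
        tm_swap_left[OF G_hom L_hom M_lin M_lin G_hom L_hom M_G M_L] u
      by simp
    finally show ?case .
  }
qed

lemma comult_FH: "comult FH p = tp FH FH (\<lambda>x. x) (\<lambda>x. x) (dl p)"
proof -
  interpret FA: free_alg_rec M un FA by (rule FA_rec)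
  note P2 = pres_tensor[OF FA.pres_A FA.pres_A]
  have "comult FH p = (\<Oplus>\<^bsub>tensor FA FA\<^esub>x\<in>Poly_Mapping.keys p.
        tp FA FA (\<lambda>x. x) (\<lambda>x. x) (fscale (Poly_Mapping.lookup p x) (dlw (snd x) (fst x))))"
    by (simp add: F_hopf_def module.defs bialg.defs F_comult_word_tp pres_smult[OF P2])
  also have "\<dots> = tp FA FA (\<lambda>x. x) (\<lambda>x. x) (dl p)"
    unfolding dl_def lev_def by (subst pres_finsum[OF P2]) (simp_all add: case_prod_unfold)
  also have "\<dots> = tp FH FH (\<lambda>x. x) (\<lambda>x. x) (dl p)"
    by (simp only: tp_def tclass_def tensor_rels_def FH_fields)
  finally show ?thesis .
qed

lemma counit_FH: "counit FH p = cu p"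
  by (auto simp: F_hopf_def module.defs bialg.defs cu_def lev_def case_prod_unfold intro!: sum.cong)

text \<open>Because of this, the elements with coproduct in \<open>tens_span I\<close> form an
  ideal, and the coideal condition can be tested on generators.\<close>

lemma tens_span_mult:
  assumes "ideal I FH" "z \<in> tens_span I"
  shows "tm M M (swap23 (tens w z)) \<in> tens_span I" "tm M M (swap23 (tens z w)) \<in> tens_span I"
proof -
  have I: "x \<in> I \<Longrightarrow> M (tens a x) \<in> I" "x \<in> I \<Longrightarrow> M (tens x a) \<in> I" for a x
    using assms(1) by (auto simp: ideal_iff)
  have 1: "lin (\<lambda>w. tm M M (swap23 (tens w z)))" and 2: "lin (\<lambda>z. tm M M (swap23 (tens w z)))" for w z
    by (rule hom_compose[OF hom_compose[OF tens_hom1[OF lin_ident] swap23_hom] tm_hom],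
        rule hom_compose[OF hom_compose[OF tens_hom2[OF lin_ident] swap23_hom] tm_hom])
  have A: "tm M M (swap23 (tens w (tens p q))) \<in> tens_span I" if "p \<in> I \<or> q \<in> I" for w p q
  proof -
    have "tm M M (swap23 (tens (tens (basis u) (basis v)) (tens p q))) \<in> tens_span I" for u v
      using that I(1) by (auto simp: tm_tens M_lin simp del: tens_basis intro: tens_spanI1 tens_spanI2)
    then have "tm M M (swap23 (tens (basis u) (tens p q))) \<in> tens_span I" for u
      by (cases u) simp
    then show ?thesis
      unfolding hom_expand[OF 1, of w] by (intro lev_in_subspace[OF tens_span_subspace])
  qed
  show "tm M M (swap23 (tens w z)) \<in> tens_span I"
    by (rule tens_span_map[OF 2 tens_span_subspace _ _ assms(2)]) (simp_all add: A)
  have B: "tm M M (swap23 (tens (tens p q) w)) \<in> tens_span I" if "p \<in> I \<or> q \<in> I" for w p q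
  proof -
    have "tm M M (swap23 (tens (tens p q) (tens (basis u) (basis v)))) \<in> tens_span I" for u v
      using that I(2) by (auto simp: tm_tens M_lin simp del: tens_basis intro: tens_spanI1 tens_spanI2)
    then have "tm M M (swap23 (tens (tens p q) (basis u))) \<in> tens_span I" for u
      by (cases u) simp
    then show ?thesis
      unfolding hom_expand[OF 2, of _ w] by (intro lev_in_subspace[OF tens_span_subspace])
  qed
  show "tm M M (swap23 (tens z w)) \<in> tens_span I"
    by (rule tens_span_map[OF 1 tens_span_subspace _ _ assms(2)]) (simp_all add: B)
qed

lemma gen_coideal:
  assumes "\<And>r. r \<in> S \<Longrightarrow> dl r \<in> tens_span (Idl\<^bsub>FH\<^esub> S)" "a \<in> Idl\<^bsub>FH\<^esub> S"
  shows "dl a \<in> tens_span (Idl\<^bsub>FH\<^esub> S)"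
proof -
  have "ideal {a. dl a \<in> tens_span (Idl\<^bsub>FH\<^esub> S)} FH"
    unfolding ideal_iff using subspace_vimage[OF dl_lin tens_span_subspace]
    by (auto simp: dl_M dl2_tens tens_span_mult[OF ideal_gen])
  from gen_minimal[OF this] assms show ?thesis by blast
qed

lemma gen_cu:
  assumes "\<And>r. r \<in> S \<Longrightarrow> cu r = 0" "a \<in> Idl\<^bsub>FH\<^esub> S" shows "cu a = 0"
proof -
  have "ideal {a. cu a = 0} FH"
    unfolding ideal_iff using subspace_kernel[OF cu_lin] by (auto simp: cu_M cu2_tens)
  from gen_minimal[OF this] assms show ?thesis by blast
qed

lemma gen_ap:
  assumes "\<And>r. r \<in> S \<Longrightarrow> ap r \<in> Idl\<^bsub>FH\<^esub> S" "a \<in> Idl\<^bsub>FH\<^esub> S" shows "ap a \<in> Idl\<^bsub>FH\<^esub> S"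
proof -
  have "ideal {a. ap a \<in> Idl\<^bsub>FH\<^esub> S} FH"
    unfolding ideal_iff using ideal_gen[of S, unfolded ideal_iff]
    by (intro conjI subspace_vimage[OF ap_hom] allI ballI) (simp_all add: ap_M)
  from gen_minimal[OF this] assms show ?thesis by blast
qed

lemma hopf_quot_gen:
  assumes "\<And>r. r \<in> S \<Longrightarrow> dl r \<in> tens_span (Idl\<^bsub>FH\<^esub> S)" "\<And>r. r \<in> S \<Longrightarrow> cu r = 0"
    "\<And>r. r \<in> S \<Longrightarrow> ap r \<in> Idl\<^bsub>FH\<^esub> S"
  shows "hopf_quot dl cu M un FH (Idl\<^bsub>FH\<^esub> S) ap"
proof (intro hopf_quot.intro free_bialg_axioms free_alg_quot.intro free_alg_rec_axioms
      free_alg_quot_axioms.intro ideal_gen hopf_quot_axioms.intro comult_FH counit_FH ap_hom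
      antipode_left antipode_right)
  fix a assume a: "a \<in> Idl\<^bsub>FH\<^esub> S"
  show "dl a \<in> tens_span (Idl\<^bsub>FH\<^esub> S)" by (rule gen_coideal[OF assms(1) a])
  show "cu a = 0" by (rule gen_cu[OF assms(2) a])
  show "ap a \<in> Idl\<^bsub>FH\<^esub> S" by (rule gen_ap[OF assms(3) a])
qed

end

section \<open>The twisted action\<close>

text \<open>\<open>dd i m\<close> is the scalar to which \<open>x_i\<close> contracts
  \<open>x_m\<close>. Its support conditions mirror membership in \<Xi>: inverse characters, and a
  strictly lower block for \<open>m\<close>.\<close>

locale diag_twist = diag g \<chi> for g :: "'i \<Rightarrow> 'g::ab_group_add" and \<chi> :: "'i \<Rightarrow> 'g \<Rightarrow> 'k::comm_ring_1" +
  fixes blk :: "'i \<Rightarrow> nat" and dd :: "'i \<Rightarrow> 'i \<Rightarrow> 'k"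
  assumes qq: "blk i \<noteq> blk j \<Longrightarrow> \<chi> j (g i) * \<chi> i (g j) = 1"
    and dd_char: "dd i m \<noteq> 0 \<Longrightarrow> \<chi> i h * \<chi> m h = 1"
    and dd_blk: "dd i m \<noteq> 0 \<Longrightarrow> blk m < blk i"
begin

lemma dd_char': "dd i m \<noteq> 0 \<Longrightarrow> \<chi> m h = \<chi> i (- h)"
proof -
  assume "dd i m \<noteq> 0"
  then have "\<chi> i h * \<chi> m h = 1" by (rule dd_char)
  then have "\<chi> i (- h) * (\<chi> i h * \<chi> m h) = \<chi> i (- h)" by simp
  then show ?thesis by (simp add: mult.assoc[symmetric])
qed

section \<open>The skew derivations\<close>

primrec Dw :: "'i \<Rightarrow> 'g \<Rightarrow> 'i list \<Rightarrow> ('i list \<times> 'g \<Rightarrow>\<^sub>0 'k)" where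
  "Dw i h [] = 0"
| "Dw i h (m # w) = fscale (dd i m) (basis (w, h)) + fscale (\<chi> i (- g m)) (L m (Dw i h w))"

definition D :: "'i \<Rightarrow> ('i list \<times> 'g \<Rightarrow>\<^sub>0 'k) \<Rightarrow> ('i list \<times> 'g \<Rightarrow>\<^sub>0 'k)" where
  "D i = lev fscale (\<lambda>(w, h). Dw i h w)"

lemma D_hom: "lin (D i)"
  unfolding D_def by (rule lev_hom[OF module_fscale])

lemma D_group [simp]: "D i (basis ([], h)) = 0"
  by (simp add: D_def module_fscale)

lemma D_L: "D i (L m p) = fscale (dd i m) p + fscale (\<chi> i (- g m)) (L m (D i p))"
  by (rule hom_ext[OF hom_compose[OF L_hom D_hom]
        lin_add[OF fscale_hom2[OF lin_ident] fscale_hom2[OF hom_compose[OF D_hom L_hom]]]], case_tac x)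
    (simp add: D_def module_fscale)

lemma D_G: "D i (G x p) = fscale (\<chi> i (- x)) (G x (D i p))"
proof (rule hom_ext_F[OF hom_compose[OF G_hom D_hom] fscale_hom2[OF hom_compose[OF D_hom G_hom]]])
  show "D i (G x (basis ([], h))) = fscale (\<chi> i (- x)) (G x (D i (basis ([], h))))" for h
    by (simp add: G_basis hom_zero[OF G_hom])
  fix m p
  assume IH: "D i (G x p) = fscale (\<chi> i (- x)) (G x (D i p))"
  \<comment> \<open>A nonzero contraction forces \<open>\<chi> m\<close> to be inverse to
    \<open>\<chi> i\<close>, so moving the group element past \<open>x_m\<close> costs the same
    scalar as moving it past \<open>D i\<close>.\<close>
  have e: "\<chi> m x * dd i m = \<chi> i (- x) * dd i m" using dd_char'[of i m x] by (cases "dd i m = 0") simp_all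
  have "D i (G x (L m p)) = fscale (\<chi> m x * dd i m) (G x p) + fscale (\<chi> m x * (\<chi> i (- g m) * \<chi> i (- x))) (L m (G x (D i p)))"
    by (simp add: G_L hom_scale[OF D_hom] D_L IH fmod.scale_right_distrib hom_scale[OF L_hom])
  also have "\<dots> = fscale (\<chi> i (- x)) (G x (D i (L m p)))"
    by (simp add: D_L hom_add[OF G_hom] hom_scale[OF G_hom] G_L fmod.scale_right_distrib e ac_simps)
  finally show "D i (G x (L m p)) = fscale (\<chi> i (- x)) (G x (D i (L m p)))" .
qed

text \<open>Both parts of the coproduct of \<open>x_m\<close> yield the same scalar
  \<open>\<chi> i (- g m)\<close>: \<open>L m\<close> through the skew Leibniz rule, and
  \<open>G (g m)\<close> through \<open>D_G\<close>.\<close>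

lemma dl_D: "dl (D i p) = tm (D i) (\<lambda>x. x) (dl p)"
proof (rule hom_ext_F[OF hom_compose[OF D_hom dl_lin] hom_compose[OF dl_lin tm_hom]])
  show "dl (D i (basis ([], h))) = tm (D i) (\<lambda>x. x) (dl (basis ([], h)))" for h
    by (simp add: dl_group tm_tens D_hom lin_ident hom_zero[OF dl_lin] del: tens_basis)
  fix m p
  assume IH: "dl (D i p) = tm (D i) (\<lambda>x. x) (dl p)"
  let ?c = "\<chi> i (- g m)" and ?z = "dl p"
  have "tm (D i) (\<lambda>x. x) (dl (L m p)) = tm (\<lambda>x. D i (L m x)) (\<lambda>x. x) ?z + tm (\<lambda>x. D i (G (g m) x)) (L m) ?z"
    by (simp add: dl_L hom_add[OF tm_hom] tm_tm L_hom G_hom D_hom lin_ident)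
  also have "\<dots> = fscale (dd i m) ?z + fscale ?c (tm (\<lambda>x. L m (D i x)) (\<lambda>x. x) ?z) + fscale ?c (tm (\<lambda>x. G (g m) (D i x)) (L m) ?z)"
    by (simp add: D_L D_G tm_add1 tm_scale1 tm_id)
  also have "\<dots> = fscale (dd i m) ?z + fscale ?c (dl (L m (D i p)))"
    by (simp add: dl_L IH tm_tm L_hom G_hom D_hom lin_ident fmod.scale_right_distrib)
  also have "\<dots> = dl (D i (L m p))"
    by (simp add: D_L hom_add[OF dl_lin] hom_scale[OF dl_lin])
  finally show "dl (D i (L m p)) = tm (D i) (\<lambda>x. x) (dl (L m p))" by simp
qed

definition d :: "'i \<Rightarrow> ('i list \<times> 'g \<Rightarrow>\<^sub>0 'k) \<Rightarrow> 'k" where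
  "d i p = cu (D i p)"

lemma d_hom: "linf (d i)"
  unfolding d_def by (rule hom_compose[OF D_hom cu_lin])

lemma D_lc: "D i p = lc (d i) p"
  unfolding d_def by (rule colinear_lc[OF D_hom dl_D])

lemma D_keys: "x \<in> Poly_Mapping.keys (D i (basis (w, h))) \<Longrightarrow> length (fst x) < length w"
proof -
  have "Poly_Mapping.keys (Dw i h w) \<subseteq> {x. length (fst x) < length w}"
  proof (induction w)
    case (Cons m w)
    let ?U = "{z :: 'i list \<times> 'g \<Rightarrow>\<^sub>0 'k. Poly_Mapping.keys z \<subseteq> {x. length (fst x) < length (m # w)}}"
    have "L m (Dw i h w) \<in> ?U"
      unfolding L_def by (rule lev_in_subspace[OF subspace_keys]) (use Cons in auto)
    then have "Dw i h (m # w) \<in> ?U"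
      unfolding Dw.simps by (intro fmod.subspace_add[OF subspace_keys] fmod.subspace_scale[OF subspace_keys]) simp_all
    then show ?case by simp
  qed simp
  then show "x \<in> Poly_Mapping.keys (D i (basis (w, h))) \<Longrightarrow> length (fst x) < length w"
    by (auto simp: D_def module_fscale)
qed

section \<open>The action of \<open>F\<close> on itself\<close>

definition X :: "'i \<Rightarrow> ('i list \<times> 'g \<Rightarrow>\<^sub>0 'k) \<Rightarrow> ('i list \<times> 'g \<Rightarrow>\<^sub>0 'k)" where
  "X i p = L i p + D i p"

lemma X_hom: "lin (X i)"
  unfolding X_def by (rule lin_add[OF L_hom D_hom])

lemma G_D: "G x (D i p) = fscale (\<chi> i x) (D i (G x p))"
  by (simp add: D_G)

lemma G_X: "G x (X i p) = fscale (\<chi> i x) (X i (G x p))"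
  by (simp add: X_def hom_add[OF G_hom] G_L G_D fmod.scale_right_distrib)

lemma dl_X: "dl (X i p) = tm (X i) (\<lambda>x. x) (dl p) + tm (G (g i)) (L i) (dl p)"
proof -
  have "X i = (\<lambda>p. L i p + D i p)" by (rule ext) (rule X_def)
  then show ?thesis by (simp add: hom_add[OF dl_lin] dl_L dl_D tm_add1)
qed

definition act :: "('i list \<times> 'g \<Rightarrow>\<^sub>0 'k) \<Rightarrow> ('i list \<times> 'g \<Rightarrow>\<^sub>0 'k) \<Rightarrow> ('i list \<times> 'g \<Rightarrow>\<^sub>0 'k)" where
  "act p y = lev fscale (\<lambda>(w, h). foldr X w (G h y)) p"

lemma foldr_X_hom: "lin (foldr X w)"
proof (induction w)
  case Nil
  show ?case by (simp add: id_def lin_ident)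
next
  case (Cons i w)
  show ?case using hom_compose[OF Cons X_hom] by (simp add: o_def)
qed

lemma act_bil: "bil fscale act"
proof (rule bilI)
  show "lin (\<lambda>p. act p y)" for y unfolding act_def by (rule lev_hom[OF module_fscale])
  show "lin (\<lambda>y. act p y)" for p
    unfolding act_def by (rule lev_fun_hom[OF module_fscale module_fscale], clarsimp)
      (rule hom_compose[OF G_hom foldr_X_hom])
qed

lemmas act_hom1 = bil1[OF act_bil] and act_hom2 = bil2[OF act_bil]

lemma act_group [simp]: "act (basis ([], h)) y = G h y"
  by (simp add: act_def module_fscale)

lemma act_L: "act (L i p) y = X i (act p y)"
  by (rule hom_ext[OF hom_compose[OF L_hom act_hom1] hom_compose[OF act_hom1 X_hom]], case_tac x)
    (simp add: act_def module_fscale)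

lemma act_G: "act (G x p) y = G x (act p y)"
proof (rule hom_ext_F[OF hom_compose[OF G_hom act_hom1] hom_compose[OF act_hom1 G_hom]])
  show "act (G x (basis ([], h))) y = G x (act (basis ([], h)) y)" for h
    by (simp add: G_basis G_G)
  show "act (G x (L i p)) y = G x (act (L i p) y)" if "act (G x p) y = G x (act p y)" for i p
    by (simp add: G_L hom_scale[OF act_hom1] act_L that G_X)
qed

text \<open>The only relation between letters and group elements in \<open>F\<close> is their
  commutation rule, and the operators \<open>X i\<close> satisfy it by \<open>G_X\<close>. Hence
  they define a module.\<close>

lemma act_M: "act (M (tens p q)) y = act p (act q y)"
proof (rule hom_ext_F[OF hom_compose[OF M_hom1[OF lin_ident] act_hom1] act_hom1])
  show "act (M (tens (basis ([], h)) q)) y = act (basis ([], h)) (act q y)" for h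
    by (simp add: G_M[symmetric] act_G)
  show "act (M (tens (L i p) q)) y = act (L i p) (act q y)" if "act (M (tens p q)) y = act p (act q y)" for i p
    by (simp add: M_L act_L that)
qed

definition AM :: "(('i list \<times> 'g) \<times> ('i list \<times> 'g) \<Rightarrow>\<^sub>0 'k) \<Rightarrow> ('i list \<times> 'g \<Rightarrow>\<^sub>0 'k)" where
  "AM = pr fscale act"

lemma AM_hom: "lin AM"
  unfolding AM_def by (rule pr_hom[OF module_fscale])

lemma AM_tens: "AM (tens p y) = act p y"
  unfolding AM_def by (rule pr_tens[OF act_bil])

text \<open>By \<open>dl_X\<close> a letter acts as \<open>X i\<close> on left legs but as plain
  multiplication on right legs. The action is therefore determined by the pairing
  \<open>cu (act p y)\<close>, which \<open>act_skew\<close> exploits.\<close>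

lemma dl_act: "dl (act p y) = tm AM M (swap23 (tens (dl p) (dl y)))"
proof (rule hom_ext_F[of fscale "\<lambda>p. dl (act p y)" "\<lambda>p. tm AM M (swap23 (tens (dl p) (dl y)))"])
  show "lin (\<lambda>p. dl (act p y))" by (rule hom_compose[OF act_hom1 dl_lin])
  show "lin (\<lambda>p. tm AM M (swap23 (tens (dl p) (dl y))))"
    by (rule hom_compose[OF hom_compose[OF tens_hom1[OF dl_lin] swap23_hom] tm_hom])
  show "dl (act (basis ([], h)) y) = tm AM M (swap23 (tens (dl (basis ([], h))) (dl y)))" for h
  proof -
    have "tm AM M (swap23 (tens (tens (basis ([], h)) (basis ([], h))) w)) = tm (G h) (G h) w" for w
      by (rule hom_ext2[OF hom_compose[OF hom_compose[OF tens_hom2[OF lin_ident] swap23_hom] tm_hom] tm_hom])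
        (simp add: tm_tens M_lin AM_hom AM_tens G_hom G_M[symmetric] del: tens_basis)
    then show ?thesis by (simp add: dl_G dl_group del: tens_basis)
  qed
  fix i p
  assume IH: "dl (act p y) = tm AM M (swap23 (tens (dl p) (dl y)))"
  have 1: "AM (tens (L i p) q) = X i (AM (tens p q))" "AM (tens (G x p) q) = G x (AM (tens p q))" for p q x
    by (simp_all add: AM_tens act_L act_G)
  show "dl (act (L i p) y) = tm AM M (swap23 (tens (dl (L i p)) (dl y)))"
    unfolding act_L dl_X IH dl_L tens_add1 hom_add[OF swap23_hom] hom_add[OF tm_hom]
      tm_swap_left[OF L_hom lin_ident AM_hom M_lin X_hom lin_ident 1(1) HOL.refl]
      tm_swap_left[OF G_hom L_hom AM_hom M_lin G_hom L_hom 1(2) M_L] ..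
qed

section \<open>The colinear bijection and its inverse\<close>

definition theta :: "('i list \<times> 'g \<Rightarrow>\<^sub>0 'k) \<Rightarrow> ('i list \<times> 'g \<Rightarrow>\<^sub>0 'k)" where
  "theta p = act p un"

lemma theta_hom: "lin theta"
  unfolding theta_def by (rule act_hom1)

lemma theta_group: "theta (basis ([], h)) = basis ([], h)"
  by (simp add: theta_def un_def G_basis)

lemma theta_L: "theta (L i p) = X i (theta p)"
  by (simp add: theta_def act_L)

lemma dl_theta: "dl (theta p) = tm theta (\<lambda>x. x) (dl p)"
proof -
  have "tm AM M (swap23 (tens z (tens un un))) = tm theta (\<lambda>x. x) z" for z
    by (rule hom_ext2[OF hom_compose[OF hom_compose[OF tens_hom1[OF lin_ident] swap23_hom] tm_hom] tm_hom])
      (simp add: tm_tens M_lin AM_hom AM_tens theta_hom lin_ident M_un_r theta_def[symmetric])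
  then show ?thesis by (simp add: theta_def dl_act dl_un)
qed

text \<open>The inverse of \<open>theta\<close> on words. The recursion is forced by the requirement
  that it turn \<open>X i\<close> into \<open>L i\<close>, and it terminates because
  \<open>D i\<close> shortens words.\<close>

function tw :: "'i list \<times> 'g \<Rightarrow> ('i list \<times> 'g \<Rightarrow>\<^sub>0 'k)" where
  "tw ([], h) = basis ([], h)"
| "tw (i # w, h) = L i (tw (w, h)) - (\<Sum>x\<in>Poly_Mapping.keys (D i (basis (w, h))).
     fscale (Poly_Mapping.lookup (D i (basis (w, h))) x) (tw x))"
  by (auto, metis list.exhaust)
termination
  by (relation "measure (\<lambda>(w, h). length w)") (auto dest: D_keys)

definition theta' :: "('i list \<times> 'g \<Rightarrow>\<^sub>0 'k) \<Rightarrow> ('i list \<times> 'g \<Rightarrow>\<^sub>0 'k)" where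
  "theta' = lev fscale tw"

lemma theta'_hom: "lin theta'"
  unfolding theta'_def by (rule lev_hom[OF module_fscale])

lemma theta'_L: "theta' (L i p) = L i (theta' p) - theta' (D i p)"
  by (rule hom_ext[OF hom_compose[OF L_hom theta'_hom]
        lin_minus[OF hom_compose[OF theta'_hom L_hom] hom_compose[OF D_hom theta'_hom]]], case_tac x)
    (simp add: theta'_def module_fscale lev_def[of _ _ "D _ _"])

lemma theta'_X: "theta' (X i p) = L i (theta' p)"
  by (simp add: X_def hom_add[OF theta'_hom] theta'_L)

lemma theta'_theta [simp]: "theta' (theta p) = p"
proof (rule hom_ext_F[OF hom_compose[OF theta_hom theta'_hom] lin_ident])
  show "theta' (theta (basis ([], h))) = basis ([], h)" for h
    by (simp add: theta_group) (simp add: theta'_def module_fscale)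
qed (simp add: theta_L theta'_X)

lemma theta_theta' [simp]: "theta (theta' p) = p"
proof (rule hom_ext[OF hom_compose[OF theta'_hom theta_hom] lin_ident])
  fix x :: "'i list \<times> 'g"
  show "theta (theta' (basis x)) = basis x"
  proof (induction "length (fst x)" arbitrary: x rule: less_induct)
    case less
    obtain w h where x: "x = (w, h)" by (cases x)
    show ?case
    proof (cases w)
      case Nil
      then show ?thesis by (simp add: x theta'_def module_fscale theta_group)
    next
      case (Cons i v)
      have 1: "theta (theta' (basis (v, h))) = basis (v, h)"
        using less[of "(v, h)"] by (simp add: x Cons)
      have "theta (theta' (D i (basis (v, h)))) = lev fscale (\<lambda>y. theta (theta' (basis y))) (D i (basis (v, h)))"
        by (rule hom_expand[OF hom_compose[OF theta'_hom theta_hom]])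
      also have "\<dots> = lev fscale basis (D i (basis (v, h)))"
        using D_keys less by (intro lev_cong) (fastforce simp: x Cons)
      finally have 2: "theta (theta' (D i (basis (v, h)))) = D i (basis (v, h))"
        by (simp add: lev_basis_expand)
      have "theta (theta' (L i (basis (v, h)))) = L i (basis (v, h))"
        unfolding theta'_L hom_sub[OF theta_hom] theta_L 1 2 by (simp add: X_def)
      then show ?thesis by (simp add: x Cons)
    qed
  qed
qed

lemma dl_theta': "dl (theta' p) = tm theta' (\<lambda>x. x) (dl p)"
proof -
  have "tm theta' (\<lambda>x. x) (dl (theta (theta' p))) = tm (\<lambda>x. theta' (theta x)) (\<lambda>x. x) (dl (theta' p))"
    unfolding dl_theta by (rule tm_tm[OF theta_hom lin_ident theta'_hom lin_ident])
  then show ?thesis by (simp add: tm_id)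
qed

definition f :: "('i list \<times> 'g \<Rightarrow>\<^sub>0 'k) \<Rightarrow> 'k" where "f p = cu (theta' p)"
definition f' :: "('i list \<times> 'g \<Rightarrow>\<^sub>0 'k) \<Rightarrow> 'k" where "f' p = cu (theta p)"

lemma f_lin: "linf f" and f'_lin: "linf f'"
  unfolding f_def f'_def by (rule hom_compose[OF theta'_hom cu_lin] hom_compose[OF theta_hom cu_lin])+

lemma theta_lc: "theta = lc f'" and theta'_lc: "theta' = lc f"
  unfolding f_def f'_def by (rule ext, rule colinear_lc[OF theta_hom dl_theta], rule ext, rule colinear_lc[OF theta'_hom dl_theta'])

lemma theta'_un: "theta' un = un"
  by (simp add: un_def theta'_def module_fscale)

sublocale coboundary dl cu M un f f'
proof (intro coboundary.intro free_bialg_axioms coboundary_axioms.intro f_lin f'_lin)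
  show "f un = 1" by (simp add: f_def theta'_un cu_un)
  show "conv f f' = cu"
    by (rule ext) (simp add: form_lc[OF f'_lin, symmetric] theta'_lc[symmetric] f'_def)
  show "conv f' f = cu"
    by (rule ext) (simp add: form_lc[OF f_lin, symmetric] theta_lc[symmetric] f_def)
qed

text \<open>\<open>theta\<close> is a module map from \<open>F\<close> with left multiplication to
  \<open>F\<close> with the twisted action. So the transported product is the twisted action of the
  preimage of the first argument.\<close>

lemma star_act: "star (tens x y) = act (theta' x) y"
proof -
  have "th = theta" "th' = theta'" by (simp_all add: th_def th'_def theta_lc theta'_lc)
  then have "star (tens x y) = theta (M (tens (theta' x) (theta' y)))"
    by (simp add: star_def tm_tens theta'_hom)
  also have "\<dots> = act (theta' x) (theta (theta' y))" unfolding theta_def by (rule act_M)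
  finally show ?thesis by simp
qed

end

section \<open>The defining ideals\<close>

lemma lin_zero: "lin (\<lambda>x. 0)"
  by (simp add: module_hom_iff module_fscale)

context diag_twist
begin

lemma theta'_G: "theta' (G x p) = G x (theta' p)"
proof -
  have "theta (G x (theta' p)) = G x p" by (simp add: theta_def act_G) (simp add: theta_def[symmetric])
  then have "theta' (G x p) = theta' (theta (G x (theta' p)))" by simp
  then show ?thesis by simp
qed

lemma theta_M: "theta (M (tens v z)) = act v (theta z)"
  by (simp add: theta_def act_M)

lemma M_words: "M (tens (basis (w, h)) x) = foldr L w (G h x)"
  by (induction w) (simp_all add: G_M[symmetric] M_L flip: L_basis)

lemma d_L: "d i (L m p) = dd i m * cu p"
  by (simp add: d_def D_L hom_add[OF cu_lin] hom_scale[OF cu_lin])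

lemma d_group [simp]: "d i (basis ([], h)) = 0"
  by (simp add: d_def hom_zero[OF cu_lin])

lemma d_G: "d i (G x p) = \<chi> i (- x) * d i p"
  by (simp add: d_def D_G hom_scale[OF cu_lin])

text \<open>The counit and all forms \<open>d i\<close> vanish on words of length at least two.
  Containing the relations in this ideal makes the ideals they generate stable under the skew
  derivations.\<close>

definition len2 :: "('i list \<times> 'g \<Rightarrow>\<^sub>0 'k) set" where
  "len2 = {p. Poly_Mapping.keys p \<subseteq> {x. 2 \<le> length (fst x)}}"

lemma len2_subspace: "fmod.subspace len2"
  unfolding len2_def by (rule subspace_keys)

lemma len2_ideal: "ideal len2 FH"
  unfolding ideal_iff
proof (intro conjI allI ballI len2_subspace)
  have b: "M (basis (u, v)) \<in> len2" if "2 \<le> length (fst u) + length (fst v)" for u v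
  proof -
    have "M (basis ((fst u, snd u), (fst v, snd v))) \<in> len2"
      unfolding M_basis by (rule fmod.subspace_scale[OF len2_subspace]) (use that in \<open>simp add: len2_def\<close>)
    then show ?thesis by simp
  qed
  fix a x assume x: "x \<in> len2"
  have "M (tens a x) = lev fscale (\<lambda>u. lev fscale (\<lambda>v. M (basis (u, v))) x) a"
    unfolding tens_def hom_lev[OF M_lin] ..
  also have "\<dots> \<in> len2"
    using x by (intro lev_in_subspace[OF len2_subspace] b) (auto simp: len2_def)
  finally show "M (tens a x) \<in> len2" .
  have "M (tens x a) = lev fscale (\<lambda>u. lev fscale (\<lambda>v. M (basis (u, v))) a) x"
    unfolding tens_def hom_lev[OF M_lin] ..
  also have "\<dots> \<in> len2"
    using x by (intro lev_in_subspace[OF len2_subspace] b) (auto simp: len2_def)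
  finally show "M (tens x a) \<in> len2" .
qed

lemma len2_word: "2 \<le> length w \<Longrightarrow> basis (w, h) \<in> len2"
  by (simp add: len2_def)

lemma len2_cu:
  assumes "p \<in> len2" shows "cu p = 0"
proof -
  have "fmod.subspace {p. cu p = 0}" by (rule subspace_kernel[OF cu_lin])
  then have "lev fscale basis p \<in> {p. cu p = 0}"
    using assms by (intro lev_in_subspace) (auto simp: len2_def cu_basis)
  then show ?thesis by (simp add: lev_basis_expand)
qed

lemma len2_d:
  assumes "p \<in> len2" shows "d i p = 0"
proof -
  have w: "d i (basis (w, h)) = 0" if "2 \<le> length w" for w h
    using that by (cases w) (auto simp: d_L cu_basis simp flip: L_basis)
  have "fmod.subspace {p. d i p = 0}" by (rule subspace_kernel[OF d_hom])
  then have "lev fscale basis p \<in> {p. d i p = 0}"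
    using assms by (intro lev_in_subspace) (auto simp: len2_def w)
  then show ?thesis by (simp add: lev_basis_expand)
qed

text \<open>\<open>D i\<close> is \<open>lc (d i)\<close>, and \<open>lc\<close> of a form that
  kills a coideal preserves it; the other half \<open>L i\<close> of \<open>X i\<close> preserves
  any ideal.\<close>

lemma act_stable:
  assumes "ideal I FH" "\<And>a. a \<in> I \<Longrightarrow> dl a \<in> tens_span I" "I \<subseteq> len2" "y \<in> I"
  shows "act p y \<in> I"
proof -
  have s: "fmod.subspace I" and m: "\<And>a x. x \<in> I \<Longrightarrow> M (tens a x) \<in> I"
    using assms(1) by (simp_all add: ideal_iff)
  have D: "D i x \<in> I" if "x \<in> I" for i x
    unfolding D_lc by (rule lc_stable[OF s assms(2) d_hom _ that]) (use assms(3) len2_d in auto)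
  have "X i x \<in> I" if "x \<in> I" for i x
    unfolding X_def L_M by (intro fmod.subspace_add[OF s] m D that)
  then have "foldr X w (G h y) \<in> I" for w h
    by (induction w) (simp_all add: G_M m assms(4))
  then show ?thesis
    unfolding act_def by (intro lev_in_subspace[OF s]) auto
qed

subsection \<open>The quantum commutators\<close>

definition u :: "'i \<Rightarrow> 'i \<Rightarrow> ('i list \<times> 'g \<Rightarrow>\<^sub>0 'k)" where
  "u i j = basis ([i, j], 0) - fscale (\<chi> j (g i)) (basis ([j, i], 0))"

lemma u_L: "u i j = L i (L j un) - fscale (\<chi> j (g i)) (L j (L i un))"
  by (simp add: u_def un_def)

lemma M_u: "M (tens (u i j) y) = L i (L j y) - fscale (\<chi> j (g i)) (L j (L i y))"
  by (simp add: u_L hom_sub[OF M_hom1[OF lin_ident]] tens_scale1 hom_scale[OF M_lin] M_L M_un_l)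

lemma act_u: "act (u i j) y = X i (X j y) - fscale (\<chi> j (g i)) (X j (X i y))"
  by (simp add: u_L hom_sub[OF act_hom1] hom_scale[OF act_hom1] act_L) (simp add: un_def G_0)

lemma u_len2: "u i j \<in> len2"
  unfolding u_def
  by (intro fmod.subspace_diff[OF len2_subspace] fmod.subspace_scale[OF len2_subspace] len2_word) simp_all

context
  fixes i j assumes ij: "blk j < blk i"
begin

lemma q_swap': "\<chi> i (- g j) = \<chi> j (g i)"
proof -
  have "\<chi> i (- g j) * (\<chi> i (g j) * \<chi> j (g i)) = \<chi> i (- g j)" using qq[of i j] ij by (simp add: mult.commute)
  then show ?thesis by (simp add: mult.assoc[symmetric])
qed

text \<open>Induction on words; after expanding both sides on a word starting with
  \<open>x_m\<close>, the claim is a match of the scalars at the two single contractions of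
  \<open>x_m\<close>, which are \<open>e1\<close> and \<open>e2\<close>.\<close>

lemma D_D: "D i (D j p) = fscale (\<chi> j (g i)) (D j (D i p))"
proof (cases "\<forall>n. dd j n = 0")
  case True
  have "D j p = 0" for p
  proof (rule hom_ext_F[OF D_hom lin_zero])
    show "D j (L m p) = 0" if "D j p = 0" for m p using that True by (simp add: D_L hom_zero[OF L_hom])
  qed simp
  then show ?thesis by (simp add: hom_zero[OF D_hom])
next
  case False
  \<comment> \<open>A letter that \<open>D j\<close> really contracts; its character is the inverse
    of \<open>\<chi> j\<close>.\<close>
  then obtain n where n: "dd j n \<noteq> 0" by blast
  show ?thesis
  proof (rule hom_ext_F[OF hom_compose[OF D_hom D_hom] fscale_hom2[OF hom_compose[OF D_hom D_hom]]])
    show "D i (D j (basis ([], h))) = fscale (\<chi> j (g i)) (D j (D i (basis ([], h))))" for h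
      by (simp add: hom_zero[OF D_hom])
    fix m p
    assume IH: "D i (D j p) = fscale (\<chi> j (g i)) (D j (D i p))"
    have e1: "dd j m = \<chi> j (g i) * (\<chi> i (- g m) * dd j m)"
    proof (cases "dd j m = 0")
      case False
      have "blk m < blk i" using dd_blk[OF False] ij by simp
      then have "\<chi> m (g i) * \<chi> i (g m) = 1" using qq[of i m] by simp
      then have "\<chi> i (- g m) * (\<chi> m (g i) * \<chi> i (g m)) = \<chi> i (- g m)" by simp
      then have "\<chi> i (- g m) = \<chi> m (g i)" by (simp add: mult.left_commute[of "\<chi> i (- g m)"])
      then show ?thesis using dd_char[OF False, of "g i"] by (simp add: mult.assoc[symmetric])
    qed simp
    have e2: "\<chi> j (- g m) * dd i m = \<chi> j (g i) * dd i m"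
    proof (cases "dd i m = 0")
      case False
      have "\<chi> j (- g m) = \<chi> j (g i)"
      proof (cases "blk m = blk j")
        case True
        \<comment> \<open>\<open>m\<close> and \<open>j\<close> share a block, so nothing is known
          about their mutual braiding. The chain of equalities passes through \<open>n\<close>,
          whose block is below those of \<open>m\<close> and of \<open>i\<close>.\<close>
        have n_m: "blk n < blk m" and n_i: "blk n < blk i" using dd_blk[OF n] True ij by simp_all
        have a: "\<chi> m h * \<chi> m (- h) = 1" for h by simp
        have "\<chi> j (- g m) = \<chi> n (g m)" using dd_char'[OF n, of "g m"] by simp
        also have "\<dots> = \<chi> m (- g n)"
          using qq[of m n] n_m a[of "g n"] by (metis mult.assoc mult.commute mult_1 less_irrefl)
        also have "\<dots> = \<chi> i (g n)" using dd_char'[OF False, of "- g n"] by simp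
        also have "\<dots> = \<chi> n (- g i)"
          using qq[of i n] n_i \<chi>_inv[of n "g i"] by (metis mult.assoc mult.commute mult_1 less_irrefl)
        also have "\<dots> = \<chi> j (g i)" using dd_char'[OF n, of "- g i"] by simp
        finally show ?thesis .
      next
        case False
        have "\<chi> j (- g m) = \<chi> m (g j)"
          using qq[of m j] False \<chi>_inv[of j "g m"] by (metis mult.assoc mult.commute mult_1)
        also have "\<dots> = \<chi> i (- g j)" using dd_char'[OF \<open>dd i m \<noteq> 0\<close>] by simp
        finally show ?thesis by (simp add: q_swap')
      qed
      then show ?thesis by simp
    qed simp
    have A: "D i (D j (L m p)) = fscale (dd j m) (D i p) + fscale (\<chi> j (- g m) * dd i m) (D j p)
        + fscale (\<chi> j (- g m) * \<chi> i (- g m)) (L m (D i (D j p)))"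
      by (simp add: D_L hom_add[OF D_hom] hom_scale[OF D_hom] fmod.scale_right_distrib ac_simps)
    have B: "fscale (\<chi> j (g i)) (D j (D i (L m p))) = fscale (\<chi> j (g i) * dd i m) (D j p)
        + fscale (\<chi> j (g i) * (\<chi> i (- g m) * dd j m)) (D i p)
        + fscale (\<chi> j (g i) * (\<chi> i (- g m) * \<chi> j (- g m))) (L m (D j (D i p)))"
      by (simp add: D_L hom_add[OF D_hom] hom_scale[OF D_hom] fmod.scale_right_distrib ac_simps)
    show "D i (D j (L m p)) = fscale (\<chi> j (g i)) (D j (D i (L m p)))"
      unfolding A B e1[symmetric] e2 IH hom_scale[OF L_hom] by (simp add: ac_simps)
  qed
qed

text \<open>Expanding the commutator of \<open>X i\<close> and \<open>X j\<close>, the double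
  contractions cancel by \<open>D_D\<close> and the mixed terms by the braiding condition; since the
  lower letter does not contract the higher one, a single scalar remains.\<close>

lemma act_u_eq: "act (u i j) y = M (tens (u i j) y) + fscale (dd i j) y"
proof -
  have "dd j i = 0" using dd_blk[of j i] ij by (cases "dd j i = 0") auto
  then have "act (u i j) y = L i (L j y) - fscale (\<chi> j (g i)) (L j (L i y)) + fscale (dd i j) y
      + (fscale (\<chi> i (- g j)) (L j (D i y)) - fscale (\<chi> j (g i)) (L j (D i y)))
      + (L i (D j y) - fscale (\<chi> j (g i) * \<chi> j (- g i)) (L i (D j y)))"
    by (simp add: act_u X_def hom_add[OF L_hom] hom_add[OF D_hom] D_L D_D fmod.scale_right_distrib algebra_simps)
  then show ?thesis by (simp add: M_u q_swap')
qed

text \<open>The contractions of \<open>x_k\<close> with either letter of the commutator cancel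
  between its two terms; \<open>e1\<close> and \<open>e2\<close> compare their scalars.\<close>

lemma D_M_u: "D k (M (tens (u i j) b)) = fscale (\<chi> k (- g i) * \<chi> k (- g j)) (M (tens (u i j) (D k b)))"
proof -
  have e1: "\<chi> j (g i) * (\<chi> k (- g j) * dd k i) = dd k i"
  proof (cases "dd k i = 0")
    case False
    have "\<chi> k (- g j) = \<chi> i (g j)" using dd_char'[OF False] by simp
    then show ?thesis using qq[of i j] ij by (simp add: mult.assoc[symmetric])
  qed simp
  have e2: "\<chi> k (- g i) * dd k j = \<chi> j (g i) * dd k j"
    using dd_char'[of k j "g i"] by (cases "dd k j = 0") simp_all
  have "D k (M (tens (u i j) b)) = fscale (dd k i - \<chi> j (g i) * (\<chi> k (- g j) * dd k i)) (L j b)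
      + fscale (\<chi> k (- g i) * dd k j - \<chi> j (g i) * dd k j) (L i b)
      + fscale (\<chi> k (- g i) * \<chi> k (- g j)) (L i (L j (D k b)) - fscale (\<chi> j (g i)) (L j (L i (D k b))))"
    by (simp add: M_u hom_sub[OF D_hom] hom_scale[OF D_hom] D_L hom_add[OF L_hom] hom_scale[OF L_hom]
        fmod.scale_right_distrib fmod.scale_right_diff_distrib fmod.scale_left_diff_distrib ac_simps)
  then show ?thesis by (simp add: e1 e2 M_u)
qed

text \<open>By \<open>act_u_eq\<close> the element \<open>u i j - dd i j\<close> acts as left
  multiplication by \<open>u i j\<close>; the claim follows since \<open>theta\<close> intertwines
  the two module structures.\<close>

lemma theta'_M_u: "theta' (M (tens (u i j) b)) = M (tens (u i j - fscale (dd i j) un) (theta' b))"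
proof -
  have "theta (M (tens (u i j - fscale (dd i j) un) (theta' b))) = M (tens (u i j) b)"
    unfolding theta_M by (simp add: hom_sub[OF act_hom1] hom_scale[OF act_hom1] act_u_eq) (simp add: un_def G_0)
  then have "theta' (M (tens (u i j) b)) = theta' (theta (M (tens (u i j - fscale (dd i j) un) (theta' b))))" by simp
  then show ?thesis by simp
qed

text \<open>Of the two pairs of mixed terms, the one with \<open>x_i\<close> on the right leg
  cancels by the commutation rule of \<open>g_i\<close> and \<open>x_j\<close>. The one with
  \<open>x_j\<close> on the right leg needs that the two braiding scalars have product 1.\<close>

lemma dl_u: "dl (u i j) = tens (u i j) un + tens (basis ([], g i + g j)) (u i j)"
proof -
  have "dl (L i (L j un)) = tens (L i (L j un)) un + tens (L i (G (g j) un)) (L j un)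
      + tens (G (g i) (L j un)) (L i un) + tens (G (g i) (G (g j) un)) (L i (L j un))" for i j
    by (simp add: dl_L dl_un tm_tens L_hom G_hom lin_ident hom_add[OF tm_hom])
  then have "dl (u i j) = tens (u i j) un + (tens (L i (G (g j) un)) (L j un) - fscale (\<chi> j (g i)) (tens (G (g j) (L i un)) (L j un)))
      + (tens (G (g i) (L j un)) (L i un) - fscale (\<chi> j (g i)) (tens (L j (G (g i) un)) (L i un)))
      + tens (basis ([], g i + g j)) (u i j)"
    by (simp add: u_L hom_sub[OF dl_lin] hom_scale[OF dl_lin] fmod.scale_right_distrib tens_sub1 tens_sub2
        tens_scale1 tens_scale2 G_G add.commute[of "g j"]) (simp add: un_def G_basis algebra_simps)
  then show ?thesis
    using qq[of i j] ij by (simp add: G_L tens_scale1 mult.commute)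
qed

end

definition ul :: "'i \<Rightarrow> 'i \<Rightarrow> ('i list \<times> 'g \<Rightarrow>\<^sub>0 'k)" where
  "ul i j = u i j + fscale (dd i j) (basis ([], g i + g j) - un)"

lemma dl_ul: "blk j < blk i \<Longrightarrow> dl (ul i j) = tens (ul i j) un + tens (basis ([], g i + g j)) (ul i j)"
  by (simp add: ul_def hom_add[OF dl_lin] hom_scale[OF dl_lin] hom_sub[OF dl_lin] dl_u dl_group dl_un
      tens_add1 tens_add2 tens_scale1 tens_scale2 tens_sub1 tens_sub2 fmod.scale_right_diff_distrib del: tens_basis)

text \<open>Modulo I the antipode axiom for \<open>r\<close> says that the antipode of
  \<open>r\<close> plus \<open>x\<close> inverse times \<open>r\<close> is the counit, which is
  0.\<close>

lemma skew_primitive_ap: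
  assumes "ideal I FH" "\<And>a. a \<in> I \<Longrightarrow> ap a \<in> I"
    "dl r - (tens r un + tens (basis ([], x)) r) \<in> tens_span I" "cu r = 0" "r \<in> I'" "I \<subseteq> I'" "ideal I' FH"
  shows "ap r \<in> I'"
proof -
  have I: "fmod.subspace I" "\<And>a x. x \<in> I \<Longrightarrow> M (tens a x) \<in> I" "\<And>a x. x \<in> I \<Longrightarrow> M (tens x a) \<in> I"
    and I': "fmod.subspace I'" "\<And>a x. x \<in> I' \<Longrightarrow> M (tens a x) \<in> I'"
    using assms(1,7) by (simp_all add: ideal_iff)
  have l: "lin (\<lambda>z. M (tm ap (\<lambda>x. x) z))" by (rule hom_compose[OF tm_hom M_lin])
  have "M (tm ap (\<lambda>x. x) (dl r - (tens r un + tens (basis ([], x)) r))) \<in> I"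
    by (rule tens_span_map[OF l I(1) _ _ assms(3)]) (simp_all add: tm_tens ap_hom lin_ident I assms(2))
  moreover have "M (tm ap (\<lambda>x. x) (dl r - (tens r un + tens (basis ([], x)) r)))
      = - (ap r + M (tens (basis ([], - x)) r))"
    by (simp add: hom_sub[OF l] hom_add[OF l] antipode_left assms(4) tm_tens ap_hom lin_ident M_un_r ap_group)
  ultimately have "- (ap r + M (tens (basis ([], - x)) r)) \<in> I'" using assms(6) by auto
  from fmod.subspace_neg[OF I'(1) this] have "ap r + M (tens (basis ([], - x)) r) \<in> I'" by (simp add: add.commute)
  from fmod.subspace_diff[OF I'(1) this I'(2)[OF assms(5), of "basis ([], - x)"]] show ?thesis by simp
qed

subsection \<open>Words in a single block\<close>

text \<open>Modulo the words containing a letter from the blocks \<open>\<ge> s\<close>, the operator \<open>X i\<close> with \<open>|i| = s\<close> is the skew derivation \<open>D i\<close>.\<close>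

definition high :: "nat \<Rightarrow> ('i list \<times> 'g \<Rightarrow>\<^sub>0 'k) set" where
  "high s = {p. Poly_Mapping.keys p \<subseteq> {x. \<exists>m\<in>set (fst x). s \<le> blk m}}"

lemma high_subspace: "fmod.subspace (high s)"
  unfolding high_def by (rule subspace_keys)

lemma high_word: "m \<in> set w \<Longrightarrow> s \<le> blk m \<Longrightarrow> basis (w, h) \<in> high s"
  by (auto simp: high_def)

lemma high_map:
  assumes "lin A" "\<And>w h m. m \<in> set w \<Longrightarrow> s \<le> blk m \<Longrightarrow> A (basis (w, h)) \<in> high s" "p \<in> high s"
  shows "A p \<in> high s"
  unfolding hom_expand[OF assms(1), of p]
proof (rule lev_in_subspace[OF high_subspace])
  fix x assume "x \<in> Poly_Mapping.keys p"
  then obtain m where "m \<in> set (fst x)" "s \<le> blk m" using assms(3) by (auto simp: high_def)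
  from assms(2)[OF this, of "snd x"] show "A (basis x) \<in> high s" by simp
qed

lemma high_L: "p \<in> high s \<Longrightarrow> L i p \<in> high s"
  by (rule high_map[OF L_hom]) (auto intro: high_word)

lemma high_L': "s \<le> blk i \<Longrightarrow> L i p \<in> high s"
  unfolding hom_expand[OF L_hom, of i p] by (rule lev_in_subspace[OF high_subspace]) (auto intro!: high_word[of i])

lemma high_G: "p \<in> high s \<Longrightarrow> G x p \<in> high s"
  by (rule high_map[OF G_hom]) (auto simp: G_basis intro: high_word fmod.subspace_scale[OF high_subspace])

text \<open>\<open>D i\<close> removes only letters of blocks below s, so a letter witnessing
  membership is never the one removed.\<close>

lemma high_D:
  assumes "blk i = s" "p \<in> high s" shows "D i p \<in> high s"
proof (rule high_map[OF D_hom _ assms(2)])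
  fix w h m assume "m \<in> set w" "s \<le> blk m"
  then show "D i (basis (w, h)) \<in> high s"
  proof (induction w)
    case (Cons n w)
    have 1: "fscale (dd i n) (basis (w, h)) \<in> high s"
    proof (cases "dd i n = 0")
      case False
      then have "m \<in> set w" using dd_blk[OF False] Cons.prems assms(1) by auto
      then show ?thesis using Cons.prems by (intro fmod.subspace_scale[OF high_subspace] high_word)
    qed (simp add: fmod.subspace_0[OF high_subspace])
    have 2: "L n (D i (basis (w, h))) \<in> high s"
    proof (cases "s \<le> blk n")
      case False
      then have "m \<in> set w" using Cons.prems by auto
      then show ?thesis using Cons by (intro high_L) auto
    qed (rule high_L')
    show ?case
      unfolding L_basis[symmetric] D_L
      by (intro fmod.subspace_add[OF high_subspace] 1 fmod.subspace_scale[OF high_subspace] 2)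
  qed simp
qed

lemma high_X: "blk i = s \<Longrightarrow> p \<in> high s \<Longrightarrow> X i p \<in> high s"
  unfolding X_def by (intro fmod.subspace_add[OF high_subspace] high_L high_D)

lemma high_cu: assumes "p \<in> high s" shows "cu p = 0"
proof -
  have "lev fscale basis p \<in> {p. cu p = 0}"
    by (rule lev_in_subspace[OF subspace_kernel[OF cu_lin]]) (use assms in \<open>auto simp: high_def cu_basis\<close>)
  then show ?thesis by (simp add: lev_basis_expand)
qed

lemma high_d: "blk i = s \<Longrightarrow> p \<in> high s \<Longrightarrow> d i p = 0"
  unfolding d_def by (rule high_cu[OF high_D])

abbreviation "xm m \<equiv> basis ([m], 0)"

context
  fixes s :: nat and m :: 'i assumes m: "blk m < s"
begin

text \<open>Either the first letter that acts contracts \<open>x_m\<close>, leaving a group element,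
  or it stays in the word, which is then high. A further letter has nothing to contract in a group
  element and makes it high too.\<close>

lemma act_xm:
  assumes "set w \<subseteq> {i. blk i = s}"
  shows "foldr X w (G h (xm m)) \<in>
    (case w of [] \<Rightarrow> {fscale (\<chi> m h) (basis ([m], h))}
     | i # v \<Rightarrow> (if v = [] then {fscale (\<chi> m h * dd i m) (basis ([], h)) + z | z. z \<in> high s} else high s))"
  using assms
proof (induction w)
  case (Cons i w)
  have i: "blk i = s" using Cons.prems by simp
  consider "w = []" | j where "w = [j]" | j k v where "w = j # k # v" by (metis neq_Nil_conv)
  then show ?case
  proof cases
    case 1
    have "X i (G h (xm m)) = fscale (\<chi> m h * dd i m) (basis ([], h)) + fscale (\<chi> m h) (L i (basis ([m], h)))"
      by (simp add: G_basis hom_scale[OF X_hom]) (simp add: X_def D_L fmod.scale_right_distrib hom_zero[OF L_hom] flip: L_basis)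
    moreover have "fscale (\<chi> m h) (L i (basis ([m], h))) \<in> high s"
      using i by (intro fmod.subspace_scale[OF high_subspace] high_L') simp
    ultimately show ?thesis using 1 by auto
  next
    case 2
    then obtain z where z: "z \<in> high s" "foldr X w (G h (xm m)) = fscale (\<chi> m h * dd j m) (basis ([], h)) + z"
      using Cons by auto
    have "X i (basis ([], h)) \<in> high s"
      using high_L'[of s i "basis ([], h)"] i by (simp add: X_def)
    then have "X i (foldr X w (G h (xm m))) \<in> high s"
      unfolding z(2) hom_add[OF X_hom] hom_scale[OF X_hom]
      by (intro fmod.subspace_add[OF high_subspace] fmod.subspace_scale[OF high_subspace] high_X[OF i z(1)])
    then show ?thesis using 2 by simp
  next
    case 3
    then have "foldr X w (G h (xm m)) \<in> high s" using Cons by auto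
    then show ?thesis using 3 i by (simp add: high_X)
  qed
qed (simp add: G_basis)

lemma cu_act_xm: "set w \<subseteq> {i. blk i = s} \<Longrightarrow> 2 \<le> length w \<Longrightarrow> cu (act (basis (w, h)) (xm m)) = 0"
proof -
  assume w: "set w \<subseteq> {i. blk i = s}" "2 \<le> length w"
  then obtain i j v where "w = i # j # v" by (cases w; cases "tl w") auto
  then have "act (basis (w, h)) (xm m) \<in> high s"
    using act_xm[OF w(1), of h] by (simp add: act_def module_fscale)
  then show ?thesis by (rule high_cu)
qed

lemma d_act_xm:
  assumes w: "set w \<subseteq> {i. blk i = s}" and i: "blk i = s"
  shows "d i (act (basis (w, h)) (xm m)) = (if w = [] then \<chi> m h * dd i m else 0)"
proof -
  have "d i (basis ([m], h)) = dd i m" by (simp add: d_L cu_basis flip: L_basis)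
  then show ?thesis
    using act_xm[OF w, of h] i
    by (auto simp: act_def module_fscale hom_scale[OF d_hom] hom_add[OF d_hom] high_d split: list.splits if_splits)
qed

text \<open>The character \<open>\<chi> m\<close> of \<Gamma>, extended by zero to nonempty words.
  By \<open>lc_kap\<close>, \<open>lc\<close> of it scales a homogeneous element by the value of the
  character at its degree.\<close>

definition kap :: "('i list \<times> 'g \<Rightarrow>\<^sub>0 'k) \<Rightarrow> 'k" where
  "kap = lev (*) (\<lambda>(w, h). if w = [] then \<chi> m h else 0)"

lemma kap_hom: "linf kap"
  unfolding kap_def by (rule lev_hom[OF module_times])

lemma kap_basis: "kap (basis (w, h)) = (if w = [] then \<chi> m h else 0)"
  by (simp add: kap_def module_times)

lemma lc_kap: "lc kap (basis (w, h)) = fscale (\<chi> m (word_deg g w + h)) (basis (w, h))"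
proof (induction w)
  case Nil
  show ?case by (simp add: lc_def dl_group cl_id_tens kap_hom kap_basis word_deg_def del: tens_basis)
next
  case (Cons i w)
  have kL: "kap (L i p) = 0" for i p
    by (rule hom_ext[OF hom_compose[OF L_hom kap_hom] linf_zero], case_tac x) (simp add: kap_basis)
  have kG: "kap (G x p) = \<chi> m x * kap p" for x p
    by (rule hom_ext[OF hom_compose[OF G_hom kap_hom] times_hom2[OF kap_hom]], case_tac xa)
      (simp add: G_basis hom_scale[OF kap_hom] kap_basis \<chi>_add)
  note prl = pr_hom[OF module_fscale]
  have "lc kap (L i (basis (w, h))) = pr fscale (\<lambda>a b. fscale (kap (L i a)) b) (dl (basis (w, h)))
      + pr fscale (\<lambda>a b. fscale (kap (G (g i) a)) (L i b)) (dl (basis (w, h)))"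
    by (simp only: lc_def dl_L hom_add[OF prl] pr_tm[OF bil_cl[OF kap_hom lin_ident] L_hom lin_ident]
        pr_tm[OF bil_cl[OF kap_hom lin_ident] G_hom L_hom])
  also have "pr fscale (\<lambda>a b. fscale (kap (L i a)) b) (dl (basis (w, h))) = 0"
    by (simp add: kL pr_def lev_def case_prod_unfold)
  also have "pr fscale (\<lambda>a b. fscale (kap (G (g i) a)) (L i b)) (dl (basis (w, h))) = fscale (\<chi> m (g i)) (L i (lc kap (basis (w, h))))"
    by (simp add: hom_lc[OF L_hom] kG pr_def lev_def case_prod_unfold fmod.scale_sum_right ac_simps)
  finally show ?case by (simp add: Cons hom_scale[OF L_hom] word_deg_def \<chi>_add ac_simps)
qed

end

text \<open>Sweedler factors of a word from one block are again words from that block, so results on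
  such words apply to both legs.\<close>

lemma dl_letters:
  assumes "(a, b) \<in> Poly_Mapping.keys (dl (basis (w, h)))" shows "set (fst a) \<subseteq> set w" "set (fst b) \<subseteq> set w"
proof -
  let ?S = "\<lambda>w. {(a, b). set (fst a) \<subseteq> set w \<and> set (fst b) \<subseteq> set w} :: (('i list \<times> 'g) \<times> ('i list \<times> 'g)) set"
  have "Poly_Mapping.keys (dlw h w) \<subseteq> ?S w"
  proof (induction w)
    case (Cons i w)
    have "tm (L i) (\<lambda>x. x) (dlw h w) \<in> {z. Poly_Mapping.keys z \<subseteq> ?S (i # w)}"
      by (rule tm_in_subspace[OF subspace_keys]) (use subsetD[OF Cons] in \<open>fastforce\<close>)
    moreover have "tm (G (g i)) (L i) (dlw h w) \<in> {z. Poly_Mapping.keys z \<subseteq> ?S (i # w)}"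
      by (rule tm_in_subspace[OF subspace_keys])
        (use subsetD[OF Cons] keys_fscale in \<open>fastforce simp: G_basis tens_scale1\<close>)
    ultimately have "dlw h (i # w) \<in> {z. Poly_Mapping.keys z \<subseteq> ?S (i # w)}"
      unfolding dlw.simps by (rule fmod.subspace_add[OF subspace_keys])
    then show ?case by simp
  qed simp
  then show "set (fst a) \<subseteq> set w" "set (fst b) \<subseteq> set w"
    using assms by (auto simp: dl_def module_fscale)
qed

lemma pr_cong_keys:
  "(\<And>u v. (u, v) \<in> Poly_Mapping.keys z \<Longrightarrow> \<Phi> (basis u) (basis v) = \<Psi> (basis u) (basis v)) \<Longrightarrow> pr sc \<Phi> z = pr sc \<Psi> z"
  unfolding pr_def by (rule lev_cong) auto

text \<open>Let the letters of the word act one after the other. Each either contracts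
  \<open>x_m\<close>, which is collected in \<open>W\<close>, or passes it up to a commutator, which
  is high. What is left has \<open>x_m\<close> in front and counit 0.\<close>

lemma cu_act_L:
  assumes m: "blk m < s" and w: "set w \<subseteq> {i. blk i = s}"
  shows "cu (act (basis (w, h)) (L m z)) = cc (\<lambda>a. cu (act a (xm m))) (\<lambda>b. cu (act b z)) (dl (basis (w, h)))"
proof -
  define e where "e a = cu (act a (xm m))" for a
  have e: "linf e" unfolding e_def by (rule hom_compose[OF act_hom1 cu_lin])
  have az: "lin (\<lambda>b. act b z)" by (rule act_hom1)
  define W where "W = cl e (\<lambda>b. act b z)"
  have W: "lin W" unfolding W_def by (rule pr_hom[OF module_fscale])
  \<comment> \<open>The term with \<open>x_m\<close> in front is kept so that the induction goes
    through; only the final counit removes it.\<close>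
  have main: "act (basis (w, h)) (L m z) - W (dl (basis (w, h)))
      - fscale (\<chi> m (word_deg g w + h)) (L m (act (basis (w, h)) z)) \<in> high s"
    using w
  proof (induction w)
    case Nil
    have "e (basis ([], h)) = 0" by (simp add: e_def flip: L_basis)
    then have "W (dl (basis ([], h))) = 0"
      by (simp add: W_def dl_group cl_tens e az del: tens_basis)
    then show ?case by (simp add: G_L word_deg_def fmod.subspace_0[OF high_subspace])
  next
    case (Cons i w)
    let ?p = "basis (w, h) :: 'i list \<times> 'g \<Rightarrow>\<^sub>0 'k"
    let ?c = "\<chi> m (word_deg g w + h)" and ?y = "act ?p z"
    have i: "blk i = s" and ww: "set w \<subseteq> {i. blk i = s}" using Cons.prems by auto
    have "blk m < blk i" using m i by simp
    note q = q_swap'[OF this]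
    have "X i (act ?p (L m z) - W (dl ?p) - fscale ?c (L m ?y)) \<in> high s"
      using Cons by (intro high_X[OF i]) simp
    then have 1: "X i (act ?p (L m z)) - X i (W (dl ?p)) - fscale ?c (X i (L m ?y)) \<in> high s"
      by (simp only: hom_sub[OF X_hom] hom_scale[OF X_hom])
    have 2: "X i (L m ?y) = fscale (dd i m) ?y + fscale (\<chi> m (g i)) (L m (X i ?y)) + (L i (L m ?y) - fscale (\<chi> m (g i)) (L m (L i ?y)))"
      by (simp add: X_def D_L q hom_add[OF L_hom] fmod.scale_right_distrib)
    have 3: "fscale ?c (L i (L m ?y) - fscale (\<chi> m (g i)) (L m (L i ?y))) \<in> high s"
      by (intro fmod.subspace_scale[OF high_subspace] fmod.subspace_diff[OF high_subspace] high_L high_L') (simp_all add: i)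
    note prl = pr_hom[OF module_fscale]
    have "W (dl (L i ?p)) = pr fscale (\<lambda>a b. fscale (e (L i a)) (act b z)) (dl ?p)
        + pr fscale (\<lambda>a b. fscale (e (G (g i) a)) (act (L i b) z)) (dl ?p)"
      unfolding W_def
      by (simp only: dl_L hom_add[OF prl] pr_tm[OF bil_cl[OF e az] L_hom lin_ident] pr_tm[OF bil_cl[OF e az] G_hom L_hom])
    also have "pr fscale (\<lambda>a b. fscale (e (G (g i) a)) (act (L i b) z)) (dl ?p) = X i (W (dl ?p))"
      by (simp add: W_def hom_pr[OF X_hom] hom_scale[OF X_hom] e_def act_G act_L)
    \<comment> \<open>The letter \<open>i\<close> can contract \<open>x_m\<close> only if the left
      Sweedler factor acting before it is a group element, by \<open>d_act_xm\<close>. This is what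
      the form \<open>kap m\<close> records.\<close>
    also have "pr fscale (\<lambda>a b. fscale (e (L i a)) (act b z)) (dl ?p)
        = pr fscale (\<lambda>a b. fscale (dd i m) (fscale (kap m a) (act b z))) (dl ?p)"
    proof (rule pr_cong_keys)
      fix u v assume "(u, v) \<in> Poly_Mapping.keys (dl ?p)"
      then have "set (fst u) \<subseteq> {i. blk i = s}" using dl_letters(1) ww by blast
      then have "d i (act (basis (fst u, snd u)) (xm m)) = (if fst u = [] then \<chi> m (snd u) * dd i m else 0)"
        by (rule d_act_xm[OF m _ i])
      moreover have "e (L i (basis u)) = d i (act (basis u) (xm m))"
        by (simp add: e_def act_L X_def hom_add[OF cu_lin] d_def)
      moreover have "kap m (basis (fst u, snd u)) = (if fst u = [] then \<chi> m (snd u) else 0)"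
        by (rule kap_basis[OF m])
      ultimately show "fscale (e (L i (basis u))) (act (basis v) z) = fscale (dd i m) (fscale (kap m (basis u)) (act (basis v) z))"
        by (simp add: mult.commute)
    qed
    also have "\<dots> = fscale (dd i m) (act (lc (kap m) ?p) z)"
      by (simp add: hom_lc[OF az] pr_def lev_def case_prod_unfold fmod.scale_sum_right ac_simps)
    also have "\<dots> = fscale (?c * dd i m) ?y"
      by (simp add: lc_kap[OF m] hom_scale[OF az] mult.commute)
    finally have 4: "W (dl (L i ?p)) = fscale (?c * dd i m) ?y + X i (W (dl ?p))" .
    have "act (L i ?p) (L m z) - W (dl (L i ?p)) - fscale (?c * \<chi> m (g i)) (L m (act (L i ?p) z))
        = (X i (act ?p (L m z)) - X i (W (dl ?p)) - fscale ?c (X i (L m ?y)))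
          + fscale ?c (L i (L m ?y) - fscale (\<chi> m (g i)) (L m (L i ?y)))"
      unfolding 4 2 act_L by (simp add: fmod.scale_right_distrib fmod.scale_right_diff_distrib algebra_simps)
    also have "\<dots> \<in> high s" by (rule fmod.subspace_add[OF high_subspace 1 3])
    finally show ?case by (simp add: word_deg_def \<chi>_add ac_simps)
  qed
  have "cu (act (basis (w, h)) (L m z)) = cu (W (dl (basis (w, h))))"
    using high_cu[OF main] by (simp add: hom_sub[OF cu_lin] hom_scale[OF cu_lin])
  also have "\<dots> = cc e (\<lambda>b. cu (act b z)) (dl (basis (w, h)))"
    unfolding W_def by (simp add: hom_pr[OF cu_lin] hom_scale[OF cu_lin])
  finally show ?thesis by (simp add: e_def)
qed

end

text \<open>\<open>Rf\<close> stands for the image in \<open>F\<close> of the filtration of the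
  relations. In the bosonization a braided primitive element becomes skew primitive, with its
  \<Gamma>-degree as the group-like element.\<close>

locale diag_chain = diag_twist g \<chi> blk dd
  for g :: "'i \<Rightarrow> 'g::ab_group_add" and \<chi> :: "'i \<Rightarrow> 'g \<Rightarrow> 'k::comm_ring_1" and blk dd +
  fixes Rf :: "nat \<Rightarrow> ('i list \<times> 'g \<Rightarrow>\<^sub>0 'k) set" and N :: nat
  assumes Rf_0: "Rf 0 = {}"
    and Rf_mono: "h < N \<Longrightarrow> Rf h \<subseteq> Rf (Suc h)"
    and Rf_block: "h < N \<Longrightarrow> r \<in> Rf (Suc h) \<Longrightarrow>
      \<exists>s. Poly_Mapping.keys r \<subseteq> {(w, x). 2 \<le> length w \<and> set w \<subseteq> {i. blk i = s}}"
    and Rf_primitive: "h < N \<Longrightarrow> r \<in> Rf (Suc h) \<Longrightarrow>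
      \<exists>x. dl r - (tens r un + tens (basis ([], x)) r) \<in> tens_span (Idl\<^bsub>FH\<^esub> (Rf h))"
begin

abbreviation "Ih h \<equiv> Idl\<^bsub>FH\<^esub> (Rf h)"
definition "S0 = Rf N \<union> {u i j | i j. blk j < blk i}"
definition "Sl = Rf N \<union> {ul i j | i j. blk j < blk i}"
abbreviation "I0 \<equiv> Idl\<^bsub>FH\<^esub> S0"
abbreviation "Il \<equiv> Idl\<^bsub>FH\<^esub> Sl"

lemma ideal_sub: "ideal I FH \<Longrightarrow> fmod.subspace I"
  and ideal_l: "ideal I FH \<Longrightarrow> x \<in> I \<Longrightarrow> M (tens a x) \<in> I"
  and ideal_r: "ideal I FH \<Longrightarrow> x \<in> I \<Longrightarrow> M (tens x a) \<in> I"
  by (simp_all add: ideal_iff)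

lemma Ih_mono: "h < N \<Longrightarrow> Ih h \<subseteq> Ih (Suc h)"
  using Rf_mono[of h] gen_subset[of "Rf (Suc h)"] by (intro gen_minimal[OF ideal_gen]) blast

lemma Rf_N: "h \<le> N \<Longrightarrow> Rf h \<subseteq> Rf N"
proof (induction rule: inc_induct)
  case (step n)
  then show ?case using Rf_mono[of n] by blast
qed simp

lemma Ih_I0: "h \<le> N \<Longrightarrow> Ih h \<subseteq> I0"
  using Rf_N[of h] gen_subset[of S0] by (intro gen_minimal[OF ideal_gen]) (auto simp: S0_def)

lemma Rf_len2: "h < N \<Longrightarrow> r \<in> Rf (Suc h) \<Longrightarrow> r \<in> len2"
  using Rf_block[of h r] by (auto simp: len2_def)

lemma Ih_len2: "h \<le> N \<Longrightarrow> Ih h \<subseteq> len2"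
proof (rule gen_minimal[OF len2_ideal])
  show "Rf h \<subseteq> len2" if "h \<le> N"
    using that Rf_0 Rf_len2[of "h - 1"] by (cases h) auto
qed

lemma I0_len2: "I0 \<subseteq> len2"
proof (rule gen_minimal[OF len2_ideal])
  show "S0 \<subseteq> len2"
    using Ih_len2[of N] gen_subset[of "Rf N"] u_len2 by (auto simp: S0_def)
qed

lemma skew_dl:
  assumes "dl r - (tens r un + tens x r) \<in> tens_span I" "I \<subseteq> I'" "r \<in> I'"
  shows "dl r \<in> tens_span I'"
proof -
  have "dl r - (tens r un + tens x r) \<in> tens_span I'" using assms(1) tens_span_mono[OF assms(2)] by blast
  moreover have "tens r un + tens x r \<in> tens_span I'"
    by (intro fmod.subspace_add[OF tens_span_subspace] tens_spanI1 tens_spanI2 assms(3))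
  ultimately have "(dl r - (tens r un + tens x r)) + (tens r un + tens x r) \<in> tens_span I'"
    by (rule fmod.subspace_add[OF tens_span_subspace])
  then show ?thesis by simp
qed

lemma Ih_coideal: "h \<le> N \<Longrightarrow> a \<in> Ih h \<Longrightarrow> dl a \<in> tens_span (Ih h)"
proof (rule gen_coideal)
  fix r assume h: "h \<le> N" and r: "r \<in> Rf h"
  then obtain h' where h': "h = Suc h'" "h' < N" using Rf_0 by (cases h) auto
  obtain x where "dl r - (tens r un + tens (basis ([], x)) r) \<in> tens_span (Ih h')"
    using Rf_primitive[OF h'(2)] r h' by blast
  then show "dl r \<in> tens_span (Ih h)"
    using skew_dl Ih_mono[OF h'(2)] gen_subset[of "Rf h"] r h' by blast
qed

text \<open>Goes up the chain: a relation is skew primitive only modulo the previous ideal, whose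
  stability under the antipode is needed first.\<close>

lemma Ih_ap: "h \<le> N \<Longrightarrow> a \<in> Ih h \<Longrightarrow> ap a \<in> Ih h"
proof (induction h arbitrary: a)
  case 0
  show ?case by (rule gen_ap[OF _ 0(2)]) (simp add: Rf_0)
next
  case (Suc h)
  then have h: "h < N" by simp
  show ?case
  proof (rule gen_ap[OF _ Suc.prems(2)])
    fix r assume r: "r \<in> Rf (Suc h)"
    obtain x where "dl r - (tens r un + tens (basis ([], x)) r) \<in> tens_span (Ih h)"
      using Rf_primitive[OF h r] by blast
    then show "ap r \<in> Ih (Suc h)"
      using Suc.IH h r gen_subset[of "Rf (Suc h)"] len2_cu[OF Rf_len2[OF h r]] Ih_mono[OF h] ideal_gen
      by (intro skew_primitive_ap[of "Ih h" r x "Ih (Suc h)"]) auto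
  qed
qed

text \<open>Treats both quotients at once: \<open>C\<close> will be the set of commutators or that
  of their deformations.\<close>

lemma hopf_quot_extend:
  assumes C: "\<And>r. r \<in> C \<Longrightarrow> cu r = 0 \<and> (\<exists>x. dl r = tens r un + tens (basis ([], x)) r)"
  shows "hopf_quot dl cu M un FH (Idl\<^bsub>FH\<^esub> (Rf N \<union> C)) ap"
proof (rule hopf_quot_gen)
  let ?I = "Idl\<^bsub>FH\<^esub> (Rf N \<union> C)"
  have sub: "Ih N \<subseteq> ?I"
    using gen_subset[of "Rf N \<union> C"] by (intro gen_minimal[OF ideal_gen]) blast
  have c0: "cu r = 0" if "r \<in> Rf N" for r
    using that Ih_len2[of N] gen_subset[of "Rf N"] by (intro len2_cu) auto
  fix r assume r: "r \<in> Rf N \<union> C"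
  have rI: "r \<in> ?I" using r gen_subset[of "Rf N \<union> C"] by blast
  show "cu r = 0" using r c0 C by blast
  show "dl r \<in> tens_span ?I"
  proof (cases "r \<in> Rf N")
    case True
    then have "dl r \<in> tens_span (Ih N)" using gen_subset[of "Rf N"] by (intro Ih_coideal) auto
    then show ?thesis using tens_span_mono[OF sub] by blast
  next
    case False
    then obtain x where "dl r = tens r un + tens (basis ([], x)) r" using C r by blast
    then show ?thesis by (simp add: fmod.subspace_add[OF tens_span_subspace] tens_spanI1 tens_spanI2 rI)
  qed
  show "ap r \<in> ?I"
  proof (cases "r \<in> Rf N")
    case True
    then have "ap r \<in> Ih N" using gen_subset[of "Rf N"] by (intro Ih_ap) auto
    then show ?thesis using sub by blast
  next
    case False
    then obtain x where x: "dl r = tens r un + tens (basis ([], x)) r" and c: "cu r = 0" using C r by blast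
    have "ap 0 = 0" by (rule hom_zero[OF ap_hom])
    \<comment> \<open>Elements of \<open>C\<close> are skew primitive exactly, so the error ideal is
      zero.\<close>
    have i0: "ideal {0} FH"
      by (simp add: ideal_iff fmod.subspace_single_0 hom_zero[OF M_lin])
    show ?thesis
      by (rule skew_primitive_ap[OF i0 _ _ c rI _ ideal_gen, of x])
        (auto simp: x \<open>ap 0 = 0\<close> fmod.subspace_0[OF tens_span_subspace] intro: fmod.subspace_0[OF ideal_sub[OF ideal_gen]])
  qed
qed

lemma hopf_quot_I0: "hopf_quot dl cu M un FH I0 ap"
  unfolding S0_def by (rule hopf_quot_extend) (use dl_u len2_cu[OF u_len2] in blast)

lemma cu_ul: "cu (ul i j) = 0"
  by (simp add: ul_def hom_add[OF cu_lin] hom_scale[OF cu_lin] hom_sub[OF cu_lin] len2_cu[OF u_len2] cu_basis cu_un)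

lemma hopf_quot_Il: "hopf_quot dl cu M un FH Il ap"
  unfolding Sl_def by (rule hopf_quot_extend) (use dl_ul cu_ul in blast)

lemma I0_coideal: "a \<in> I0 \<Longrightarrow> dl a \<in> tens_span I0"
  by (rule hopf_quot.J_coideal[OF hopf_quot_I0])

lemma Il_coideal: "a \<in> Il \<Longrightarrow> dl a \<in> tens_span Il"
  by (rule hopf_quot.J_coideal[OF hopf_quot_Il])

lemma I0_act: "y \<in> I0 \<Longrightarrow> act p y \<in> I0"
  by (rule act_stable[OF ideal_gen I0_coideal I0_len2])

lemma Ih_act: "h \<le> N \<Longrightarrow> y \<in> Ih h \<Longrightarrow> act p y \<in> Ih h"
  by (rule act_stable[OF ideal_gen Ih_coideal Ih_len2])

subsection \<open>The action of the relations\<close>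

text \<open>Split off the first letter \<open>x_m\<close> of \<open>y\<close>. For a low letter,
  multiplicativity and skew primitivity leave two products. One contains the pairing of
  \<open>r\<close> with \<open>x_m\<close>, zero since one letter allows only one contraction; the
  other pairs a group element with \<open>x_m\<close>. For a letter of block at least s, or a bare
  group element, every result is high.\<close>

lemma act_block_vanish:
  assumes r: "Poly_Mapping.keys r \<subseteq> {(w, x). 2 \<le> length w \<and> set w \<subseteq> {i. blk i = s}}"
    and dlr: "dl r - (tens r un + tens (basis ([], x)) r) \<in> tens_span I"
    and I: "\<And>a y. a \<in> I \<Longrightarrow> cu (act a y) = 0"
  shows "cu (act r y) = 0"
proof -
  have l: "linf (\<lambda>p. cu (act p y))" for y by (rule hom_compose[OF act_hom1 cu_lin])
  have red: "cu (act r y) = 0" if "\<And>w h. 2 \<le> length w \<Longrightarrow> set w \<subseteq> {i. blk i = s} \<Longrightarrow> cu (act (basis (w, h)) y) = 0" for y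
    unfolding hom_expand[OF l, of r] using that r by (simp add: lev_def) (intro sum.neutral, fastforce)
  have hi: "cu (act (basis (w, h)) y) = 0" if "y \<in> high s" "set w \<subseteq> {i. blk i = s}" for w h y
  proof -
    have "foldr X w (G h y) \<in> high s"
      using that by (induction w) (auto simp: high_G high_X)
    then show ?thesis by (simp add: act_def module_fscale high_cu)
  qed
  have base: "cu (act r (basis ([], h))) = 0" for h
  proof (rule red)
    fix w k assume w: "2 \<le> length w" "set w \<subseteq> {i. blk i = s}"
    have "foldr X w (G k (basis ([], h))) \<in> high s"
      using w(2,1)
    proof (induction w)
      case (Cons i v)
      have i: "blk i = s" using Cons.prems by simp
      show ?case
      proof (cases "2 \<le> length v")
        case True
        then show ?thesis using Cons i by (simp add: high_X)
      next
        case False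
        then obtain j where v: "v = [j]" using Cons.prems by (cases v; cases "tl v") auto
        have "X j (G k (basis ([], h))) = L j (G k (basis ([], h)))" by (simp add: X_def D_G hom_zero[OF G_hom])
        moreover have "L j (G k (basis ([], h))) \<in> high s" using Cons.prems v by (intro high_L') simp
        ultimately show ?thesis using v i by (simp add: high_X)
      qed
    qed simp
    then show "cu (act (basis (w, k)) (basis ([], h))) = 0" by (simp add: act_def module_fscale high_cu)
  qed
  have step: "cu (act r (L m z)) = 0" for m z
  proof (cases "blk m < s")
    case False
    then show ?thesis by (intro red hi high_L') auto
  next
    case True
    have xm0: "cu (act r (xm m)) = 0" by (rule red) (rule cu_act_xm[OF True])
    define Z where "Z = cc (\<lambda>a. cu (act a (xm m))) (\<lambda>b. cu (act b z))"
    have Z: "linf Z" unfolding Z_def by (rule pr_hom[OF module_times])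
    have Zt: "Z (tens a b) = cu (act a (xm m)) * cu (act b z)" for a b
      unfolding Z_def by (rule cc_tens[OF l l])
    have "cu (act r (L m z)) = lev (*) (\<lambda>p. cu (act (basis p) (L m z))) r"
      by (rule hom_expand[OF l])
    also have "\<dots> = lev (*) (\<lambda>p. Z (dl (basis p))) r"
    proof (rule lev_cong)
      fix p assume "p \<in> Poly_Mapping.keys r"
      from subsetD[OF r this] have "set (fst p) \<subseteq> {i. blk i = s}" by (simp add: case_prod_unfold)
      from cu_act_L[OF True this, of "snd p" z] show "cu (act (basis p) (L m z)) = Z (dl (basis p))"
        by (simp add: Z_def)
    qed
    also have "\<dots> = Z (dl r)" by (rule hom_expand[OF hom_compose[OF dl_lin Z], symmetric])
    also have "\<dots> = Z (dl r - (tens r un + tens (basis ([], x)) r)) + Z (tens r un) + Z (tens (basis ([], x)) r)"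
      by (simp add: hom_sub[OF Z] hom_add[OF Z])
    also have "Z (dl r - (tens r un + tens (basis ([], x)) r)) = 0"
      by (rule tens_span_form[OF Z _ _ dlr]) (simp_all add: Zt I)
    also have "Z (tens r un) = 0" by (simp add: Zt xm0)
    also have "Z (tens (basis ([], x)) r) = 0" by (simp add: Zt flip: L_basis)
    finally show ?thesis by simp
  qed
  show ?thesis
  proof (rule hom_ext_F[OF hom_compose[OF act_hom2 cu_lin] linf_zero])
  qed (rule base step)+
qed

text \<open>By colinearity \<open>act r y\<close> is the sum of \<open>cu (act r1 y1)\<close> times
  \<open>r2 y2\<close>. For skew primitive \<open>r\<close> the summand with \<open>r\<close> in the
  pairing vanishes, and the one with the group-like element is \<open>r y\<close>.\<close>

lemma act_skew:
  assumes dlr: "dl r - (tens r un + tens (basis ([], x)) r) \<in> tens_span I" and I: "ideal I FH"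
    "\<And>a y. a \<in> I \<Longrightarrow> cu (act a y) = 0" and r: "\<And>y. cu (act r y) = 0"
  shows "act r y - M (tens r y) \<in> I"
proof -
  have l: "linf (\<lambda>z. cu (AM z))" by (rule hom_compose[OF AM_hom cu_lin])
  define Z where "Z z = cl (\<lambda>z. cu (AM z)) M (swap23 (tens z (dl y)))" for z
  have Z: "lin Z" unfolding Z_def by (rule hom_compose[OF hom_compose[OF tens_hom1[OF lin_ident] swap23_hom] pr_hom[OF module_fscale]])
  have la: "linf (\<lambda>y. cu (act a y))" for a by (rule hom_compose[OF act_hom2 cu_lin])
  have Zt: "Z (tens a b) = M (tens b (lc (\<lambda>y. cu (act a y)) y))" for a b
  proof -
    have "cl (\<lambda>z. cu (AM z)) M (swap23 (tens (tens a b) w)) = M (tens b (cl (\<lambda>y. cu (act a y)) (\<lambda>x. x) w))" for w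
      by (rule hom_ext2[OF hom_compose[OF hom_compose[OF tens_hom2[OF lin_ident] swap23_hom] pr_hom[OF module_fscale]]
            M_hom2[OF pr_hom[OF module_fscale]]])
        (simp add: cl_tens l M_lin la lin_ident AM_tens tens_scale2 hom_scale[OF M_lin])
    then show ?thesis by (simp add: Z_def lc_def)
  qed
  have lc0: "lc (\<lambda>y. 0) y = 0" by (simp add: lc_def pr_def lev_def case_prod_unfold)
  have "act r y = cl cu (\<lambda>x. x) (tm AM M (swap23 (tens (dl r) (dl y))))"
    by (simp only: dl_act[symmetric] counit_l)
  also have "\<dots> = Z (dl r)"
    unfolding Z_def by (rule pr_tm[OF bil_cl[OF cu_lin lin_ident] AM_hom M_lin])
  also have "\<dots> = Z (dl r - (tens r un + tens (basis ([], x)) r)) + Z (tens r un) + Z (tens (basis ([], x)) r)"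
    by (simp add: hom_sub[OF Z] hom_add[OF Z])
  also have "Z (tens r un) = 0" by (simp add: Zt r lc0 M_un_l hom_zero[OF M_lin])
  also have "Z (tens (basis ([], x)) r) = M (tens r y)" by (simp add: Zt)
  finally have "act r y - M (tens r y) = Z (dl r - (tens r un + tens (basis ([], x)) r))" by simp
  also have "\<dots> \<in> I"
    by (rule tens_span_map[OF Z ideal_sub[OF I(1)] _ _ dlr])
      (simp_all add: Zt I(2) lc0 hom_zero[OF M_lin] fmod.subspace_0[OF ideal_sub[OF I(1)]] ideal_r[OF I(1)])
  finally show ?thesis .
qed

text \<open>This set is the annihilator of the module \<open>F / I\<close> for the twisted
  action.\<close>

lemma act_ideal:
  assumes I: "ideal I FH" "\<And>y p. y \<in> I \<Longrightarrow> act p y \<in> I"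
  shows "ideal {p. \<forall>y. act p y \<in> I} FH"
  unfolding ideal_iff
proof (intro conjI allI ballI)
  show "fmod.subspace {p. \<forall>y. act p y \<in> I}"
    using ideal_sub[OF I(1)] by (simp add: fmod.subspace_def hom_add[OF act_hom1] hom_scale[OF act_hom1] hom_zero[OF act_hom1])
qed (auto simp: act_M I(2))

text \<open>The claims alternate along the chain: stability at one level controls the error in
  comparing \<open>act r y\<close> with the product for the next relations, and this comparison
  gives stability at the next level.\<close>

lemma Ih_props:
  "h \<le> N \<Longrightarrow> a \<in> Ih h \<Longrightarrow> act a y \<in> Ih h"
  "h < N \<Longrightarrow> r \<in> Rf (Suc h) \<Longrightarrow> act r y - M (tens r y) \<in> Ih h"
proof -
  have skew: "act r y - M (tens r y) \<in> Ih h"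
    if h: "h < N" and r: "r \<in> Rf (Suc h)" and IH: "\<And>a y. a \<in> Ih h \<Longrightarrow> act a y \<in> Ih h" for h r y
  proof -
    obtain x where x: "dl r - (tens r un + tens (basis ([], x)) r) \<in> tens_span (Ih h)"
      using Rf_primitive[OF h r] by blast
    obtain s where s: "Poly_Mapping.keys r \<subseteq> {(w, x). 2 \<le> length w \<and> set w \<subseteq> {i. blk i = s}}"
      using Rf_block[OF h r] by blast
    have c: "cu (act a y) = 0" if "a \<in> Ih h" for a y
      using IH[OF that] Ih_len2[of h] h by (intro len2_cu) auto
    show ?thesis
      by (rule act_skew[OF x ideal_gen c act_block_vanish[OF s x c]])
  qed
  have act: "h \<le> N \<Longrightarrow> a \<in> Ih h \<Longrightarrow> act a y \<in> Ih h" for h a y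
  proof (induction h arbitrary: a y)
    case 0
    have "Ih 0 \<subseteq> {p. \<forall>y. act p y \<in> Ih 0}"
      by (rule gen_minimal[OF act_ideal[OF ideal_gen Ih_act]]) (simp_all add: Rf_0)
    then show ?case using 0 by blast
  next
    case (Suc h)
    then have h: "h < N" by simp
    have "Ih (Suc h) \<subseteq> {p. \<forall>y. act p y \<in> Ih (Suc h)}"
    proof (rule gen_minimal[OF act_ideal[OF ideal_gen Ih_act]])
      show "Suc h \<le> N" by (rule Suc.prems(1))
      show "Rf (Suc h) \<subseteq> {p. \<forall>y. act p y \<in> Ih (Suc h)}"
      proof clarify
        fix r y assume r: "r \<in> Rf (Suc h)"
        have "act r y - M (tens r y) \<in> Ih (Suc h)"
          using skew[OF h r] Suc.IH h Ih_mono[OF h] by auto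
        moreover have "M (tens r y) \<in> Ih (Suc h)"
          using gen_subset[of "Rf (Suc h)"] r by (intro ideal_r[OF ideal_gen]) auto
        ultimately have "(act r y - M (tens r y)) + M (tens r y) \<in> Ih (Suc h)"
          by (rule fmod.subspace_add[OF ideal_sub[OF ideal_gen]])
        then show "act r y \<in> Ih (Suc h)" by simp
      qed
    qed
    then show ?case using Suc.prems(2) by blast
  qed
  show "h \<le> N \<Longrightarrow> a \<in> Ih h \<Longrightarrow> act a y \<in> Ih h" by (rule act)
  show "h < N \<Longrightarrow> r \<in> Rf (Suc h) \<Longrightarrow> act r y - M (tens r y) \<in> Ih h"
    by (rule skew) (auto intro: act)
qed

subsection \<open>The cocycle vanishes on the defining ideal\<close>

text \<open>The annihilator of \<open>F / I0\<close> for the twisted action. It contains the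
  relations and the elements \<open>u i j - dd i j\<close>; the aim is that \<open>theta'\<close>
  carries \<open>I0\<close> into it.\<close>

definition Q :: "('i list \<times> 'g \<Rightarrow>\<^sub>0 'k) set" where
  "Q = {p. \<forall>y. act p y \<in> I0}"

lemma Q_ideal: "ideal Q FH"
  unfolding Q_def by (rule act_ideal[OF ideal_gen I0_act])

text \<open>
  Left multiplication by \<open>x\<^sub>i\<close> does not commute with \<open>theta'\<close>, but only up to \<open>theta' \<circ> D i\<close>.
  Requiring stability under all \<open>D i\<close> as well makes the set a left ideal.
\<close>

definition hereditary :: "('i list \<times> 'g \<Rightarrow>\<^sub>0 'k) set" where
  "hereditary = {x. \<forall>js. theta' (foldr D js x) \<in> Q}"

lemma foldr_D_hom: "lin (foldr D js)"
proof (induction js)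
  case Nil
  show ?case by (simp add: id_def lin_ident)
next
  case (Cons i w)
  show ?case using hom_compose[OF Cons D_hom] by (simp add: o_def)
qed

lemma hereditary_subspace: "fmod.subspace hereditary"
  using ideal_sub[OF Q_ideal]
  by (simp add: hereditary_def fmod.subspace_def hom_add[OF foldr_D_hom] hom_scale[OF foldr_D_hom] hom_zero[OF foldr_D_hom]
      hom_add[OF theta'_hom] hom_scale[OF theta'_hom] hom_zero[OF theta'_hom])

lemma hereditary_D: "x \<in> hereditary \<Longrightarrow> D i x \<in> hereditary"
proof -
  assume x: "x \<in> hereditary"
  have "theta' (foldr D (js @ [i]) x) \<in> Q" for js using x unfolding hereditary_def by blast
  then show ?thesis by (simp add: hereditary_def)
qed

lemma hereditary_theta': "x \<in> hereditary \<Longrightarrow> theta' x \<in> Q"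
  unfolding hereditary_def by (auto dest: spec[of _ "[]"])

text \<open>A coinduction rule: \<open>T\<close> need only be closed under the skew derivations up
  to scalars and up to elements already known to be hereditary.\<close>

lemma hereditaryI:
  assumes T: "\<And>x. x \<in> T \<Longrightarrow> theta' x \<in> Q" and D: "\<And>i x. x \<in> T \<Longrightarrow> \<exists>y\<in>T. \<exists>c. \<exists>z\<in>hereditary. D i x = fscale c y + z"
    and x: "x \<in> T"
  shows "x \<in> hereditary"
proof -
  have "theta' (foldr D js x) \<in> Q" for js
    using x
  \<comment> \<open>\<open>foldr\<close> applies the last operator of the list first, so that one is
    split off.\<close>
  proof (induction js arbitrary: x rule: rev_induct)
    case Nil
    then show ?case by (simp add: T)
  next
    case (snoc i js)
    obtain y c z where y: "y \<in> T" and z: "z \<in> hereditary" and e: "D i x = fscale c y + z" using D[OF snoc.prems] by blast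
    have "theta' (foldr D js z) \<in> Q" using z by (auto simp: hereditary_def)
    then show ?case
      unfolding foldr_append foldr.simps o_def id_def e
      by (simp add: hom_add[OF foldr_D_hom] hom_scale[OF foldr_D_hom] hom_add[OF theta'_hom] hom_scale[OF theta'_hom]
          fmod.subspace_add[OF ideal_sub[OF Q_ideal]] fmod.subspace_scale[OF ideal_sub[OF Q_ideal]] snoc.IH[OF y])
  qed
  then show ?thesis by (simp add: hereditary_def)
qed

lemma hereditary_L: "x \<in> hereditary \<Longrightarrow> L i x \<in> hereditary"
proof (rule hereditaryI[of "L i ` hereditary"])
  fix y assume "y \<in> L i ` hereditary"
  then obtain x where x: "x \<in> hereditary" and y: "y = L i x" by blast
  show "theta' y \<in> Q"
    unfolding y theta'_L L_M[of i "theta' x"]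
    by (intro fmod.subspace_diff[OF ideal_sub[OF Q_ideal]] ideal_l[OF Q_ideal] hereditary_theta' hereditary_D x)
  show "\<exists>y'\<in>L i ` hereditary. \<exists>c. \<exists>z\<in>hereditary. D k y = fscale c y' + z" for k
    using x by (intro bexI[of _ "L i (D k x)"] exI[of _ "\<chi> k (- g i)"] bexI[of _ "fscale (dd k i) x"])
      (simp_all add: y D_L hereditary_D fmod.subspace_scale[OF hereditary_subspace] add.commute)
qed simp

lemma hereditary_G: "x \<in> hereditary \<Longrightarrow> G a x \<in> hereditary"
proof (rule hereditaryI[of "G a ` hereditary"])
  fix y assume "y \<in> G a ` hereditary"
  then obtain x where x: "x \<in> hereditary" and y: "y = G a x" by blast
  show "theta' y \<in> Q"
    unfolding y theta'_G G_M[of a "theta' x"] by (intro ideal_l[OF Q_ideal] hereditary_theta' x)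
  show "\<exists>y'\<in>G a ` hereditary. \<exists>c. \<exists>z\<in>hereditary. D k y = fscale c y' + z" for k
    using x by (intro bexI[of _ "G a (D k x)"] exI[of _ "\<chi> k (- a)"] bexI[of _ 0])
      (simp_all add: y D_G hereditary_D fmod.subspace_0[OF hereditary_subspace])
qed simp

lemma hereditary_M: assumes "x \<in> hereditary" shows "M (tens a x) \<in> hereditary"
proof -
  have w: "M (tens (basis (w, h)) x) \<in> hereditary" for w h
    unfolding M_words by (induction w) (simp_all add: hereditary_L hereditary_G assms)
  have "M (tens a x) = lev fscale (\<lambda>p. M (tens (basis p) x)) a"
    by (rule hom_expand[OF M_hom1[OF lin_ident]])
  also have "\<dots> \<in> hereditary"
    using w by (intro lev_in_subspace[OF hereditary_subspace]) (metis surj_pair)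
  finally show ?thesis .
qed

text \<open>\<open>hereditary\<close> has been shown to be a left ideal, so left factors are free
  and right factors must be kept with the generators.\<close>

lemma gen_hereditary:
  assumes "\<And>r b. r \<in> S \<Longrightarrow> M (tens r b) \<in> hereditary" shows "Idl\<^bsub>FH\<^esub> S \<subseteq> hereditary"
  unfolding gen_span by (rule fmod.span_minimal[OF _ hereditary_subspace]) (auto intro: hereditary_M assms)

lemma u_hereditary:
  assumes "blk j < blk i" shows "M (tens (u i j) b) \<in> hereditary"
proof (rule hereditaryI[of "range (\<lambda>b. M (tens (u i j) b))"])
  have "u i j - fscale (dd i j) un \<in> Q"
  proof -
    have "act (u i j - fscale (dd i j) un) y \<in> I0" for y
    proof -
      have "act (u i j - fscale (dd i j) un) y = M (tens (u i j) y)"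
        by (simp add: hom_sub[OF act_hom1] hom_scale[OF act_hom1] act_u_eq[OF assms]) (simp add: un_def G_0)
      also have "\<dots> \<in> I0"
        using gen_subset[of S0] assms by (intro ideal_r[OF ideal_gen]) (auto simp: S0_def)
      finally show ?thesis .
    qed
    then show ?thesis by (simp add: Q_def)
  qed
  then show "theta' x \<in> Q" if "x \<in> range (\<lambda>b. M (tens (u i j) b))" for x
    using that by (auto simp: theta'_M_u[OF assms] ideal_r[OF Q_ideal])
  show "\<exists>y\<in>range (\<lambda>b. M (tens (u i j) b)). \<exists>c. \<exists>z\<in>hereditary. D k x = fscale c y + z"
    if x: "x \<in> range (\<lambda>b. M (tens (u i j) b))" for k x
  proof -
    obtain b where "x = M (tens (u i j) b)" using x by blast
    then have "D k x = fscale (\<chi> k (- g i) * \<chi> k (- g j)) (M (tens (u i j) (D k b))) + 0"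
      by (simp add: D_M_u[OF assms])
    then show ?thesis using fmod.subspace_0[OF hereditary_subspace] by blast
  qed
qed simp

text \<open>The form \<open>d j\<close> reads the left Sweedler factor of the product. It vanishes
  if that factor contains \<open>r\<close>, whose words are too long; the remaining part has the
  group-like element there and contributes \<open>\<chi> j (- x)\<close>.\<close>

lemma D_skew:
  assumes dlr: "dl r - (tens r un + tens (basis ([], x)) r) \<in> tens_span I" and I: "ideal I FH" "I \<subseteq> len2"
    and r: "r \<in> len2"
  shows "D j (M (tens r b)) - fscale (\<chi> j (- x)) (M (tens r (D j b))) \<in> I"
proof -
  define Z where "Z z = cl (d j) (\<lambda>x. x) (tm M M (swap23 (tens z (dl b))))" for z
  have Z: "lin Z" unfolding Z_def
    by (rule hom_compose[OF hom_compose[OF hom_compose[OF tens_hom1[OF lin_ident] swap23_hom] tm_hom] pr_hom[OF module_fscale]])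
  have ld: "linf (\<lambda>z. d j (M (tens a z)))" for a by (rule hom_compose[OF M_hom2[OF lin_ident] d_hom])
  have Zt: "Z (tens a c) = M (tens c (lc (\<lambda>z. d j (M (tens a z))) b))" for a c
  proof -
    have "cl (d j) (\<lambda>x. x) (tm M M (swap23 (tens (tens a c) w))) = M (tens c (cl (\<lambda>z. d j (M (tens a z))) (\<lambda>x. x) w))" for w
      by (rule hom_ext2[OF hom_compose[OF hom_compose[OF hom_compose[OF tens_hom2[OF lin_ident] swap23_hom] tm_hom] pr_hom[OF module_fscale]]
            M_hom2[OF pr_hom[OF module_fscale]]])
        (simp add: tm_tens cl_tens M_lin d_hom ld lin_ident tens_scale2 hom_scale[OF M_lin])
    then show ?thesis by (simp add: Z_def lc_def)
  qed
  have lc0: "lc (\<lambda>y. 0) b = 0" by (simp add: lc_def pr_def lev_def case_prod_unfold)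
  have lcs: "lc (\<lambda>z. c * d j z) b = fscale c (D j b)" for c
    by (simp add: D_lc lc_def pr_def lev_def case_prod_unfold fmod.scale_sum_right ac_simps)
  have l0: "d j (M (tens a z)) = 0" if "a \<in> len2" for a z
    by (intro len2_d ideal_r[OF len2_ideal] that)
  have "D j (M (tens r b)) = Z (dl r)"
    unfolding D_lc lc_def Z_def dl_M dl2_tens ..
  also have "\<dots> = Z (dl r - (tens r un + tens (basis ([], x)) r)) + Z (tens r un) + Z (tens (basis ([], x)) r)"
    by (simp add: hom_sub[OF Z] hom_add[OF Z])
  also have "Z (tens r un) = 0" by (simp add: Zt l0[OF r] lc0 M_un_l hom_zero[OF M_lin])
  also have "Z (tens (basis ([], x)) r) = fscale (\<chi> j (- x)) (M (tens r (D j b)))"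
    by (simp add: Zt G_M[symmetric] d_G lcs tens_scale2 hom_scale[OF M_lin])
  finally have "D j (M (tens r b)) - fscale (\<chi> j (- x)) (M (tens r (D j b)))
      = Z (dl r - (tens r un + tens (basis ([], x)) r))" by simp
  also have "\<dots> \<in> I"
    by (rule tens_span_map[OF Z ideal_sub[OF I(1)] _ _ dlr])
      (use I(2) in \<open>auto simp: Zt l0 lc0 hom_zero[OF M_lin] fmod.subspace_0[OF ideal_sub[OF I(1)]] ideal_r[OF I(1)]\<close>)
  finally show ?thesis .
qed

lemma Ih_hereditary: "h \<le> N \<Longrightarrow> Ih h \<subseteq> hereditary"
proof (induction h)
  case 0
  show ?case by (rule gen_hereditary) (simp add: Rf_0)
next
  case (Suc h)
  then have h: "h < N" and IH: "Ih h \<subseteq> hereditary" by simp_all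
  show ?case
  proof (rule gen_hereditary)
    fix r b assume r: "r \<in> Rf (Suc h)"
    obtain x where x: "dl r - (tens r un + tens (basis ([], x)) r) \<in> tens_span (Ih h)"
      using Rf_primitive[OF h r] by blast
    have "r \<in> Ih (Suc h)" using r gen_subset[of "Rf (Suc h)"] by blast
    then have "r \<in> Q" using Ih_props(1)[of "Suc h"] Ih_I0[of "Suc h"] h by (auto simp: Q_def)
    show "M (tens r b) \<in> hereditary"
    proof (rule hereditaryI[of "range (\<lambda>b. M (tens r b))"])
      fix y assume "y \<in> range (\<lambda>b. M (tens r b))"
      then obtain b where y: "y = M (tens r b)" by blast
      have e: "act r b - M (tens r b) \<in> hereditary" using Ih_props(2)[OF h r] IH by blast
      \<comment> \<open>\<open>theta'\<close> turns the twisted action into multiplication, so only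
        the difference of \<open>act r b\<close> and the product is left, and that comes from
        earlier relations.\<close>
      have "theta' (act r b) = M (tens r (theta' b))"
        using arg_cong[OF theta_M[of r "theta' b"], of theta'] by simp
      then have "theta' y = M (tens r (theta' b)) - theta' (act r b - M (tens r b))"
        by (simp add: y hom_sub[OF theta'_hom])
      also have "\<dots> \<in> Q"
        by (intro fmod.subspace_diff[OF ideal_sub[OF Q_ideal]] ideal_r[OF Q_ideal] \<open>r \<in> Q\<close> hereditary_theta' e)
      finally show "theta' y \<in> Q" .
      fix i
      have "D i y - fscale (\<chi> i (- x)) (M (tens r (D i b))) \<in> hereditary"
        using D_skew[OF x ideal_gen Ih_len2 Rf_len2[OF h r]] h IH unfolding y by auto
      then show "\<exists>z\<in>range (\<lambda>b. M (tens r b)). \<exists>c. \<exists>e\<in>hereditary. D i y = fscale c z + e"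
        by (intro bexI[of _ "M (tens r (D i b))"] exI[of _ "\<chi> i (- x)"] bexI[of _ "D i y - fscale (\<chi> i (- x)) (M (tens r (D i b)))"]) auto
    qed simp
  qed
qed

lemma I0_hereditary: "I0 \<subseteq> hereditary"
proof (rule gen_hereditary)
  fix r b assume "r \<in> S0"
  then consider "r \<in> Rf N" | i j where "r = u i j" "blk j < blk i" by (auto simp: S0_def)
  then show "M (tens r b) \<in> hereditary"
  proof cases
    case 1
    then have "M (tens r b) \<in> Ih N" using gen_subset[of "Rf N"] by (intro ideal_r[OF ideal_gen]) auto
    then show ?thesis using Ih_hereditary[of N] by auto
  qed (simp add: u_hereditary)
qed

lemma I0_cu: "a \<in> I0 \<Longrightarrow> cu a = 0"
  using I0_len2 by (intro len2_cu) auto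

lemma sg_act: "sg (tens x y) = cu (act (theta' x) y)"
  by (simp add: sg_def star_act)

lemma sg_I0: "z \<in> tens_span I0 \<Longrightarrow> sg z = 0"
proof (rule tens_span_form[OF sg_hom])
  show "sg (tens a b) = 0" if "a \<in> I0" for a b
  proof -
    have "theta' a \<in> Q" using that I0_hereditary by (intro hereditary_theta') auto
    then show ?thesis unfolding sg_act Q_def by (intro I0_cu) auto
  qed
  show "sg (tens a b) = 0" if "b \<in> I0" for a b
    unfolding sg_act by (intro I0_cu I0_act that)
qed

lemma ta_I0: "z \<in> tens_span I0 \<Longrightarrow> ta z = 0"
proof (rule ta_vanish[where deg = "\<lambda>x. length (fst x)"])
  show "length (fst u) + length (fst v) = length (fst c)" if "(u, v) \<in> Poly_Mapping.keys (dl (basis c))" for c u v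
    by (rule dl_keys[OF that])
  show "sg (basis (u, v)) = cu2 (basis (u, v))" if "length (fst u) = 0" "length (fst v) = 0" for u v
  proof -
    have "theta' (basis ([], a)) = basis ([], a)" for a by (simp add: theta'_def module_fscale)
    then have "sg (tens (basis ([], a)) (basis ([], b))) = cu2 (tens (basis ([], a)) (basis ([], b)))" for a b
      unfolding sg_act cu2_tens by (simp add: cu_basis)
    moreover have "u = ([], snd u)" "v = ([], snd v)" using that by (cases u, simp, cases v, simp)
    ultimately show ?thesis by (metis tens_basis)
  qed
qed (auto intro: I0_coideal I0_cu sg_I0)

subsection \<open>The isomorphism\<close>

text \<open>Contractions go strictly down in the order of blocks, so none occurs within a single
  block.\<close>

lemma theta_block:
  assumes "set w \<subseteq> {i. blk i = s}" shows "theta (basis (w, h)) = basis (w, h)"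
proof -
  have D0: "D i (basis (w, h)) = 0" if "blk i = s" "set w \<subseteq> {i. blk i = s}" for i w
    using that(2)
  proof (induction w)
    case (Cons m w)
    have "dd i m = 0" using dd_blk[of i m] Cons.prems that(1) by (cases "dd i m = 0") auto
    then show ?case unfolding L_basis[symmetric] D_L using Cons by (simp add: hom_zero[OF L_hom] del: L_basis)
  qed simp
  show ?thesis using assms
  proof (induction w)
    case (Cons i w)
    then have "theta (L i (basis (w, h))) = X i (basis (w, h))" by (simp add: theta_L del: L_basis)
    then show ?case using D0[of i w] Cons.prems by (simp add: X_def)
  qed (simp add: theta_group)
qed

lemma f_block: "set w \<subseteq> {i. blk i = s} \<Longrightarrow> f (basis (w, h)) = cu (basis (w, h))"
  using theta'_theta[of "basis (w, h)"] theta_block[of w s h] by (simp add: f_def)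

lemma psi_block: "set w \<subseteq> {i. blk i = s} \<Longrightarrow> psi (basis (w, h)) = basis (w, h)"
proof -
  assume w: "set w \<subseteq> {i. blk i = s}"
  have "thr (basis (w, h)) = rc cu (basis (w, h))"
    unfolding thr_def rc_def
  proof (rule pr_cong_keys)
    fix u v assume "(u, v) \<in> Poly_Mapping.keys (dl (basis (w, h)))"
    then have "set (fst v) \<subseteq> {i. blk i = s}" using dl_letters(2) w by blast
    then have "f (basis (fst v, snd v)) = cu (basis (fst v, snd v))" by (rule f_block)
    then show "fscale (f (basis v)) (basis u) = fscale (cu (basis v)) (basis u)" by simp
  qed
  then show ?thesis using theta_block[OF w] by (simp add: psi_def th_def theta_lc[symmetric])
qed

lemma psi_Rf: assumes "r \<in> Rf N" shows "psi r = r"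
proof -
  obtain h where h: "N = Suc h" using assms Rf_0 by (cases N) auto
  then obtain s where s: "Poly_Mapping.keys r \<subseteq> {(w, x). 2 \<le> length w \<and> set w \<subseteq> {i. blk i = s}}"
    using Rf_block[of h r] assms by auto
  have "psi r = lev fscale (\<lambda>p. psi (basis p)) r" by (rule hom_expand[OF psi_hom])
  also have "\<dots> = lev fscale basis r"
    using s psi_block by (intro lev_cong) auto
  finally show ?thesis by (simp add: lev_basis_expand)
qed

text \<open>This explains the form of the deformed relation. Convolving with \<open>f\<close> on the
  right turns \<open>u i j\<close> into \<open>u i j - dd i j (g_i g_j)\<close>; the added term of
  \<open>ul i j\<close> changes this to \<open>u i j - dd i j\<close>, which is
  \<open>theta' (u i j)\<close>, and \<open>theta\<close> takes it back.\<close>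

lemma psi_ul: assumes ij: "blk j < blk i" shows "psi (ul i j) = u i j"
proof -
  have t: "theta' (u i j) = u i j - fscale (dd i j) un"
    using theta'_M_u[OF ij, of un] by (simp add: M_un_r theta'_un)
  have fu: "f (u i j) = - dd i j"
    by (simp add: f_def t hom_sub[OF cu_lin] hom_scale[OF cu_lin] len2_cu[OF u_len2] cu_un)
  have fg: "f (basis ([], x)) = 1" for x by (simp add: f_def theta'_def module_fscale cu_basis)
  have "thr (u i j) = u i j - fscale (dd i j) (basis ([], g i + g j))"
    by (simp add: thr_def rc_def dl_u[OF ij] hom_add[OF pr_hom[OF module_fscale]] cr_id_tens f_hom f_un fu)
  moreover have "thr (basis ([], x)) = basis ([], x)" for x
    by (simp add: thr_def rc_def dl_group cr_id_tens f_hom fg del: tens_basis)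
  ultimately have "thr (ul i j) = u i j - fscale (dd i j) un"
    by (simp add: ul_def un_def hom_add[OF thr_hom] hom_sub[OF thr_hom] hom_scale[OF thr_hom] fmod.scale_right_diff_distrib)
  then have "psi (ul i j) = theta (u i j - fscale (dd i j) un)"
    by (simp add: psi_def th_def theta_lc)
  also have "\<dots> = theta (theta' (u i j))" by (simp only: t)
  finally show ?thesis by simp
qed

lemma psi_I: "psi a \<in> I0 \<longleftrightarrow> a \<in> Il"
proof
  \<comment> \<open>The image of \<open>Il\<close> under \<open>psi\<close>. Transport of structure
    makes it an ideal for \<open>dm\<close>. Being contained in \<open>I0\<close> it is killed by
    the cocycle and its inverse, so the twist can be undone and it is an ideal for \<open>M\<close>
    too.\<close>
  define J where "J = {y. psi' y \<in> Il}"
  have M_span: "M z \<in> I" if "ideal I FH" "z \<in> tens_span I" for z I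
    by (rule tens_span_map[OF M_lin ideal_sub[OF that(1)] ideal_r[OF that(1)] ideal_l[OF that(1)] that(2)])
  have "ideal {x. psi x \<in> I0} FH"
    unfolding ideal_iff
  proof (intro conjI allI ballI)
    show "fmod.subspace {x. psi x \<in> I0}" by (rule subspace_vimage[OF psi_hom ideal_sub[OF ideal_gen]])
    have dm: "dm z \<in> I0" if "z \<in> tens_span I0" for z
      by (rule dm_stable[OF ideal_sub[OF ideal_gen] I0_coideal sg_I0 ta_I0 M_span[OF ideal_gen] that])
    fix a x assume "x \<in> {x. psi x \<in> I0}"
    then show "M (tens a x) \<in> {x. psi x \<in> I0}" "M (tens x a) \<in> {x. psi x \<in> I0}"
      by (auto simp: psi_M intro: dm tens_spanI1 tens_spanI2)
  qed
  moreover have "Sl \<subseteq> {x. psi x \<in> I0}"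
  proof
    fix r assume "r \<in> Sl"
    then have "psi r \<in> S0" by (auto simp: Sl_def S0_def psi_Rf psi_ul)
    then show "r \<in> {x. psi x \<in> I0}" using gen_subset[of S0] by blast
  qed
  ultimately have 1: "Il \<subseteq> {x. psi x \<in> I0}" by (rule gen_minimal)
  then show "a \<in> Il \<Longrightarrow> psi a \<in> I0" by blast
  have J_sub: "fmod.subspace J" unfolding J_def by (rule subspace_vimage[OF psi'_hom ideal_sub[OF ideal_gen]])
  have JI0: "J \<subseteq> I0"
  proof
    fix y assume "y \<in> J"
    then have "psi (psi' y) \<in> I0" using 1 by (auto simp: J_def)
    then show "y \<in> I0" by simp
  qed
  have psiJ: "psi x \<in> J" if "x \<in> Il" for x using that by (simp add: J_def)
  have J_coideal: "dl y \<in> tens_span J" if "y \<in> J" for y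
  proof -
    have "tm psi psi (dl (psi' y)) \<in> tens_span J"
      by (rule tens_span_map[OF tm_hom tens_span_subspace _ _ Il_coideal[of "psi' y"]])
        (use that psiJ in \<open>auto simp: tm_tens psi_hom J_def intro: tens_spanI1 tens_spanI2\<close>)
    then show ?thesis by (simp add: dl_psi[symmetric])
  qed
  have sgJ: "sg z = 0" "ta z = 0" if "z \<in> tens_span J" for z
    using that tens_span_mono[OF JI0] by (auto intro: sg_I0 ta_I0)
  have "dm z \<in> J" if z: "z \<in> tens_span J" for z
  proof -
    have "tm psi' psi' z \<in> tens_span Il"
      by (rule tens_span_map[OF tm_hom tens_span_subspace _ _ z])
        (auto simp: tm_tens psi'_hom J_def intro: tens_spanI1 tens_spanI2)
    then show ?thesis unfolding dm_def by (intro psiJ M_span[OF ideal_gen])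
  qed
  then have MJ: "M z \<in> J" if "z \<in> tens_span J" for z
    using M_stable[OF J_sub J_coideal sgJ _ that] by blast
  have "ideal J FH"
    unfolding ideal_iff using J_sub MJ by (auto intro: tens_spanI1 tens_spanI2)
  moreover have "S0 \<subseteq> J"
  proof
    fix r assume "r \<in> S0"
    then have "\<exists>x\<in>Sl. psi x = r" using psi_Rf psi_ul by (auto simp: S0_def Sl_def)
    then show "r \<in> J" using psiJ gen_subset[of Sl] by blast
  qed
  ultimately have "I0 \<subseteq> J" by (rule gen_minimal)
  then show "psi a \<in> I0 \<Longrightarrow> a \<in> Il" by (auto simp: J_def)
qed

theorem cocycle_deformations_quotients: "cocycle_deformations (quot_bialg FH Il) (quot_bialg FH I0)"
proof -
  interpret Q: coboundary_quot dl cu M un FH I0 ap f f'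
    by (intro coboundary_quot.intro hopf_quot_I0 coboundary_axioms coboundary_quot_axioms.intro sg_I0 ta_I0)
  show ?thesis by (rule Q.cocycle_deformation[OF hopf_quot_Il psi_I])
qed

end

section \<open>From the tensor algebra to the bosonization\<close>

definition unassoc :: "('x \<times> ('y \<times> 'z) \<Rightarrow>\<^sub>0 'k::comm_ring_1) \<Rightarrow> (('x \<times> 'y) \<times> 'z \<Rightarrow>\<^sub>0 'k)" where
  "unassoc = lev fscale (\<lambda>(u, (v, w)). basis ((u, v), w))"

lemma unassoc_hom: "lin unassoc"
  unfolding unassoc_def by (rule lev_hom[OF module_fscale])

lemma unassoc_tens [simp]: "unassoc (tens a (tens b c)) = tens (tens a b) c"
proof -
  have "unassoc (reassoc z) = z" for z
    by (rule hom_ext[OF hom_compose[OF reassoc_hom unassoc_hom] lin_ident])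
      (auto simp: reassoc_def unassoc_def module_fscale)
  from this[of "tens (tens a b) c"] show ?thesis by simp
qed

context diag
begin

section \<open>The braided comultiplication of the tensor algebra\<close>

definition MT :: "('i list \<times> 'i list \<Rightarrow>\<^sub>0 'k) \<Rightarrow> ('i list \<Rightarrow>\<^sub>0 'k)" where
  "MT = lev fscale (\<lambda>(u, v). basis (u @ v))"

abbreviation "TVk \<equiv> TV :: ('k, 'i list \<Rightarrow>\<^sub>0 'k) module"

lemma MT_hom: "lin MT"
  unfolding MT_def by (rule lev_hom[OF module_fscale])

lemma MT_basis: "MT (basis (u, v)) = basis (u @ v)"
  by (simp add: MT_def module_fscale)

lemma MT_hom1: "module_hom s fscale f \<Longrightarrow> module_hom s fscale (\<lambda>x. MT (tens (f x) q))"
  by (rule hom_compose[OF tens_hom1 MT_hom])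

lemma MT_hom2: "module_hom s fscale f \<Longrightarrow> module_hom s fscale (\<lambda>x. MT (tens q (f x)))"
  by (rule hom_compose[OF tens_hom2 MT_hom])

lemma free_alg_MT: "free_alg MT (basis [])"
proof (rule free_alg.intro[OF MT_hom])
  fix a b c :: "'i list \<Rightarrow>\<^sub>0 'k"
  have "MT (tm MT (\<lambda>x. x) z) = MT (tm (\<lambda>x. x) MT (reassoc z))" for z
  proof (rule hom_ext[OF hom_compose[OF tm_hom MT_hom] hom_compose[OF hom_compose[OF reassoc_hom tm_hom] MT_hom]])
    fix p :: "('i list \<times> 'i list) \<times> 'i list"
    obtain u v w where p: "p = ((u, v), w)" by (metis surj_pair)
    have "MT (tm MT (\<lambda>x. x) (tens (tens (basis u) (basis v)) (basis w)))
      = MT (tm (\<lambda>x. x) MT (reassoc (tens (tens (basis u) (basis v)) (basis w))))"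
      unfolding reassoc_tens tm_tens[OF MT_hom lin_ident] tm_tens[OF lin_ident MT_hom]
      by (simp add: MT_basis)
    then show "MT (tm MT (\<lambda>x. x) (basis p)) = MT (tm (\<lambda>x. x) MT (reassoc (basis p)))" by (simp add: p)
  qed
  from this[of "tens (tens a b) c"] show "MT (tens (MT (tens a b)) c) = MT (tens a (MT (tens b c)))"
    by (simp add: tm_tens MT_hom lin_ident)
  show "MT (tens (basis []) a) = a"
    by (rule hom_ext[OF MT_hom2[OF lin_ident] lin_ident]) (simp add: MT_basis)
  show "MT (tens a (basis [])) = a"
    by (rule hom_ext[OF MT_hom1[OF lin_ident] lin_ident]) (simp add: MT_basis)
qed

lemma TV_rec: "free_alg_rec MT (basis []) TVk"
proof -
  have "flin (\<lambda>u. flin (\<lambda>v. basis (u @ v)) q) p = MT (tens p q)" for p q :: "'i list \<Rightarrow>\<^sub>0 'k"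
    unfolding tens_def hom_lev[OF MT_hom] flin_lev by (simp add: MT_basis)
  then show ?thesis
    by (intro free_alg_rec.intro free_alg_MT free_alg_rec_axioms.intro) (auto simp: TV_def)
qed

interpretation T: free_alg_rec MT "basis []" TVk
  by (rule TV_rec)

abbreviation "tT \<equiv> tp TVk TVk (\<lambda>x. x) (\<lambda>x. x)"

definition Lt :: "'i \<Rightarrow> ('i list \<Rightarrow>\<^sub>0 'k) \<Rightarrow> ('i list \<Rightarrow>\<^sub>0 'k)" where
  "Lt i = lev fscale (\<lambda>w. basis (i # w))"

definition Gt :: "'g \<Rightarrow> ('i list \<Rightarrow>\<^sub>0 'k) \<Rightarrow> ('i list \<Rightarrow>\<^sub>0 'k)" where
  "Gt x = lev fscale (\<lambda>w. fscale (wc w x) (basis w))"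

definition br :: "('i list \<times> 'i list \<Rightarrow>\<^sub>0 'k) \<Rightarrow> ('i list \<times> 'i list \<Rightarrow>\<^sub>0 'k)" where
  "br = lev fscale (\<lambda>(u, v). fscale (wc v (word_deg g u)) (basis (v, u)))"

lemma Lt_hom: "lin (Lt i)" and Gt_hom: "lin (Gt x)" and br_hom: "lin br"
  unfolding Lt_def Gt_def br_def by (rule lev_hom[OF module_fscale])+

lemma Lt_MT: "MT (tens (basis [i]) a) = Lt i a"
  by (rule hom_ext[OF MT_hom2[OF lin_ident] Lt_hom]) (simp add: MT_basis Lt_def module_fscale)

lemma br_un: "br (tens (basis []) c) = tens c (basis [])"
  by (rule hom_ext[OF hom_compose[OF tens_hom2[OF lin_ident] br_hom] tens_hom1[OF lin_ident]])
    (simp add: br_def module_fscale word_deg_def)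

lemma br_x: "br (tens (basis [i]) c) = tens (Gt (g i) c) (basis [i])"
  by (rule hom_ext[OF hom_compose[OF tens_hom2[OF lin_ident] br_hom] tens_hom1[OF Gt_hom]])
    (simp add: br_def Gt_def module_fscale word_deg_def tens_scale1)

lemma TV_braiding_tp: "TV_braiding g \<chi> p q = tT (br (tens p q))"
proof -
  have "flin (\<lambda>u. flin (\<lambda>v. fscale (wc v (word_deg g u)) (basis (basis v, basis u))) q) p
      = temb (\<lambda>x. x) (\<lambda>x. x) (br (tens p q))"
    unfolding tens_def hom_lev[OF br_hom] hom_lev[OF temb_hom] flin_lev
    by (simp add: br_def module_fscale hom_scale[OF temb_hom]) (simp add: temb_def module_fscale)
  then show ?thesis by (simp add: TV_braiding_def tp_def)
qed

text \<open>The product of the braided tensor square; the reassociations only bring the two middle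
  factors together for the braiding.\<close>

definition Zb :: "(('i list \<times> 'i list) \<times> ('i list \<times> 'i list) \<Rightarrow>\<^sub>0 'k) \<Rightarrow> ('i list \<times> 'i list \<Rightarrow>\<^sub>0 'k)" where
  "Zb p = tm MT MT (unassoc (tm (\<lambda>x. x) reassoc (tm (\<lambda>x. x) (tm br (\<lambda>x. x)) (tm (\<lambda>x. x) unassoc (reassoc p)))))"

lemma Zb_hom: "lin Zb"
  unfolding Zb_def
  by (rule hom_compose[OF hom_compose[OF hom_compose[OF hom_compose[OF hom_compose[OF reassoc_hom tm_hom] tm_hom] tm_hom] unassoc_hom] tm_hom])

lemma Zb_tens: "Zb (tens (tens a b) (tens c d)) = tm MT MT (unassoc (tm (\<lambda>x. x) reassoc (tens a (tens (br (tens b c)) d))))"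
  by (simp add: Zb_def tm_tens lin_ident unassoc_hom br_hom tm_hom)

lemma braided_mult_tp: "TV_braided_mult g \<chi> (tT z) (tT z') = tT (Zb (tens z z'))"
  unfolding TV_braided_mult_def
proof (rule tlift_pres'[OF T.pres_A T.pres_A pres_tensor[OF T.pres_A T.pres_A]])
  note P2 = pres_tensor[OF T.pres_A T.pres_A]
  show "lin (\<lambda>z. Zb (tens z z'))" by (rule hom_compose[OF tens_hom1[OF lin_ident] Zb_hom])
  fix a b
  show "tlift (tensor TVk TVk) (\<lambda>c d. tlift (tensor TVk TVk) (\<lambda>c' b'. pure TVk TVk (a \<otimes>\<^bsub>TVk\<^esub> c') (b' \<otimes>\<^bsub>TVk\<^esub> d))
      (TV_braiding g \<chi> b c)) (tT z') = tT (Zb (tens (tens a b) z'))"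
  proof (rule tlift_pres'[OF T.pres_A T.pres_A P2])
    show "lin (\<lambda>z'. Zb (tens (tens a b) z'))" by (rule hom_compose[OF tens_hom2[OF lin_ident] Zb_hom])
    fix c d
    show "tlift (tensor TVk TVk) (\<lambda>c' b'. pure TVk TVk (a \<otimes>\<^bsub>TVk\<^esub> c') (b' \<otimes>\<^bsub>TVk\<^esub> d)) (TV_braiding g \<chi> b c)
      = tT (Zb (tens (tens a b) (tens c d)))"
      unfolding TV_braiding_tp Zb_tens
    proof (rule tlift_pres'[OF T.pres_A T.pres_A P2])
      show "lin (\<lambda>w. tm MT MT (unassoc (tm (\<lambda>x. x) reassoc (tens a (tens w d)))))"
        by (rule hom_compose[OF hom_compose[OF hom_compose[OF tens_hom2[OF tens_hom1[OF lin_ident]] tm_hom] unassoc_hom] tm_hom])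
      fix c' b'
      show "pure TVk TVk (a \<otimes>\<^bsub>TVk\<^esub> c') (b' \<otimes>\<^bsub>TVk\<^esub> d)
        = tT (tm MT MT (unassoc (tm (\<lambda>x. x) reassoc (tens a (tens (tens c' b') d)))))"
        by (simp add: T.rec_A tp_tens[OF T.pres_A T.pres_A] tm_tens lin_ident reassoc_hom MT_hom)
    qed
  qed
qed

primrec cw :: "'i list \<Rightarrow> ('i list \<times> 'i list \<Rightarrow>\<^sub>0 'k)" where
  "cw [] = basis ([], [])"
| "cw (i # w) = tm (Lt i) (\<lambda>x. x) (cw w) + tm (Gt (g i)) (Lt i) (cw w)"

definition ct :: "('i list \<Rightarrow>\<^sub>0 'k) \<Rightarrow> ('i list \<times> 'i list \<Rightarrow>\<^sub>0 'k)" where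
  "ct = lev fscale cw"

lemma TV_comult_word_tp: "TV_comult_word g \<chi> w = tT (cw w)"
proof (induction w)
  note P = T.pres_A
  note P2 = pres_tensor[OF P P]
  {
    case Nil
    show ?case by (simp add: T.rec_A tp_tens[OF P P])
  next
    case (Cons i w)
    have 1: "Zb (tens (tens (basis [i]) (basis [])) z) = tm (Lt i) (\<lambda>x. x) z" for z
      by (rule hom_ext2[OF hom_compose[OF tens_hom2[OF lin_ident] Zb_hom] tm_hom])
        (simp add: Zb_tens br_un tm_tens lin_ident reassoc_hom MT_hom Lt_hom Lt_MT T.M_unit_l del: tens_basis)
    have 2: "Zb (tens (tens (basis []) (basis [i])) z) = tm (Gt (g i)) (Lt i) z" for z
      by (rule hom_ext2[OF hom_compose[OF tens_hom2[OF lin_ident] Zb_hom] tm_hom])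
        (simp add: Zb_tens br_x tm_tens lin_ident reassoc_hom MT_hom Lt_hom Gt_hom Lt_MT T.M_unit_l del: tens_basis)
    show ?case
      by (simp only: TV_comult_word.simps Cons.IH T.rec_A(3) tp_tens[OF P P] pres_add[OF P2] braided_mult_tp
          tens_add1 hom_add[OF Zb_hom] 1 2 cw.simps)
  }
qed

lemma TV_comult_tp: "TV_comult g \<chi> p = tT (ct p)"
proof -
  note P2 = pres_tensor[OF T.pres_A T.pres_A]
  have "TV_comult g \<chi> p = (\<Oplus>\<^bsub>tensor TVk TVk\<^esub>w\<in>Poly_Mapping.keys p. tT (fscale (Poly_Mapping.lookup p w) (cw w)))"
    by (simp add: TV_comult_def TV_comult_word_tp pres_smult[OF P2])
  also have "\<dots> = tT (ct p)"
    unfolding ct_def lev_def by (rule pres_finsum[OF P2]) simp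
  finally show ?thesis .
qed

lemma primitive_mod_TV:
  assumes J: "ideal J TVk" and r: "primitive_mod TVk (TV_comult g \<chi>) J r"
  shows "ct r - (tens r (basis []) + tens (basis []) r) \<in> tens_span J"
proof -
  interpret q: free_alg_quot MT "basis []" TVk J
    by (intro free_alg_quot.intro TV_rec free_alg_quot_axioms.intro J)
  note P = q.pres_quot
  have "q.T2 (ct r) = q.T2 (tens r (basis []) + tens (basis []) r)"
    using r unfolding primitive_mod_def Let_def TV_comult_tp q.tensor_proj_eq q.pj_def[symmetric] q.quot_module_simps(3)
      tp_tens[OF P P] pres_add[OF pres_tensor[OF P P]] .
  then show ?thesis by (simp only: q.T2_eq_iff)
qed

text \<open>The bosonization formula: the degree of the right leg is appended as a group element to
  the left leg. By \<open>E_ct\<close> it turns the braided coproduct into that of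
  \<open>F\<close>.\<close>

definition E :: "('i list \<times> 'i list \<Rightarrow>\<^sub>0 'k) \<Rightarrow> (('i list \<times> 'g) \<times> ('i list \<times> 'g) \<Rightarrow>\<^sub>0 'k)" where
  "E = lev fscale (\<lambda>(a, b). basis ((a, word_deg g b), (b, 0)))"

abbreviation tf :: "('i list \<Rightarrow>\<^sub>0 'k) \<Rightarrow> ('i list \<times> 'g \<Rightarrow>\<^sub>0 'k)" where
  "tf \<equiv> TV_to_F"

lemma tf_lev: "tf = lev fscale (\<lambda>w. basis (w, 0))"
  by (rule ext) (simp add: TV_to_F_def flin_lev)

lemma tf_hom: "lin tf"
  unfolding tf_lev by (rule lev_hom[OF module_fscale])

lemma tf_basis [simp]: "tf (basis w) = basis (w, 0)"
  by (simp add: tf_lev module_fscale)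

lemma E_hom: "lin E"
  unfolding E_def by (rule lev_hom[OF module_fscale])

lemma E_basis: "E (basis (a, b)) = basis ((a, word_deg g b), (b, 0))"
  by (simp add: E_def module_fscale)

lemma E_ct: "E (ct p) = dl (tf p)"
proof (rule hom_ext[OF hom_compose[OF _ E_hom] hom_compose[OF tf_hom dl_lin]])
  show "lin ct" unfolding ct_def by (rule lev_hom[OF module_fscale])
  have 1: "E (tm (Lt i) (\<lambda>x. x) z) = tm (L i) (\<lambda>x. x) (E z)" for i z
  proof (rule hom_ext2[OF hom_compose[OF tm_hom E_hom] hom_compose[OF E_hom tm_hom]],
        rule bil_ext[OF bil_hom_tens[OF hom_compose[OF tm_hom E_hom]] bil_hom_tens[OF hom_compose[OF E_hom tm_hom]]])
    fix a b
    have "E (tm (Lt i) (\<lambda>x. x) (tens (basis a) (basis b))) = basis ((i # a, word_deg g b), (b, 0))"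
      unfolding tm_tens[OF Lt_hom lin_ident] by (simp add: Lt_def module_fscale E_basis)
    moreover have "tm (L i) (\<lambda>x. x) (tens (basis (a, word_deg g b)) (basis (b, 0 :: 'g))) = basis ((i # a, word_deg g b), (b, 0))"
      unfolding tm_tens[OF L_hom lin_ident] by simp
    ultimately show "E (tm (Lt i) (\<lambda>x. x) (tens (basis a) (basis b))) = tm (L i) (\<lambda>x. x) (E (tens (basis a) (basis b)))"
      by (simp add: E_basis)
  qed
  have 2: "E (tm (Gt (g i)) (Lt i) z) = tm (G (g i)) (L i) (E z)" for i z
  proof (rule hom_ext2[OF hom_compose[OF tm_hom E_hom] hom_compose[OF E_hom tm_hom]],
        rule bil_ext[OF bil_hom_tens[OF hom_compose[OF tm_hom E_hom]] bil_hom_tens[OF hom_compose[OF E_hom tm_hom]]])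
    fix a b
    have "E (tm (Gt (g i)) (Lt i) (tens (basis a) (basis b))) = fscale (wc a (g i)) (basis ((a, g i + word_deg g b), (i # b, 0)))"
      unfolding tm_tens[OF Gt_hom Lt_hom]
      by (simp add: Gt_def Lt_def module_fscale tens_scale1 hom_scale[OF E_hom] E_basis word_deg_def)
    moreover have "tm (G (g i)) (L i) (tens (basis (a, word_deg g b)) (basis (b, 0))) = fscale (wc a (g i)) (basis ((a, g i + word_deg g b), (i # b, 0)))"
      unfolding tm_tens[OF G_hom L_hom] by (simp add: G_basis tens_scale1)
    ultimately show "E (tm (Gt (g i)) (Lt i) (tens (basis a) (basis b))) = tm (G (g i)) (L i) (E (tens (basis a) (basis b)))"
      by (simp add: E_basis)
  qed
  fix w
  have "E (cw w) = dlw 0 w"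
    by (induction w) (simp_all add: E_basis word_deg_def hom_add[OF E_hom] 1 2)
  then show "E (ct (basis w)) = dl (tf (basis w))" by (simp add: ct_def dl_def module_fscale)
qed

lemma E_tens_word: "E (tens a (basis v)) = tens (M (tens (tf a) (basis ([], word_deg g v)))) (basis (v, 0))"
  by (rule hom_ext[OF hom_compose[OF tens_hom1[OF lin_ident] E_hom] tens_hom1[OF M_hom1[OF tf_hom]]])
    (simp add: E_basis M_basis)

lemma E_tens_homogeneous:
  assumes "\<And>v. v \<in> Poly_Mapping.keys b \<Longrightarrow> word_deg g v = x"
  shows "E (tens (basis a) b) = tens (basis (a, x)) (tf b)"
proof -
  have "E (tens (basis a) b) = lev fscale (\<lambda>v. E (tens (basis a) (basis v))) b"
    by (rule hom_expand[OF hom_compose[OF tens_hom2[OF lin_ident] E_hom]])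
  also have "\<dots> = lev fscale (\<lambda>v. tens (basis (a, x)) (tf (basis v))) b"
    using assms by (intro lev_cong) (simp add: E_basis)
  also have "\<dots> = tens (basis (a, x)) (tf b)"
    by (rule hom_expand[OF tens_hom2[OF tf_hom], symmetric])
  finally show ?thesis .
qed

lemma tf_MT: "tf (MT (tens p q)) = M (tens (tf p) (tf q))"
proof (rule bil_ext[of fscale "\<lambda>p q. tf (MT (tens p q))" "\<lambda>p q. M (tens (tf p) (tf q))"])
  show "bil fscale (\<lambda>p q. tf (MT (tens p q)))" by (rule bil_hom_tens[OF hom_compose[OF MT_hom tf_hom]])
  show "bil fscale (\<lambda>p q. M (tens (tf p) (tf q)))" by (rule bil_compose[OF M_bil' tf_hom tf_hom])
qed (simp add: MT_basis M_basis)

text \<open>The group element that \<open>E\<close> puts on the left leg depends on the degree of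
  the right leg. An ideal in the right leg therefore has to be spanned by homogeneous elements, and
  this is where the relations must have a degree.\<close>

lemma E_span:
  assumes R: "\<And>r. r \<in> R \<Longrightarrow> \<exists>x. \<forall>v\<in>Poly_Mapping.keys r. word_deg g v = x"
    and z: "z \<in> tens_span (Idl\<^bsub>TVk\<^esub> R)"
  shows "E z \<in> tens_span (Idl\<^bsub>FH\<^esub> (tf ` R))"
proof -
  let ?I = "Idl\<^bsub>FH\<^esub> (tf ` R)"
  \<comment> \<open>Words rather than arbitrary elements on both sides keep the spanning set
    homogeneous.\<close>
  let ?S = "fmod.span {MT (tens (basis v) (MT (tens r (basis w)))) | v r w. r \<in> R}"
  have Isub: "fmod.subspace ?I" and Il: "x \<in> ?I \<Longrightarrow> M (tens a x) \<in> ?I" and Ir: "x \<in> ?I \<Longrightarrow> M (tens x a) \<in> ?I" for a x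
    using ideal_gen[of "tf ` R"] by (simp_all add: ideal_iff)
  have tfI: "tf (MT (tens a (MT (tens r b)))) \<in> ?I" if "r \<in> R" for a r b
    unfolding tf_MT using that gen_subset[of "tf ` R"] by (intro Il Ir) auto
  have tfJ: "tf p \<in> ?I" if "p \<in> Idl\<^bsub>TVk\<^esub> R" for p
  proof -
    have "Idl\<^bsub>TVk\<^esub> R \<subseteq> {p. tf p \<in> ?I}"
      unfolding T.gen_span by (rule fmod.span_minimal[OF _ subspace_vimage[OF tf_hom Isub]]) (auto intro: tfI)
    then show ?thesis using that by blast
  qed
  have JS: "Idl\<^bsub>TVk\<^esub> R \<subseteq> ?S"
    unfolding T.gen_span
  proof (rule fmod.span_minimal[OF _ fmod.subspace_span], clarify)
    fix a r b assume r: "r \<in> R"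
    have *: "MT (tens (basis v) (MT (tens r b))) \<in> ?S" for v
      unfolding hom_expand[OF MT_hom2[OF MT_hom2[OF lin_ident]], of "basis v" r b]
      by (rule lev_in_subspace[OF fmod.subspace_span]) (use r in \<open>blast intro: fmod.span_base\<close>)
    show "MT (tens a (MT (tens r b))) \<in> ?S"
      unfolding hom_expand[OF MT_hom1[OF lin_ident], of a]
      by (rule lev_in_subspace[OF fmod.subspace_span *])
  qed
  show ?thesis
  proof (rule tens_span_map[OF E_hom tens_span_subspace _ _ z])
    fix a b assume "a \<in> Idl\<^bsub>TVk\<^esub> R"
    then have *: "E (tens a (basis v)) \<in> tens_span ?I" for v
      unfolding E_tens_word by (intro tens_spanI1 Ir tfJ)
    show "E (tens a b) \<in> tens_span ?I"
      unfolding hom_expand[OF hom_compose[OF tens_hom2[OF lin_ident] E_hom], of a b]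
      by (rule lev_in_subspace[OF tens_span_subspace *])
  next
    fix a b assume b: "b \<in> Idl\<^bsub>TVk\<^esub> R"
    have *: "E (tens (basis c) b) \<in> tens_span ?I" for c
    proof -
      have "?S \<subseteq> {b. E (tens (basis c) b) \<in> tens_span ?I}"
      proof (rule fmod.span_minimal[OF _ subspace_vimage[OF hom_compose[OF tens_hom2[OF lin_ident] E_hom] tens_span_subspace]], clarify)
        fix v r w assume r: "r \<in> R"
        then obtain x where x: "\<And>u. u \<in> Poly_Mapping.keys r \<Longrightarrow> word_deg g u = x" using R by blast
        let ?b = "MT (tens (basis v) (MT (tens r (basis w))))"
        have "?b = lev fscale (\<lambda>u. MT (tens (basis v) (MT (tens (basis u) (basis w))))) r"
          by (rule hom_expand[OF MT_hom2[OF MT_hom1[OF lin_ident]]])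
        also have "\<dots> \<in> {p. Poly_Mapping.keys p \<subseteq> {u. word_deg g u = word_deg g v + x + word_deg g w}}"
          by (rule lev_in_subspace[OF subspace_keys]) (auto simp: MT_basis word_deg_def x[unfolded word_deg_def])
        finally have "E (tens (basis c) ?b) = tens (basis (c, word_deg g v + x + word_deg g w)) (tf ?b)"
          by (intro E_tens_homogeneous) auto
        then show "E (tens (basis c) ?b) \<in> tens_span ?I"
          by (simp only:) (intro tens_spanI2 tfI r)
      qed
      then show ?thesis using b JS by blast
    qed
    show "E (tens a b) \<in> tens_span ?I"
      unfolding hom_expand[OF hom_compose[OF tens_hom1[OF lin_ident] E_hom], of a b]
      by (rule lev_in_subspace[OF tens_span_subspace *])
  qed
qed

lemma primitive_mod_F:
  assumes R: "\<And>r. r \<in> R \<Longrightarrow> \<exists>x. \<forall>v\<in>Poly_Mapping.keys r. word_deg g v = x"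
    and prim: "primitive_mod TVk (TV_comult g \<chi>) (Idl\<^bsub>TVk\<^esub> R) r"
    and x: "\<And>v. v \<in> Poly_Mapping.keys r \<Longrightarrow> word_deg g v = x"
  shows "dl (tf r) - (tens (tf r) un + tens (basis ([], x)) (tf r)) \<in> tens_span (Idl\<^bsub>FH\<^esub> (tf ` R))"
proof -
  have "E (ct r - (tens r (basis []) + tens (basis []) r)) \<in> tens_span (Idl\<^bsub>FH\<^esub> (tf ` R))"
    by (rule E_span[OF R primitive_mod_TV[OF T.ideal_gen prim]])
  moreover have "E (tens r (basis [])) = tens (tf r) un"
    unfolding E_tens_word by (simp add: word_deg_def un_def[symmetric] M_un_r)
  ultimately show ?thesis
    by (simp add: hom_sub[OF E_hom] hom_add[OF E_hom] E_ct E_tens_homogeneous[OF x])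
qed

text \<open>A braid letter permutes a word up to a scalar. Hence a relation stays within one block,
  keeps its length, and is homogeneous for \<Gamma>.\<close>

lemma braid_act_keys:
  assumes "\<xi> \<in> braid_group_algebra (length w)"
  shows "Poly_Mapping.keys (braid_act g \<chi> \<xi> (basis w)) \<subseteq> {v. mset v = mset w}"
proof -
  let ?U = "{p :: 'i list \<Rightarrow>\<^sub>0 'k. Poly_Mapping.keys p \<subseteq> {v. mset v = mset w}}"
  have eq: "u \<in> braid_words l \<and> v \<in> braid_words l" if "braid_eq l u v" for l u v
    using that by (induction rule: braid_eq.induct) (auto simp: braid_words_def)
  have word: "braid_word_act g \<chi> u (basis w) \<in> ?U" if "u \<in> braid_words (length w)" for u
    using that
  proof (induction u)
    case (Cons z u)
    then have IH: "braid_word_act g \<chi> u (basis w) \<in> ?U" and z: "fst z + 1 < length w"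
      by (auto simp: braid_words_def case_prod_unfold)
    show ?case
      unfolding braid_word_act.simps flin_lev
    proof (rule lev_in_subspace[OF subspace_keys])
      fix v assume "v \<in> Poly_Mapping.keys (braid_word_act g \<chi> u (basis w))"
      then have v: "mset v = mset w" using IH by auto
      then have "length v = length w" by (rule mset_eq_length)
      then have "mset (v[fst z := v ! (fst z + 1), fst z + 1 := v ! fst z]) = mset v"
        using z by (intro mset_swap) simp_all
      then show "braid_letter_act g \<chi> z v \<in> ?U"
        using v by (auto simp: braid_letter_act_def Let_def)
    qed
  qed simp
  \<comment> \<open>The chosen representative of a braid is an admissible word, as
    \<open>braid_eq\<close> relates only such words.\<close>
  have "rep b \<in> braid_words (length w)" if "b \<in> braid_group (length w)" for b
  proof -
    from that obtain x where x: "x \<in> braid_words (length w)" and b: "b = {v. braid_eq (length w) x v}"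
      by (auto simp: braid_group_def quotient_def)
    have "x \<in> b" using braid_eq.refl[OF x] by (simp add: b)
    then have "rep b \<in> b" unfolding rep_def by (rule someI)
    then show ?thesis using eq by (auto simp: b)
  qed
  then have "braid_act g \<chi> \<xi> (basis w) \<in> ?U"
    unfolding braid_act_def flin_lev using assms word
    by (intro lev_in_subspace[OF subspace_keys]) (auto simp: braid_group_algebra_def)
  then show ?thesis by simp
qed

end

theorem theorem4p3:
  fixes g :: "'i::finite \<Rightarrow> 'g::ab_group_add"
    and \<chi> :: "'i \<Rightarrow> 'g \<Rightarrow> 'k::comm_ring_1"
    and blk :: "'i \<Rightarrow> nat" and N L :: nat
    and R :: "('i list \<Rightarrow>\<^sub>0 'k) set" and Rc :: "nat \<Rightarrow> ('i list \<Rightarrow>\<^sub>0 'k) set"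
    and lam :: "'i \<times> 'i \<Rightarrow> 'k"
  assumes "\<And>i. character (\<chi> i)"
    and "range blk = {1..N}"
    and "\<And>i j. blk i \<noteq> blk j \<Longrightarrow> \<chi> j (g i) * \<chi> i (g j) = 1"
    and "\<And>r. r \<in> R \<Longrightarrow> \<exists>l w \<xi>. l \<ge> 2 \<and> length w = l \<and> \<xi> \<in> braid_group_algebra l \<and>
           (\<forall>i\<in>set w. \<forall>j\<in>set w. blk i = blk j) \<and> r = braid_act g \<chi> \<xi> (basis w)"
    and "Rc 0 = {}" and "Rc L = R" and "\<And>h. h < L \<Longrightarrow> Rc h \<subseteq> Rc (Suc h)"
    and "\<And>h r. 0 < h \<Longrightarrow> h \<le> L \<Longrightarrow> r \<in> Rc h \<Longrightarrow>
           primitive_mod TV (TV_comult g \<chi>) (Idl\<^bsub>TV\<^esub> (Rc (h - 1))) r"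
  shows "cocycle_deformations (Hlam g \<chi> blk R lam) (H0 g \<chi> blk R)"
proof -
  \<comment> \<open>The sign makes \<open>ul i j\<close> the defining relation of the deformed
    quotient.\<close>
  define dd where "dd i j = (if (i, j) \<in> Xi \<chi> blk then - lam (i, j) else 0)" for i j
  interpret tw: diag_twist g \<chi> blk dd
    by unfold_locales (use assms(1,3) in \<open>auto simp: dd_def Xi_def Theta_def split: if_splits\<close>)
  have RcR: "Rc h \<subseteq> R" if "h \<le> L" for h
    using that
  proof (induction rule: inc_induct)
    case (step n)
    then show ?case using assms(7)[of n] by blast
  qed (simp add: assms(6))
  have block: "\<exists>w. 2 \<le> length w \<and> (\<forall>i\<in>set w. \<forall>j\<in>set w. blk i = blk j) \<and> Poly_Mapping.keys r \<subseteq> {v. mset v = mset w}"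
    if r: "r \<in> R" for r
  proof -
    obtain w \<xi> where "2 \<le> length w" "\<xi> \<in> braid_group_algebra (length w)"
      "\<forall>i\<in>set w. \<forall>j\<in>set w. blk i = blk j" "r = braid_act g \<chi> \<xi> (basis w)"
      using assms(4)[OF r] by blast
    then show ?thesis using tw.braid_act_keys by blast
  qed
  have deg: "\<exists>x. \<forall>v\<in>Poly_Mapping.keys r. word_deg g v = x" if r: "r \<in> R" for r
  proof -
    obtain w where w: "Poly_Mapping.keys r \<subseteq> {v. mset v = mset w}" using block[OF r] by blast
    have "word_deg g v = word_deg g w" if "mset v = mset w" for v
      unfolding word_deg_def by (metis that mset_map sum_mset_sum_list)
    then show ?thesis using w by blast
  qed
  interpret ch: diag_chain g \<chi> blk dd "\<lambda>h. TV_to_F ` Rc h" L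
  proof
    show "TV_to_F ` Rc 0 = {}" by (simp add: assms(5))
    show "TV_to_F ` Rc h \<subseteq> TV_to_F ` Rc (Suc h)" if "h < L" for h
      using assms(7)[OF that] by blast
    fix h and r :: "'i list \<times> 'g \<Rightarrow>\<^sub>0 'k"
    assume h: "h < L" and "r \<in> TV_to_F ` Rc (Suc h)"
    then obtain p where p: "p \<in> Rc (Suc h)" and r: "r = TV_to_F p" by blast
    have pR: "p \<in> R" using RcR[of "Suc h"] h p by auto
    obtain w where w: "2 \<le> length w" "\<forall>i\<in>set w. \<forall>j\<in>set w. blk i = blk j" "Poly_Mapping.keys p \<subseteq> {v. mset v = mset w}"
      using block[OF pR] by blast
    show "\<exists>s. Poly_Mapping.keys r \<subseteq> {(w, x). 2 \<le> length w \<and> set w \<subseteq> {i. blk i = s}}"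
    proof
      let ?U = "{q :: 'i list \<times> 'g \<Rightarrow>\<^sub>0 'k. Poly_Mapping.keys q \<subseteq> {(v, x). 2 \<le> length v \<and> set v \<subseteq> {i. blk i = blk (hd w)}}}"
      have "r \<in> ?U"
        unfolding r tw.tf_lev
      proof (rule lev_in_subspace[OF subspace_keys])
        fix v assume "v \<in> Poly_Mapping.keys p"
        then have v: "mset v = mset w" using w(3) by blast
        have "hd w \<in> set w" using w(1) by (cases w) auto
        then have "set v \<subseteq> {i. blk i = blk (hd w)}" using mset_eq_setD[OF v] w(2) by blast
        then show "basis (v, 0) \<in> ?U" using mset_eq_length[OF v] w(1) by simp
      qed
      then show "Poly_Mapping.keys r \<subseteq> {(v, x). 2 \<le> length v \<and> set v \<subseteq> {i. blk i = blk (hd w)}}" by simp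
    qed
    obtain x where x: "\<And>v. v \<in> Poly_Mapping.keys p \<Longrightarrow> word_deg g v = x" using deg[OF pR] by blast
    have "primitive_mod TV (TV_comult g \<chi>) (Idl\<^bsub>TV\<^esub> (Rc h)) p"
      using assms(8)[of "Suc h" p] h p by simp
    from tw.primitive_mod_F[OF _ this x]
    show "\<exists>x. tw.dl r - (tens r tw.un + tens (basis ([], x)) r) \<in> tens_span (Idl\<^bsub>tw.FH\<^esub> (TV_to_F ` Rc h))"
      using deg RcR[of h] h unfolding r by (intro exI[of _ x]) auto
  qed
  have u: "TV_to_F (ad_c g \<chi> i j) = tw.u i j" for i j
    by (simp add: ad_c_def tw.u_def hom_sub[OF tw.tf_hom] hom_scale[OF tw.tf_hom])
  have "H0 g \<chi> blk R = quot_bialg tw.FH ch.I0"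
    unfolding H0_def ch.S0_def assms(6) by (simp add: u Theta_def)
  moreover have "TV_to_F (ad_c g \<chi> i j) - fscale (if (i, j) \<in> Xi \<chi> blk then lam (i, j) else 0)
      (basis ([], g i + g j) - basis ([], 0)) = tw.ul i j" for i j
    by (simp add: tw.ul_def u dd_def tw.un_def)
  then have "Hlam g \<chi> blk R lam = quot_bialg tw.FH ch.Il"
    unfolding Hlam_def ch.Sl_def assms(6) by (simp add: Theta_def)
  ultimately show ?thesis using ch.cocycle_deformations_quotients by simp
qed

end
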